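(* Let $i\ne j$ be in $[n]$, $x\in\mathcal{T}U_{ij}$, $J=J(x)$. Let $T$ be a tree with $x\in\overline{\mathscr C_T}$, $\preceq$ a partial order on $[n]\smallsetminus\{i,j\}$ with the cherry property on $T$ with respect to $i,j$, and $I$ an index set compatible with $\preceq$ and $J(ij)$. Put $\rho_{kl}=\exp(x_{kl}-x_{ij})$ for $kl\ne ij$, and $$A=K\{\rho_{kl}^{-1}u_{kl},\ \rho_{kl}u_{kl}^{-1}: kl\in I\smallsetminus J\},\qquad B=A\{\rho_{rs}^{-1}f_{rs},\ \rho_{rs}f_{rs}^{-1}: rs\notin I\cup J\cup\{ij\}\}.$$ Assume that all $\rho_{kl}$ with $kl\notin J\cup\{ij\}$ are contained in the value group $|K^\ast|$. Then the reduction $\widetilde B$ is isomorphic to a localization of the Laurent polynomial ring $\widetilde K[u_{kl}^{\pm1}:kl\in I\smallsetminus J]$, where $\widetilde K$ is the residue field of $K$.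
   Context: $K$ is a field complete with respect to a non-Archimedean absolute value $|\cdot|$ (possibly trivial). Pairs $kl\in\binom{[n]}2$ are unordered. $\mathrm{Gr}(2,n)\subset\mathbb{P}_K^{\binom n2-1}$ is embedded by Plücker coordinates $p_{kl}$ ($p_{lk}=-p_{kl}$); $^{\mathrm{an}}$ is Berkovich analytification. $\overline{\mathbb R}=\mathbb R\cup\{-\infty\}$, $\log0=-\infty$, $\exp(-\infty)=0$. $\mathbb{TP}^{N}=(\overline{\mathbb R}^{N+1}\smallsetminus\{(-\infty,\dots,-\infty)\})/\mathbb R\cdot(1,\dots,1)$. $\mathrm{trop}\colon\mathrm{Gr}(2,n)^{\mathrm{an}}\to\mathbb{TP}^{\binom n2-1}$ sends $\gamma$ over $\{p_{ij}\ne0\}$ to the class of $x$ with $x_{kl}-x_{ij}=\log\gamma(p_{kl}/p_{ij})$; $\mathcal{T}\mathrm{Gr}(2,n)$ is its image; $\mathcal TU_{ij}=\{x\in\mathcal{T}\mathrm{Gr}(2,n):x_{ij}\ne-\infty\}$; $J(x)=\{kl:x_{kl}=-\infty\}$. $R(ij)=K[u_{kl}:kl\in I(ij)]$ (polynomial ring), $u_{kl}=p_{kl}/p_{ij}$, $I(ij)=\{il,jl:l\ne i,j\}$, is the coordinate ring of $\{p_{ij}\ne0\}\subset\mathrm{Gr}(2,n)$; for $k,l\notin\{i,j\}$, $u_{kl}=u_{ik}u_{jl}-u_{il}u_{jk}\in R(ij)$. Trees: a tree $T$ on $n$ leaves is a finite connected acyclic graph without degree-two vertices whose leaves are labeled bijectively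 by $[n]$; inner edges are those not ending in a leaf. $\mathscr{C}_T\subset\mathbb R^{\binom n2}/\mathbb R\cdot(1,\dots,1)\subset\mathbb{TP}^{\binom n2-1}$ is the set of classes of vectors $x$ for which there is $\omega\colon E(T)\to\mathbb R$, nonnegative on inner edges, with $x_{kl}$ the sum of $\omega(e)$ over the edges $e$ of the path from $k$ to $l$; $\overline{\mathscr C_T}$ is its closure in $\mathbb{TP}^{\binom n2-1}$ (quotient topology, $[-\infty,a)$ being basic neighborhoods of $-\infty$). Given $i\ne j$, let $v_1,\dots,v_m$ be the internal vertices of the path from $i$ to $j$ in $T$, and let $T_a$ be the set of leaves $l\neq i,j$ whose path to the $i$–$j$ path first meets it at $v_a$. A quartet $\{a,b,c,d\}$ of $T$ is the subtree spanned by four leaves (degree-two vertices suppressed); a cherry is a pair of leaves adjacent to the same vertex. A partial order $\preceq$ on $[n]\smallsetminus\{i,j\}$ has the cherry property on $T$ with respect to $i,j$ if: leaves in different $T_a,T_b$ are incomparable; $\preceq$ is total on each $T_a$; and whenever $k\prec l\prec v$, either $\{k,l\}$ or $\{l,v\}$ is a cherry of the quartet $\{i,k,l,v\}$. Put $J(ij)=J\cap I(ij)$. A set $I\subset\binom{[n]}2$ of size $2(n-2)$ with $ij\notin I$ is compatible with $\preceq$ and $J(ij)$ if for each $a$ and each $k\in T_a$ exactly one of the following holds: (i) $ik,jk\in I$, and for all $l\prec k$ we have $il\in J(ij)$ or $jl\in J(ij)$; (ii) $ik\notin I$, $jl\in I$ for all $l\in T_a$, there is $t\prec k$ in $T_a$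 with $it,jt\notin J(ij)$, and for the maximal such $t$, $kt\in I$; (iii) the same as (ii) with the roles of $i$ and $j$ exchanged. Let $H=I\cap I(ij)$. The $u_{kl}$, $kl\in I$, are algebraically independent over $K$, and inside the fraction field of $R(ij)$ there is an inclusion $\mu\colon R(ij)\hookrightarrow K[u_{kl}:kl\in I][u_{kl}^{-1}:kl\in H\smallsetminus J]$. For $rs\notin J\cup\{ij\}$, $f_{rs}\in K[u_{kl}:kl\in I\smallsetminus J][u_{kl}^{-1}:kl\in H\smallsetminus J]$ is obtained from $\mu(u_{rs})$ by setting $u_{kl}=0$ for all $kl\in I\cap J$. Affinoid algebras: $K\{r_1^{-1}x_1,r_1x_1^{-1},\dots,r_N^{-1}x_N,r_Nx_N^{-1}\}$ is the Banach algebra of series $\sum_{\alpha\in\mathbb Z^N}c_\alpha x^\alpha$ with $|c_\alpha|r^\alpha\to0$ as $\sum_i|\alpha_i|\to\infty$, with norm $\max_\alpha|c_\alpha|r^\alpha$. For an affinoid algebra $A$, $f,g\in A$, $r,s>0$: $A\{r^{-1}f,sg^{-1}\}=A\{r^{-1}x,sy\}/(x-f,gy-1)$, where $A\{r^{-1}x,sy\}=\{\sum_{m,n\ge0} a_{mn}x^my^n: a_{mn}\in A,\ \|a_{mn}\|r^ms^{-n}\to0\}$; this is iterated for several elements. The reduction of an affinoid algebra $B$ is $\widetilde B=\{f\in B:\|f\|\le1\}/\{f\in B:\|f\|<1\}$, where $\|\cdot\|$ is the spectral seminorm $\|f\|=\sup_{\gamma\in\mathcal M(B)}\gamma(f)$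 and $\mathcal M(B)$ is the Berkovich spectrum of bounded multiplicative seminorms on $B$. *)

theory Defs
  imports
    "HOL-Analysis.Infinite_Sum"
    "HOL-Analysis.Function_Topology"
    "HOL-Algebra.Weak_Morphisms"
    "HOL-Computational_Algebra.Fraction_Field"
    "HOL-Library.Poly_Mapping"
    "HOL-Library.Uprod"
begin

section \<open>Complete non-Archimedean fields\<close>

text \<open>The metric is determined by the absolute value; it is only there to make the library's
  notion of completeness and of unconditional sums available. The trivial absolute value is allowed.\<close>

class complete_nonarch_field = field + complete_space +
  fixes nabs :: "'a \<Rightarrow> real"
  assumes nabs_nonneg: "nabs a \<ge> 0"
    and nabs_eq_0: "nabs a = 0 \<longleftrightarrow> a = 0"
    and nabs_mult: "nabs (a * b) = nabs a * nabs b"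
    and nabs_add: "nabs (a + b) \<le> max (nabs a) (nabs b)"
    and dist_nabs: "dist a b = nabs (a - b)"

definition type_ring :: "'a::comm_ring_1 ring" where
  "type_ring = \<lparr>carrier = UNIV, mult = (*), one = 1, zero = 0, add = (+)\<rparr>"


section \<open>Unordered pairs of indices\<close>

text \<open>Pairs are compared lexicographically as (smaller entry, larger entry). This order is only
  needed for the library's proof that polynomials in these variables form an integral domain.\<close>

instantiation uprod :: (linorder) linorder
begin

definition less_eq_uprod :: "'a uprod \<Rightarrow> 'a uprod \<Rightarrow> bool" where
  "p \<le> q \<longleftrightarrow> Min (set_uprod p) < Min (set_uprod q) \<or>
     Min (set_uprod p) = Min (set_uprod q) \<and> Max (set_uprod p) \<le> Max (set_uprod q)"

definition less_uprod :: "'a uprod \<Rightarrow> 'a uprod \<Rightarrow> bool" where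
  "p < q \<longleftrightarrow> p \<le> q \<and> \<not> q \<le> (p :: 'a uprod)"

instance
proof
  fix p q s :: "'a uprod"
  show "p < q \<longleftrightarrow> p \<le> q \<and> \<not> q \<le> p" by (rule less_uprod_def)
  show "p \<le> p" by (simp add: less_eq_uprod_def)
  show "p \<le> s" if "p \<le> q" "q \<le> s"
    using that by (auto simp: less_eq_uprod_def)
  show "p \<le> q \<or> q \<le> p" by (auto simp: less_eq_uprod_def)
  show "p = q" if "p \<le> q" "q \<le> p"
  proof -
    have "Min (set_uprod p) = Min (set_uprod q)" "Max (set_uprod p) = Max (set_uprod q)"
      using that by (auto simp: less_eq_uprod_def)
    then show ?thesis
      by (cases p; cases q) (auto simp: min_def max_def split: if_splits)
  qed
qed

end

definition pairs :: "nat \<Rightarrow> nat uprod set" where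
  "pairs n = {Upair k l | k l. k \<in> {1..n} \<and> l \<in> {1..n} \<and> k \<noteq> l}"

definition chart_vars :: "nat \<Rightarrow> nat \<Rightarrow> nat \<Rightarrow> nat uprod set" where
  "chart_vars n i j = {q. \<exists>l\<in>{1..n} - {i, j}. q = Upair i l \<or> q = Upair j l}"


section \<open>Coordinate rings of the charts of the Grassmannian\<close>

type_synonym 'k mpoly = "(nat uprod \<Rightarrow>\<^sub>0 nat) \<Rightarrow>\<^sub>0 'k"
type_synonym 'k lpoly = "(nat uprod \<Rightarrow>\<^sub>0 int) \<Rightarrow>\<^sub>0 'k"

definition const_poly :: "'k::zero \<Rightarrow> 'k mpoly" where
  "const_poly c = Poly_Mapping.single 0 c"

definition var_poly :: "nat uprod \<Rightarrow> 'k::zero_neq_one mpoly" where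
  "var_poly q = Poly_Mapping.single (Poly_Mapping.single q 1) 1"

definition chart_ring :: "nat \<Rightarrow> nat \<Rightarrow> nat \<Rightarrow> 'k::zero mpoly set" where
  "chart_ring n i j =
     {p. \<forall>\<alpha>\<in>Poly_Mapping.keys p. Poly_Mapping.keys \<alpha> \<subseteq> chart_vars n i j}"

text \<open>The element p(kl)/p(ij) of the coordinate ring of the chart where p(ij) does not vanish.
  The variables of the chart are the coordinates p(il)/p(ij) and p(jl)/p(ij) with i, respectively j,
  as first index; the coordinate of a pair disjoint from i, j is taken with
  its indices k, l in increasing order, and is given by the Pluecker relation
  p(ij) p(kl) = p(ik) p(jl) - p(il) p(jk).\<close>

definition chart_coord :: "nat \<Rightarrow> nat \<Rightarrow> nat uprod \<Rightarrow> 'k::comm_ring_1 mpoly" where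
  "chart_coord i j q =
     (if q = Upair i j then 1
      else if i \<in> set_uprod q \<or> j \<in> set_uprod q then var_poly q
      else (let k = Min (set_uprod q); l = Max (set_uprod q)
            in var_poly (Upair i k) * var_poly (Upair j l)
             - var_poly (Upair i l) * var_poly (Upair j k)))"


section \<open>Tropical projective space and the tropical Grassmannian\<close>

text \<open>Vectors are indexed by a set N and have entries in the reals together with negative infinity.\<close>

definition trop_vectors :: "'i set \<Rightarrow> ('i \<Rightarrow> ereal) set" where
  "trop_vectors N = {x \<in> N \<rightarrow>\<^sub>E {a. a \<noteq> \<infinity>}. \<exists>q\<in>N. x q \<noteq> - \<infinity>}"

definition trop_class :: "'i set \<Rightarrow> ('i \<Rightarrow> ereal) \<Rightarrow> ('i \<Rightarrow> ereal) set" where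
  "trop_class N x = {y \<in> trop_vectors N. \<exists>c::real. \<forall>q\<in>N. y q = x q + ereal c}"

definition trop_proj :: "'i set \<Rightarrow> ('i \<Rightarrow> ereal) set set" where
  "trop_proj N = trop_class N ` trop_vectors N"

text \<open>On the entries this is the order topology of the extended reals, in which the intervals from
  negative infinity to a real number form a neighbourhood base of negative infinity.\<close>

definition trop_vectors_topology :: "'i set \<Rightarrow> ('i \<Rightarrow> ereal) topology" where
  "trop_vectors_topology N =
     subtopology (product_topology (\<lambda>_. subtopology euclidean {a. a \<noteq> \<infinity>}) N) (trop_vectors N)"

definition trop_proj_topology :: "'i set \<Rightarrow> ('i \<Rightarrow> ereal) set topology" where
  "trop_proj_topology N = topology (\<lambda>U. U \<subseteq> trop_proj N \<and>
     openin (trop_vectors_topology N) {x \<in> trop_vectors N. trop_class N x \<in> U})"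

lemma topspace_trop_vectors_topology: "topspace (trop_vectors_topology N) = trop_vectors N"
  by (auto simp: trop_vectors_topology_def trop_vectors_def)

lemma openin_trop_proj_topology:
  "openin (trop_proj_topology N) U \<longleftrightarrow> U \<subseteq> trop_proj N \<and>
     openin (trop_vectors_topology N) {x \<in> trop_vectors N. trop_class N x \<in> U}"
proof -
  have "istopology (\<lambda>U. U \<subseteq> trop_proj N \<and>
     openin (trop_vectors_topology N) {x \<in> trop_vectors N. trop_class N x \<in> U})"
    unfolding istopology_def
  proof (intro conjI allI impI)
    fix S T
    assume "S \<subseteq> trop_proj N \<and>
        openin (trop_vectors_topology N) {x \<in> trop_vectors N. trop_class N x \<in> S}"
      and "T \<subseteq> trop_proj N \<and>
        openin (trop_vectors_topology N) {x \<in> trop_vectors N. trop_class N x \<in> T}"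
    moreover have "{x \<in> trop_vectors N. trop_class N x \<in> S \<inter> T} =
        {x \<in> trop_vectors N. trop_class N x \<in> S} \<inter> {x \<in> trop_vectors N. trop_class N x \<in> T}"
      by auto
    ultimately show "S \<inter> T \<subseteq> trop_proj N"
      and "openin (trop_vectors_topology N) {x \<in> trop_vectors N. trop_class N x \<in> S \<inter> T}"
      by (auto simp: openin_Int)
  next
    fix \<K>
    assume *: "\<forall>K\<in>\<K>. K \<subseteq> trop_proj N \<and>
        openin (trop_vectors_topology N) {x \<in> trop_vectors N. trop_class N x \<in> K}"
    have "{x \<in> trop_vectors N. trop_class N x \<in> \<Union>\<K>} =
        (\<Union>K\<in>\<K>. {x \<in> trop_vectors N. trop_class N x \<in> K})"
      by auto
    then show "openin (trop_vectors_topology N) {x \<in> trop_vectors N. trop_class N x \<in> \<Union>\<K>}"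
      using * by auto
    show "\<Union>\<K> \<subseteq> trop_proj N"
      using * by auto
  qed
  then show ?thesis
    by (simp add: trop_proj_topology_def)
qed

lemma quotient_map_trop_class:
  "quotient_map (trop_vectors_topology N) (trop_proj_topology N) (trop_class N)"
proof -
  have top: "topspace (trop_proj_topology N) = trop_proj N"
  proof
    have "openin (trop_proj_topology N) (trop_proj N)"
    proof -
      have "{x \<in> trop_vectors N. trop_class N x \<in> trop_proj N} = topspace (trop_vectors_topology N)"
        by (auto simp: trop_proj_def topspace_trop_vectors_topology)
      then show ?thesis
        by (simp add: openin_trop_proj_topology)
    qed
    then show "trop_proj N \<subseteq> topspace (trop_proj_topology N)"
      by (rule openin_subset)
  qed (use openin_trop_proj_topology[of N "topspace (trop_proj_topology N)"] in simp)
  show ?thesis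
    unfolding quotient_map_def top topspace_trop_vectors_topology
    by (auto simp: openin_trop_proj_topology trop_proj_def)
qed

definition trop_log :: "real \<Rightarrow> ereal" where
  "trop_log t = (if t = 0 then - \<infinity> else ereal (ln t))"

definition trop_exp :: "ereal \<Rightarrow> real" where
  "trop_exp a = (if a = - \<infinity> then 0 else exp (real_of_ereal a))"

text \<open>The Berkovich analytification of the chart: multiplicative seminorms on its coordinate ring
  extending the absolute value of the ground field (only their values on that ring matter).\<close>

definition chart_an :: "nat \<Rightarrow> nat \<Rightarrow> nat \<Rightarrow> ('k::complete_nonarch_field mpoly \<Rightarrow> real) set" where
  "chart_an n i j = {\<gamma>.
     (\<forall>f\<in>chart_ring n i j. \<gamma> f \<ge> 0) \<and>
     (\<forall>c. \<gamma> (const_poly c) = nabs c) \<and>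
     (\<forall>f\<in>chart_ring n i j. \<forall>g\<in>chart_ring n i j.
        \<gamma> (f * g) = \<gamma> f * \<gamma> g \<and> \<gamma> (f + g) \<le> \<gamma> f + \<gamma> g)}"

text \<open>The value of trop at a point of the chart, represented by the vector whose ij-entry is 0.\<close>

definition chart_trop ::
  "nat \<Rightarrow> nat \<Rightarrow> nat \<Rightarrow> ('k::complete_nonarch_field mpoly \<Rightarrow> real) \<Rightarrow> (nat uprod \<Rightarrow> ereal) set" where
  "chart_trop n i j \<gamma> =
     trop_class (pairs n) (\<lambda>q\<in>pairs n. trop_log (\<gamma> (chart_coord i j q)))"

text \<open>The analytification of the Grassmannian is covered by the analytifications of its charts.\<close>

definition trop_grassmannian ::
  "'k::complete_nonarch_field itself \<Rightarrow> nat \<Rightarrow> (nat uprod \<Rightarrow> ereal) set set" where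
  "trop_grassmannian K n = (\<Union>i\<in>{1..n}. \<Union>j\<in>{1..n} - {i}.
     chart_trop n i j ` (chart_an n i j :: ('k mpoly \<Rightarrow> real) set))"

definition trop_chart ::
  "'k::complete_nonarch_field itself \<Rightarrow> nat \<Rightarrow> nat \<Rightarrow> nat \<Rightarrow> (nat uprod \<Rightarrow> ereal) set set" where
  "trop_chart K n i j = {X \<in> trop_grassmannian K n. \<forall>x\<in>X. x (Upair i j) \<noteq> - \<infinity>}"


section \<open>Trees with labelled leaves\<close>

text \<open>Finite simple graphs whose edges are two-element sets of vertices;
  \<open>leaf\<close> gives the vertex labelled by an index.\<close>

record 'v ltree =
  verts :: "'v set"
  edges :: "'v set set"
  leaf :: "nat \<Rightarrow> 'v"

definition degr :: "('v, 'z) ltree_scheme \<Rightarrow> 'v \<Rightarrow> nat" where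
  "degr T v = card {e \<in> edges T. v \<in> e}"

definition leaves :: "('v, 'z) ltree_scheme \<Rightarrow> 'v set" where
  "leaves T = {v \<in> verts T. degr T v = 1}"

definition path_edges :: "'v list \<Rightarrow> 'v set set" where
  "path_edges p = {{p ! m, p ! Suc m} | m. Suc m < length p}"

definition is_path :: "('v, 'z) ltree_scheme \<Rightarrow> 'v \<Rightarrow> 'v list \<Rightarrow> 'v \<Rightarrow> bool" where
  "is_path T u p w \<longleftrightarrow> p \<noteq> [] \<and> hd p = u \<and> last p = w \<and> distinct p \<and>
     set p \<subseteq> verts T \<and> path_edges p \<subseteq> edges T"

definition tree_on :: "nat \<Rightarrow> ('v, 'z) ltree_scheme \<Rightarrow> bool" where
  "tree_on n T \<longleftrightarrow>
     finite (verts T) \<and> verts T \<noteq> {} \<and>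
     edges T \<subseteq> {{u, w} | u w. u \<in> verts T \<and> w \<in> verts T \<and> u \<noteq> w} \<and>
     (\<forall>u\<in>verts T. \<forall>w\<in>verts T. \<exists>p. is_path T u p w) \<and>
     \<not> (\<exists>u p w. is_path T u p w \<and> length p \<ge> 3 \<and> {u, w} \<in> edges T) \<and>
     (\<forall>v\<in>verts T. degr T v \<noteq> 2) \<and>
     bij_betw (leaf T) {1..n} (leaves T)"

definition inner_edges :: "('v, 'z) ltree_scheme \<Rightarrow> 'v set set" where
  "inner_edges T = {e \<in> edges T. e \<inter> leaves T = {}}"

definition leaf_path :: "('v, 'z) ltree_scheme \<Rightarrow> nat \<Rightarrow> nat \<Rightarrow> 'v list" where
  "leaf_path T k l = (THE p. is_path T (leaf T k) p (leaf T l))"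

definition tree_cone :: "nat \<Rightarrow> ('v, 'z) ltree_scheme \<Rightarrow> (nat uprod \<Rightarrow> ereal) set set" where
  "tree_cone n T = {trop_class (pairs n) x | x. x \<in> trop_vectors (pairs n) \<and>
     (\<exists>\<omega> :: 'v set \<Rightarrow> real. (\<forall>e\<in>inner_edges T. \<omega> e \<ge> 0) \<and>
       (\<forall>k\<in>{1..n}. \<forall>l\<in>{1..n}. k \<noteq> l \<longrightarrow>
          x (Upair k l) = ereal (\<Sum>e\<in>path_edges (leaf_path T k l). \<omega> e)))}"

definition internal_verts :: "('v, 'z) ltree_scheme \<Rightarrow> nat \<Rightarrow> nat \<Rightarrow> 'v set" where
  "internal_verts T i j = set (leaf_path T i j) - {leaf T i, leaf T j}"

definition branch :: "nat \<Rightarrow> ('v, 'z) ltree_scheme \<Rightarrow> nat \<Rightarrow> nat \<Rightarrow> 'v \<Rightarrow> nat set" where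
  "branch n T i j v = {l \<in> {1..n} - {i, j}.
     \<exists>p. is_path T (leaf T l) p v \<and> set p \<inter> set (leaf_path T i j) = {v}}"

definition spanned_subtree :: "('v, 'z) ltree_scheme \<Rightarrow> nat set \<Rightarrow> 'v ltree" where
  "spanned_subtree T L =
     \<lparr>verts = (\<Union>k\<in>L. \<Union>l\<in>L. set (leaf_path T k l)),
      edges = (\<Union>k\<in>L. \<Union>l\<in>L. path_edges (leaf_path T k l)),
      leaf = leaf T\<rparr>"

definition suppress_deg2 :: "('v, 'z) ltree_scheme \<Rightarrow> 'v ltree" where
  "suppress_deg2 T =
     \<lparr>verts = {v \<in> verts T. degr T v \<noteq> 2},
      edges = {{u, w} | u w. u \<noteq> w \<and> degr T u \<noteq> 2 \<and> degr T w \<noteq> 2 \<and>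
                 (\<exists>p. is_path T u p w \<and> (\<forall>v \<in> set p - {u, w}. degr T v = 2))},
      leaf = leaf T\<rparr>"

definition quartet :: "('v, 'z) ltree_scheme \<Rightarrow> nat set \<Rightarrow> 'v ltree" where
  "quartet T L = suppress_deg2 (spanned_subtree T L)"

definition is_cherry :: "('v, 'z) ltree_scheme \<Rightarrow> nat \<Rightarrow> nat \<Rightarrow> bool" where
  "is_cherry T k l \<longleftrightarrow> k \<noteq> l \<and> leaf T k \<in> leaves T \<and> leaf T l \<in> leaves T \<and>
     (\<exists>w\<in>verts T. {leaf T k, w} \<in> edges T \<and> {leaf T l, w} \<in> edges T)"


section \<open>Cherry property and compatible index sets\<close>

definition cherry_property ::
  "nat \<Rightarrow> ('v, 'z) ltree_scheme \<Rightarrow> nat \<Rightarrow> nat \<Rightarrow> nat rel \<Rightarrow> bool" where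
  "cherry_property n T i j r \<longleftrightarrow>
     (\<forall>a\<in>internal_verts T i j. \<forall>b\<in>internal_verts T i j. a \<noteq> b \<longrightarrow>
        (\<forall>k\<in>branch n T i j a. \<forall>l\<in>branch n T i j b. (k, l) \<notin> r \<and> (l, k) \<notin> r)) \<and>
     (\<forall>a\<in>internal_verts T i j. total_on (branch n T i j a) r) \<and>
     (\<forall>k l v. (k, l) \<in> r \<and> k \<noteq> l \<and> (l, v) \<in> r \<and> l \<noteq> v \<longrightarrow>
        is_cherry (quartet T {i, k, l, v}) k l \<or> is_cherry (quartet T {i, k, l, v}) l v)"

definition compatible_both ::
  "nat rel \<Rightarrow> nat uprod set \<Rightarrow> nat uprod set \<Rightarrow> nat \<Rightarrow> nat \<Rightarrow> nat \<Rightarrow> bool" where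
  "compatible_both r Jij I i j k \<longleftrightarrow> Upair i k \<in> I \<and> Upair j k \<in> I \<and>
     (\<forall>l. (l, k) \<in> r \<and> l \<noteq> k \<longrightarrow> Upair i l \<in> Jij \<or> Upair j l \<in> Jij)"

definition admissible_below ::
  "nat rel \<Rightarrow> nat uprod set \<Rightarrow> nat \<Rightarrow> nat \<Rightarrow> nat set \<Rightarrow> nat \<Rightarrow> nat set" where
  "admissible_below r Jij i j Ta k =
     {t \<in> Ta. (t, k) \<in> r \<and> t \<noteq> k \<and> Upair i t \<notin> Jij \<and> Upair j t \<notin> Jij}"

definition compatible_one ::
  "nat rel \<Rightarrow> nat uprod set \<Rightarrow> nat uprod set \<Rightarrow> nat \<Rightarrow> nat \<Rightarrow> nat set \<Rightarrow> nat \<Rightarrow> bool" where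
  "compatible_one r Jij I i j Ta k \<longleftrightarrow> Upair i k \<notin> I \<and> (\<forall>l\<in>Ta. Upair j l \<in> I) \<and>
     (\<exists>t\<in>admissible_below r Jij i j Ta k.
        (\<forall>t'\<in>admissible_below r Jij i j Ta k. (t', t) \<in> r) \<and> Upair k t \<in> I)"

definition compatible ::
  "nat \<Rightarrow> ('v, 'z) ltree_scheme \<Rightarrow> nat \<Rightarrow> nat \<Rightarrow> nat rel \<Rightarrow> nat uprod set \<Rightarrow> nat uprod set \<Rightarrow> bool"
  where
  "compatible n T i j r Jij I \<longleftrightarrow>
     I \<subseteq> pairs n \<and> card I = 2 * (n - 2) \<and> Upair i j \<notin> I \<and>
     (\<forall>a\<in>internal_verts T i j. \<forall>k\<in>branch n T i j a.
        let c1 = compatible_both r Jij I i j k;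
            c2 = compatible_one r Jij I i j (branch n T i j a) k;
            c3 = compatible_one r Jij I j i (branch n T i j a) k
        in (c1 \<and> \<not> c2 \<and> \<not> c3) \<or> (\<not> c1 \<and> c2 \<and> \<not> c3) \<or> (\<not> c1 \<and> \<not> c2 \<and> c3))"


section \<open>Coordinates attached to a compatible index set\<close>

text \<open>Polynomials in the variables indexed by V, those indexed by W being inverted.\<close>

definition mixed_ring :: "nat uprod set \<Rightarrow> nat uprod set \<Rightarrow> 'k::zero lpoly set" where
  "mixed_ring V W = {p. \<forall>\<alpha>\<in>Poly_Mapping.keys p. Poly_Mapping.keys \<alpha> \<subseteq> V \<and>
     (\<forall>q\<in>V - W. Poly_Mapping.lookup \<alpha> q \<ge> 0)}"

text \<open>Substitution of the elements p(kl)/p(ij) of the function field for the variables.\<close>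

definition eval_coord :: "nat \<Rightarrow> nat \<Rightarrow> 'k::field lpoly \<Rightarrow> 'k mpoly fract" where
  "eval_coord i j p = (\<Sum>\<alpha>\<in>Poly_Mapping.keys p.
     Fract (const_poly (Poly_Mapping.lookup p \<alpha>)) 1 *
     (\<Prod>q\<in>Poly_Mapping.keys \<alpha>. Fract (chart_coord i j q) 1 powi Poly_Mapping.lookup \<alpha> q))"

text \<open>For a compatible index set I and W the set of those pairs in both I and I(ij) that are not
  in J, the restriction of \<open>eval_coord i j\<close> to \<open>mixed_ring I W\<close> is injective and its
  image contains the coordinate ring of the chart, so that \<open>coord_incl i j I W\<close> is an
  embedding of the latter.\<close>

definition coord_incl ::
  "nat \<Rightarrow> nat \<Rightarrow> nat uprod set \<Rightarrow> nat uprod set \<Rightarrow> 'k::field mpoly \<Rightarrow> 'k lpoly" where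
  "coord_incl i j I W g = (THE p. p \<in> mixed_ring I W \<and> eval_coord i j p = Fract g 1)"

text \<open>Setting to zero the variables indexed by Z. This is only used when they occur
  with nonnegative exponents, so that it removes the monomials in which one of them occurs.\<close>

definition set_zero :: "nat uprod set \<Rightarrow> 'k::comm_monoid_add lpoly \<Rightarrow> 'k lpoly" where
  "set_zero Z p = (\<Sum>\<alpha>\<in>{\<alpha> \<in> Poly_Mapping.keys p. Poly_Mapping.keys \<alpha> \<inter> Z = {}}.
     Poly_Mapping.single \<alpha> (Poly_Mapping.lookup p \<alpha>))"

definition f_coord ::
  "nat \<Rightarrow> nat \<Rightarrow> nat \<Rightarrow> nat uprod set \<Rightarrow> nat uprod set \<Rightarrow> nat uprod \<Rightarrow> 'k::field lpoly" where
  "f_coord n i j I J q =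
     set_zero (I \<inter> J) (coord_incl i j I ((I \<inter> chart_vars n i j) - J) (chart_coord i j q))"


section \<open>Affinoid algebras\<close>

record 'a normed_ring = "'a ring" +
  nrm :: "'a \<Rightarrow> real"

text \<open>The Banach algebra of Laurent series in the variables indexed by V that converge on the torus
  with polyradius \<open>\<rho>\<close>; the supremum is attained.\<close>

definition monomial_radius :: "('i \<Rightarrow> real) \<Rightarrow> ('i \<Rightarrow>\<^sub>0 int) \<Rightarrow> real" where
  "monomial_radius \<rho> \<alpha> = (\<Prod>q\<in>Poly_Mapping.keys \<alpha>. \<rho> q powi Poly_Mapping.lookup \<alpha> q)"

definition torus_algebra ::
  "'i set \<Rightarrow> ('i \<Rightarrow> real) \<Rightarrow> (('i \<Rightarrow>\<^sub>0 int) \<Rightarrow> 'k::complete_nonarch_field) normed_ring" where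
  "torus_algebra V \<rho> =
     \<lparr>carrier = {c. (\<forall>\<alpha>. \<not> Poly_Mapping.keys \<alpha> \<subseteq> V \<longrightarrow> c \<alpha> = 0) \<and>
        (\<forall>\<epsilon>>0. \<exists>N. \<forall>\<alpha>. Poly_Mapping.keys \<alpha> \<subseteq> V \<and>
            (\<Sum>q\<in>Poly_Mapping.keys \<alpha>. \<bar>Poly_Mapping.lookup \<alpha> q\<bar>) \<ge> N \<longrightarrow>
            nabs (c \<alpha>) * monomial_radius \<rho> \<alpha> < \<epsilon>)},
      mult = (\<lambda>c d \<gamma>. \<Sum>\<^sub>\<infinity>\<alpha>. c \<alpha> * d (\<gamma> - \<alpha>)),
      one = (\<lambda>\<alpha>. if \<alpha> = 0 then 1 else 0),
      zero = (\<lambda>_. 0),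
      add = (\<lambda>c d \<alpha>. c \<alpha> + d \<alpha>),
      nrm = (\<lambda>c. SUP \<alpha>. nabs (c \<alpha>) * monomial_radius \<rho> \<alpha>)\<rparr>"

definition torus_const :: "'k::zero \<Rightarrow> ('i \<Rightarrow>\<^sub>0 int) \<Rightarrow> 'k" where
  "torus_const a = (\<lambda>\<alpha>. if \<alpha> = 0 then a else 0)"

text \<open>The algebra of series \<open>\<Sum> a m n x^m y^n\<close> over R, written \<open>R{r\<inverse> x, s y}\<close>.\<close>

definition relative_tate ::
  "('a, 'z) normed_ring_scheme \<Rightarrow> real \<Rightarrow> real \<Rightarrow> (nat \<Rightarrow> nat \<Rightarrow> 'a) normed_ring" where
  "relative_tate R r s =
     \<lparr>carrier = {a. (\<forall>m n. a m n \<in> carrier R) \<and>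
        (\<forall>\<epsilon>>0. \<exists>N. \<forall>m n. m + n \<ge> N \<longrightarrow> nrm R (a m n) * r ^ m / s ^ n < \<epsilon>)},
      mult = (\<lambda>a b m n. \<Oplus>\<^bsub>R\<^esub>p\<in>{..m}. \<Oplus>\<^bsub>R\<^esub>q\<in>{..n}. a p q \<otimes>\<^bsub>R\<^esub> b (m - p) (n - q)),
      one = (\<lambda>m n. if m = 0 \<and> n = 0 then \<one>\<^bsub>R\<^esub> else \<zero>\<^bsub>R\<^esub>),
      zero = (\<lambda>m n. \<zero>\<^bsub>R\<^esub>),
      add = (\<lambda>a b m n. a m n \<oplus>\<^bsub>R\<^esub> b m n),
      nrm = (\<lambda>a. SUP (m, n). nrm R (a m n) * r ^ m / s ^ n)\<rparr>"

definition relative_const :: "('a, 'z) ring_scheme \<Rightarrow> 'a \<Rightarrow> nat \<Rightarrow> nat \<Rightarrow> 'a" where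
  "relative_const R a = (\<lambda>m n. if m = 0 \<and> n = 0 then a else \<zero>\<^bsub>R\<^esub>)"

text \<open>The ideal generated by \<open>x - f\<close> and \<open>g y - 1\<close>.\<close>

definition laurent_ideal ::
  "('a, 'z) normed_ring_scheme \<Rightarrow> 'a \<Rightarrow> real \<Rightarrow> 'a \<Rightarrow> real \<Rightarrow> (nat \<Rightarrow> nat \<Rightarrow> 'a) set" where
  "laurent_ideal R f r g s = Idl\<^bsub>relative_tate R r s\<^esub>
     {\<lambda>m n. if m = 1 \<and> n = 0 then \<one>\<^bsub>R\<^esub> else if m = 0 \<and> n = 0 then \<ominus>\<^bsub>R\<^esub> f else \<zero>\<^bsub>R\<^esub>,
      \<lambda>m n. if m = 0 \<and> n = 1 then g else if m = 0 \<and> n = 0 then \<ominus>\<^bsub>R\<^esub> \<one>\<^bsub>R\<^esub> else \<zero>\<^bsub>R\<^esub>}"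

text \<open>\<open>R{r\<inverse> f, s g\<inverse>}\<close> with the residue norm, and its structure map.\<close>

definition laurent_domain ::
  "('a, 'z) normed_ring_scheme \<Rightarrow> 'a \<Rightarrow> real \<Rightarrow> 'a \<Rightarrow> real \<Rightarrow> (nat \<Rightarrow> nat \<Rightarrow> 'a) set normed_ring" where
  "laurent_domain R f r g s =
     ring.extend (relative_tate R r s Quot laurent_ideal R f r g s)
       (normed_ring.fields (\<lambda>C. INF a\<in>C. nrm (relative_tate R r s) a))"

definition laurent_domain_map ::
  "('a, 'z) normed_ring_scheme \<Rightarrow> 'a \<Rightarrow> real \<Rightarrow> 'a \<Rightarrow> real \<Rightarrow> 'a \<Rightarrow> (nat \<Rightarrow> nat \<Rightarrow> 'a) set" where
  "laurent_domain_map R f r g s a =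
     laurent_ideal R f r g s +>\<^bsub>relative_tate R r s\<^esub> relative_const R a"

text \<open>Each application of \<open>laurent_domain\<close> changes the type of the elements. In order to iterate
  it a variable number of times, the result is transported, together with its norm, along
  an injection into a type that is closed under forming series: a residue class is
  represented by one of its elements.\<close>

datatype ('e, 'k) tower = Ground "'e \<Rightarrow> 'k" | Series "nat \<Rightarrow> nat \<Rightarrow> ('e, 'k) tower"

definition image_normed_ring ::
  "('a \<Rightarrow> 'b) \<Rightarrow> ('a, 'z) normed_ring_scheme \<Rightarrow> 'b normed_ring" where
  "image_normed_ring h R = ring.extend (image_ring h R)
     (normed_ring.fields (\<lambda>b. nrm R (inv_into (carrier R) h b)))"

definition encode_class :: "(nat \<Rightarrow> nat \<Rightarrow> ('e, 'k) tower) set \<Rightarrow> ('e, 'k) tower" where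
  "encode_class C = Series (SOME a. a \<in> C)"

text \<open>Starting from a normed ring R and a map h from A to R, adjoin successively
  \<open>r\<inverse> f, s g\<inverse>\<close> for the entries \<open>(f, r, g, s)\<close> of a list, f and g being elements of A,
  and keep track of the resulting map from A.\<close>

fun iterated_domain ::
  "('e, 'k) tower normed_ring \<Rightarrow> ('a \<Rightarrow> ('e, 'k) tower) \<Rightarrow> ('a \<times> real \<times> 'a \<times> real) list \<Rightarrow>
   ('e, 'k) tower normed_ring \<times> ('a \<Rightarrow> ('e, 'k) tower)" where
  "iterated_domain R h [] = (R, h)"
| "iterated_domain R h ((f, r, g, s) # fs) =
     iterated_domain
       (image_normed_ring encode_class (laurent_domain R (h f) r (h g) s))
       (\<lambda>a. encode_class (laurent_domain_map R (h f) r (h g) s (h a)))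
       fs"


section \<open>Spectral seminorm and reduction\<close>

definition berkovich_spectrum :: "('a, 'z) normed_ring_scheme \<Rightarrow> ('a \<Rightarrow> real) set" where
  "berkovich_spectrum B = {\<gamma>.
     (\<forall>f\<in>carrier B. \<gamma> f \<ge> 0) \<and> \<gamma> \<zero>\<^bsub>B\<^esub> = 0 \<and> \<gamma> \<one>\<^bsub>B\<^esub> = 1 \<and>
     (\<forall>f\<in>carrier B. \<forall>g\<in>carrier B.
        \<gamma> (f \<otimes>\<^bsub>B\<^esub> g) = \<gamma> f * \<gamma> g \<and> \<gamma> (f \<oplus>\<^bsub>B\<^esub> g) \<le> \<gamma> f + \<gamma> g) \<and>
     (\<exists>C. \<forall>f\<in>carrier B. \<gamma> f \<le> C * nrm B f)}"

text \<open>The value 0 is inserted so that the seminorm of the zero algebra, whose spectrum is empty, is 0.\<close>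

definition spectral_norm :: "('a, 'z) normed_ring_scheme \<Rightarrow> 'a \<Rightarrow> real" where
  "spectral_norm B f = Sup (insert 0 {\<gamma> f | \<gamma>. \<gamma> \<in> berkovich_spectrum B})"

definition ball_ring :: "('a, 'z) ring_scheme \<Rightarrow> ('a \<Rightarrow> real) \<Rightarrow> ('a, 'z) ring_scheme" where
  "ball_ring R N = R\<lparr>carrier := {f \<in> carrier R. N f \<le> 1}\<rparr>"

definition open_ball_ideal :: "('a, 'z) ring_scheme \<Rightarrow> ('a \<Rightarrow> real) \<Rightarrow> 'a set" where
  "open_ball_ideal R N = {f \<in> carrier R. N f < 1}"

definition reduction_wrt :: "('a, 'z) ring_scheme \<Rightarrow> ('a \<Rightarrow> real) \<Rightarrow> 'a set ring" where
  "reduction_wrt R N = ball_ring R N Quot open_ball_ideal R N"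

definition reduction :: "('a, 'z) normed_ring_scheme \<Rightarrow> 'a set ring" where
  "reduction B = reduction_wrt B (spectral_norm B)"

definition residue_field :: "'k::complete_nonarch_field set ring" where
  "residue_field = reduction_wrt type_ring nabs"

text \<open>The map from the residue field to the reduction of B induced by a map h from K to B.\<close>

definition reduction_map ::
  "('k::complete_nonarch_field \<Rightarrow> 'a) \<Rightarrow> ('a, 'z) normed_ring_scheme \<Rightarrow> 'k set \<Rightarrow> 'a set" where
  "reduction_map h B c = the_elem
     ((\<lambda>a. open_ball_ideal B (spectral_norm B) +>\<^bsub>ball_ring B (spectral_norm B)\<^esub> h a) ` c)"


section \<open>Laurent polynomials over a ring, and localization\<close>

definition laurent_poly_ring ::
  "('b, 'z) ring_scheme \<Rightarrow> 'i set \<Rightarrow> (('i \<Rightarrow>\<^sub>0 int) \<Rightarrow> 'b) ring" where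
  "laurent_poly_ring k V =
     \<lparr>carrier = {c. (\<forall>\<alpha>. c \<alpha> \<in> carrier k) \<and> finite {\<alpha>. c \<alpha> \<noteq> \<zero>\<^bsub>k\<^esub>} \<and>
        (\<forall>\<alpha>. \<not> Poly_Mapping.keys \<alpha> \<subseteq> V \<longrightarrow> c \<alpha> = \<zero>\<^bsub>k\<^esub>)},
      mult = (\<lambda>c d \<gamma>. \<Oplus>\<^bsub>k\<^esub>\<alpha>\<in>{\<alpha>. c \<alpha> \<noteq> \<zero>\<^bsub>k\<^esub>}. c \<alpha> \<otimes>\<^bsub>k\<^esub> d (\<gamma> - \<alpha>)),
      one = (\<lambda>\<alpha>. if \<alpha> = 0 then \<one>\<^bsub>k\<^esub> else \<zero>\<^bsub>k\<^esub>),
      zero = (\<lambda>_. \<zero>\<^bsub>k\<^esub>),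
      add = (\<lambda>c d \<alpha>. c \<alpha> \<oplus>\<^bsub>k\<^esub> d \<alpha>)\<rparr>"

definition laurent_poly_const :: "('b, 'z) ring_scheme \<Rightarrow> 'b \<Rightarrow> ('i \<Rightarrow>\<^sub>0 int) \<Rightarrow> 'b" where
  "laurent_poly_const k a = (\<lambda>\<alpha>. if \<alpha> = 0 then a else \<zero>\<^bsub>k\<^esub>)"

definition frac_rel :: "('a, 'z) ring_scheme \<Rightarrow> 'a set \<Rightarrow> ('a \<times> 'a) rel" where
  "frac_rel R S = {((a, s), (b, t)). a \<in> carrier R \<and> b \<in> carrier R \<and> s \<in> S \<and> t \<in> S \<and>
     (\<exists>u\<in>S. u \<otimes>\<^bsub>R\<^esub> (a \<otimes>\<^bsub>R\<^esub> t) = u \<otimes>\<^bsub>R\<^esub> (b \<otimes>\<^bsub>R\<^esub> s))}"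

definition frac_class :: "('a, 'z) ring_scheme \<Rightarrow> 'a set \<Rightarrow> 'a \<Rightarrow> 'a \<Rightarrow> ('a \<times> 'a) set" where
  "frac_class R S a s = frac_rel R S `` {(a, s)}"

definition localization :: "('a, 'z) ring_scheme \<Rightarrow> 'a set \<Rightarrow> ('a \<times> 'a) set ring" where
  "localization R S =
     \<lparr>carrier = (carrier R \<times> S) // frac_rel R S,
      mult = (\<lambda>X Y. \<Union>(a, s)\<in>X. \<Union>(b, t)\<in>Y. frac_class R S (a \<otimes>\<^bsub>R\<^esub> b) (s \<otimes>\<^bsub>R\<^esub> t)),
      one = frac_class R S \<one>\<^bsub>R\<^esub> \<one>\<^bsub>R\<^esub>,
      zero = frac_class R S \<zero>\<^bsub>R\<^esub> \<one>\<^bsub>R\<^esub>,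
      add = (\<lambda>X Y. \<Union>(a, s)\<in>X. \<Union>(b, t)\<in>Y.
               frac_class R S (a \<otimes>\<^bsub>R\<^esub> t \<oplus>\<^bsub>R\<^esub> b \<otimes>\<^bsub>R\<^esub> s) (s \<otimes>\<^bsub>R\<^esub> t))\<rparr>"

definition localization_map :: "('a, 'z) ring_scheme \<Rightarrow> 'a set \<Rightarrow> 'a \<Rightarrow> ('a \<times> 'a) set" where
  "localization_map R S a = frac_class R S a \<one>\<^bsub>R\<^esub>"

text \<open>Isomorphism of k-algebras, given as rings with structure maps from k.\<close>

definition algebra_isomorphic ::
  "('c, 'z) ring_scheme \<Rightarrow> ('a, 'y) ring_scheme \<Rightarrow> ('c \<Rightarrow> 'a) \<Rightarrow>
   ('b, 'x) ring_scheme \<Rightarrow> ('c \<Rightarrow> 'b) \<Rightarrow> bool" where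
  "algebra_isomorphic k R \<eta> S \<theta> \<longleftrightarrow>
     (\<exists>\<phi>\<in>ring_iso R S. \<forall>c\<in>carrier k. \<phi> (\<eta> c) = \<theta> c)"

end

theory Submission
  imports Defs "HOL-Analysis.Elementary_Metric_Spaces" "HOL-Algebra.UnivPoly"
begin

text \<open>While the elements \<open>f\<close> are adjoined to A one after the other, the following dichotomy persists: either 1
  has seminorm 0, or the seminorm is multiplicative, A is mapped isometrically, and the fractions \<open>a/s\<close>
  with \<open>|s| = 1\<close> and s invertible are dense. Indeed, if \<open>|f| < \<rho>\<close>, then \<open>1 = f f\<inverse>\<close> gets a norm less
  than 1; if \<open>|f| = \<rho>\<close>, then an expression in \<open>f, f\<inverse>\<close> over the given ring becomes an element of that ring
  after multiplication with a power of f, which changes all norms by the same factor. The case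
  \<open>|f| > \<rho>\<close> does not occur: by the four-point conditions on the closed cone of the tree, and by the cherry
  property in the inductive step, every coordinate has an expression in the chosen coordinates whose
  Gauss norm is bounded by its \<open>\<rho>\<close>. Rescaling the variables by scalars of absolute value \<open>\<rho>\<close> maps the
  unit ball of A onto the Laurent polynomials over the residue field, with kernel the open unit ball.
  Hence the reduction of B consists of fractions of Laurent polynomials; if 1 has seminorm 0, then it is
  zero, that is, the localization at a set containing 0.\<close>

section \<open>Trees and the four-point conditions\<close>

text \<open>Each adjunction is a quotient by an ideal that is only algebraically generated, so the
  new seminorm is an infimum over cosets and need not separate points. The difficulty is to bound
  this infimum from below. As f is not invertible before the step, the evaluation x = f, y = 1/f has
  no target yet; instead finite truncations are evaluated after multiplication by f^N, and
  membership in the ideal becomes smallness relative to \<rho>^N. The new ring is described by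
  density of fractions and not by an explicit completion, because a reduction sees elements only up
  to norm less than 1. On the combinatorial side, u_ik u_jl - u_il u_jk can have a larger Gauss norm
  than \<rho>_kl if k and l leave the i-j path at the same vertex. An expression through an
  intermediate leaf avoids this cancellation, and the cherry property bounds its two terms. All tree
  estimates are kept in exponential form: an entry -\<infinity> becomes 0, and the inequalities
  remain meaningful on the boundary of the cone.\<close>

lemma path_edges_Nil [simp]: "path_edges [] = {}"
  by (simp add: path_edges_def)

lemma path_edges_singleton [simp]: "path_edges [u] = {}"
  by (simp add: path_edges_def)

lemma path_edges_Cons [simp]: "path_edges (u # v # p) = insert {u, v} (path_edges (v # p))"
proof -
  have "path_edges (u # v # p) = (\<lambda>m. {(u # v # p) ! m, (v # p) ! m}) ` {m. m < Suc (length p)}"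
    by (auto simp: path_edges_def)
  also have "{m. m < Suc (length p)} = insert 0 (Suc ` {m. m < length p})"
    by (auto simp: less_Suc_eq_0_disj)
  also have "(\<lambda>m. {(u # v # p) ! m, (v # p) ! m}) ` \<dots> =
      insert {u, v} ((\<lambda>m. {(v # p) ! m, p ! m}) ` {m. m < length p})"
    by (auto simp: image_image)
  also have "\<dots> = insert {u, v} (path_edges (v # p))"
    by (auto simp: path_edges_def)
  finally show ?thesis .
qed

lemma path_edges_append:
  assumes "p \<noteq> []" "q \<noteq> []"
  shows "path_edges (p @ q) = path_edges p \<union> {{last p, hd q}} \<union> path_edges q"
  using assms
proof (induction p)
  case (Cons u p)
  show ?case
  proof (cases p)
    case Nil
    with Cons.prems show ?thesis by (cases q) auto
  next
    case (Cons v p')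
    with Cons.IH Cons.prems show ?thesis by auto
  qed
qed simp

lemma path_edges_subset: "e \<in> path_edges p \<Longrightarrow> e \<subseteq> set p"
  by (auto simp: path_edges_def)

lemma path_edges_rev: "path_edges (rev p) = path_edges p"
proof (induction p)
  case (Cons u p)
  show ?case
  proof (cases "p = []")
    case False
    then have "path_edges (rev (u # p)) = path_edges p \<union> {{hd p, u}}"
      using Cons by (simp add: path_edges_append last_rev)
    then show ?thesis
      using False by (cases p) (auto simp: insert_commute)
  qed simp
qed simp

lemma ex_path_edge:
  assumes "v \<in> set p" "length p \<ge> 2"
  obtains z where "z \<in> set p" "{v, z} \<in> path_edges p"
proof -
  obtain m where m: "m < length p" "v = p ! m"
    using assms(1) by (auto simp: in_set_conv_nth)
  show thesis
  proof (cases m)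
    case 0
    with assms m show thesis
      by (intro that[of "p ! 1"]) (auto simp: path_edges_def)
  next
    case (Suc m')
    then show thesis
      using m by (intro that[of "p ! m'"]) (auto simp: path_edges_def insert_commute)
  qed
qed

lemma is_path_rev: "is_path T u p w \<Longrightarrow> is_path T w (rev p) u"
  by (auto simp: is_path_def path_edges_rev hd_rev last_rev)

lemma is_path_split:
  assumes "is_path T u p w" "v \<in> set p"
  obtains p1 p2 where "is_path T u p1 v" "is_path T v p2 w"
    "path_edges p1 \<subseteq> path_edges p" "path_edges p2 \<subseteq> path_edges p"
    "set p1 \<subseteq> set p" "set p2 \<subseteq> set p"
proof -
  obtain ys zs where p: "p = ys @ v # zs"
    using assms(2) by (auto dest: split_list)
  have e1: "path_edges (ys @ [v]) \<subseteq> path_edges p"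
    unfolding p by (cases "ys = []") (auto simp: path_edges_append)
  have e2: "path_edges (v # zs) \<subseteq> path_edges p"
    unfolding p by (cases "ys = []") (auto simp: path_edges_append)
  have "is_path T u (ys @ [v]) v" "is_path T v (v # zs) w"
    using assms(1) e1 e2 by (auto simp: is_path_def p hd_append split: if_splits)
  from that[OF this e1 e2] show thesis
    by (auto simp: p)
qed

text \<open>Without repetitions the first vertex lies on one edge only, and this edge determines the
  second vertex. Removing it from both edge sets leaves the induction hypothesis for the
  tails.\<close>

lemma is_path_same_edges_unique:
  assumes "path_edges p = path_edges q" "p \<noteq> []" "q \<noteq> []" "hd p = hd q" "distinct p" "distinct q"
  shows "p = q"
  using assms
proof (induction p arbitrary: q)
  case (Cons u p)
  show ?case
  proof (cases p)
    case Nil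
    then have "path_edges q = {}" using Cons.prems by simp
    moreover obtain q' where "q = u # q'" using Cons.prems by (cases q) auto
    ultimately show ?thesis using Nil by (cases q') auto
  next
    case p: (Cons v p')
    obtain q1 where q1: "q = u # q1" using Cons.prems by (cases q) auto
    have "q1 \<noteq> []" using Cons.prems(1) unfolding p q1 by (cases q1) auto
    then obtain v' q' where q: "q1 = v' # q'" by (cases q1) auto
    have *: "{u, z} \<notin> path_edges (v # p')" "{u, z} \<notin> path_edges (v' # q')" for z
      using Cons.prems(5,6) path_edges_subset[of "{u, z}"] unfolding p q1 q by fastforce+
    have "{u, v} \<in> path_edges q" using Cons.prems(1) unfolding p by auto
    then have v: "v = v'" using * unfolding q1 q by (auto simp: doubleton_eq_iff)
    have "path_edges (v # p') = path_edges (v' # q')"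
      using Cons.prems(1) * unfolding p q1 q v by (simp add: insert_ident)
    then have "p = v' # q'"
      using Cons.IH[of "v' # q'"] Cons.prems unfolding p q1 q v by simp
    then show ?thesis unfolding q1 q by simp
  qed
qed simp

text \<open>Deleting an edge splits a tree into two sides, and a path uses the edge iff its ends
  lie on different sides.\<close>

definition side :: "('v, 'z) ltree_scheme \<Rightarrow> 'v \<Rightarrow> 'v \<Rightarrow> 'v \<Rightarrow> bool" where
  "side T a b v \<longleftrightarrow> (\<exists>p. is_path T a p v \<and> {a, b} \<notin> path_edges p)"

lemma tree_edgeD:
  assumes "tree_on n T" "{u, w} \<in> edges T"
  shows "u \<in> verts T" "w \<in> verts T" "u \<noteq> w"
proof -
  obtain u' w' where "{u, w} = {u', w'}" "u' \<in> verts T" "w' \<in> verts T" "u' \<noteq> w'"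
    using assms unfolding tree_on_def by blast
  then show "u \<in> verts T" "w \<in> verts T" "u \<noteq> w" by (auto simp: doubleton_eq_iff)
qed

text \<open>A path that avoids the edge is prolonged by one step. If the new vertex already lies on
  it, the initial part up to that vertex is taken instead, so that the vertices stay
  distinct.\<close>

lemma side_adj:
  assumes T: "tree_on n T" and e: "{u, w} \<in> edges T" "{u, w} \<noteq> {a, b}" and s: "side T a b u"
  shows "side T a b w"
proof -
  obtain p where p: "is_path T a p u" "{a, b} \<notin> path_edges p"
    using s by (auto simp: side_def)
  show ?thesis
  proof (cases "w \<in> set p")
    case True
    then obtain p1 p2 where "is_path T a p1 w" "path_edges p1 \<subseteq> path_edges p"
      using is_path_split[OF p(1)] by metis
    then show ?thesis using p(2) by (auto simp: side_def)
  next
    case False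
    have "path_edges (p @ [w]) = insert {u, w} (path_edges p)"
      using p(1) by (auto simp: is_path_def path_edges_append)
    then have "is_path T a (p @ [w]) w \<and> {a, b} \<notin> path_edges (p @ [w])"
      using p e tree_edgeD[OF T e(1)] False by (auto simp: is_path_def)
    then show ?thesis unfolding side_def by blast
  qed
qed

text \<open>A path from \<open>a\<close> to \<open>b\<close> that avoids the edge has at least three
  vertices and would close up to a cycle, which the acyclicity clause of \<open>tree_on\<close>
  excludes.\<close>

lemma side_ends:
  assumes T: "tree_on n T" and e: "{a, b} \<in> edges T"
  shows "side T a b a" "\<not> side T a b b"
proof -
  have ab: "a \<in> verts T" "b \<in> verts T" "a \<noteq> b" using tree_edgeD[OF T e] by auto
  then have "is_path T a [a] a" by (simp add: is_path_def)
  then show "side T a b a" unfolding side_def by (metis empty_iff path_edges_singleton)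
  show "\<not> side T a b b"
  proof
    assume "side T a b b"
    then obtain p where p: "is_path T a p b" "{a, b} \<notin> path_edges p" by (auto simp: side_def)
    obtain u q where q: "p = a # u # q"
      using p(1) ab by (cases p rule: remdups_adj.cases) (auto simp: is_path_def)
    have "q \<noteq> []" using p unfolding q by (auto simp: is_path_def)
    then have "length p \<ge> 3" unfolding q by (cases q) auto
    then show False using p(1) e T unfolding tree_on_def by blast
  qed
qed

lemma side_const:
  assumes T: "tree_on n T" and "p \<noteq> []" "path_edges p \<subseteq> edges T" "{a, b} \<notin> path_edges p"
  shows "side T a b (hd p) \<longleftrightarrow> side T a b (last p)"
  using assms(2-)
proof (induction p)
  case (Cons u p)
  show ?case
  proof (cases p)
    case (Cons v p')
    with Cons.prems have e: "{u, v} \<in> edges T" "{u, v} \<noteq> {a, b}" "{v, u} \<in> edges T" "{v, u} \<noteq> {a, b}"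
      by (auto simp: insert_commute)
    have "side T a b u \<longleftrightarrow> side T a b v"
      using side_adj[OF T e(1,2)] side_adj[OF T e(3,4)] by blast
    then show ?thesis using Cons.IH Cons.prems Cons by simp
  qed simp
qed simp

text \<open>The vertices of a path are distinct, so it traverses the edge at most once: cut there,
  both halves avoid the edge and each stays on one side.\<close>

lemma side_path_iff:
  assumes T: "tree_on n T" and e: "{a, b} \<in> edges T" and p: "is_path T u p w"
  shows "{a, b} \<in> path_edges p \<longleftrightarrow> side T a b u \<noteq> side T a b w"
proof
  assume "{a, b} \<in> path_edges p"
  then obtain m where m: "{a, b} = {p ! m, p ! Suc m}" "Suc m < length p"
    by (auto simp: path_edges_def)
  define p1 p2 where "p1 = take (Suc m) p" and "p2 = drop (Suc m) p"
  have pp: "p = p1 @ p2" "p1 \<noteq> []" "p2 \<noteq> []"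
    using m by (auto simp: p1_def p2_def)
  have l: "last p1 = p ! m" "hd p2 = p ! Suc m"
    using m by (auto simp: p1_def p2_def last_conv_nth hd_drop_conv_nth take_Suc_conv_app_nth)
  have d: "distinct (p1 @ p2)" using p pp by (simp add: is_path_def)
  have "p ! Suc m \<notin> set p1" "p ! m \<notin> set p2"
    using d l pp by (metis disjoint_iff distinct_append hd_in_set last_in_set)+
  then have no: "{a, b} \<notin> path_edges p1" "{a, b} \<notin> path_edges p2"
    using m path_edges_subset by (metis insert_subset)+
  have "path_edges p1 \<subseteq> edges T" "path_edges p2 \<subseteq> edges T"
    using p pp by (auto simp: is_path_def path_edges_append)
  then have "side T a b u \<longleftrightarrow> side T a b (p ! m)" "side T a b (p ! Suc m) \<longleftrightarrow> side T a b w"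
    using side_const[OF T pp(2) _ no(1)] side_const[OF T pp(3) _ no(2)] l p pp
    by (auto simp: is_path_def)
  moreover have "side T a b (p ! m) \<noteq> side T a b (p ! Suc m)"
    using m(1) side_ends[OF T e] by (auto simp: doubleton_eq_iff)
  ultimately show "side T a b u \<noteq> side T a b w" by auto
next
  assume "side T a b u \<noteq> side T a b w"
  then show "{a, b} \<in> path_edges p"
    using side_const[OF T, of p a b] p by (auto simp: is_path_def)
qed

text \<open>\<open>side\<close> depends on an orientation of the edge. One orientation per edge is
  chosen; what is left is a Boolean labelling of which only the comparison of two labels matters,
  and questions about paths become propositional statements about single edges.\<close>

lemma tree_sides:
  fixes T :: "('v, 'z) ltree_scheme"
  assumes T: "tree_on n T"
  obtains s :: "'v set \<Rightarrow> 'v \<Rightarrow> bool" where "\<And>e u p w. e \<in> edges T \<Longrightarrow> is_path T u p w \<Longrightarrow> e \<in> path_edges p \<longleftrightarrow> s e u \<noteq> s e w"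
proof -
  have "\<exists>s :: 'v \<Rightarrow> bool. \<forall>u p w. is_path T u p w \<longrightarrow> (e \<in> path_edges p \<longleftrightarrow> s u \<noteq> s w)" if eT: "e \<in> edges T" for e
  proof -
    obtain a b where ab: "e = {a, b}" using T eT unfolding tree_on_def by blast
    show ?thesis
      by (rule exI[of _ "side T a b"]) (use eT ab side_path_iff[OF T, of a b] in blast)
  qed
  then obtain s :: "'v set \<Rightarrow> 'v \<Rightarrow> bool" where "\<forall>e\<in>edges T. \<forall>u p w. is_path T u p w \<longrightarrow> (e \<in> path_edges p \<longleftrightarrow> s e u \<noteq> s e w)"
    by metis
  with that show thesis by blast
qed

text \<open>By the labelling, the edges of a path depend only on its ends.\<close>

lemma is_path_unique:
  assumes T: "tree_on n T" and p: "is_path T u p w" and q: "is_path T u q w"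
  shows "p = q"
proof -
  obtain s :: "_ \<Rightarrow> _ \<Rightarrow> bool" where "\<And>e u p w. e \<in> edges T \<Longrightarrow> is_path T u p w \<Longrightarrow> e \<in> path_edges p \<longleftrightarrow> s e u \<noteq> s e w"
    using tree_sides[OF T] by metis
  then have "path_edges p = path_edges q"
    using p q unfolding is_path_def by blast
  then show ?thesis
    using is_path_same_edges_unique[of p q] p q by (auto simp: is_path_def)
qed

section \<open>Leaves and the paths between them\<close>

lemma card_2_third: "card S = 2 \<Longrightarrow> a \<in> S \<Longrightarrow> b \<in> S \<Longrightarrow> a \<noteq> b \<Longrightarrow> c \<in> S \<Longrightarrow> c = a \<or> c = b"
  by (auto simp: card_2_iff)

lemma degr_one_unique:
  assumes "degr T v = 1" "{v, y} \<in> edges T" "{v, z} \<in> edges T"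
  shows "y = z"
proof -
  obtain e where e: "{e \<in> edges T. v \<in> e} = {e}"
    using assms(1) unfolding degr_def by (auto simp: card_1_singleton_iff)
  have "{v, y} \<in> {e \<in> edges T. v \<in> e}" "{v, z} \<in> {e \<in> edges T. v \<in> e}"
    using assms(2,3) by auto
  then have "{v, y} = {v, z}" unfolding e by simp
  then show ?thesis by (auto simp: doubleton_eq_iff)
qed

text \<open>An interior vertex of a path has two different neighbours on it.\<close>

lemma degr_one_path_end:
  assumes "is_path T u p w" "v \<in> set p" "degr T v = 1"
  shows "v = u \<or> v = w"
proof (rule ccontr)
  assume *: "\<not> (v = u \<or> v = w)"
  obtain m where m: "m < length p" "v = p ! m"
    using assms(2) by (auto simp: in_set_conv_nth)
  have "m \<noteq> 0" "m \<noteq> length p - 1"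
    using * m assms(1) by (auto simp: is_path_def hd_conv_nth last_conv_nth intro!: Suc_leI gr0I)
  then obtain k where k: "m = Suc k" "Suc (Suc k) < length p"
    using m by (cases m) auto
  have "{v, p ! k} \<in> path_edges p" "{v, p ! Suc (Suc k)} \<in> path_edges p"
    using k m by (auto simp: path_edges_def insert_commute)
  then have "p ! k = p ! Suc (Suc k)"
    using degr_one_unique[OF assms(3)] assms(1) by (auto simp: is_path_def)
  then show False
    using assms(1) k by (auto simp: is_path_def nth_eq_iff_index_eq)
qed

lemma tree_leaf:
  assumes "tree_on n T" "k \<in> {1..n}"
  shows "leaf T k \<in> verts T" "degr T (leaf T k) = 1" "leaf T k \<in> leaves T"
proof -
  have "leaf T k \<in> leaves T"
    using assms unfolding tree_on_def by (meson bij_betwE)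
  then show "leaf T k \<in> verts T" "degr T (leaf T k) = 1" "leaf T k \<in> leaves T"
    by (auto simp: leaves_def)
qed

lemma tree_leaf_eq_iff:
  assumes "tree_on n T" "k \<in> {1..n}" "l \<in> {1..n}"
  shows "leaf T k = leaf T l \<longleftrightarrow> k = l"
  using assms unfolding tree_on_def bij_betw_def inj_on_def by blast

text \<open>Makes the description operator in \<open>leaf_path\<close> usable: connectedness gives
  existence, \<open>is_path_unique\<close> uniqueness.\<close>

lemma is_path_leaf_path:
  assumes T: "tree_on n T" and "k \<in> {1..n}" "l \<in> {1..n}"
  shows "is_path T (leaf T k) (leaf_path T k l) (leaf T l)"
proof -
  have "\<exists>p. is_path T (leaf T k) p (leaf T l)"
    using T tree_leaf[OF T] assms(2,3) unfolding tree_on_def by blast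
  then have "\<exists>!p. is_path T (leaf T k) p (leaf T l)"
    using is_path_unique[OF T] by blast
  then show ?thesis unfolding leaf_path_def by (rule theI')
qed

section \<open>Distances between leaves and four-point conditions\<close>

definition tree_dist :: "('v, 'z) ltree_scheme \<Rightarrow> ('v set \<Rightarrow> real) \<Rightarrow> nat \<Rightarrow> nat \<Rightarrow> real" where
  "tree_dist T \<omega> k l = (\<Sum>e\<in>path_edges (leaf_path T k l). \<omega> e)"

locale sided_tree =
  fixes n :: nat and T :: "'v ltree" and s :: "'v set \<Rightarrow> 'v \<Rightarrow> bool"
  assumes T: "tree_on n T"
    and s: "\<And>e u p w. e \<in> edges T \<Longrightarrow> is_path T u p w \<Longrightarrow> e \<in> path_edges p \<longleftrightarrow> s e u \<noteq> s e w"
begin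

lemma finite_edges: "finite (edges T)"
proof (rule finite_subset)
  show "edges T \<subseteq> Pow (verts T)" using T unfolding tree_on_def by blast
  show "finite (Pow (verts T))" using T unfolding tree_on_def by blast
qed

text \<open>All distances become sums over the same index set \<open>edges T\<close>. Inequalities
  between sums of distances can then be checked edge by edge, by looking at how an edge splits the
  leaves involved.\<close>

lemma tree_dist_eq:
  assumes "k \<in> {1..n}" "l \<in> {1..n}"
  shows "tree_dist T \<omega> k l = (\<Sum>e\<in>edges T. if s e (leaf T k) \<noteq> s e (leaf T l) then \<omega> e else 0)"
proof -
  note p = is_path_leaf_path[OF T assms]
  have "path_edges (leaf_path T k l) = {e \<in> edges T. s e (leaf T k) \<noteq> s e (leaf T l)}"
    using s[OF _ p] p unfolding is_path_def by blast
  then show ?thesis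
    unfolding tree_dist_def by (simp add: sum.inter_filter[symmetric] finite_edges)
qed

text \<open>Weights are nonnegative on inner edges only. A leaf on \<open>e\<close> would be an end
  of the path from \<open>a\<close> to \<open>c\<close> and of the path from \<open>b\<close> to
  \<open>d\<close>, but these have no end in common. So an edge that contributes twice to a sum of
  distances is inner.\<close>

lemma inner_edgeI:
  assumes "a \<in> {1..n}" "b \<in> {1..n}" "c \<in> {1..n}" "d \<in> {1..n}" "{a, c} \<inter> {b, d} = {}"
    and e: "e \<in> edges T" "s e (leaf T a) \<noteq> s e (leaf T c)" "s e (leaf T b) \<noteq> s e (leaf T d)"
  shows "e \<in> inner_edges T"
proof (rule ccontr)
  assume "e \<notin> inner_edges T"
  then obtain v where v: "v \<in> e" "v \<in> leaves T" using e(1) by (auto simp: inner_edges_def)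
  then have d: "degr T v = 1" by (simp add: leaves_def)
  have "e \<in> path_edges (leaf_path T a c)" "e \<in> path_edges (leaf_path T b d)"
    using s[OF e(1)] is_path_leaf_path[OF T] assms by blast+
  then have "v \<in> set (leaf_path T a c)" "v \<in> set (leaf_path T b d)"
    using v path_edges_subset by blast+
  then have "v = leaf T a \<or> v = leaf T c" "v = leaf T b \<or> v = leaf T d"
    using degr_one_path_end[OF is_path_leaf_path[OF T] _ d] assms by blast+
  then show False
    using tree_leaf_eq_iff[OF T] assms by auto
qed

text \<open>The hypotheses \<open>no\<close> leave the split ab|cd and those that cut off at most
  one of the four leaves. The latter contribute equally to all three sums; the former contributes
  nothing to the first sum and twice its weight to the other two.\<close>

lemma four_point:
  assumes abcd: "a \<in> {1..n}" "b \<in> {1..n}" "c \<in> {1..n}" "d \<in> {1..n}" "distinct [a, b, c, d]"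
    and pos: "\<forall>e\<in>inner_edges T. \<omega> e \<ge> 0"
    and no: "\<And>e. e \<in> edges T \<Longrightarrow> \<not> (s e (leaf T a) = s e (leaf T c) \<and> s e (leaf T b) = s e (leaf T d) \<and>
      s e (leaf T a) \<noteq> s e (leaf T b))"
      "\<And>e. e \<in> edges T \<Longrightarrow> \<not> (s e (leaf T a) = s e (leaf T d) \<and> s e (leaf T b) = s e (leaf T c) \<and>
      s e (leaf T a) \<noteq> s e (leaf T b))"
  shows "tree_dist T \<omega> a b + tree_dist T \<omega> c d \<le> tree_dist T \<omega> a c + tree_dist T \<omega> b d"
    and "tree_dist T \<omega> a c + tree_dist T \<omega> b d = tree_dist T \<omega> a d + tree_dist T \<omega> b c"
proof -
  show "tree_dist T \<omega> a b + tree_dist T \<omega> c d \<le> tree_dist T \<omega> a c + tree_dist T \<omega> b d"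
    unfolding tree_dist_eq[OF abcd(1,2)] tree_dist_eq[OF abcd(1,3)] tree_dist_eq[OF abcd(2,4)]
      tree_dist_eq[OF abcd(3,4)] sum.distrib[symmetric]
  proof (rule sum_mono)
    fix e assume e: "e \<in> edges T"
    show "(if s e (leaf T a) \<noteq> s e (leaf T b) then \<omega> e else 0) + (if s e (leaf T c) \<noteq> s e (leaf T d) then \<omega> e else 0)
      \<le> (if s e (leaf T a) \<noteq> s e (leaf T c) then \<omega> e else 0) + (if s e (leaf T b) \<noteq> s e (leaf T d) then \<omega> e else 0)"
    proof (cases "s e (leaf T a) \<noteq> s e (leaf T c) \<and> s e (leaf T b) \<noteq> s e (leaf T d)")
      case True
      then have "\<omega> e \<ge> 0" using inner_edgeI[OF abcd(1-4) _ e] abcd(5) pos by auto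
      then show ?thesis using True no[OF e] by auto
    next
      case False
      then show ?thesis using no[OF e] by auto
    qed
  qed
  show "tree_dist T \<omega> a c + tree_dist T \<omega> b d = tree_dist T \<omega> a d + tree_dist T \<omega> b c"
    unfolding tree_dist_eq[OF abcd(1,4)] tree_dist_eq[OF abcd(1,3)] tree_dist_eq[OF abcd(2,4)]
      tree_dist_eq[OF abcd(2,3)] sum.distrib[symmetric]
    by (rule sum.cong) (use no in auto)
qed

text \<open>With ab|cd excluded, the splits ac|bd and ad|bc remain. The first counts twice on the
  right and not at all on the left, the second twice on both sides.\<close>

lemma four_point':
  assumes abcd: "a \<in> {1..n}" "b \<in> {1..n}" "c \<in> {1..n}" "d \<in> {1..n}" "distinct [a, b, c, d]"
    and pos: "\<forall>e\<in>inner_edges T. \<omega> e \<ge> 0"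
    and no: "\<And>e. e \<in> edges T \<Longrightarrow> \<not> (s e (leaf T a) = s e (leaf T b) \<and> s e (leaf T c) = s e (leaf T d) \<and>
      s e (leaf T a) \<noteq> s e (leaf T c))"
  shows "tree_dist T \<omega> a c + tree_dist T \<omega> b d \<le> tree_dist T \<omega> a b + tree_dist T \<omega> c d"
  unfolding tree_dist_eq[OF abcd(1,2)] tree_dist_eq[OF abcd(1,3)] tree_dist_eq[OF abcd(2,4)]
    tree_dist_eq[OF abcd(3,4)] sum.distrib[symmetric]
proof (rule sum_mono)
  fix e assume e: "e \<in> edges T"
  show "(if s e (leaf T a) \<noteq> s e (leaf T c) then \<omega> e else 0) + (if s e (leaf T b) \<noteq> s e (leaf T d) then \<omega> e else 0)
    \<le> (if s e (leaf T a) \<noteq> s e (leaf T b) then \<omega> e else 0) + (if s e (leaf T c) \<noteq> s e (leaf T d) then \<omega> e else 0)"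
  proof (cases "s e (leaf T a) \<noteq> s e (leaf T b) \<and> s e (leaf T c) \<noteq> s e (leaf T d)")
    case True
    then have "\<omega> e \<ge> 0" using inner_edgeI[OF abcd(1,3,2,4) _ e] abcd(5) pos by auto
    then show ?thesis using True no[OF e] by auto
  next
    case False
    then show ?thesis using no[OF e] by auto
  qed
qed

section \<open>Branches at the path from i to j, and quartets\<close>

lemma edge_not_singleton: "e \<in> edges T \<Longrightarrow> e \<subseteq> {v} \<Longrightarrow> False"
  using T unfolding tree_on_def by blast

lemma branch_subset: "k \<in> branch n T i j v \<Longrightarrow> k \<in> {1..n} \<and> k \<noteq> i \<and> k \<noteq> j"
  by (auto simp: branch_def)

text \<open>An edge that separates \<open>i\<close> from \<open>j\<close> lies on their path. If it
  also separated \<open>k\<close> from \<open>v\<close>, it would lie on the path from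
  \<open>k\<close> to \<open>v\<close>, whose only vertex on the i-j path is \<open>v\<close>; but
  an edge has two vertices.\<close>

lemma same_branch_split:
  assumes ij: "i \<in> {1..n}" "j \<in> {1..n}" and kl: "k \<in> branch n T i j v" "l \<in> branch n T i j v"
    and e: "e \<in> edges T" "s e (leaf T i) \<noteq> s e (leaf T j)"
  shows "s e (leaf T k) = s e (leaf T l)"
proof -
  have E: "e \<subseteq> set (leaf_path T i j)"
    using s[OF e(1) is_path_leaf_path[OF T ij]] e(2) path_edges_subset by blast
  have "s e (leaf T k) = s e v" if kv: "k \<in> branch n T i j v" for k
  proof (rule ccontr)
    assume *: "s e (leaf T k) \<noteq> s e v"
    obtain p where p: "is_path T (leaf T k) p v" "set p \<inter> set (leaf_path T i j) = {v}"
      using kv unfolding branch_def by blast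
    have "e \<subseteq> set p" using s[OF e(1) p(1)] * path_edges_subset by blast
    then have "e \<subseteq> {v}" using E p(2) by blast
    then show False using edge_not_singleton e by blast
  qed
  then show ?thesis using kl by simp
qed

text \<open>If \<open>e\<close> cut \<open>k\<close> and \<open>l\<close> off from \<open>i\<close>,
  it would lie on both branch paths, so these would share a vertex \<open>x\<close>. An edge
  \<open>f\<close> that separates the attaching vertices \<open>a\<close> and \<open>b\<close> lies
  on the i-j path and on neither branch path, and would have \<open>x\<close> on the side of
  \<open>a\<close> and on that of \<open>b\<close>.\<close>

lemma diff_branch_split:
  assumes ij: "i \<in> {1..n}" "j \<in> {1..n}" and kl: "k \<in> branch n T i j a" "l \<in> branch n T i j b" "a \<noteq> b"
    and e: "e \<in> edges T" "s e (leaf T i) = s e (leaf T j)"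
  shows "\<not> (s e (leaf T k) = s e (leaf T l) \<and> s e (leaf T i) \<noteq> s e (leaf T k))"
proof
  assume H: "s e (leaf T k) = s e (leaf T l) \<and> s e (leaf T i) \<noteq> s e (leaf T k)"
  let ?L = "leaf_path T i j"
  note L = is_path_leaf_path[OF T ij]
  obtain p where p: "is_path T (leaf T k) p a" "set p \<inter> set ?L = {a}"
    using kl unfolding branch_def by blast
  obtain q where q: "is_path T (leaf T l) q b" "set q \<inter> set ?L = {b}"
    using kl unfolding branch_def by blast
  have aL: "a \<in> set ?L" and bL: "b \<in> set ?L" using p q by auto
  \<comment> \<open>An edge off the i-j path has this whole path on one side.\<close>
  have onL: "s f v = s f (leaf T i)" if vf: "v \<in> set ?L" "f \<in> edges T" "f \<notin> path_edges ?L" for f v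
  proof -
    obtain p1 p2 where "is_path T (leaf T i) p1 v" "path_edges p1 \<subseteq> path_edges ?L"
      using is_path_split[OF L vf(1)] by metis
    then show ?thesis using s[OF vf(2)] vf(3) by blast
  qed
  have eL: "e \<notin> path_edges ?L" using s[OF e(1) L] e(2) by simp
  have "e \<in> path_edges p" "e \<in> path_edges q"
    using s[OF e(1) p(1)] s[OF e(1) q(1)] onL[OF aL e(1) eL] onL[OF bL e(1) eL] H by auto
  then have "e \<subseteq> set p" "e \<subseteq> set q" using path_edges_subset by blast+
  moreover obtain x where "x \<in> e" using edge_not_singleton[OF e(1)] by blast
  ultimately have x: "x \<in> set p" "x \<in> set q" by auto
  have "a \<in> verts T" "b \<in> verts T" using aL bL L by (auto simp: is_path_def)
  then obtain r where r: "is_path T a r b" using T unfolding tree_on_def by blast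
  obtain f where f: "f \<in> path_edges r"
    using r kl(3) by (cases r rule: remdups_adj.cases) (auto simp: is_path_def)
  have fE: "f \<in> edges T" using r f by (auto simp: is_path_def)
  have fab: "s f a \<noteq> s f b" using s[OF fE r] f by simp
  then have "f \<in> path_edges ?L" using onL[OF aL fE] onL[OF bL fE] by auto
  then have fL: "f \<subseteq> set ?L" by (rule path_edges_subset)
  have "f \<notin> path_edges p" using fL p(2) path_edges_subset[of f p] edge_not_singleton[OF fE] by blast
  moreover have "f \<notin> path_edges q" using fL q(2) path_edges_subset[of f q] edge_not_singleton[OF fE] by blast
  moreover obtain p2 where "is_path T x p2 a" "path_edges p2 \<subseteq> path_edges p"
    using is_path_split[OF p(1) x(1)] by metis
  moreover obtain q2 where "is_path T x q2 b" "path_edges q2 \<subseteq> path_edges q"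
    using is_path_split[OF q(1) x(2)] by metis
  ultimately have "s f x = s f a" "s f x = s f b" using s[OF fE] by blast+
  then show False using fab by simp
qed

text \<open>The attaching vertex is the first vertex on the path from \<open>l\<close> to
  \<open>i\<close> that lies on the i-j path. It is no leaf, as it has one neighbour off that path
  and one on it.\<close>

lemma ex_branch:
  assumes ij: "i \<in> {1..n}" "j \<in> {1..n}" "i \<noteq> j" and l: "l \<in> {1..n} - {i, j}"
  obtains v where "v \<in> internal_verts T i j" "l \<in> branch n T i j v"
proof -
  let ?L = "leaf_path T i j"
  note L = is_path_leaf_path[OF T ij(1,2)]
  have lP: "is_path T (leaf T l) (leaf_path T l i) (leaf T i)"
    using is_path_leaf_path[OF T] l ij by blast
  have "leaf T i \<in> set (leaf_path T l i)" "leaf T i \<in> set ?L"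
    using lP L unfolding is_path_def by (metis last_in_set, metis hd_in_set)
  then obtain ys v zs where v: "leaf_path T l i = ys @ v # zs" "v \<in> set ?L" "\<forall>y\<in>set ys. y \<notin> set ?L"
    using split_list_first_prop[of "leaf_path T l i" "\<lambda>y. y \<in> set ?L"] by metis
  have pe: "path_edges (ys @ [v]) \<subseteq> path_edges (leaf_path T l i)"
    unfolding v(1) by (cases "ys = []") (auto simp: path_edges_append)
  have p: "is_path T (leaf T l) (ys @ [v]) v"
    using lP pe unfolding v(1) by (auto simp: is_path_def hd_append split: if_splits)
  have "set (ys @ [v]) \<inter> set ?L = {v}" using v by auto
  then have own_branch: "l \<in> branch n T i j v"
    unfolding branch_def using p l by blast
  have nl: "leaf T l \<notin> set ?L"
    using degr_one_path_end[OF L, of "leaf T l"] tree_leaf[OF T, of l] tree_leaf_eq_iff[OF T] l ij by auto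
  then have "ys \<noteq> []" using p v(2) by (auto simp: is_path_def)
  then have yE: "{last ys, v} \<in> edges T" and yL: "last ys \<notin> set ?L"
    using p v(3) by (auto simp: is_path_def path_edges_append)
  have len: "length ?L \<ge> 2"
    using L tree_leaf_eq_iff[OF T ij(1,2)] ij(3)
    by (cases ?L rule: remdups_adj.cases) (auto simp: is_path_def)
  obtain z where z: "z \<in> set ?L" "{v, z} \<in> path_edges ?L" using ex_path_edge[OF v(2) len] by metis
  have "degr T v \<noteq> 1"
  proof
    assume "degr T v = 1"
    then have "last ys = z"
      using degr_one_unique yE z(2) L unfolding is_path_def by (metis insert_commute subsetD)
    then show False using z yL by simp
  qed
  then have "v \<in> internal_verts T i j"
    using v(2) tree_leaf[OF T] ij by (auto simp: internal_verts_def)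
  then show thesis using own_branch that by blast
qed

text \<open>An edge of a quartet at the leaf \<open>c\<close> stands for a path through degree-two
  vertices. Such a path never has a choice: its first step is forced because \<open>c\<close> is a
  leaf, each later one because only one edge besides the arriving one is left. So it runs along the
  path from \<open>c\<close> to any other leaf \<open>x\<close> of the quartet.\<close>

lemma suppressed_path_initial:
  assumes L: "L \<subseteq> {1..n}" "c \<in> L" "x \<in> L" "c \<noteq> x"
    and p: "is_path (spanned_subtree T L) (leaf T c) p w"
      "\<forall>v\<in>set p - {leaf T c, w}. degr (spanned_subtree T L) v = 2"
  shows "path_edges p \<subseteq> path_edges (leaf_path T c x)"
proof -
  let ?S = "spanned_subtree T L" and ?q = "leaf_path T c x"
  have cx: "c \<in> {1..n}" "x \<in> {1..n}" using L by auto
  note q = is_path_leaf_path[OF T cx]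
  have ES: "edges ?S \<subseteq> edges T"
  proof -
    have "path_edges (leaf_path T k l) \<subseteq> edges T" if "k \<in> L" "l \<in> L" for k l
    proof -
      have "k \<in> {1..n}" "l \<in> {1..n}" using that L(1) by blast+
      from is_path_leaf_path[OF T this] show ?thesis by (simp add: is_path_def)
    qed
    then show ?thesis by (auto simp: spanned_subtree_def)
  qed
  have pS: "path_edges p \<subseteq> edges ?S" using p by (simp add: is_path_def)
  have qS: "path_edges ?q \<subseteq> edges ?S" using L by (auto simp: spanned_subtree_def)
  have dp: "distinct p" "distinct ?q" using p(1) q by (auto simp: is_path_def)
  have pE: "{p ! m, p ! Suc m} \<in> edges ?S" if "Suc m < length p" for m
    using pS that by (auto simp: path_edges_def)
  have qE: "{?q ! m, ?q ! Suc m} \<in> edges ?S" if "Suc m < length ?q" for m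
    using qS that by (auto simp: path_edges_def)
  have 0: "p ! 0 = leaf T c" "?q ! 0 = leaf T c" "p \<noteq> []" "?q \<noteq> []"
    using p(1) q by (auto simp: is_path_def hd_conv_nth)
  \<comment> \<open>The next vertex is determined by the two preceding ones, hence the induction
    over all smaller positions.\<close>
  have agree: "m < length ?q \<and> ?q ! m = p ! m" if "m < length p" for m
    using that
  proof (induction m rule: less_induct)
    case (less M)
    show ?case
    proof (cases M)
      case 0
      then show ?thesis using \<open>?q ! 0 = leaf T c\<close> \<open>p ! 0 = leaf T c\<close> \<open>?q \<noteq> []\<close> by simp
    next
    case M: (Suc m)
    note Suc_prems = less.prems[unfolded M]
    have m: "m < length ?q" "?q ! m = p ! m" using less.IH[of m] less.prems M by auto
    show ?thesis unfolding M
    proof (cases m)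
      case m0: 0
      have "length ?q \<ge> 2"
        using q tree_leaf_eq_iff[OF T cx] L(4)
        by (cases ?q rule: remdups_adj.cases) (auto simp: is_path_def)
      then have "{leaf T c, ?q ! 1} \<in> edges T" "{leaf T c, p ! 1} \<in> edges T"
        using pE[of 0] qE[of 0] Suc_prems 0 m0 ES by auto
      then have "?q ! 1 = p ! 1" using degr_one_unique tree_leaf[OF T cx(1)] by metis
      then show "Suc m < length ?q \<and> ?q ! Suc m = p ! Suc m" using m0 \<open>length ?q \<ge> 2\<close> by simp
    next
      case (Suc k)
      have e1: "{p ! m, p ! k} \<in> edges ?S" "{p ! m, p ! Suc m} \<in> edges ?S"
        using pE[of k] pE[of m] Suc_prems Suc by (auto simp: insert_commute)
      have ne: "p ! k \<noteq> p ! Suc m" "p ! m \<noteq> p ! Suc m" "p ! m \<noteq> p ! k"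
        using dp(1) Suc_prems Suc by (auto simp: nth_eq_iff_index_eq)
      have "p ! m \<noteq> p ! 0" "p ! m \<noteq> p ! (length p - 1)"
      proof -
        have "m < length p" "0 < length p" "length p - 1 < length p" "m \<noteq> 0" "m \<noteq> length p - 1"
          using Suc_prems Suc by auto
        then show "p ! m \<noteq> p ! 0" "p ! m \<noteq> p ! (length p - 1)"
          using nth_eq_iff_index_eq[OF dp(1)] by blast+
      qed
      moreover have "w = p ! (length p - 1)" using p(1) 0 by (auto simp: is_path_def last_conv_nth)
      ultimately have "degr ?S (p ! m) = 2"
        using p(2) 0 Suc_prems by auto
      then have c2: "card {e \<in> edges ?S. p ! m \<in> e} = 2" by (simp add: degr_def)
      \<comment> \<open>The path to \<open>x\<close> cannot stop here: it ends in a leaf, while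
        \<open>p ! m\<close> has two neighbours.\<close>
      have "degr T (p ! m) \<noteq> 1" using degr_one_unique[of T "p ! m"] e1 ES ne by blast
      then have "p ! m \<noteq> leaf T x" using tree_leaf[OF T cx(2)] by metis
      then have "m \<noteq> length ?q - 1"
        using q m 0 by (auto simp: is_path_def last_conv_nth)
      then have lq: "Suc m < length ?q" using m by auto
      have e3: "{p ! m, ?q ! Suc m} \<in> edges ?S" using qE[OF lq] m by simp
      have "?q ! Suc m \<noteq> ?q ! k"
        using dp(2) lq Suc by (auto simp: nth_eq_iff_index_eq)
      moreover have "?q ! k = p ! k" using less.IH[of k] less.prems M Suc by simp
      ultimately have "{p ! m, ?q ! Suc m} \<noteq> {p ! m, p ! k}" by (auto simp: doubleton_eq_iff)
      moreover have "{p ! m, p ! k} \<noteq> {p ! m, p ! Suc m}" using ne by (auto simp: doubleton_eq_iff)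
      ultimately have "{p ! m, ?q ! Suc m} = {p ! m, p ! Suc m}"
        using card_2_third[OF c2, of "{p ! m, p ! k}" "{p ! m, p ! Suc m}"] e1 e3 by auto
      then show "Suc m < length ?q \<and> ?q ! Suc m = p ! Suc m" using lq by (auto simp: doubleton_eq_iff)
    qed
    qed
  qed
  show ?thesis
  proof
    fix e assume "e \<in> path_edges p"
    then obtain m where "e = {p ! m, p ! Suc m}" "Suc m < length p" by (auto simp: path_edges_def)
    then have "e = {?q ! m, ?q ! Suc m}" "Suc m < length ?q"
      using agree[of m] agree[of "Suc m"] by auto
    then show "e \<in> path_edges ?q" unfolding path_edges_def by blast
  qed
qed


text \<open>Let \<open>w\<close> be the common neighbour in the quartet. An edge separating
  \<open>c\<close> from \<open>d\<close> lies on the way from \<open>c\<close> to \<open>w\<close>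
  or from \<open>d\<close> to \<open>w\<close>. These are initial pieces of the paths from
  \<open>c\<close> to \<open>x\<close> and from \<open>d\<close> to \<open>y\<close>, so the edge
  also separates \<open>c\<close> from \<open>x\<close> or \<open>d\<close> from
  \<open>y\<close>.\<close>

lemma cherry_split:
  assumes L: "L \<subseteq> {1..n}" "c \<in> L" "d \<in> L" "x \<in> L" "y \<in> L" "c \<noteq> x" "d \<noteq> y"
    and ch: "is_cherry (quartet T L) c d" and e: "e \<in> edges T"
  shows "\<not> (s e (leaf T c) = s e (leaf T x) \<and> s e (leaf T d) = s e (leaf T y) \<and>
    s e (leaf T c) \<noteq> s e (leaf T d))"
proof
  assume H: "s e (leaf T c) = s e (leaf T x) \<and> s e (leaf T d) = s e (leaf T y) \<and>
    s e (leaf T c) \<noteq> s e (leaf T d)"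
  let ?S = "spanned_subtree T L"
  have sel: "leaf (quartet T L) = leaf T"
    by (simp add: quartet_def suppress_deg2_def spanned_subtree_def)
  obtain w where w: "{leaf T c, w} \<in> edges (quartet T L)" "{leaf T d, w} \<in> edges (quartet T L)"
    using ch unfolding is_cherry_def sel by blast
  have path: "\<exists>p. is_path ?S v p w \<and> (\<forall>z\<in>set p - {v, w}. degr ?S z = 2)"
    if vw: "{v, w} \<in> edges (quartet T L)" for v
  proof -
    obtain u u' p where p: "{v, w} = {u, u'}" "is_path ?S u p u'"
      "\<forall>z\<in>set p - {u, u'}. degr ?S z = 2"
      using vw unfolding quartet_def suppress_deg2_def by auto
    from p(1) consider "v = u" "w = u'" | "v = u'" "w = u" by (auto simp: doubleton_eq_iff)
    then show ?thesis
    proof cases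
      case 1
      then show ?thesis using p by auto
    next
      case 2
      then show ?thesis using is_path_rev[OF p(2)] p(3) by (intro exI[of _ "rev p"]) auto
    qed
  qed
  obtain p where p: "is_path ?S (leaf T c) p w" "\<forall>z\<in>set p - {leaf T c, w}. degr ?S z = 2"
    using path[OF w(1)] by blast
  obtain q where q: "is_path ?S (leaf T d) q w" "\<forall>z\<in>set q - {leaf T d, w}. degr ?S z = 2"
    using path[OF w(2)] by blast
  have pc: "path_edges p \<subseteq> path_edges (leaf_path T c x)"
    using suppressed_path_initial[OF L(1,2,4,6) p] .
  have qd: "path_edges q \<subseteq> path_edges (leaf_path T d y)"
    using suppressed_path_initial[OF L(1,3,5,7) q] .
  have cx: "is_path T (leaf T c) (leaf_path T c x) (leaf T x)" "is_path T (leaf T d) (leaf_path T d y) (leaf T y)"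
    using is_path_leaf_path[OF T] L by blast+
  have ES: "edges ?S \<subseteq> edges T" "verts ?S \<subseteq> verts T"
  proof -
    have "path_edges (leaf_path T k l) \<subseteq> edges T \<and> set (leaf_path T k l) \<subseteq> verts T" if "k \<in> L" "l \<in> L" for k l
    proof -
      have "k \<in> {1..n}" "l \<in> {1..n}" using that L(1) by blast+
      from is_path_leaf_path[OF T this] show ?thesis by (simp add: is_path_def)
    qed
    then show "edges ?S \<subseteq> edges T" "verts ?S \<subseteq> verts T" by (auto simp: spanned_subtree_def)
  qed
  have "is_path T (leaf T c) p w" "is_path T (leaf T d) q w"
    using p(1) q(1) ES by (auto simp: is_path_def)
  then have "e \<in> path_edges p \<or> e \<in> path_edges q" using s[OF e] H by blast
  then have "e \<in> path_edges (leaf_path T c x) \<or> e \<in> path_edges (leaf_path T d y)" using pc qd by blast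
  then show False using s[OF e] cx H by blast
qed

text \<open>Taking \<open>a\<close> and \<open>b\<close> in both orders as the partners of the
  cherry excludes the two splits other than ab|cd.\<close>

lemma cherry_four_point:
  assumes abcd: "a \<in> {1..n}" "b \<in> {1..n}" "c \<in> {1..n}" "d \<in> {1..n}" "distinct [a, b, c, d]"
    and pos: "\<forall>e\<in>inner_edges T. \<omega> e \<ge> 0" and ch: "is_cherry (quartet T {a, b, c, d}) c d"
  shows "tree_dist T \<omega> a b + tree_dist T \<omega> c d \<le> tree_dist T \<omega> a c + tree_dist T \<omega> b d"
    and "tree_dist T \<omega> a c + tree_dist T \<omega> b d = tree_dist T \<omega> a d + tree_dist T \<omega> b c"
proof -
  have L: "{a, b, c, d} \<subseteq> {1..n}" using abcd by auto
  have ac: "\<not> (s e (leaf T a) = s e (leaf T c) \<and> s e (leaf T b) = s e (leaf T d) \<and>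
      s e (leaf T a) \<noteq> s e (leaf T b))" if "e \<in> edges T" for e
    using cherry_split[OF L _ _ _ _ _ _ ch that, of a b] abcd(5) by auto
  have ad: "\<not> (s e (leaf T a) = s e (leaf T d) \<and> s e (leaf T b) = s e (leaf T c) \<and>
      s e (leaf T a) \<noteq> s e (leaf T b))" if "e \<in> edges T" for e
    using cherry_split[OF L _ _ _ _ _ _ ch that, of b a] abcd(5) by auto
  show "tree_dist T \<omega> a b + tree_dist T \<omega> c d \<le> tree_dist T \<omega> a c + tree_dist T \<omega> b d"
    and "tree_dist T \<omega> a c + tree_dist T \<omega> b d = tree_dist T \<omega> a d + tree_dist T \<omega> b c"
    by (rule four_point[OF abcd pos ac ad]; assumption)+
qed

text \<open>Either of the splits to be excluded would separate \<open>i\<close> from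
  \<open>j\<close> and \<open>k\<close> from \<open>l\<close> at once.\<close>

lemma same_branch_four_point:
  assumes ij: "i \<in> {1..n}" "j \<in> {1..n}" "i \<noteq> j" and kl: "k \<in> branch n T i j v" "l \<in> branch n T i j v" "k \<noteq> l"
    and pos: "\<forall>e\<in>inner_edges T. \<omega> e \<ge> 0"
  shows "tree_dist T \<omega> i j + tree_dist T \<omega> k l \<le> tree_dist T \<omega> i k + tree_dist T \<omega> j l"
    and "tree_dist T \<omega> i k + tree_dist T \<omega> j l = tree_dist T \<omega> i l + tree_dist T \<omega> j k"
proof -
  have k: "k \<in> {1..n}" "l \<in> {1..n}" "distinct [i, j, k, l]"
    using branch_subset[OF kl(1)] branch_subset[OF kl(2)] kl(3) ij by auto
  note split = same_branch_split[OF ij(1,2) kl(1,2)]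
  have no1: "\<not> (s e (leaf T i) = s e (leaf T k) \<and> s e (leaf T j) = s e (leaf T l) \<and>
      s e (leaf T i) \<noteq> s e (leaf T j))" if "e \<in> edges T" for e
    using split[OF that] by auto
  have no2: "\<not> (s e (leaf T i) = s e (leaf T l) \<and> s e (leaf T j) = s e (leaf T k) \<and>
      s e (leaf T i) \<noteq> s e (leaf T j))" if "e \<in> edges T" for e
    using split[OF that] by auto
  show "tree_dist T \<omega> i j + tree_dist T \<omega> k l \<le> tree_dist T \<omega> i k + tree_dist T \<omega> j l"
    using four_point(1)[OF ij(1,2) k pos no1 no2] .
  show "tree_dist T \<omega> i k + tree_dist T \<omega> j l = tree_dist T \<omega> i l + tree_dist T \<omega> j k"
    using four_point(2)[OF ij(1,2) k pos no1 no2] .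
qed

lemma diff_branch_four_point:
  assumes ij: "i \<in> {1..n}" "j \<in> {1..n}" "i \<noteq> j" and kl: "k \<in> branch n T i j a" "l \<in> branch n T i j b"
    "a \<noteq> b" "k \<noteq> l"
    and pos: "\<forall>e\<in>inner_edges T. \<omega> e \<ge> 0"
  shows "tree_dist T \<omega> i k + tree_dist T \<omega> j l \<le> tree_dist T \<omega> i j + tree_dist T \<omega> k l"
proof -
  have k: "k \<in> {1..n}" "l \<in> {1..n}" "distinct [i, j, k, l]"
    using branch_subset[OF kl(1)] branch_subset[OF kl(2)] kl(4) ij by auto
  show ?thesis
    by (rule four_point'[OF ij(1,2) k pos]) (use diff_branch_split[OF ij(1,2) kl(1-3)] in blast)
qed

end

section \<open>Non-Archimedean absolute values\<close>

lemma nabs_0 [simp]: "nabs (0 :: 'k :: complete_nonarch_field) = 0"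
  by (simp add: nabs_eq_0)

lemma nabs_1 [simp]: "nabs (1 :: 'k :: complete_nonarch_field) = 1"
proof -
  have "nabs (1 :: 'k) * nabs (1 :: 'k) = nabs (1 :: 'k) * 1" by (simp flip: nabs_mult)
  moreover have "nabs (1 :: 'k) \<noteq> 0" by (simp add: nabs_eq_0)
  ultimately show ?thesis by simp
qed

lemma nabs_uminus [simp]: "nabs (- a) = nabs (a :: 'k :: complete_nonarch_field)"
proof -
  have "nabs (- 1 :: 'k) * nabs (- 1 :: 'k) = 1" by (simp flip: nabs_mult)
  then have "nabs (- 1 :: 'k) = 1"
    using nabs_nonneg[of "- 1 :: 'k"] by (auto simp: square_eq_1_iff)
  then have "nabs ((- 1) * a) = nabs a" by (simp only: nabs_mult mult_1)
  then show ?thesis by simp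
qed

lemma nabs_diff: "nabs (a - b :: 'k :: complete_nonarch_field) \<le> max (nabs a) (nabs b)"
  using nabs_add[of a "- b"] by simp

lemma nabs_sum_le:
  fixes f :: "'i \<Rightarrow> 'k::complete_nonarch_field"
  shows "(\<And>x. x \<in> A \<Longrightarrow> nabs (f x) \<le> e) \<Longrightarrow> e \<ge> 0 \<Longrightarrow> nabs (sum f A) \<le> e"
proof (induction A rule: infinite_finite_induct)
  case (insert x F)
  then have "max (nabs (f x)) (nabs (sum f F)) \<le> e" by simp
  from order_trans[OF nabs_add this] show ?case using insert.hyps by simp
qed auto

lemma nabs_sum_less:
  fixes f :: "'i \<Rightarrow> 'k::complete_nonarch_field"
  shows "finite A \<Longrightarrow> (\<And>x. x \<in> A \<Longrightarrow> nabs (f x) < e) \<Longrightarrow> e > 0 \<Longrightarrow> nabs (sum f A) < e"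
proof (induction A rule: finite_induct)
  case (insert x F)
  then have "max (nabs (f x)) (nabs (sum f F)) < e" by simp
  from le_less_trans[OF nabs_add this] show ?case using insert.hyps by simp
qed auto

lemma nabs_divide: "nabs (a / b :: 'k :: complete_nonarch_field) = nabs a / nabs b"
proof (cases "b = 0")
  case False
  then have "nabs (a / b) * nabs b = nabs a" by (simp flip: nabs_mult)
  then show ?thesis using False by (simp add: nabs_eq_0 field_simps)
qed simp

lemma nabs_inverse: "nabs (inverse a :: 'k :: complete_nonarch_field) = inverse (nabs a)"
  using nabs_divide[of 1 a] by (simp add: field_simps)

lemma nabs_powi: "nabs (a powi m :: 'k :: complete_nonarch_field) = nabs a powi m"
proof -
  have "nabs (a ^ k) = nabs a ^ k" for k and a :: 'k by (induction k) (auto simp: nabs_mult)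
  then show ?thesis by (simp add: power_int_def nabs_inverse)
qed

lemma nabs_prod: "nabs (prod f A :: 'k :: complete_nonarch_field) = (\<Prod>x\<in>A. nabs (f x))"
  by (induction A rule: infinite_finite_induct) (auto simp: nabs_mult)

text \<open>The class of the ground field does not include continuity of addition, so unordered sums are
  handled directly through Cauchy filters.\<close>

lemma nonarch_infsum:
  fixes f :: "'i \<Rightarrow> 'k::complete_nonarch_field"
  assumes fin: "\<And>\<epsilon>. \<epsilon> > 0 \<Longrightarrow> finite {a. nabs (f a) \<ge> \<epsilon>}"
    and F: "finite F" and e: "e \<ge> 0" "\<And>a. a \<notin> F \<Longrightarrow> nabs (f a) \<le> e"
  shows "nabs (infsum f UNIV - sum f F) \<le> e"
proof -
  \<comment> \<open>Only terms outside the intersection survive in the difference, and by the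
    ultrametric inequality their number does not matter. This yields the Cauchy property and, with
    \<open>F\<close> as the second set, the final estimate.\<close>
  have near: "nabs (sum f X - sum f Y) \<le> \<epsilon>"
    if "\<epsilon> \<ge> 0" "finite X" "finite Y" "\<And>a. a \<notin> X \<inter> Y \<Longrightarrow> nabs (f a) \<le> \<epsilon>" for X Y \<epsilon>
  proof -
    have "sum f X - sum f Y = sum f (X - Y) - sum f (Y - X)"
      using sum.Int_Diff[OF that(2), of f Y] sum.Int_Diff[OF that(3), of f X] by (simp add: Int_commute)
    moreover have "nabs (sum f (X - Y)) \<le> \<epsilon>" "nabs (sum f (Y - X)) \<le> \<epsilon>"
      using that by (auto intro!: nabs_sum_le)
    ultimately show ?thesis using nabs_diff[of "sum f (X - Y)" "sum f (Y - X)"] by simp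
  qed
  let ?\<FF> = "filtermap (sum f) (finite_subsets_at_top UNIV)"
  have "cauchy_filter ?\<FF>"
    unfolding cauchy_filter_metric_filtermap
  proof (intro allI impI)
    fix \<epsilon> :: real assume "\<epsilon> > 0"
    define S where "S = {a. nabs (f a) \<ge> \<epsilon> / 2}"
    have S: "finite S" using fin[of "\<epsilon> / 2"] \<open>\<epsilon> > 0\<close> by (simp add: S_def)
    have "dist (sum f X) (sum f Y) < \<epsilon>" if "finite X" "S \<subseteq> X" "finite Y" "S \<subseteq> Y" for X Y
    proof -
      have "nabs (sum f X - sum f Y) \<le> \<epsilon> / 2"
        using that \<open>\<epsilon> > 0\<close> by (intro near) (fastforce simp: S_def not_le)+
      then show ?thesis using \<open>\<epsilon> > 0\<close> by (simp add: dist_nabs)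
    qed
    then show "\<exists>P. eventually P (finite_subsets_at_top UNIV) \<and> (\<forall>x y. P x \<and> P y \<longrightarrow> dist (sum f x) (sum f y) < \<epsilon>)"
      by (intro exI[of _ "\<lambda>X. finite X \<and> S \<subseteq> X"]) (use S in \<open>auto simp: eventually_finite_subsets_at_top\<close>)
  qed
  moreover have "?\<FF> \<noteq> bot" by (simp add: filtermap_bot_iff)
  ultimately obtain l where l: "?\<FF> \<le> nhds l"
    using complete_UNIV unfolding complete_uniform by auto
  then have "(sum f \<longlongrightarrow> l) (finite_subsets_at_top UNIV)" by (simp add: filterlim_def)
  then have "(f has_sum l) UNIV" by (simp add: has_sum_def)
  then have "infsum f UNIV = l" by (rule infsumI)
  have "nabs (l - sum f F) \<le> e"
  proof (rule field_le_epsilon)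
    fix \<epsilon> :: real assume "\<epsilon> > 0"
    then have "eventually (\<lambda>X. dist (sum f X) l < \<epsilon>) (finite_subsets_at_top UNIV)"
      using \<open>(sum f \<longlongrightarrow> l) _\<close> by (simp add: tendsto_iff)
    then obtain X where X: "finite X" "\<And>Y. finite Y \<Longrightarrow> X \<subseteq> Y \<Longrightarrow> dist (sum f Y) l < \<epsilon>"
      unfolding eventually_finite_subsets_at_top by auto
    let ?Y = "X \<union> F"
    have "nabs (sum f ?Y - l) < \<epsilon>" using X(2)[of ?Y] X(1) F by (auto simp: dist_nabs)
    moreover have "nabs (sum f ?Y - sum f F) \<le> e" using e X(1) F by (intro near) auto
    moreover have "nabs (l - sum f F) \<le> max (nabs (sum f ?Y - sum f F)) (nabs (sum f ?Y - l))"
      using nabs_diff[of "sum f ?Y - sum f F" "sum f ?Y - l"] by simp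
    ultimately show "nabs (l - sum f F) \<le> e + \<epsilon>" using e \<open>\<epsilon> > 0\<close> by linarith
  qed
  then show ?thesis using \<open>infsum f UNIV = l\<close> by simp
qed

text \<open>Strict bounds on terms usually become weak in the limit. Here only finitely many terms
  reach \<open>e / 2\<close>; they are added to \<open>F\<close>, which gives \<open>G\<close>. The
  tail after \<open>G\<close> is at most \<open>e / 2\<close>, and a finite sum of terms below
  \<open>e\<close> stays below \<open>e\<close>.\<close>

lemma nonarch_infsum_less:
  fixes f :: "'i \<Rightarrow> 'k::complete_nonarch_field"
  assumes fin: "\<And>\<epsilon>. \<epsilon> > 0 \<Longrightarrow> finite {a. nabs (f a) \<ge> \<epsilon>}"
    and F: "finite F" and e: "e > 0" "\<And>a. a \<notin> F \<Longrightarrow> nabs (f a) < e"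
  shows "nabs (infsum f UNIV - sum f F) < e"
proof -
  define G where "G = F \<union> {a. nabs (f a) \<ge> e / 2}"
  have G: "finite G" using fin[of "e / 2"] F e by (simp add: G_def)
  have "nabs (infsum f UNIV - sum f G) \<le> e / 2"
    using e by (intro nonarch_infsum fin G) (auto simp: G_def not_le intro: less_imp_le)
  moreover have "nabs (sum f (G - F)) < e"
    using e G by (intro nabs_sum_less) auto
  moreover have "infsum f UNIV - sum f F = (infsum f UNIV - sum f G) + sum f (G - F)"
    using sum.subset_diff[of F G f] G by (simp add: G_def)
  ultimately show ?thesis
    using nabs_add[of "infsum f UNIV - sum f G" "sum f (G - F)"] e by (simp only:)
qed

section \<open>The closed cone of a tree\<close>

lemma trop_exp_nonneg [simp]: "trop_exp a \<ge> 0"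
  by (simp add: trop_exp_def)

lemma trop_exp_eq_0_iff: "trop_exp a = 0 \<longleftrightarrow> a = - \<infinity>"
  by (simp add: trop_exp_def)

lemma trop_exp_ereal [simp]: "trop_exp (ereal t) = exp t"
  by (simp add: trop_exp_def)

lemma trop_exp_add: "a \<noteq> \<infinity> \<Longrightarrow> trop_exp (a + ereal c) = trop_exp a * exp c"
  by (cases a) (auto simp: trop_exp_def exp_add)

lemma trop_exp_diff: "a \<noteq> \<infinity> \<Longrightarrow> b \<noteq> \<infinity> \<Longrightarrow> b \<noteq> - \<infinity> \<Longrightarrow> trop_exp (a - b) = trop_exp a / trop_exp b"
  by (cases a; cases b) (auto simp: trop_exp_def exp_diff)

text \<open>It suffices to consider preimages of open rays, and by monotonicity these are relatively
  open rays, everything or nothing. Continuity at -\<infinity> comes from the preimages of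
  \<open>{..<t}\<close> with t > 0, which are intervals from -\<infinity> to a real number.\<close>

lemma continuous_map_trop_exp:
  "continuous_map (subtopology euclidean {a. a \<noteq> \<infinity>}) euclideanreal trop_exp"
proof -
  let ?F = "{a :: ereal. a \<noteq> \<infinity>}"
  have *: "openin (top_of_set ?F) {a \<in> ?F. trop_exp a \<in> U}" if "U \<in> range (\<lambda>t. {..<t}) \<union> range (\<lambda>t. {t<..})" for U
  proof -
    have "\<exists>V. open V \<and> {a \<in> ?F. trop_exp a < t} = ?F \<inter> V" for t
    proof (cases "t > 0")
      case True
      have "trop_exp a < t \<longleftrightarrow> a < ereal (ln t)" if "a \<noteq> \<infinity>" for a
        using that True exp_less_cancel_iff[of _ "ln t"] by (cases a) (auto simp: trop_exp_def)
      then have "{a \<in> ?F. trop_exp a < t} = ?F \<inter> {..<ereal (ln t)}" by auto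
      then show ?thesis by (intro exI[of _ "{..<ereal (ln t)}"]) auto
    next
      case False
      then have "{a \<in> ?F. trop_exp a < t} = ?F \<inter> {}"
        using trop_exp_nonneg by (auto simp: not_less intro: order_trans)
      then show ?thesis by blast
    qed
    moreover have "\<exists>V. open V \<and> {a \<in> ?F. trop_exp a > t} = ?F \<inter> V" for t
    proof (cases "t > 0")
      case True
      have "trop_exp a > t \<longleftrightarrow> a > ereal (ln t)" if "a \<noteq> \<infinity>" for a
        using that True exp_less_cancel_iff[of "ln t"] by (cases a) (auto simp: trop_exp_def)
      then have "{a \<in> ?F. trop_exp a > t} = ?F \<inter> {ereal (ln t)<..}" by auto
      then show ?thesis by (intro exI[of _ "{ereal (ln t)<..}"]) auto
    next
      case False
      show ?thesis
      proof (cases "t = 0")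
        case True
        have "trop_exp a > 0 \<longleftrightarrow> a > - \<infinity>" for a
          by (auto simp: trop_exp_def)
        then have "{a \<in> ?F. trop_exp a > t} = ?F \<inter> {- \<infinity><..}" using True by auto
        then show ?thesis by (intro exI[of _ "{- \<infinity><..}"]) auto
      next
        case False
        then have "{a \<in> ?F. trop_exp a > t} = ?F \<inter> UNIV"
          using \<open>\<not> t > 0\<close> less_le_trans[OF _ trop_exp_nonneg] by (auto simp: not_less)
        then show ?thesis by blast
      qed
    qed
    ultimately show ?thesis
      using that by (auto simp: openin_open)
  qed
  have "continuous_on ?F trop_exp"
  proof (rule continuous_on_generate_topology[OF open_generated_order])
    fix B :: "real set" assume "B \<in> range lessThan \<union> range greaterThan"
    from *[OF this] show "\<exists>C. open C \<and> C \<inter> ?F = trop_exp -` B \<inter> ?F"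
      by (auto simp: openin_open)
  qed
  then show ?thesis by simp
qed

lemma trop_class_eq_iff:
  assumes "x \<in> trop_vectors N" "z \<in> trop_vectors N" "trop_class N x = trop_class N z"
  obtains c where "\<And>q. q \<in> N \<Longrightarrow> z q = x q + ereal c"
proof -
  have "\<forall>q\<in>N. z q = z q + ereal 0" by simp
  then have "z \<in> trop_class N z" using assms(2) unfolding trop_class_def by blast
  then have "z \<in> trop_class N x" using assms(3) by simp
  then obtain c where "\<forall>q\<in>N. z q = x q + ereal c" unfolding trop_class_def by blast
  then show thesis using that by blast
qed

lemma trop_vectors_not_PInf: "x \<in> trop_vectors N \<Longrightarrow> q \<in> N \<Longrightarrow> x q \<noteq> \<infinity>"
  by (auto simp: trop_vectors_def)

lemma continuous_map_trop_coord:
  assumes "a \<in> N"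
  shows "continuous_map (trop_vectors_topology N) euclideanreal (\<lambda>z. trop_exp (z a))"
proof -
  have "continuous_map (trop_vectors_topology N) (subtopology euclidean {a. a \<noteq> \<infinity>}) (\<lambda>z. z a)"
    unfolding trop_vectors_topology_def
    by (rule continuous_map_from_subtopology) (rule continuous_map_product_projection[OF assms])
  from continuous_map_compose[OF this continuous_map_trop_exp] show ?thesis
    by (simp add: o_def)
qed

text \<open>Both sides have the same degree, so the set where the inequality fails is a union of
  classes and descends to the quotient. It is open by continuity of \<open>trop_exp\<close>, and an
  open set that misses \<open>C\<close> contains no point of its closure.\<close>

lemma trop_closure_binomial_le:
  assumes x: "x \<in> trop_vectors N" "trop_class N x \<in> trop_proj_topology N closure_of C"
    and N: "a \<in> N" "b \<in> N" "c \<in> N" "d \<in> N"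
    and C: "\<And>z. z \<in> trop_vectors N \<Longrightarrow> trop_class N z \<in> C \<Longrightarrow>
      trop_exp (z a) * trop_exp (z b) \<le> trop_exp (z c) * trop_exp (z d)"
  shows "trop_exp (x a) * trop_exp (x b) \<le> trop_exp (x c) * trop_exp (x d)"
proof (rule ccontr)
  define P where "P z \<longleftrightarrow> trop_exp (z c) * trop_exp (z d) < trop_exp (z a) * trop_exp (z b)" for z
  assume "\<not> trop_exp (x a) * trop_exp (x b) \<le> trop_exp (x c) * trop_exp (x d)"
  then have Px: "P x" by (simp add: P_def)
  define U where "U = trop_class N ` {z \<in> trop_vectors N. P z}"
  have sat: "P z'" if "P z" "z \<in> trop_vectors N" "z' \<in> trop_vectors N" "trop_class N z = trop_class N z'" for z z'
  proof -
    obtain t where t: "\<And>q. q \<in> N \<Longrightarrow> z' q = z q + ereal t"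
      using trop_class_eq_iff[OF \<open>z \<in> trop_vectors N\<close> \<open>z' \<in> trop_vectors N\<close> \<open>trop_class N z = trop_class N z'\<close>] by metis
    have e: "trop_exp (z' q) = trop_exp (z q) * exp t" if "q \<in> N" for q
      using t[OF that] trop_exp_add trop_vectors_not_PInf[OF \<open>z \<in> trop_vectors N\<close> that] by simp
    have "trop_exp (z' c) * trop_exp (z' d) = (trop_exp (z c) * trop_exp (z d)) * (exp t * exp t)"
      "trop_exp (z' a) * trop_exp (z' b) = (trop_exp (z a) * trop_exp (z b)) * (exp t * exp t)"
      using e N by simp_all
    moreover have "exp t * exp t > 0" by simp
    ultimately show ?thesis using \<open>P z\<close> unfolding P_def by (metis mult_strict_right_mono)
  qed
  have "{z \<in> trop_vectors N. trop_class N z \<in> U} = {z \<in> trop_vectors N. P z}"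
    using sat unfolding U_def by blast
  also have "\<dots> = {z \<in> topspace (trop_vectors_topology N).
      trop_exp (z a) * trop_exp (z b) - trop_exp (z c) * trop_exp (z d) \<in> {0<..}}"
    by (auto simp: P_def topspace_trop_vectors_topology)
  also have "openin (trop_vectors_topology N) \<dots>"
    by (rule openin_continuous_map_preimage[where Y = euclideanreal])
      (auto intro!: continuous_map_diff continuous_map_real_mult continuous_map_trop_coord N)
  finally have "openin (trop_proj_topology N) U"
    unfolding openin_trop_proj_topology by (auto simp: U_def trop_proj_def)
  moreover have "trop_class N x \<in> U" using x Px by (auto simp: U_def)
  ultimately obtain Y where "Y \<in> C" "Y \<in> U"
    using x(2) by (auto simp: in_closure_of)
  then show False using C unfolding U_def P_def by fastforce
qed

lemma Upair_in_pairs: "k \<in> {1..n} \<Longrightarrow> l \<in> {1..n} \<Longrightarrow> k \<noteq> l \<Longrightarrow> Upair k l \<in> pairs n"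
  by (auto simp: pairs_def)

text \<open>Multiplicative forms of the four-point conditions on the closed cone; the entries that are
  negative infinity are covered because products, unlike sums of reals, extend continuously.\<close>

lemma tree_cone_coord:
  assumes "z \<in> trop_vectors (pairs n)" "trop_class (pairs n) z \<in> tree_cone n T"
  obtains \<omega> t where "\<forall>e\<in>inner_edges T. \<omega> e \<ge> 0"
    "\<And>k l. k \<in> {1..n} \<Longrightarrow> l \<in> {1..n} \<Longrightarrow> k \<noteq> l \<Longrightarrow> trop_exp (z (Upair k l)) = exp (tree_dist T \<omega> k l + t)"
proof -
  obtain z0 \<omega> where z0: "trop_class (pairs n) z = trop_class (pairs n) z0" "z0 \<in> trop_vectors (pairs n)"
    and \<omega>: "\<forall>e\<in>inner_edges T. \<omega> e \<ge> 0"
    "\<forall>k\<in>{1..n}. \<forall>l\<in>{1..n}. k \<noteq> l \<longrightarrow>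
          z0 (Upair k l) = ereal (\<Sum>e\<in>path_edges (leaf_path T k l). \<omega> e)"
    using assms(2) unfolding tree_cone_def by auto
  obtain t where "\<And>q. q \<in> pairs n \<Longrightarrow> z q = z0 q + ereal t"
    using trop_class_eq_iff[OF z0(2) assms(1) z0(1)[symmetric]] by metis
  then have "trop_exp (z (Upair k l)) = exp (tree_dist T \<omega> k l + t)"
    if "k \<in> {1..n}" "l \<in> {1..n}" "k \<noteq> l" for k l
    using \<omega>(2) that by (simp add: Upair_in_pairs tree_dist_def)
  then show thesis using that \<omega>(1) by blast
qed

context
  fixes n :: nat and T :: "'v ltree" and x :: "nat uprod \<Rightarrow> ereal" and i j :: nat
  assumes T: "tree_on n T" and x: "x \<in> trop_vectors (pairs n)"
    "trop_class (pairs n) x \<in> trop_proj_topology (pairs n) closure_of tree_cone n T"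
    and ij: "i \<in> {1..n}" "j \<in> {1..n}" "i \<noteq> j"
begin

text \<open>An inequality between two-term sums of distances that holds for all admissible weights
  passes to the closed cone. On the cone itself it is exponentiated; the shift \<open>t\<close>
  between representatives enters twice on either side.\<close>

lemma tropical_le:
  assumes abcd: "a \<in> {1..n}" "b \<in> {1..n}" "c \<in> {1..n}" "d \<in> {1..n}" "a \<noteq> b" "c \<noteq> d"
    "a' \<in> {1..n}" "b' \<in> {1..n}" "c' \<in> {1..n}" "d' \<in> {1..n}" "a' \<noteq> b'" "c' \<noteq> d'"
    and le: "\<And>\<omega>. \<forall>e\<in>inner_edges T. \<omega> e \<ge> 0 \<Longrightarrow>
      tree_dist T \<omega> a b + tree_dist T \<omega> c d \<le> tree_dist T \<omega> a' b' + tree_dist T \<omega> c' d'"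
  shows "trop_exp (x (Upair a b)) * trop_exp (x (Upair c d))
    \<le> trop_exp (x (Upair a' b')) * trop_exp (x (Upair c' d'))"
proof (rule trop_closure_binomial_le[OF x])
  fix z assume z: "z \<in> trop_vectors (pairs n)" "trop_class (pairs n) z \<in> tree_cone n T"
  obtain \<omega> t where \<omega>: "\<forall>e\<in>inner_edges T. \<omega> e \<ge> 0"
    "\<And>k l. k \<in> {1..n} \<Longrightarrow> l \<in> {1..n} \<Longrightarrow> k \<noteq> l \<Longrightarrow> trop_exp (z (Upair k l)) = exp (tree_dist T \<omega> k l + t)"
    using tree_cone_coord[OF z] by metis
  show "trop_exp (z (Upair a b)) * trop_exp (z (Upair c d))
    \<le> trop_exp (z (Upair a' b')) * trop_exp (z (Upair c' d'))"
    unfolding \<omega>(2)[OF abcd(1,2,5)] \<omega>(2)[OF abcd(3,4,6)] \<omega>(2)[OF abcd(7,8,11)] \<omega>(2)[OF abcd(9,10,12)]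
    using le[OF \<omega>(1)] by (simp flip: exp_add)
qed (use abcd in \<open>auto intro: Upair_in_pairs\<close>)

lemma sided_tree_exists: obtains s where "sided_tree n T s"
  using tree_sides[OF T] T unfolding sided_tree_def by metis

lemma trop_ex_branch:
  assumes "l \<in> {1..n} - {i, j}"
  obtains v where "v \<in> internal_verts T i j" "l \<in> branch n T i j v"
  using sided_tree_exists sided_tree.ex_branch ij assms by metis

lemma trop_same_branch:
  assumes kl: "k \<in> branch n T i j v" "l \<in> branch n T i j v" "k \<noteq> l"
  shows "trop_exp (x (Upair i j)) * trop_exp (x (Upair k l)) \<le> trop_exp (x (Upair i k)) * trop_exp (x (Upair j l))"
    and "trop_exp (x (Upair i k)) * trop_exp (x (Upair j l)) = trop_exp (x (Upair i l)) * trop_exp (x (Upair j k))"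
proof -
  obtain s where "sided_tree n T s" using sided_tree_exists .
  then interpret sided_tree n T s .
  have k: "k \<in> {1..n}" "l \<in> {1..n}" "i \<noteq> k" "i \<noteq> l" "j \<noteq> k" "j \<noteq> l"
    using branch_subset[OF kl(1)] branch_subset[OF kl(2)] by auto
  note d = same_branch_four_point[OF ij kl]
  show "trop_exp (x (Upair i j)) * trop_exp (x (Upair k l)) \<le> trop_exp (x (Upair i k)) * trop_exp (x (Upair j l))"
    by (rule tropical_le) (use ij k kl d(1) in auto)
  show "trop_exp (x (Upair i k)) * trop_exp (x (Upair j l)) = trop_exp (x (Upair i l)) * trop_exp (x (Upair j k))"
    by (rule antisym; rule tropical_le) (use ij k kl eq_refl[OF d(2)] eq_refl[OF d(2)[symmetric]] in auto)
qed

lemma trop_diff_branch: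
  assumes kl: "k \<in> branch n T i j a" "l \<in> branch n T i j b" "a \<noteq> b" "k \<noteq> l"
  shows "trop_exp (x (Upair i k)) * trop_exp (x (Upair j l)) \<le> trop_exp (x (Upair i j)) * trop_exp (x (Upair k l))"
proof -
  obtain s where "sided_tree n T s" using sided_tree_exists .
  then interpret sided_tree n T s .
  have k: "k \<in> {1..n}" "l \<in> {1..n}" "i \<noteq> k" "i \<noteq> l" "j \<noteq> k" "j \<noteq> l"
    using branch_subset[OF kl(1)] branch_subset[OF kl(2)] by auto
  show ?thesis
    by (rule tropical_le) (use ij k kl diff_branch_four_point[OF ij kl] in auto)
qed

text \<open>The quartet contains \<open>i\<close> but not \<open>j\<close>. The version for
  \<open>j\<close> follows because within one branch the difference of the distances to
  \<open>i\<close> and to \<open>j\<close> is constant, by the equality in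
  \<open>same_branch_four_point\<close>.\<close>

lemma trop_cherry:
  assumes acd: "a \<in> branch n T i j v" "c \<in> branch n T i j v" "d \<in> branch n T i j v" "distinct [a, c, d]"
    and ch: "is_cherry (quartet T {i, a, c, d}) c d" and p: "p \<in> {i, j}"
  shows "trop_exp (x (Upair p a)) * trop_exp (x (Upair c d)) \<le> trop_exp (x (Upair p c)) * trop_exp (x (Upair a d))"
    and "trop_exp (x (Upair p c)) * trop_exp (x (Upair a d)) = trop_exp (x (Upair p d)) * trop_exp (x (Upair a c))"
proof -
  obtain s where "sided_tree n T s" using sided_tree_exists .
  then interpret sided_tree n T s .
  have k: "a \<in> {1..n}" "c \<in> {1..n}" "d \<in> {1..n}" "distinct [i, a, c, d]" "distinct [j, a, c, d]"
    using branch_subset[OF acd(1)] branch_subset[OF acd(2)] branch_subset[OF acd(3)] acd(4) by auto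
  have pn: "p \<in> {1..n}" "distinct [p, a, c, d]" using p ij k by auto
  have le: "tree_dist T \<omega> p a + tree_dist T \<omega> c d \<le> tree_dist T \<omega> p c + tree_dist T \<omega> a d"
    "tree_dist T \<omega> p c + tree_dist T \<omega> a d = tree_dist T \<omega> p d + tree_dist T \<omega> a c"
    if \<omega>: "\<forall>e\<in>inner_edges T. \<omega> e \<ge> 0" for \<omega>
  proof -
    note q = cherry_four_point[OF ij(1) k(1-4) \<omega> ch]
    have "a \<noteq> c" "a \<noteq> d" using acd by auto
    note r = same_branch_four_point(2)[OF ij acd(1,2) \<open>a \<noteq> c\<close> \<omega>]
      same_branch_four_point(2)[OF ij acd(1,3) \<open>a \<noteq> d\<close> \<omega>]
    show "tree_dist T \<omega> p a + tree_dist T \<omega> c d \<le> tree_dist T \<omega> p c + tree_dist T \<omega> a d"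
      "tree_dist T \<omega> p c + tree_dist T \<omega> a d = tree_dist T \<omega> p d + tree_dist T \<omega> a c"
      using p q r by auto
  qed
  show "trop_exp (x (Upair p a)) * trop_exp (x (Upair c d)) \<le> trop_exp (x (Upair p c)) * trop_exp (x (Upair a d))"
    by (rule tropical_le) (use le(1) k pn in auto)
  show "trop_exp (x (Upair p c)) * trop_exp (x (Upair a d)) = trop_exp (x (Upair p d)) * trop_exp (x (Upair a c))"
  proof (rule antisym)
    show "trop_exp (x (Upair p c)) * trop_exp (x (Upair a d)) \<le> trop_exp (x (Upair p d)) * trop_exp (x (Upair a c))"
      by (rule tropical_le, goal_cases) (use k pn eq_refl[OF le(2)] in auto)
    show "trop_exp (x (Upair p d)) * trop_exp (x (Upair a c)) \<le> trop_exp (x (Upair p c)) * trop_exp (x (Upair a d))"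
      by (rule tropical_le, goal_cases) (use k pn eq_refl[OF le(2)[symmetric]] in auto)
  qed
qed

end

section \<open>Polynomials and Laurent polynomials\<close>

lemma poly_mapping_sum_single: "(\<Sum>\<alpha>\<in>Poly_Mapping.keys p. Poly_Mapping.single \<alpha> (Poly_Mapping.lookup p \<alpha>)) = p"
proof (rule poly_mapping_eqI)
  fix k
  show "Poly_Mapping.lookup (\<Sum>\<alpha>\<in>Poly_Mapping.keys p. Poly_Mapping.single \<alpha> (Poly_Mapping.lookup p \<alpha>)) k =
    Poly_Mapping.lookup p k"
    by (auto simp: lookup_sum lookup_single when_def in_keys_iff sum.delta' sum.delta)
qed

lemma lookup_mult_sum:
  fixes p q :: "'m::comm_monoid_add \<Rightarrow>\<^sub>0 'k::comm_semiring_0"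
  shows "p * q = (\<Sum>\<alpha>\<in>Poly_Mapping.keys p. \<Sum>\<beta>\<in>Poly_Mapping.keys q.
    Poly_Mapping.single (\<alpha> + \<beta>) (Poly_Mapping.lookup p \<alpha> * Poly_Mapping.lookup q \<beta>))"
proof -
  have "p * q = (\<Sum>\<alpha>\<in>Poly_Mapping.keys p. Poly_Mapping.single \<alpha> (Poly_Mapping.lookup p \<alpha>)) *
    (\<Sum>\<alpha>\<in>Poly_Mapping.keys q. Poly_Mapping.single \<alpha> (Poly_Mapping.lookup q \<alpha>))"
    by (simp add: poly_mapping_sum_single)
  then show ?thesis by (simp add: sum_product mult_single)
qed

subsection \<open>Evaluation homomorphisms\<close>

definition pm_eval :: "('k::comm_ring_1 \<Rightarrow> 'e::comm_ring_1) \<Rightarrow> ('m::comm_monoid_add \<Rightarrow> 'e) \<Rightarrow> ('m \<Rightarrow>\<^sub>0 'k) \<Rightarrow> 'e" where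
  "pm_eval C \<phi> p = (\<Sum>\<alpha>\<in>Poly_Mapping.keys p. C (Poly_Mapping.lookup p \<alpha>) * \<phi> \<alpha>)"

text \<open>Multiplicativity of \<open>\<phi>\<close> is restricted to a set \<open>D\<close> of
  exponents: setting variables to 0 is not multiplicative once they occur with negative exponents,
  and neither are integer powers of 0. Additivity of the evaluation holds for all arguments.\<close>

locale eval_hom =
  fixes C :: "'k::comm_ring_1 \<Rightarrow> 'e::comm_ring_1" and \<phi> :: "'m::comm_monoid_add \<Rightarrow> 'e" and D :: "'m set"
  assumes C_add: "C (a + b) = C a + C b" and C_mult: "C (a * b) = C a * C b" and C_1: "C 1 = 1"
    and \<phi>_0: "\<phi> 0 = 1" and \<phi>_add: "\<alpha> \<in> D \<Longrightarrow> \<beta> \<in> D \<Longrightarrow> \<phi> (\<alpha> + \<beta>) = \<phi> \<alpha> * \<phi> \<beta>"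
begin

lemma C_0: "C 0 = 0"
  using C_add[of 0 0] by simp

lemma superset:
  assumes "finite F" "Poly_Mapping.keys p \<subseteq> F"
  shows "pm_eval C \<phi> p = (\<Sum>\<alpha>\<in>F. C (Poly_Mapping.lookup p \<alpha>) * \<phi> \<alpha>)"
  unfolding pm_eval_def
  by (rule sum.mono_neutral_left) (use assms in \<open>auto simp: in_keys_iff C_0\<close>)

lemma single: "pm_eval C \<phi> (Poly_Mapping.single \<alpha> a) = C a * \<phi> \<alpha>"
  by (cases "a = 0") (auto simp: pm_eval_def C_0)

lemma zero: "pm_eval C \<phi> 0 = 0"
  by (simp add: pm_eval_def)

lemma one: "pm_eval C \<phi> 1 = 1"
  using single[of 0 1] by (simp add: C_1 \<phi>_0)

lemma add: "pm_eval C \<phi> (p + q) = pm_eval C \<phi> p + pm_eval C \<phi> q"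
proof -
  let ?F = "Poly_Mapping.keys p \<union> Poly_Mapping.keys q"
  have "pm_eval C \<phi> (p + q) = (\<Sum>\<alpha>\<in>?F. C (Poly_Mapping.lookup (p + q) \<alpha>) * \<phi> \<alpha>)"
    by (rule superset) (use Poly_Mapping.keys_add[of p q] in auto)
  also have "\<dots> = (\<Sum>\<alpha>\<in>?F. C (Poly_Mapping.lookup p \<alpha>) * \<phi> \<alpha>) + (\<Sum>\<alpha>\<in>?F. C (Poly_Mapping.lookup q \<alpha>) * \<phi> \<alpha>)"
    by (simp add: lookup_add C_add distrib_right sum.distrib)
  also have "\<dots> = pm_eval C \<phi> p + pm_eval C \<phi> q"
    using superset[of ?F p] superset[of ?F q] by simp
  finally show ?thesis .
qed

lemma uminus: "pm_eval C \<phi> (- p) = - pm_eval C \<phi> p"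
  using add[of p "- p"] zero by (simp add: eq_neg_iff_add_eq_0 add.commute)

lemma diff: "pm_eval C \<phi> (p - q) = pm_eval C \<phi> p - pm_eval C \<phi> q"
  using add[of p "- q"] uminus[of q] by simp

lemma sum: "pm_eval C \<phi> (sum f A) = (\<Sum>x\<in>A. pm_eval C \<phi> (f x))"
  by (induction A rule: infinite_finite_induct) (auto simp: zero add)

lemma mult:
  assumes "Poly_Mapping.keys p \<subseteq> D" "Poly_Mapping.keys q \<subseteq> D"
  shows "pm_eval C \<phi> (p * q) = pm_eval C \<phi> p * pm_eval C \<phi> q"
proof -
  have "pm_eval C \<phi> (p * q) = (\<Sum>\<alpha>\<in>Poly_Mapping.keys p. \<Sum>\<beta>\<in>Poly_Mapping.keys q.
      C (Poly_Mapping.lookup p \<alpha> * Poly_Mapping.lookup q \<beta>) * \<phi> (\<alpha> + \<beta>))"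
    by (subst lookup_mult_sum) (simp add: sum single)
  also have "\<dots> = (\<Sum>\<alpha>\<in>Poly_Mapping.keys p. \<Sum>\<beta>\<in>Poly_Mapping.keys q.
      (C (Poly_Mapping.lookup p \<alpha>) * \<phi> \<alpha>) * (C (Poly_Mapping.lookup q \<beta>) * \<phi> \<beta>))"
  proof (intro sum.cong refl)
    fix \<alpha> \<beta> assume "\<alpha> \<in> Poly_Mapping.keys p" "\<beta> \<in> Poly_Mapping.keys q"
    then have "\<phi> (\<alpha> + \<beta>) = \<phi> \<alpha> * \<phi> \<beta>" using assms by (intro \<phi>_add) auto
    then show "C (Poly_Mapping.lookup p \<alpha> * Poly_Mapping.lookup q \<beta>) * \<phi> (\<alpha> + \<beta>) =
      (C (Poly_Mapping.lookup p \<alpha>) * \<phi> \<alpha>) * (C (Poly_Mapping.lookup q \<beta>) * \<phi> \<beta>)"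
      by (simp add: C_mult mult_ac)
  qed
  also have "\<dots> = pm_eval C \<phi> p * pm_eval C \<phi> q"
    by (simp add: pm_eval_def sum_product)
  finally show ?thesis .
qed

end

definition pm_monom :: "('i \<Rightarrow> 'f::field) \<Rightarrow> ('i \<Rightarrow>\<^sub>0 int) \<Rightarrow> 'f" where
  "pm_monom b \<alpha> = (\<Prod>q\<in>Poly_Mapping.keys \<alpha>. b q powi Poly_Mapping.lookup \<alpha> q)"

lemma monomial_radius_eq: "monomial_radius \<rho> = pm_monom \<rho>"
  by (rule ext) (simp add: monomial_radius_def pm_monom_def)

lemma pm_monom_superset:
  assumes "finite F" "Poly_Mapping.keys \<alpha> \<subseteq> F"
  shows "pm_monom b \<alpha> = (\<Prod>q\<in>F. b q powi Poly_Mapping.lookup \<alpha> q)"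
  unfolding pm_monom_def
  by (rule prod.mono_neutral_left) (use assms in \<open>auto simp: in_keys_iff\<close>)

lemma pm_monom_0 [simp]: "pm_monom b 0 = 1"
  by (simp add: pm_monom_def)

lemma pm_monom_add:
  assumes "\<And>q. q \<in> V \<Longrightarrow> b q \<noteq> 0" "Poly_Mapping.keys \<alpha> \<subseteq> V" "Poly_Mapping.keys \<beta> \<subseteq> V"
  shows "pm_monom b (\<alpha> + \<beta>) = pm_monom b \<alpha> * pm_monom b \<beta>"
proof -
  let ?F = "Poly_Mapping.keys \<alpha> \<union> Poly_Mapping.keys \<beta>"
  have "pm_monom b (\<alpha> + \<beta>) = (\<Prod>q\<in>?F. b q powi Poly_Mapping.lookup (\<alpha> + \<beta>) q)"
    by (rule pm_monom_superset) (use Poly_Mapping.keys_add[of \<alpha> \<beta>] in auto)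
  also have "\<dots> = (\<Prod>q\<in>?F. b q powi Poly_Mapping.lookup \<alpha> q * b q powi Poly_Mapping.lookup \<beta> q)"
    by (rule prod.cong) (use assms in \<open>auto simp: lookup_add power_int_add\<close>)
  also have "\<dots> = pm_monom b \<alpha> * pm_monom b \<beta>"
    using pm_monom_superset[of ?F \<alpha> b] pm_monom_superset[of ?F \<beta> b] by (simp add: prod.distrib)
  finally show ?thesis .
qed

lemma pm_monom_pos:
  fixes b :: "'i \<Rightarrow> real"
  assumes "\<And>q. q \<in> V \<Longrightarrow> b q > 0" "Poly_Mapping.keys \<alpha> \<subseteq> V"
  shows "pm_monom b \<alpha> > 0"
  unfolding pm_monom_def using assms by (auto intro!: prod_pos zero_less_power_int)

lemma pm_monom_single: "pm_monom b (Poly_Mapping.single q m) = b q powi m"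
  by (simp add: pm_monom_def)

definition nn_exponents :: "'i set \<Rightarrow> 'i set \<Rightarrow> ('i \<Rightarrow>\<^sub>0 int) set" where
  "nn_exponents V U = {\<alpha>. Poly_Mapping.keys \<alpha> \<subseteq> V \<and> (\<forall>q\<in>U. Poly_Mapping.lookup \<alpha> q \<ge> 0)}"

lemma nn_exponents_add: "\<alpha> \<in> nn_exponents V U \<Longrightarrow> \<beta> \<in> nn_exponents V U \<Longrightarrow> \<alpha> + \<beta> \<in> nn_exponents V U"
  using Poly_Mapping.keys_add[of \<alpha> \<beta>] by (auto simp: nn_exponents_def lookup_add)

lemma mixed_ring_eq: "mixed_ring V W = {p. Poly_Mapping.keys p \<subseteq> nn_exponents V (V - W)}"
  by (auto simp: mixed_ring_def nn_exponents_def)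

lemma mixed_ring_add: "p \<in> mixed_ring V W \<Longrightarrow> q \<in> mixed_ring V W \<Longrightarrow> p + q \<in> mixed_ring V W"
  using Poly_Mapping.keys_add[of p q] by (auto simp: mixed_ring_eq)

lemma mixed_ring_uminus: "p \<in> mixed_ring V W \<Longrightarrow> - (p :: 'k::field lpoly) \<in> mixed_ring V W"
  by (simp add: mixed_ring_eq)

lemma mixed_ring_diff:
  "p \<in> mixed_ring V W \<Longrightarrow> q \<in> mixed_ring V W \<Longrightarrow> p - (q :: 'k::field lpoly) \<in> mixed_ring V W"
  using mixed_ring_add[of p V W "- q"] mixed_ring_uminus[of q V W] by simp

lemma mixed_ring_mult:
  assumes "p \<in> mixed_ring V W" "q \<in> mixed_ring V W"
  shows "p * (q :: 'k::field lpoly) \<in> mixed_ring V W"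
  unfolding mixed_ring_eq
proof (intro CollectI subsetI)
  fix \<gamma> assume "\<gamma> \<in> Poly_Mapping.keys (p * q)"
  then obtain \<alpha> \<beta> where "\<gamma> = \<alpha> + \<beta>" "\<alpha> \<in> Poly_Mapping.keys p" "\<beta> \<in> Poly_Mapping.keys q"
    using Poly_Mapping.keys_mult[of p q] by blast
  then show "\<gamma> \<in> nn_exponents V (V - W)"
    using assms nn_exponents_add unfolding mixed_ring_eq by blast
qed

text \<open>Exhibits the removal of monomials as an evaluation, so that its ring properties come
  from \<open>eval_hom\<close>.\<close>

lemma set_zero_eq: "set_zero Z p = pm_eval (Poly_Mapping.single 0)
    (\<lambda>\<alpha>. if Poly_Mapping.keys \<alpha> \<inter> Z = {} then Poly_Mapping.single \<alpha> 1 else 0) (p :: 'k::field lpoly)"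
  unfolding set_zero_def pm_eval_def
  by (subst sum.inter_filter) (auto intro!: sum.cong simp: mult_single)

text \<open>Nonnegative exponents cannot cancel: a variable of \<open>Z\<close> occurs in a product
  of monomials iff it occurs in one of the factors.\<close>

lemma set_zero_hom:
  assumes "Z \<subseteq> U"
  shows "eval_hom (Poly_Mapping.single 0 :: 'k::field \<Rightarrow> 'k lpoly)
    (\<lambda>\<alpha>. if Poly_Mapping.keys \<alpha> \<inter> Z = {} then Poly_Mapping.single \<alpha> 1 else 0) (nn_exponents V U)"
proof
  fix \<alpha> \<beta> :: "nat uprod \<Rightarrow>\<^sub>0 int" assume "\<alpha> \<in> nn_exponents V U" "\<beta> \<in> nn_exponents V U"
  then have nn: "Poly_Mapping.lookup \<alpha> q \<ge> 0" "Poly_Mapping.lookup \<beta> q \<ge> 0" if "q \<in> Z" for q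
    using assms that by (auto simp: nn_exponents_def)
  have "Poly_Mapping.keys (\<alpha> + \<beta>) \<inter> Z = {} \<longleftrightarrow> Poly_Mapping.keys \<alpha> \<inter> Z = {} \<and> Poly_Mapping.keys \<beta> \<inter> Z = {}"
  proof -
    have "q \<in> Poly_Mapping.keys (\<alpha> + \<beta>) \<longleftrightarrow> q \<in> Poly_Mapping.keys \<alpha> \<or> q \<in> Poly_Mapping.keys \<beta>" if "q \<in> Z" for q
      using nn[OF that] by (auto simp: in_keys_iff lookup_add)
    then show ?thesis by blast
  qed
  then show "(if Poly_Mapping.keys (\<alpha> + \<beta>) \<inter> Z = {} then Poly_Mapping.single (\<alpha> + \<beta>) (1::'k) else 0) =
    (if Poly_Mapping.keys \<alpha> \<inter> Z = {} then Poly_Mapping.single \<alpha> 1 else 0) *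
    (if Poly_Mapping.keys \<beta> \<inter> Z = {} then Poly_Mapping.single \<beta> 1 else 0)"
    by (auto simp: mult_single)
qed (auto simp: single_add mult_single)

lemma lookup_set_zero:
  "Poly_Mapping.lookup (set_zero Z p) \<alpha> = (if Poly_Mapping.keys \<alpha> \<inter> Z = {} then Poly_Mapping.lookup p \<alpha> else 0)"
  unfolding set_zero_def by (auto simp: lookup_sum lookup_single when_def in_keys_iff sum.delta' sum.delta)

subsection \<open>Coefficient bounds\<close>

text \<open>An upper bound for the Gauss norm with radii \<open>\<rho>\<close>, usable before the
  polynomial is known to lie in a torus algebra, and also when some radii are 0.\<close>

definition gauss_le :: "('i \<Rightarrow> real) \<Rightarrow> (('i \<Rightarrow>\<^sub>0 int) \<Rightarrow>\<^sub>0 'k::complete_nonarch_field) \<Rightarrow> real \<Rightarrow> bool" where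
  "gauss_le \<rho> P e \<longleftrightarrow> (\<forall>\<alpha>. nabs (Poly_Mapping.lookup P \<alpha>) * monomial_radius \<rho> \<alpha> \<le> e)"

lemma gauss_le_add:
  assumes \<rho>: "\<And>q. \<rho> q \<ge> 0" and "gauss_le \<rho> P e" "gauss_le \<rho> Q e'"
  shows "gauss_le \<rho> (P + Q) (max e e')"
  unfolding gauss_le_def
proof
  fix \<alpha>
  have r: "monomial_radius \<rho> \<alpha> \<ge> 0"
    unfolding monomial_radius_def using \<rho> by (auto intro!: prod_nonneg zero_le_power_int)
  have "nabs (Poly_Mapping.lookup (P + Q) \<alpha>) * monomial_radius \<rho> \<alpha> \<le>
      max (nabs (Poly_Mapping.lookup P \<alpha>)) (nabs (Poly_Mapping.lookup Q \<alpha>)) * monomial_radius \<rho> \<alpha>"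
    using r by (intro mult_right_mono) (simp_all add: lookup_add nabs_add)
  also have "\<dots> \<le> max e e'"
    using assms(2,3) r unfolding gauss_le_def by (auto simp: max_def intro: order_trans)
  finally show "nabs (Poly_Mapping.lookup (P + Q) \<alpha>) * monomial_radius \<rho> \<alpha> \<le> max e e'" .
qed

lemma gauss_le_uminus: "gauss_le \<rho> P e \<Longrightarrow> gauss_le \<rho> (- P) e"
  by (simp add: gauss_le_def)

text \<open>Positive radii make the radius of a monomial multiplicative in the exponent, negative
  exponents included. The ultrametric inequality then bounds each coefficient of the
  product.\<close>

lemma gauss_le_mult:
  assumes \<rho>: "\<And>q. q \<in> V \<Longrightarrow> \<rho> q > 0"
    and P: "\<And>\<alpha>. \<alpha> \<in> Poly_Mapping.keys P \<Longrightarrow> Poly_Mapping.keys \<alpha> \<subseteq> V"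
    and Q: "\<And>\<alpha>. \<alpha> \<in> Poly_Mapping.keys Q \<Longrightarrow> Poly_Mapping.keys \<alpha> \<subseteq> V"
    and le: "gauss_le \<rho> P e" "gauss_le \<rho> Q e'"
  shows "gauss_le \<rho> (P * Q) (e * e')"
  unfolding gauss_le_def
proof
  fix \<gamma>
  have nn: "e \<ge> 0 \<and> e' \<ge> 0"
    using le[unfolded gauss_le_def, rule_format, of 0] nabs_nonneg[of "Poly_Mapping.lookup P 0"]
      nabs_nonneg[of "Poly_Mapping.lookup Q 0"] by (auto simp: monomial_radius_eq)
  show "nabs (Poly_Mapping.lookup (P * Q) \<gamma>) * monomial_radius \<rho> \<gamma> \<le> e * e'"
  proof (cases "Poly_Mapping.lookup (P * Q) \<gamma> = 0")
    case True
    then show ?thesis using nn by simp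
  next
    case False
    then have "\<gamma> \<in> Poly_Mapping.keys (P * Q)" by (simp add: in_keys_iff)
    then obtain a b where ab: "\<gamma> = a + b" "a \<in> Poly_Mapping.keys P" "b \<in> Poly_Mapping.keys Q"
      using Poly_Mapping.keys_mult[of P Q] by blast
    then have "Poly_Mapping.keys \<gamma> \<subseteq> V"
      using P[OF ab(2)] Q[OF ab(3)] Poly_Mapping.keys_add[of a b] by blast
    then have pos: "monomial_radius \<rho> \<gamma> > 0" unfolding monomial_radius_eq using pm_monom_pos \<rho> by blast
    have "nabs (Poly_Mapping.lookup (P * Q) \<gamma>) \<le> e * e' / monomial_radius \<rho> \<gamma>"
      unfolding lookup_mult_sum lookup_sum
    proof (intro nabs_sum_le)
      fix \<alpha> \<beta> assume \<alpha>: "\<alpha> \<in> Poly_Mapping.keys P" and \<beta>: "\<beta> \<in> Poly_Mapping.keys Q"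
      show "nabs (Poly_Mapping.lookup (Poly_Mapping.single (\<alpha> + \<beta>)
         (Poly_Mapping.lookup P \<alpha> * Poly_Mapping.lookup Q \<beta>)) \<gamma>) \<le> e * e' / monomial_radius \<rho> \<gamma>"
      proof (cases "\<alpha> + \<beta> = \<gamma>")
        case True
        have "monomial_radius \<rho> \<gamma> = monomial_radius \<rho> \<alpha> * monomial_radius \<rho> \<beta>"
          unfolding True[symmetric] monomial_radius_eq
          by (rule pm_monom_add[where V = V]) (use \<rho> P[OF \<alpha>] Q[OF \<beta>] in force)+
        moreover have "(nabs (Poly_Mapping.lookup P \<alpha>) * monomial_radius \<rho> \<alpha>) *
            (nabs (Poly_Mapping.lookup Q \<beta>) * monomial_radius \<rho> \<beta>) \<le> e * e'"
        proof (intro mult_mono)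
          have "pm_monom \<rho> \<beta> > 0" by (rule pm_monom_pos[where V = V]) (use \<rho> Q[OF \<beta>] in auto)
          then show "0 \<le> nabs (Poly_Mapping.lookup Q \<beta>) * monomial_radius \<rho> \<beta>"
            by (simp add: monomial_radius_eq nabs_nonneg)
        qed (use le nn in \<open>auto simp: gauss_le_def\<close>)
        ultimately show ?thesis
          using pos True by (simp add: nabs_mult field_simps)
      next
        case False
        then show ?thesis using nn pos by (simp add: lookup_single)
      qed
    qed (use nn pos in auto)
    then show ?thesis using pos by (simp add: field_simps)
  qed
qed

lemma Fract_add_1: "Fract a 1 + Fract b 1 = Fract (a + b) (1 :: 'a::idom)"
  by simp

lemma Fract_mult_1: "Fract a 1 * Fract b 1 = Fract (a * b) (1 :: 'a::idom)"
  by simp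

lemma Fract_0_1: "Fract 0 1 = (0 :: 'a::idom fract)"
  by (simp add: Zero_fract_def)

lemma Fract_1_1: "Fract 1 1 = (1 :: 'a::idom fract)"
  by (simp add: One_fract_def)

lemma Fract_eq_0_iff: "Fract a 1 = 0 \<longleftrightarrow> a = (0 :: 'a::idom)"
  by (simp add: Zero_fract_def eq_fract)

lemma Fract_uminus_1: "Fract (- a) 1 = - Fract a (1 :: 'a::idom)"
  by simp

lemma Fract_diff_1: "Fract a 1 - Fract b 1 = Fract (a - b) (1 :: 'a::idom)"
  by simp

lemma Fract_sum_1: "Fract (sum f A) 1 = (\<Sum>x\<in>A. Fract (f x) (1 :: 'a::idom))"
  by (induction A rule: infinite_finite_induct) (simp_all add: Fract_0_1 flip: Fract_add_1)

lemma Fract_prod_1: "Fract (prod f A) 1 = (\<Prod>x\<in>A. Fract (f x) (1 :: 'a::idom))"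
  by (induction A rule: infinite_finite_induct) (simp_all add: Fract_1_1 flip: Fract_mult_1)

lemma Fract_power_1: "Fract (a ^ m) 1 = Fract a (1 :: 'a::idom) ^ m"
  by (induction m) (simp_all add: Fract_1_1 flip: Fract_mult_1)

definition nat_monom :: "('i \<Rightarrow> 'e::comm_ring_1) \<Rightarrow> ('i \<Rightarrow>\<^sub>0 nat) \<Rightarrow> 'e" where
  "nat_monom b \<alpha> = (\<Prod>q\<in>Poly_Mapping.keys \<alpha>. b q ^ Poly_Mapping.lookup \<alpha> q)"

lemma nat_monom_superset:
  assumes "finite F" "Poly_Mapping.keys \<alpha> \<subseteq> F"
  shows "nat_monom b \<alpha> = (\<Prod>q\<in>F. b q ^ Poly_Mapping.lookup \<alpha> q)"
  unfolding nat_monom_def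
  by (rule prod.mono_neutral_left) (use assms in \<open>auto simp: in_keys_iff\<close>)

lemma nat_monom_add: "nat_monom b (\<alpha> + \<beta>) = nat_monom b \<alpha> * nat_monom b \<beta>"
proof -
  let ?F = "Poly_Mapping.keys \<alpha> \<union> Poly_Mapping.keys \<beta>"
  have "nat_monom b (\<alpha> + \<beta>) = (\<Prod>q\<in>?F. b q ^ Poly_Mapping.lookup (\<alpha> + \<beta>) q)"
    by (rule nat_monom_superset) (use Poly_Mapping.keys_add[of \<alpha> \<beta>] in auto)
  then show ?thesis
    using nat_monom_superset[of ?F \<alpha> b] nat_monom_superset[of ?F \<beta> b]
    by (simp add: lookup_add power_add prod.distrib)
qed

lemma nat_monom_hom: "eval_hom (Poly_Mapping.single 0 :: 'k::field \<Rightarrow> 'k lpoly) (nat_monom M) UNIV"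
  by unfold_locales (simp_all add: single_add mult_single nat_monom_add, simp add: nat_monom_def)

lemma const_poly_hom:
  "const_poly (a + b) = const_poly a + (const_poly b :: 'k::field mpoly)"
  "const_poly (a * b) = const_poly a * (const_poly b :: 'k::field mpoly)"
  "const_poly 1 = (1 :: 'k::field mpoly)"
  by (simp_all add: const_poly_def single_add mult_single)

lemma eval_coord_eq: "eval_coord i j = pm_eval (\<lambda>c. Fract (const_poly c) 1) (pm_monom (\<lambda>q. Fract (chart_coord i j q) 1))"
  by (rule ext) (simp add: eval_coord_def pm_eval_def pm_monom_def)

abbreviation (input) sgn_pair :: "nat \<Rightarrow> nat \<Rightarrow> 'a::comm_ring_1" where
  "sgn_pair k l \<equiv> if k < l then 1 else - 1"

lemma chart_coord_pair:
  assumes "k \<noteq> l" "k \<notin> {i, j}" "l \<notin> {i, j}"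
  shows "chart_coord i j (Upair k l) = sgn_pair k l * (var_poly (Upair i k) * var_poly (Upair j l)
    - var_poly (Upair i l) * var_poly (Upair j k))"
  using assms by (auto simp: chart_coord_def Let_def)

lemma chart_coord_var:
  assumes "k \<notin> {i, j}" "i \<noteq> j"
  shows "chart_coord i j (Upair i k) = var_poly (Upair i k)" "chart_coord i j (Upair j k) = var_poly (Upair j k)"
  using assms by (auto simp: chart_coord_def)

lemma var_poly_nonzero: "var_poly q \<noteq> (0 :: 'k::field mpoly)"
proof -
  have "Poly_Mapping.lookup (var_poly q :: 'k mpoly) (Poly_Mapping.single q 1) \<noteq> 0"
    by (simp add: var_poly_def)
  then show ?thesis by auto
qed

lemma pair_cases:
  assumes "q \<in> pairs n"
  obtains "q = Upair i j" | k where "k \<in> {1..n} - {i, j}" "q = Upair i k"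
  | k where "k \<in> {1..n} - {i, j}" "q = Upair j k"
  | k l where "k \<in> {1..n} - {i, j}" "l \<in> {1..n} - {i, j}" "k \<noteq> l" "q = Upair k l"
proof -
  obtain k l where kl: "k \<in> {1..n}" "l \<in> {1..n}" "k \<noteq> l" "q = Upair k l"
    using assms unfolding pairs_def by blast
  show thesis
    using kl that Upair_inject by (cases "k \<in> {i, j}"; cases "l \<in> {i, j}") fastforce+
qed

lemma chart_coord_nonzero:
  assumes "q \<in> pairs n" "i \<noteq> j"
  shows "chart_coord i j q \<noteq> (0 :: 'k::field mpoly)"
  using assms(1)
proof (cases rule: pair_cases[where i = i and j = j])
  case 1
  then show ?thesis by (simp add: chart_coord_def)
next
  case (2 k)
  then show ?thesis using assms(2) by (simp add: chart_coord_var var_poly_nonzero)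
next
  case (3 k)
  then show ?thesis using assms(2) by (simp add: chart_coord_var var_poly_nonzero)
next
  case (4 k l)
  let ?e = "\<lambda>q. Poly_Mapping.single q (1::nat)"
  \<comment> \<open>The two monomials of the Pluecker relation differ in the exponent of
    \<open>Upair i k\<close>, so they cannot cancel.\<close>
  have "Poly_Mapping.lookup (?e (Upair i k) + ?e (Upair j l)) (Upair i k) \<noteq>
    Poly_Mapping.lookup (?e (Upair i l) + ?e (Upair j k)) (Upair i k)"
    using 4 assms(2) by (auto simp: lookup_add lookup_single when_def)
  then have ne: "?e (Upair i k) + ?e (Upair j l) \<noteq> ?e (Upair i l) + ?e (Upair j k)" by metis
  have "Poly_Mapping.lookup (var_poly (Upair i k) * var_poly (Upair j l)
    - var_poly (Upair i l) * var_poly (Upair j k) :: 'k mpoly) (?e (Upair i k) + ?e (Upair j l)) = 1"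
    using ne by (simp add: var_poly_def mult_single lookup_minus lookup_single)
  then have "(var_poly (Upair i k) * var_poly (Upair j l)
    - var_poly (Upair i l) * var_poly (Upair j k) :: 'k mpoly) \<noteq> 0" by auto
  then show ?thesis using 4 by (simp add: chart_coord_pair)
qed

lemma eval_coord_hom:
  assumes "i \<noteq> j"
  shows "eval_hom (\<lambda>c. Fract (const_poly c) 1) (pm_monom (\<lambda>q. Fract (chart_coord i j q :: 'k::field mpoly) 1))
    {\<alpha>. Poly_Mapping.keys \<alpha> \<subseteq> pairs n}"
proof
  fix \<alpha> \<beta> :: "nat uprod \<Rightarrow>\<^sub>0 int"
  assume "\<alpha> \<in> {\<alpha>. Poly_Mapping.keys \<alpha> \<subseteq> pairs n}" "\<beta> \<in> {\<alpha>. Poly_Mapping.keys \<alpha> \<subseteq> pairs n}"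
  then show "pm_monom (\<lambda>q. Fract (chart_coord i j q :: 'k::field mpoly) 1) (\<alpha> + \<beta>) =
    pm_monom (\<lambda>q. Fract (chart_coord i j q) 1) \<alpha> * pm_monom (\<lambda>q. Fract (chart_coord i j q) 1) \<beta>"
    using chart_coord_nonzero[OF _ assms] by (intro pm_monom_add[where V = "pairs n"]) (auto simp: Fract_eq_0_iff)
qed (simp_all only: const_poly_hom Fract_add_1 Fract_mult_1 Fract_1_1 pm_monom_0)

subsection \<open>Algebraic independence\<close>

abbreviation lvar :: "nat uprod \<Rightarrow> 'k::field lpoly" where
  "lvar q \<equiv> Poly_Mapping.single (Poly_Mapping.single q 1) 1"

abbreviation lvar_inv :: "nat uprod \<Rightarrow> 'k::field lpoly" where
  "lvar_inv q \<equiv> Poly_Mapping.single (Poly_Mapping.single q (- 1)) 1"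

lemma lvar_mult_inv: "lvar q * lvar_inv q = (1 :: 'k::field lpoly)"
  by (simp add: mult_single flip: single_add)

lemma prod_lvar:
  assumes "\<And>q. Poly_Mapping.lookup \<alpha> q \<ge> 0"
  shows "(\<Prod>q\<in>Poly_Mapping.keys \<alpha>. lvar q ^ nat (Poly_Mapping.lookup \<alpha> q)) = Poly_Mapping.single \<alpha> (1 :: 'k::field)"
proof -
  have pow: "(lvar q :: 'k lpoly) ^ m = Poly_Mapping.single (Poly_Mapping.single q (int m)) 1" for q m
    by (induction m) (simp_all add: mult_single flip: single_add)
  have "(\<Prod>q\<in>A. Poly_Mapping.single (h q) (1 :: 'k)) = Poly_Mapping.single (sum h A) 1"
    for h :: "nat uprod \<Rightarrow> (nat uprod \<Rightarrow>\<^sub>0 int)" and A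
    by (induction A rule: infinite_finite_induct) (simp_all add: mult_single)
  then show ?thesis
    using assms by (simp add: pow poly_mapping_sum_single)
qed

text \<open>A ring homomorphism from the coordinate ring sending each chosen coordinate to the variable
  with the same index inverts the evaluation of polynomials at these coordinates.\<close>

lemma eval_coord_inj:
  fixes M :: "nat uprod \<Rightarrow> 'k::field lpoly"
  assumes "i \<noteq> j" "I \<subseteq> pairs n"
    and M: "\<And>q. q \<in> I \<Longrightarrow> pm_eval (Poly_Mapping.single 0) (nat_monom M) (chart_coord i j q) = lvar q"
    and p: "\<And>\<alpha>. \<alpha> \<in> Poly_Mapping.keys p \<Longrightarrow> Poly_Mapping.keys \<alpha> \<subseteq> I" and "eval_coord i j p = 0"
  shows "p = (0 :: 'k lpoly)"
proof -
  interpret E: eval_hom "\<lambda>c. Fract (const_poly c) 1" "pm_monom (\<lambda>q. Fract (chart_coord i j q :: 'k mpoly) 1)"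
    "{\<alpha>. Poly_Mapping.keys \<alpha> \<subseteq> pairs n}"
    using eval_coord_hom[OF assms(1)] .
  interpret H: eval_hom "Poly_Mapping.single 0 :: 'k \<Rightarrow> 'k lpoly" "nat_monom M" UNIV
    by (rule nat_monom_hom)
  define \<delta> where "\<delta> = (\<Sum>\<alpha>\<in>Poly_Mapping.keys p. Poly_Mapping.map abs \<alpha>)"
  have l\<delta>: "Poly_Mapping.lookup \<delta> q = (\<Sum>\<alpha>\<in>Poly_Mapping.keys p. \<bar>Poly_Mapping.lookup \<alpha> q\<bar>)" for q
    by (auto simp: \<delta>_def lookup_sum map.rep_eq when_def intro!: sum.cong)
  have k\<delta>: "Poly_Mapping.keys \<delta> \<subseteq> I"
  proof
    fix q assume "q \<in> Poly_Mapping.keys \<delta>"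
    then have "(\<Sum>\<alpha>\<in>Poly_Mapping.keys p. \<bar>Poly_Mapping.lookup \<alpha> q\<bar>) \<noteq> 0"
      by (simp add: in_keys_iff l\<delta>)
    then obtain \<alpha> where "\<alpha> \<in> Poly_Mapping.keys p" "\<bar>Poly_Mapping.lookup \<alpha> q\<bar> \<noteq> 0"
      using sum.not_neutral_contains_not_neutral by metis
    then have "q \<in> Poly_Mapping.keys \<alpha>" by (auto simp: in_keys_iff)
    then show "q \<in> I" using p[OF \<open>\<alpha> \<in> Poly_Mapping.keys p\<close>] by blast
  qed
  define P where "P = p * Poly_Mapping.single \<delta> 1"
  have keysP: "\<exists>\<beta>\<in>Poly_Mapping.keys p. \<alpha> = \<beta> + \<delta>" if "\<alpha> \<in> Poly_Mapping.keys P" for \<alpha>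
  proof -
    have "\<alpha> \<in> {a + b |a b. a \<in> Poly_Mapping.keys p \<and> b \<in> Poly_Mapping.keys (Poly_Mapping.single \<delta> (1 :: 'k))}"
      using keys_mult[of p "Poly_Mapping.single \<delta> 1"] that unfolding P_def by blast
    then show ?thesis by auto
  qed
  have nn: "Poly_Mapping.lookup \<alpha> q \<ge> 0" and kI: "Poly_Mapping.keys \<alpha> \<subseteq> I" if \<alpha>: "\<alpha> \<in> Poly_Mapping.keys P" for \<alpha> q
  proof -
    obtain \<beta> where \<beta>: "\<beta> \<in> Poly_Mapping.keys p" "\<alpha> = \<beta> + \<delta>" using keysP[OF \<alpha>] by blast
    have "\<bar>Poly_Mapping.lookup \<beta> q\<bar> \<le> Poly_Mapping.lookup \<delta> q"
      unfolding l\<delta> using \<beta>(1) by (intro member_le_sum) auto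
    then show "Poly_Mapping.lookup \<alpha> q \<ge> 0" by (simp add: \<beta>(2) lookup_add)
    show "Poly_Mapping.keys \<alpha> \<subseteq> I"
      using \<beta> p k\<delta> Poly_Mapping.keys_add[of \<beta> \<delta>] by blast
  qed
  have "eval_coord i j P = eval_coord i j p * eval_coord i j (Poly_Mapping.single \<delta> 1)"
    unfolding P_def eval_coord_eq
  proof (rule E.mult)
    show "Poly_Mapping.keys p \<subseteq> {\<alpha>. Poly_Mapping.keys \<alpha> \<subseteq> pairs n}" using p assms(2) by blast
    show "Poly_Mapping.keys (Poly_Mapping.single \<delta> (1 :: 'k)) \<subseteq> {\<alpha>. Poly_Mapping.keys \<alpha> \<subseteq> pairs n}"
      using k\<delta> assms(2) by simp
  qed
  then have "eval_coord i j P = 0" using assms(5) by simp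
  \<comment> \<open>\<open>P\<close> evaluated inside the polynomial ring of the chart. The
    substitution homomorphism is defined there, and not on the field of fractions.\<close>
  moreover define g where "g = (\<Sum>\<alpha>\<in>Poly_Mapping.keys P. const_poly (Poly_Mapping.lookup P \<alpha>) *
      (\<Prod>q\<in>Poly_Mapping.keys \<alpha>. (chart_coord i j q :: 'k mpoly) ^ nat (Poly_Mapping.lookup \<alpha> q)))"
  moreover have "eval_coord i j P = Fract g 1"
    unfolding eval_coord_def g_def Fract_sum_1 using nn
    by (intro sum.cong refl) (simp add: Fract_prod_1 Fract_power_1 power_int_def flip: Fract_mult_1)
  ultimately have "g = 0" by (simp add: Fract_eq_0_iff)
  have pow: "pm_eval (Poly_Mapping.single 0) (nat_monom M) (h ^ m) =
      pm_eval (Poly_Mapping.single 0) (nat_monom M) h ^ m" for h :: "'k mpoly" and m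
    by (induction m) (simp_all add: H.one H.mult)
  have prod: "pm_eval (Poly_Mapping.single 0) (nat_monom M) (prod h A) =
      (\<Prod>x\<in>A. pm_eval (Poly_Mapping.single 0) (nat_monom M) (h x))" for h :: "nat uprod \<Rightarrow> 'k mpoly" and A
    by (induction A rule: infinite_finite_induct) (simp_all add: H.one H.mult)
  have "pm_eval (Poly_Mapping.single 0) (nat_monom M) g = (\<Sum>\<alpha>\<in>Poly_Mapping.keys P.
      Poly_Mapping.single 0 (Poly_Mapping.lookup P \<alpha>) *
      (\<Prod>q\<in>Poly_Mapping.keys \<alpha>. lvar q ^ nat (Poly_Mapping.lookup \<alpha> q)))"
    unfolding g_def H.sum
  proof (intro sum.cong refl)
    fix \<alpha> assume \<alpha>P: "\<alpha> \<in> Poly_Mapping.keys P"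
    have "(\<Prod>q\<in>Poly_Mapping.keys \<alpha>. pm_eval (Poly_Mapping.single 0) (nat_monom M) (chart_coord i j q) ^
        nat (Poly_Mapping.lookup \<alpha> q)) =
      (\<Prod>q\<in>Poly_Mapping.keys \<alpha>. lvar q ^ nat (Poly_Mapping.lookup \<alpha> q))"
    proof (intro prod.cong refl)
      fix q assume "q \<in> Poly_Mapping.keys \<alpha>"
      then have "q \<in> I" using kI[OF \<alpha>P] by blast
      then show "pm_eval (Poly_Mapping.single 0) (nat_monom M) (chart_coord i j q) ^ nat (Poly_Mapping.lookup \<alpha> q) =
          lvar q ^ nat (Poly_Mapping.lookup \<alpha> q)"
        by (simp only: M)
    qed
    moreover have "pm_eval (Poly_Mapping.single 0) (nat_monom M) (const_poly (Poly_Mapping.lookup P \<alpha>)) =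
        Poly_Mapping.single 0 (Poly_Mapping.lookup P \<alpha>)"
      by (simp add: const_poly_def H.single nat_monom_def)
    ultimately show "pm_eval (Poly_Mapping.single 0) (nat_monom M) (const_poly (Poly_Mapping.lookup P \<alpha>) *
        (\<Prod>q\<in>Poly_Mapping.keys \<alpha>. chart_coord i j q ^ nat (Poly_Mapping.lookup \<alpha> q))) =
      Poly_Mapping.single 0 (Poly_Mapping.lookup P \<alpha>) *
      (\<Prod>q\<in>Poly_Mapping.keys \<alpha>. lvar q ^ nat (Poly_Mapping.lookup \<alpha> q))"
      by (simp add: H.mult prod pow)
  qed
  also have "\<dots> = (\<Sum>\<alpha>\<in>Poly_Mapping.keys P. Poly_Mapping.single \<alpha> (Poly_Mapping.lookup P \<alpha>))"
    using nn by (intro sum.cong refl) (simp add: prod_lvar mult_single)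
  finally have "P = 0"
    using \<open>g = 0\<close> by (simp add: H.zero poly_mapping_sum_single)
  then have "P * Poly_Mapping.single (- \<delta>) 1 = 0" by simp
  then show "p = 0" by (simp add: P_def mult.assoc mult_single)
qed

section \<open>Bounds for the coordinates on a chart\<close>

locale chart_data =
  fixes n i j :: nat and x :: "nat uprod \<Rightarrow> ereal" and T :: "'v ltree" and r :: "nat rel"
    and I J :: "nat uprod set" and \<rho> :: "nat uprod \<Rightarrow> real"
  assumes ij: "i \<in> {1..n}" "j \<in> {1..n}" "i \<noteq> j"
    and x: "x \<in> trop_vectors (pairs n)" "x (Upair i j) \<noteq> - \<infinity>"
    and J: "J = {q \<in> pairs n. x q = - \<infinity>}"
    and T: "tree_on n T"
    and cl: "trop_class (pairs n) x \<in> trop_proj_topology (pairs n) closure_of tree_cone n T"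
    and po: "partial_order_on ({1..n} - {i, j}) r"
    and cherry: "cherry_property n T i j r"
    and comp: "compatible n T i j r (J \<inter> chart_vars n i j) I"
    and \<rho>: "\<rho> = (\<lambda>q. trop_exp (x q - x (Upair i j)))"
begin

lemma I_pairs: "I \<subseteq> pairs n"
  using comp by (simp add: compatible_def)

lemma ij_pairs: "Upair i j \<in> pairs n"
  using ij by (intro Upair_in_pairs)

lemma \<rho>_eq: "q \<in> pairs n \<Longrightarrow> \<rho> q = trop_exp (x q) / trop_exp (x (Upair i j))"
  unfolding \<rho> using trop_vectors_not_PInf[OF x(1)] ij_pairs x(2) by (simp add: trop_exp_diff)

lemma \<rho>_nonneg [simp]: "\<rho> q \<ge> 0"
  by (simp add: \<rho>)

lemma e_ij: "trop_exp (x (Upair i j)) > 0"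
  using x(2) trop_exp_nonneg[of "x (Upair i j)"] trop_exp_eq_0_iff[of "x (Upair i j)"] by linarith

lemma \<rho>_J: "q \<in> J \<Longrightarrow> \<rho> q = 0"
  using \<rho>_eq[of q] by (simp add: J trop_exp_eq_0_iff)

lemma \<rho>_pos: "q \<in> pairs n \<Longrightarrow> q \<notin> J \<Longrightarrow> \<rho> q > 0"
  using \<rho>_eq[of q] e_ij trop_exp_nonneg[of "x q"] trop_exp_eq_0_iff[of "x q"]
  by (auto simp: J order_less_le)

lemma \<rho>_same_branch:
  assumes kl: "k \<in> branch n T i j v" "l \<in> branch n T i j v" "k \<noteq> l"
  shows "\<rho> (Upair k l) \<le> \<rho> (Upair i k) * \<rho> (Upair j l)"
    and "\<rho> (Upair i k) * \<rho> (Upair j l) = \<rho> (Upair i l) * \<rho> (Upair j k)"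
proof -
  have "k \<in> {1..n}" "l \<in> {1..n}" "i \<noteq> k" "i \<noteq> l" "j \<noteq> k" "j \<noteq> l"
    using kl by (auto simp: branch_def)
  then have P: "Upair k l \<in> pairs n" "Upair i k \<in> pairs n" "Upair j l \<in> pairs n" "Upair i l \<in> pairs n"
    "Upair j k \<in> pairs n" using ij kl by (auto intro!: Upair_in_pairs)
  note t = trop_same_branch[OF T x(1) cl ij kl]
  show "\<rho> (Upair k l) \<le> \<rho> (Upair i k) * \<rho> (Upair j l)"
    using t(1) e_ij by (simp add: \<rho>_eq P divide_simps mult_ac)
  show "\<rho> (Upair i k) * \<rho> (Upair j l) = \<rho> (Upair i l) * \<rho> (Upair j k)"
    using t(2) e_ij by (simp add: \<rho>_eq P)
qed

lemma \<rho>_diff_branch: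
  assumes kl: "k \<in> branch n T i j a" "l \<in> branch n T i j b" "a \<noteq> b" "k \<noteq> l"
  shows "\<rho> (Upair i k) * \<rho> (Upair j l) \<le> \<rho> (Upair k l)"
proof -
  have "k \<in> {1..n}" "l \<in> {1..n}" "i \<noteq> k" "i \<noteq> l" "j \<noteq> k" "j \<noteq> l"
    using kl by (auto simp: branch_def)
  then have P: "Upair k l \<in> pairs n" "Upair i k \<in> pairs n" "Upair j l \<in> pairs n"
    using ij kl by (auto intro!: Upair_in_pairs)
  show ?thesis
    using trop_diff_branch[OF T x(1) cl ij kl] e_ij by (simp add: \<rho>_eq P divide_simps mult_ac)
qed

lemma \<rho>_cherry:
  assumes acd: "a \<in> branch n T i j v" "c \<in> branch n T i j v" "d \<in> branch n T i j v" "distinct [a, c, d]"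
    and ch: "is_cherry (quartet T {i, a, c, d}) c d" and p: "p \<in> {i, j}"
  shows "\<rho> (Upair p a) * \<rho> (Upair c d) \<le> \<rho> (Upair p c) * \<rho> (Upair a d)"
    and "\<rho> (Upair p c) * \<rho> (Upair a d) = \<rho> (Upair p d) * \<rho> (Upair a c)"
proof -
  have "a \<in> {1..n}" "c \<in> {1..n}" "d \<in> {1..n}" "a \<noteq> i" "a \<noteq> j" "c \<noteq> i" "c \<noteq> j" "d \<noteq> i" "d \<noteq> j"
    using acd by (auto simp: branch_def)
  then have P: "Upair p a \<in> pairs n" "Upair p c \<in> pairs n" "Upair p d \<in> pairs n"
     "Upair a c \<in> pairs n" "Upair a d \<in> pairs n" "Upair c d \<in> pairs n"
    using ij p acd(4) by (auto intro!: Upair_in_pairs)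
  note t = trop_cherry[OF T x(1) cl ij acd ch p]
  show "\<rho> (Upair p a) * \<rho> (Upair c d) \<le> \<rho> (Upair p c) * \<rho> (Upair a d)"
    using t(1) e_ij by (simp add: \<rho>_eq P divide_right_mono)
  show "\<rho> (Upair p c) * \<rho> (Upair a d) = \<rho> (Upair p d) * \<rho> (Upair a c)"
    using t(2) e_ij by (simp add: \<rho>_eq P)
qed

abbreviation other_leaves :: "nat set" where "other_leaves \<equiv> {1..n} - {i, j}"

text \<open>The vertex v_a with k in T_a. As a function of the leaf it turns the statement that two
  leaves share a branch into an equation.\<close>

definition meeting_vertex :: "nat \<Rightarrow> 'v" where
  "meeting_vertex k = (SOME v. v \<in> internal_verts T i j \<and> k \<in> branch n T i j v)"

abbreviation "own_branch k \<equiv> branch n T i j (meeting_vertex k)"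

lemma meeting_vertex: assumes "k \<in> other_leaves" shows "meeting_vertex k \<in> internal_verts T i j" "k \<in> own_branch k"
proof -
  have "\<exists>v. v \<in> internal_verts T i j \<and> k \<in> branch n T i j v"
    using trop_ex_branch[OF T x(1) cl ij assms] by blast
  from someI_ex[OF this] show "meeting_vertex k \<in> internal_verts T i j" "k \<in> own_branch k" unfolding meeting_vertex_def by auto
qed

lemma own_branch_other_leaves: "l \<in> own_branch k \<Longrightarrow> l \<in> other_leaves"
  by (auto simp: branch_def)

lemma r_other_leaves: "(k, l) \<in> r \<Longrightarrow> k \<in> other_leaves \<and> l \<in> other_leaves"
  using po by (auto simp: partial_order_on_def preorder_on_def refl_on_def)

lemma r_refl: "k \<in> other_leaves \<Longrightarrow> (k, k) \<in> r"
  using po by (auto simp: partial_order_on_def preorder_on_def refl_on_def)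

lemma r_trans: "(k, l) \<in> r \<Longrightarrow> (l, m) \<in> r \<Longrightarrow> (k, m) \<in> r"
  using po unfolding partial_order_on_def preorder_on_def trans_def by blast

lemma r_antisym: "(k, l) \<in> r \<Longrightarrow> (l, k) \<in> r \<Longrightarrow> k = l"
  using po unfolding partial_order_on_def antisym_def by blast

lemma r_same_meeting_vertex: assumes "(k, l) \<in> r" shows "meeting_vertex k = meeting_vertex l"
proof (rule ccontr)
  assume "meeting_vertex k \<noteq> meeting_vertex l"
  then have "(k, l) \<notin> r"
    using cherry meeting_vertex r_other_leaves[OF assms] unfolding cherry_property_def by blast
  then show False using assms by simp
qed

lemma total: assumes "k \<in> other_leaves" "l \<in> other_leaves" "meeting_vertex k = meeting_vertex l" "k \<noteq> l" shows "(k, l) \<in> r \<or> (l, k) \<in> r"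
proof -
  have "total_on (own_branch k) r" using cherry meeting_vertex(1)[OF assms(1)] unfolding cherry_property_def by blast
  then show ?thesis using meeting_vertex(2) assms unfolding total_on_def by metis
qed

definition R where "R = r - Id"

text \<open>A finite strict order is well-founded. The recursion for \<open>subst_pair\<close> and
  the inductions on leaves descend along it from a leaf to its pivot.\<close>

lemma wf_R: "wf R"
proof (rule finite_acyclic_wf)
  have "r \<subseteq> other_leaves \<times> other_leaves" using r_other_leaves by auto
  then show "finite R" unfolding R_def by (meson finite_Diff finite_SigmaI finite_atLeastAtMost finite_subset)
  have "trans R" unfolding R_def
    by (rule trans_diff_Id) (use r_trans r_antisym in \<open>auto simp: trans_def antisym_def\<close>)
  then show "acyclic R" by (simp add: acyclic_def trancl_id R_def)
qed

text \<open>The index t of conditions (ii) and (iii) of compatibility.\<close>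

definition pivot :: "nat \<Rightarrow> nat" where
  "pivot k = (SOME t. t \<in> own_branch k \<and> (t, k) \<in> r \<and> t \<noteq> k \<and> Upair i t \<notin> J \<and> Upair j t \<notin> J \<and> Upair k t \<in> I \<and>
    (\<forall>t'. t' \<in> own_branch k \<and> (t', k) \<in> r \<and> t' \<noteq> k \<and> Upair i t' \<notin> J \<and> Upair j t' \<notin> J \<longrightarrow> (t', t) \<in> r))"

lemma chart_vars_iff: "l \<in> other_leaves \<Longrightarrow> Upair i l \<in> chart_vars n i j" "l \<in> other_leaves \<Longrightarrow> Upair j l \<in> chart_vars n i j"
  by (auto simp: chart_vars_def)

lemma admissible_iff:
  assumes "k \<in> other_leaves"
  shows "t \<in> admissible_below r (J \<inter> chart_vars n i j) i j (own_branch k) k \<longleftrightarrow>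
      t \<in> own_branch k \<and> (t, k) \<in> r \<and> t \<noteq> k \<and> Upair i t \<notin> J \<and> Upair j t \<notin> J"
    "t \<in> admissible_below r (J \<inter> chart_vars n i j) j i (own_branch k) k \<longleftrightarrow>
      t \<in> own_branch k \<and> (t, k) \<in> r \<and> t \<noteq> k \<and> Upair i t \<notin> J \<and> Upair j t \<notin> J"
  using chart_vars_iff own_branch_other_leaves unfolding admissible_below_def by blast+

lemma compatible_one_iff:
  assumes "k \<in> other_leaves"
  shows "compatible_one r (J \<inter> chart_vars n i j) I i j (own_branch k) k \<or> compatible_one r (J \<inter> chart_vars n i j) I j i (own_branch k) k \<Longrightarrow>
    pivot k \<in> own_branch k \<and> (pivot k, k) \<in> r \<and> pivot k \<noteq> k \<and> Upair i (pivot k) \<notin> J \<and> Upair j (pivot k) \<notin> J \<and> Upair k (pivot k) \<in> I \<and>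
    (\<forall>t'. t' \<in> own_branch k \<and> (t', k) \<in> r \<and> t' \<noteq> k \<and> Upair i t' \<notin> J \<and> Upair j t' \<notin> J \<longrightarrow> (t', pivot k) \<in> r)"
  unfolding pivot_def by (rule someI_ex) (unfold compatible_one_def Bex_def Ball_def admissible_iff[OF assms], blast)

text \<open>Compatibility in the form used below: J(ij) is replaced by \<open>J\<close>, which makes
  no difference for pairs containing \<open>i\<close> or \<open>j\<close>, and the maximal t becomes
  the function \<open>pivot\<close>.\<close>

lemma k_cases:
  assumes k: "k \<in> other_leaves"
  obtains (both) "Upair i k \<in> I" "Upair j k \<in> I" "\<And>l. (l, k) \<in> r \<Longrightarrow> l \<noteq> k \<Longrightarrow> Upair i l \<in> J \<or> Upair j l \<in> J"
  | (onlyj) "Upair i k \<notin> I" "\<And>l. l \<in> own_branch k \<Longrightarrow> Upair j l \<in> I" "pivot k \<in> own_branch k" "(pivot k, k) \<in> r" "pivot k \<noteq> k"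
    "Upair i (pivot k) \<notin> J" "Upair j (pivot k) \<notin> J" "Upair k (pivot k) \<in> I"
    "\<And>t. (t, k) \<in> r \<Longrightarrow> t \<noteq> k \<Longrightarrow> Upair i t \<notin> J \<Longrightarrow> Upair j t \<notin> J \<Longrightarrow> (t, pivot k) \<in> r"
  | (onlyi) "Upair j k \<notin> I" "\<And>l. l \<in> own_branch k \<Longrightarrow> Upair i l \<in> I" "pivot k \<in> own_branch k" "(pivot k, k) \<in> r" "pivot k \<noteq> k"
    "Upair i (pivot k) \<notin> J" "Upair j (pivot k) \<notin> J" "Upair k (pivot k) \<in> I"
    "\<And>t. (t, k) \<in> r \<Longrightarrow> t \<noteq> k \<Longrightarrow> Upair i t \<notin> J \<Longrightarrow> Upair j t \<notin> J \<Longrightarrow> (t, pivot k) \<in> r"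
proof -
  let ?c1 = "compatible_both r (J \<inter> chart_vars n i j) I i j k"
  let ?c2 = "compatible_one r (J \<inter> chart_vars n i j) I i j (own_branch k) k"
  let ?c3 = "compatible_one r (J \<inter> chart_vars n i j) I j i (own_branch k) k"
  have "?c1 \<or> ?c2 \<or> ?c3"
    using comp meeting_vertex[OF k] unfolding compatible_def Let_def by blast
  moreover have below: "t \<in> own_branch k" if "(t, k) \<in> r" for t
    using r_same_meeting_vertex[OF that] meeting_vertex(2)[of t] r_other_leaves[OF that] by simp
  moreover have thesis if ?c1
    using that both unfolding compatible_both_def by blast
  moreover have thesis if c: ?c2
  proof (rule onlyj)
    show "Upair i k \<notin> I" "\<And>l. l \<in> own_branch k \<Longrightarrow> Upair j l \<in> I" using c unfolding compatible_one_def by blast+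
  qed (use compatible_one_iff[OF k] c below in blast)+
  moreover have thesis if c: ?c3
  proof (rule onlyi)
    show "Upair j k \<notin> I" "\<And>l. l \<in> own_branch k \<Longrightarrow> Upair i l \<in> I" using c unfolding compatible_one_def by blast+
  qed (use compatible_one_iff[OF k] c below in blast)+
  ultimately show thesis by blast
qed

text \<open>A count. Each leaf owns two elements of \<open>I\<close>, collected in
  \<open>P k\<close>: its two coordinates, or one of them and the pair with its pivot. These sets
  are disjoint, so together they have 2(n-2) elements, which is the size of
  \<open>I\<close>.\<close>

lemma I_cases:
  assumes q: "q \<in> I"
  obtains k where "k \<in> other_leaves" "q = Upair i k" | k where "k \<in> other_leaves" "q = Upair j k"
    | k where "k \<in> other_leaves" "\<not> (Upair i k \<in> I \<and> Upair j k \<in> I)" "q = Upair k (pivot k)"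
proof -
  define P where "P k = {Upair i k, Upair j k} \<inter> I \<union>
    (if Upair i k \<in> I \<and> Upair j k \<in> I then {} else {Upair k (pivot k)})" for k
  have pivot: "pivot k \<in> other_leaves" "(pivot k, k) \<in> r" "pivot k \<noteq> k" if k: "k \<in> other_leaves" "\<not> (Upair i k \<in> I \<and> Upair j k \<in> I)" for k
    using k(1) by (cases rule: k_cases; use k(2) own_branch_other_leaves in blast)+
  have P: "P k \<subseteq> I \<and> card (P k) = 2" if k: "k \<in> other_leaves" for k
    using k
  proof (cases rule: k_cases)
    case both
    then show ?thesis using ij(3) k by (auto simp: P_def)
  next
    case onlyj
    then have "Upair j k \<in> I" using meeting_vertex[OF k] by blast
    then have "P k = {Upair j k, Upair k (pivot k)}" using onlyj(1) by (auto simp: P_def)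
    moreover have "Upair j k \<noteq> Upair k (pivot k)" using own_branch_other_leaves[OF onlyj(3)] k by auto
    ultimately show ?thesis using onlyj \<open>Upair j k \<in> I\<close> by auto
  next
    case onlyi
    then have "Upair i k \<in> I" using meeting_vertex[OF k] by blast
    then have "P k = {Upair i k, Upair k (pivot k)}" using onlyi(1) by (auto simp: P_def)
    moreover have "Upair i k \<noteq> Upair k (pivot k)" using own_branch_other_leaves[OF onlyi(3)] k by auto
    ultimately show ?thesis using onlyi \<open>Upair i k \<in> I\<close> by auto
  qed
  have disj: "P k \<inter> P l = {}" if kl: "k \<in> other_leaves" "l \<in> other_leaves" "k \<noteq> l" for k l
  proof -
    \<comment> \<open>Equality would make each of \<open>k\<close> and \<open>l\<close> the pivot of
      the other, against antisymmetry of the order.\<close>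
    have "Upair k (pivot k) \<noteq> Upair l (pivot l)"
      if "\<not> (Upair i k \<in> I \<and> Upair j k \<in> I)" "\<not> (Upair i l \<in> I \<and> Upair j l \<in> I)"
      using pivot[OF kl(1) that(1)] pivot[OF kl(2) that(2)] kl(3) r_antisym by auto
    moreover have "Upair k (pivot k) \<noteq> Upair i l" "Upair k (pivot k) \<noteq> Upair j l"
      if "\<not> (Upair i k \<in> I \<and> Upair j k \<in> I)"
      using pivot(1)[OF kl(1) that] kl by auto
    moreover have "Upair l (pivot l) \<noteq> Upair i k" "Upair l (pivot l) \<noteq> Upair j k"
      if "\<not> (Upair i l \<in> I \<and> Upair j l \<in> I)"
      using pivot(1)[OF kl(2) that] kl by auto
    moreover have "Upair i k \<noteq> Upair i l" "Upair i k \<noteq> Upair j l" "Upair j k \<noteq> Upair i l" "Upair j k \<noteq> Upair j l"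
      using kl by auto
    ultimately show ?thesis unfolding P_def by (auto split: if_splits)
  qed
  have "card (\<Union>k\<in>other_leaves. P k) = (\<Sum>k\<in>other_leaves. card (P k))"
  proof (rule card_UN_disjoint)
    show "\<forall>k\<in>other_leaves. finite (P k)" by (simp add: P_def)
    show "\<forall>k\<in>other_leaves. \<forall>l\<in>other_leaves. k \<noteq> l \<longrightarrow> P k \<inter> P l = {}" using disj by blast
  qed simp
  also have "\<dots> = 2 * card other_leaves" using P by simp
  also have "\<dots> = 2 * (n - 2)"
    using ij by (subst card_Diff_subset) auto
  also have "\<dots> = card I" using comp by (simp add: compatible_def)
  finally have "card (\<Union>k\<in>other_leaves. P k) = card I" .
  moreover have "finite I"
  proof -
    have "pairs n \<subseteq> (\<lambda>(k, l). Upair k l) ` ({1..n} \<times> {1..n})" by (auto simp: pairs_def)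
    then show ?thesis using I_pairs by (meson finite_SigmaI finite_atLeastAtMost finite_imageI finite_subset)
  qed
  ultimately have "(\<Union>k\<in>other_leaves. P k) = I" using P by (intro card_subset_eq) blast+
  then obtain k where "k \<in> other_leaves" "q \<in> P k" using q by blast
  then show thesis using that by (auto simp: P_def split: if_splits)
qed

end

text \<open>Solving the Pluecker relation for a coordinate and inserting the solution gives back the
  prescribed value \<open>a\<close>. Here \<open>s\<close> is the sign of an ordered pair and
  \<open>d'\<close> a formal inverse of \<open>d\<close>.\<close>

lemma sign_cancel:
  fixes s a b c d d' :: "'a::comm_ring_1"
  assumes "s * s = 1" "d * d' = 1"
  shows "s * ((s * a + b * c) * d' * d - b * c) = a"
    and "s * (c * b - d * ((b * c - s * a) * d')) = a"
proof -
  have "s * ((s * a + b * c) * d' * d - b * c) = (s * s) * a * (d * d') + s * b * c * (d * d') - s * b * c"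
    by (simp add: algebra_simps)
  then show "s * ((s * a + b * c) * d' * d - b * c) = a" by (simp add: assms)
  have "s * (c * b - d * ((b * c - s * a) * d')) = (s * s) * a * (d * d') - s * b * c * (d * d') + s * b * c"
    by (simp add: algebra_simps)
  then show "s * (c * b - d * ((b * c - s * a) * d')) = a" by (simp add: assms)
qed

section \<open>Solving for the coordinates outside I\<close>

context chart_data
begin

text \<open>H without J in the notation of the statement: the variables that may be
  inverted.\<close>

definition W where "W = (I \<inter> chart_vars n i j) - J"

lemma pivot_R: "k \<in> other_leaves \<Longrightarrow> \<not> (Upair i k \<in> I \<and> Upair j k \<in> I) \<Longrightarrow> (pivot k, k) \<in> R"
  by (cases k rule: k_cases) (auto simp: R_def)

text \<open>If one of the two coordinates of k is not among the chosen ones, it is determined by the Pluecker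
  relation for the coordinate of the pair of k and its pivot.\<close>

definition subst_pair :: "nat \<Rightarrow> 'k::field lpoly \<times> 'k lpoly" where
  "subst_pair = wfrec R (\<lambda>g k.
    (if Upair i k \<in> I then lvar (Upair i k)
     else (sgn_pair k (pivot k) * lvar (Upair k (pivot k)) + fst (g (pivot k)) * lvar (Upair j k)) * lvar_inv (Upair j (pivot k)),
     if Upair j k \<in> I then lvar (Upair j k)
     else (snd (g (pivot k)) * lvar (Upair i k) - sgn_pair k (pivot k) * lvar (Upair k (pivot k))) * lvar_inv (Upair i (pivot k))))"

lemma subst_pair:
  assumes "k \<in> other_leaves"
  shows "(subst_pair k :: 'k::field lpoly \<times> 'k lpoly) =
    (if Upair i k \<in> I then lvar (Upair i k)
     else (sgn_pair k (pivot k) * lvar (Upair k (pivot k)) + fst (subst_pair (pivot k)) * lvar (Upair j k)) * lvar_inv (Upair j (pivot k)),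
     if Upair j k \<in> I then lvar (Upair j k)
     else (snd (subst_pair (pivot k)) * lvar (Upair i k) - sgn_pair k (pivot k) * lvar (Upair k (pivot k))) * lvar_inv (Upair i (pivot k)))"
proof (cases "Upair i k \<in> I \<and> Upair j k \<in> I")
  case True
  then show ?thesis unfolding subst_pair_def by (subst wfrec[OF wf_R]) simp
next
  case False
  have "cut subst_pair R k (pivot k) = (subst_pair (pivot k) :: 'k::field lpoly \<times> 'k lpoly)"
    by (rule cut_apply) (rule pivot_R[OF assms False])
  then show ?thesis
    unfolding subst_pair_def by (subst wfrec[OF wf_R]) simp
qed

definition subst_var :: "nat uprod \<Rightarrow> 'k::field lpoly" where
  "subst_var q = (if i \<in> set_uprod q then fst (subst_pair (THE k. q = Upair i k)) else snd (subst_pair (THE k. q = Upair j k)))"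

lemma subst_var_i: "k \<in> other_leaves \<Longrightarrow> subst_var (Upair i k) = fst (subst_pair k)"
proof -
  have "(THE l. Upair i k = Upair i l) = k" by (rule the_equality) auto
  then show ?thesis by (simp add: subst_var_def)
qed

lemma subst_var_j: "k \<in> other_leaves \<Longrightarrow> subst_var (Upair j k) = snd (subst_pair k)"
proof -
  assume "k \<in> other_leaves"
  have "(THE l. Upair j k = Upair j l) = k" by (rule the_equality) auto
  then show ?thesis using ij(3) \<open>k \<in> other_leaves\<close> by (auto simp: subst_var_def)
qed

text \<open>The premise \<open>M\<close> of \<open>eval_coord_inj\<close>. For the pair of a leaf
  and its pivot, \<open>subst_pair\<close> was obtained by solving the Pluecker relation of this
  very pair, and \<open>sign_cancel\<close> undoes the solution.\<close>

lemma subst_chart_coord: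
  assumes q: "q \<in> I"
  shows "pm_eval (Poly_Mapping.single 0) (nat_monom subst_var) (chart_coord i j q) = (lvar q :: 'k::field lpoly)"
proof -
  interpret H: eval_hom "Poly_Mapping.single 0 :: 'k \<Rightarrow> 'k lpoly" "nat_monom subst_var" UNIV
    by (rule nat_monom_hom)
  have var: "pm_eval (Poly_Mapping.single 0) (nat_monom subst_var) (var_poly q) = (subst_var q :: 'k lpoly)" for q
    by (simp add: var_poly_def H.single nat_monom_def)
  show ?thesis
    using q
  proof (cases rule: I_cases)
    case (1 k)
    then have "k \<notin> {i, j}" by simp
    then show ?thesis using q 1 ij(3) by (simp add: chart_coord_var var subst_var_i subst_pair)
  next
    case (2 k)
    then have "k \<notin> {i, j}" by simp
    then show ?thesis using q 2 ij(3) by (simp add: chart_coord_var var subst_var_j subst_pair)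
  next
    case (3 k)
    let ?t = "pivot k"
    let ?s = "sgn_pair k ?t :: 'k lpoly"
    have ss: "?s * ?s = 1" by simp
    have t: "?t \<in> other_leaves" "?t \<noteq> k" "(?t, k) \<in> r" using pivot_R[OF 3(1,2)] r_other_leaves by (auto simp: R_def)
    have e: "pm_eval (Poly_Mapping.single 0) (nat_monom subst_var) (sgn_pair k ?t * h) =
        ?s * pm_eval (Poly_Mapping.single 0) (nat_monom subst_var) h" for h :: "'k mpoly"
      by (simp add: H.uminus)
    have "chart_coord i j q = (sgn_pair k ?t :: 'k mpoly) * (var_poly (Upair i k) * var_poly (Upair j ?t)
        - var_poly (Upair i ?t) * var_poly (Upair j k))"
      unfolding 3(3) using t 3(1) by (intro chart_coord_pair) auto
    then have eq: "pm_eval (Poly_Mapping.single 0) (nat_monom subst_var) (chart_coord i j q) =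
        ?s * (fst (subst_pair k) * snd (subst_pair ?t) - fst (subst_pair ?t) * snd (subst_pair k))"
      using t(1) 3(1) by (simp only: e H.diff H.mult subset_UNIV var subst_var_i subst_var_j)
    from 3(1) show ?thesis
    proof (cases rule: k_cases)
      case both
      then show ?thesis using 3(2) by blast
    next
      case onlyj
      then have jI: "Upair j k \<in> I" "Upair j ?t \<in> I" using meeting_vertex(2)[OF 3(1)] by blast+
      define a b c d where "a = (lvar (Upair k ?t) :: 'k lpoly)" and "b = fst (subst_pair ?t :: 'k lpoly \<times> 'k lpoly)"
        and "c = (lvar (Upair j k) :: 'k lpoly)" and "d = (lvar (Upair j ?t) :: 'k lpoly)"
      define d' where "d' = (lvar_inv (Upair j ?t) :: 'k lpoly)"
      have dd: "d * d' = 1" unfolding d_def d'_def by (rule lvar_mult_inv)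
      have g: "fst (subst_pair k) = (?s * a + b * c) * d'" "snd (subst_pair k) = c" "snd (subst_pair ?t) = d"
        using onlyj(1) jI subst_pair[OF 3(1), where 'k = 'k] subst_pair[OF t(1), where 'k = 'k]
        by (simp_all add: a_def b_def c_def d_def d'_def)
      have "?s * ((?s * a + b * c) * d' * d - b * c) = a"
        by (rule sign_cancel(1)[OF ss dd])
      then have "pm_eval (Poly_Mapping.single 0) (nat_monom subst_var) (chart_coord i j q) = a"
        unfolding eq g b_def[symmetric] .
      then show ?thesis by (simp only: a_def 3(3))
    next
      case onlyi
      then have iI: "Upair i k \<in> I" "Upair i ?t \<in> I" using meeting_vertex(2)[OF 3(1)] by blast+
      define a b c d where "a = (lvar (Upair k ?t) :: 'k lpoly)" and "b = snd (subst_pair ?t :: 'k lpoly \<times> 'k lpoly)"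
        and "c = (lvar (Upair i k) :: 'k lpoly)" and "d = (lvar (Upair i ?t) :: 'k lpoly)"
      define d' where "d' = (lvar_inv (Upair i ?t) :: 'k lpoly)"
      have dd: "d * d' = 1" unfolding d_def d'_def by (rule lvar_mult_inv)
      have g: "snd (subst_pair k) = (b * c - ?s * a) * d'" "fst (subst_pair k) = c" "fst (subst_pair ?t) = d"
        using onlyi(1) iI subst_pair[OF 3(1), where 'k = 'k] subst_pair[OF t(1), where 'k = 'k]
        by (simp_all add: a_def b_def c_def d_def d'_def)
      have "?s * (c * b - d * ((b * c - ?s * a) * d')) = a"
        by (rule sign_cancel(2)[OF ss dd])
      then have "pm_eval (Poly_Mapping.single 0) (nat_monom subst_var) (chart_coord i j q) = a"
        unfolding eq g b_def[symmetric] .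
      then show ?thesis by (simp only: a_def 3(3))
    qed
  qed
qed

lemma mixed_ring_keys: "p \<in> mixed_ring I W \<Longrightarrow> \<alpha> \<in> Poly_Mapping.keys p \<Longrightarrow> Poly_Mapping.keys \<alpha> \<subseteq> I"
  by (auto simp: mixed_ring_def)

text \<open>Injectivity eliminates the description operator: any expression in the chosen
  coordinates, however it was found, is the value of the embedding.\<close>

lemma coord_incl_eq:
  assumes p: "p \<in> mixed_ring I W" "eval_coord i j p = Fract g (1 :: 'k::field mpoly)"
  shows "coord_incl i j I W g = p"
  unfolding coord_incl_def
proof (rule the_equality)
  fix p' assume p': "p' \<in> mixed_ring I W \<and> eval_coord i j p' = Fract g 1"
  interpret E: eval_hom "\<lambda>c. Fract (const_poly c) 1" "pm_monom (\<lambda>q. Fract (chart_coord i j q :: 'k mpoly) 1)"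
    "{\<alpha>. Poly_Mapping.keys \<alpha> \<subseteq> pairs n}"
    using eval_coord_hom[OF ij(3)] .
  have "eval_coord i j (p' - p) = 0"
    using p p' unfolding eval_coord_eq by (simp add: E.diff)
  then have "p' - p = 0"
    using eval_coord_inj[OF ij(3) I_pairs subst_chart_coord] mixed_ring_keys mixed_ring_diff p p' by blast
  then show "p' = p" by simp
qed (use p in auto)

text \<open>Combines the existence of an expression in the chosen coordinates with a bound for it
  after the variables in \<open>J\<close> are set to 0. Both properties pass through sums and
  products together, so a single induction along the Pluecker relations yields the inclusion and the
  estimate.\<close>

definition bounded_coord :: "'k::complete_nonarch_field mpoly fract \<Rightarrow> real \<Rightarrow> bool" where
  "bounded_coord F e \<longleftrightarrow> (\<exists>p\<in>mixed_ring I W. eval_coord i j p = F \<and> gauss_le \<rho> (set_zero (I \<inter> J) p) e)"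

lemma set_zero_keys:
  assumes "p \<in> mixed_ring I W" "\<alpha> \<in> Poly_Mapping.keys (set_zero (I \<inter> J) p)"
  shows "Poly_Mapping.keys \<alpha> \<subseteq> I - J"
proof -
  have "Poly_Mapping.keys \<alpha> \<inter> (I \<inter> J) = {}" "\<alpha> \<in> Poly_Mapping.keys p"
    using assms(2) by (auto simp: in_keys_iff lookup_set_zero split: if_splits)
  then show ?thesis using mixed_ring_keys[OF assms(1)] by blast
qed

lemma Z_hom: "eval_hom (Poly_Mapping.single 0 :: 'k::field \<Rightarrow> 'k lpoly)
    (\<lambda>\<alpha>. if Poly_Mapping.keys \<alpha> \<inter> (I \<inter> J) = {} then Poly_Mapping.single \<alpha> 1 else 0) (nn_exponents I (I - W))"
  by (rule set_zero_hom) (auto simp: W_def)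

lemma bounded_coord_mono: "bounded_coord F e \<Longrightarrow> e \<le> e' \<Longrightarrow> bounded_coord F e'"
  unfolding bounded_coord_def gauss_le_def by (meson order_trans)

lemma bounded_coord_add: assumes "bounded_coord F e" "bounded_coord G e'" shows "bounded_coord (F + G :: 'k::complete_nonarch_field mpoly fract) (max e e')"
proof -
  interpret E: eval_hom "\<lambda>c. Fract (const_poly c) 1" "pm_monom (\<lambda>q. Fract (chart_coord i j q :: 'k mpoly) 1)"
    "{\<alpha>. Poly_Mapping.keys \<alpha> \<subseteq> pairs n}" using eval_coord_hom[OF ij(3)] .
  interpret Z: eval_hom "Poly_Mapping.single 0 :: 'k \<Rightarrow> 'k lpoly"
    "\<lambda>\<alpha>. if Poly_Mapping.keys \<alpha> \<inter> (I \<inter> J) = {} then Poly_Mapping.single \<alpha> 1 else 0" "nn_exponents I (I - W)"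
    by (rule Z_hom)
  obtain p q where p: "p \<in> mixed_ring I W" "eval_coord i j p = F" "gauss_le \<rho> (set_zero (I \<inter> J) p) e"
    and q: "q \<in> mixed_ring I W" "eval_coord i j q = G" "gauss_le \<rho> (set_zero (I \<inter> J) q) e'"
    using assms unfolding bounded_coord_def by blast
  have "eval_coord i j (p + q) = F + G" using p(2) q(2) by (simp add: eval_coord_eq E.add)
  moreover have "set_zero (I \<inter> J) (p + q) = set_zero (I \<inter> J) p + set_zero (I \<inter> J) q"
    by (simp only: set_zero_eq Z.add)
  ultimately have "eval_coord i j (p + q) = F + G \<and> gauss_le \<rho> (set_zero (I \<inter> J) (p + q)) (max e e')"
    using gauss_le_add[OF \<rho>_nonneg p(3) q(3)] by simp
  then show ?thesis unfolding bounded_coord_def by (rule bexI[OF _ mixed_ring_add[OF p(1) q(1)]])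
qed

lemma bounded_coord_uminus: assumes "bounded_coord F e" shows "bounded_coord (- F :: 'k::complete_nonarch_field mpoly fract) e"
proof -
  interpret E: eval_hom "\<lambda>c. Fract (const_poly c) 1" "pm_monom (\<lambda>q. Fract (chart_coord i j q :: 'k mpoly) 1)"
    "{\<alpha>. Poly_Mapping.keys \<alpha> \<subseteq> pairs n}" using eval_coord_hom[OF ij(3)] .
  interpret Z: eval_hom "Poly_Mapping.single 0 :: 'k \<Rightarrow> 'k lpoly"
    "\<lambda>\<alpha>. if Poly_Mapping.keys \<alpha> \<inter> (I \<inter> J) = {} then Poly_Mapping.single \<alpha> 1 else 0" "nn_exponents I (I - W)"
    by (rule Z_hom)
  obtain p where p: "p \<in> mixed_ring I W" "eval_coord i j p = F" "gauss_le \<rho> (set_zero (I \<inter> J) p) e"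
    using assms unfolding bounded_coord_def by blast
  have "eval_coord i j (- p) = - F" using p(2) by (simp add: eval_coord_eq E.uminus)
  moreover have "set_zero (I \<inter> J) (- p) = - set_zero (I \<inter> J) p"
    by (simp only: set_zero_eq Z.uminus)
  ultimately have "eval_coord i j (- p) = - F \<and> gauss_le \<rho> (set_zero (I \<inter> J) (- p)) e"
    using gauss_le_uminus[OF p(3)] by simp
  then show ?thesis unfolding bounded_coord_def by (rule bexI[OF _ mixed_ring_uminus[OF p(1)]])
qed

lemma bounded_coord_diff: "bounded_coord F e \<Longrightarrow> bounded_coord G e' \<Longrightarrow> bounded_coord (F - G :: 'k::complete_nonarch_field mpoly fract) (max e e')"
  using bounded_coord_add[of F e "- G" e'] bounded_coord_uminus[of G e'] by simp

lemma bounded_coord_mult: assumes "bounded_coord F e" "bounded_coord G e'" shows "bounded_coord (F * G :: 'k::complete_nonarch_field mpoly fract) (e * e')"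
proof -
  interpret E: eval_hom "\<lambda>c. Fract (const_poly c) 1" "pm_monom (\<lambda>q. Fract (chart_coord i j q :: 'k mpoly) 1)"
    "{\<alpha>. Poly_Mapping.keys \<alpha> \<subseteq> pairs n}" using eval_coord_hom[OF ij(3)] .
  interpret Z: eval_hom "Poly_Mapping.single 0 :: 'k \<Rightarrow> 'k lpoly"
    "\<lambda>\<alpha>. if Poly_Mapping.keys \<alpha> \<inter> (I \<inter> J) = {} then Poly_Mapping.single \<alpha> 1 else 0" "nn_exponents I (I - W)"
    by (rule Z_hom)
  obtain p q where p: "p \<in> mixed_ring I W" "eval_coord i j p = F" "gauss_le \<rho> (set_zero (I \<inter> J) p) e"
    and q: "q \<in> mixed_ring I W" "eval_coord i j q = G" "gauss_le \<rho> (set_zero (I \<inter> J) q) e'"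
    using assms unfolding bounded_coord_def by blast
  have "eval_coord i j (p * q) = F * G"
    using p(2) q(2) mixed_ring_keys[OF p(1)] mixed_ring_keys[OF q(1)] I_pairs
    unfolding eval_coord_eq by (subst E.mult) blast+
  moreover have "set_zero (I \<inter> J) (p * q) = set_zero (I \<inter> J) p * set_zero (I \<inter> J) q"
    unfolding set_zero_eq by (rule Z.mult) (use p(1) q(1) in \<open>simp_all add: mixed_ring_eq\<close>)
  moreover have "gauss_le \<rho> (set_zero (I \<inter> J) p * set_zero (I \<inter> J) q) (e * e')"
    by (rule gauss_le_mult[where V = "I - J"])
      (use \<rho>_pos I_pairs set_zero_keys[OF p(1)] set_zero_keys[OF q(1)] p(3) q(3) in auto)
  ultimately have "eval_coord i j (p * q) = F * G \<and> gauss_le \<rho> (set_zero (I \<inter> J) (p * q)) (e * e')"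
    by simp
  then show ?thesis unfolding bounded_coord_def by (rule bexI[OF _ mixed_ring_mult[OF p(1) q(1)]])
qed

abbreviation u :: "nat uprod \<Rightarrow> 'k::field mpoly fract" where
  "u q \<equiv> Fract (chart_coord i j q) 1"

lemma eval_single: "eval_coord i j (Poly_Mapping.single (Poly_Mapping.single q m) (1 :: 'k::field)) = u q powi m"
proof -
  interpret E: eval_hom "\<lambda>c. Fract (const_poly c) 1" "pm_monom (\<lambda>q. Fract (chart_coord i j q :: 'k mpoly) 1)"
    "{\<alpha>. Poly_Mapping.keys \<alpha> \<subseteq> pairs n}" using eval_coord_hom[OF ij(3)] .
  show ?thesis unfolding eval_coord_eq E.single using E.C_1 by (simp add: pm_monom_single)
qed

lemma bounded_coord_var: assumes "q \<in> I" shows "bounded_coord (u q :: 'k::complete_nonarch_field mpoly fract) (\<rho> q)"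
  unfolding bounded_coord_def
proof (intro bexI conjI)
  show "lvar q \<in> mixed_ring I W" using assms by (auto simp: mixed_ring_def lookup_single when_def)
  show "eval_coord i j (lvar q) = (u q :: 'k mpoly fract)" by (simp add: eval_single)
  show "gauss_le \<rho> (set_zero (I \<inter> J) (lvar q :: 'k lpoly)) (\<rho> q)"
    unfolding gauss_le_def lookup_set_zero monomial_radius_eq
    by (auto simp: lookup_single when_def pm_monom_single)
qed

lemma bounded_coord_inv: assumes "q \<in> W" shows "bounded_coord (inverse (u q) :: 'k::complete_nonarch_field mpoly fract) (inverse (\<rho> q))"
  unfolding bounded_coord_def
proof (intro bexI conjI)
  show "lvar_inv q \<in> mixed_ring I W" using assms by (auto simp: mixed_ring_def lookup_single when_def W_def)
  show "eval_coord i j (lvar_inv q) = (inverse (u q) :: 'k mpoly fract)" by (simp add: eval_single)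
  show "gauss_le \<rho> (set_zero (I \<inter> J) (lvar_inv q :: 'k lpoly)) (inverse (\<rho> q))"
    unfolding gauss_le_def lookup_set_zero monomial_radius_eq
    by (auto simp: lookup_single when_def pm_monom_single)
qed

end

text \<open>Read a, c as u_ik, u_jk, then b, t as u_it, u_jt and e, d as u_il, u_jl. The first two
  identities solve the relation of the pair kt; the last two express the coordinate of kl through
  those of kt and tl and the coordinates at j or at i.\<close>

lemma plucker_solve:
  fixes a b c d e t :: "'f::field"
  shows "t \<noteq> 0 \<Longrightarrow> a = ((a * t - b * c) + b * c) * inverse t"
    and "b \<noteq> 0 \<Longrightarrow> c = (a * t - (a * t - b * c)) * inverse b"
    and "t \<noteq> 0 \<Longrightarrow> a * d - e * c = ((a * t - b * c) * d + (b * d - e * t) * c) * inverse t"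
    and "b \<noteq> 0 \<Longrightarrow> a * d - e * c = ((a * t - b * c) * e + (b * d - e * t) * a) * inverse b"
  by (simp_all add: field_simps)

section \<open>Gauss norm bounds by induction along the order\<close>

context chart_data
begin

lemma u_nonzero: "q \<in> pairs n \<Longrightarrow> (u q :: 'k::field mpoly fract) \<noteq> 0"
  using chart_coord_nonzero[OF _ ij(3)] by (simp add: Fract_eq_0_iff)

text \<open>The coordinate of kl up to sign, in a form that does not depend on which index is
  smaller.\<close>

abbreviation w :: "nat \<Rightarrow> nat \<Rightarrow> 'k::field mpoly fract" where
  "w k l \<equiv> u (Upair i k) * u (Upair j l) - u (Upair i l) * u (Upair j k)"

lemma u_pair:
  assumes "k \<in> other_leaves" "l \<in> other_leaves" "k \<noteq> l"
  shows "u (Upair k l) = (sgn_pair k l * w k l :: 'k::field mpoly fract)"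
proof -
  have kl: "k \<notin> {i, j}" "l \<notin> {i, j}" using assms by auto
  show ?thesis
    unfolding chart_coord_pair[OF assms(3) kl] chart_coord_var[OF kl(1) ij(3)] chart_coord_var[OF kl(2) ij(3)]
    by (cases "k < l") (simp_all only: if_True if_False mult_1 mult_minus_left Fract_uminus_1 Fract_diff_1[symmetric] Fract_mult_1[symmetric])
qed

lemma bounded_coord_pair_iff:
  assumes "k \<in> other_leaves" "l \<in> other_leaves" "k \<noteq> l"
  shows "bounded_coord (u (Upair k l) :: 'k::complete_nonarch_field mpoly fract) e \<longleftrightarrow> bounded_coord (w k l :: 'k mpoly fract) e"
  unfolding u_pair[OF assms] using bounded_coord_uminus[of "w k l :: 'k mpoly fract" e] bounded_coord_uminus[of "- w k l :: 'k mpoly fract" e]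
  by auto

lemma leaf_pairs: "k \<in> other_leaves \<Longrightarrow> Upair i k \<in> pairs n" "k \<in> other_leaves \<Longrightarrow> Upair j k \<in> pairs n"
  using ij by (auto intro!: Upair_in_pairs)

lemma max_mult_inverse_le: "a \<le> c * d \<Longrightarrow> b \<le> c * d \<Longrightarrow> d > 0 \<Longrightarrow> max a b * inverse d \<le> (c :: real)"
  by (simp add: field_simps)

lemma W_i: "k \<in> other_leaves \<Longrightarrow> Upair i k \<in> I \<Longrightarrow> Upair i k \<notin> J \<Longrightarrow> Upair i k \<in> W"
  and W_j: "k \<in> other_leaves \<Longrightarrow> Upair j k \<in> I \<Longrightarrow> Upair j k \<notin> J \<Longrightarrow> Upair j k \<in> W"
  using chart_vars_iff by (auto simp: W_def)

text \<open>A missing coordinate of \<open>k\<close> is solved from the pair of \<open>k\<close> and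
  its pivot t. For u_ik the bound closes up because \<rho>_kt is at most \<rho>_ik \<rho>_jt and
  \<rho>_it \<rho>_jk equals \<rho>_ik \<rho>_jt. Division by \<rho>_jt is possible since the
  coordinates of a pivot avoid \<open>J\<close>.\<close>

lemma bounded_coord_leaf:
  assumes "k \<in> other_leaves"
  shows "bounded_coord (u (Upair i k) :: 'k::complete_nonarch_field mpoly fract) (\<rho> (Upair i k)) \<and>
    bounded_coord (u (Upair j k) :: 'k mpoly fract) (\<rho> (Upair j k))"
  using assms
proof (induction k rule: wf_induct_rule[OF wf_R])
  case (1 k)
  let ?u = "u :: nat uprod \<Rightarrow> 'k mpoly fract" and ?t = "pivot k"
  from 1(2) show ?case
  proof (cases rule: k_cases)
    case both
    then show ?thesis by (simp add: bounded_coord_var)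
  next
    case onlyj
    have t: "?t \<in> other_leaves" "(?t, k) \<in> R" using onlyj own_branch_other_leaves by (auto simp: R_def)
    have jI: "Upair j k \<in> I" "Upair j ?t \<in> I" using onlyj meeting_vertex(2)[OF 1(2)] by blast+
    have G1: "bounded_coord (w k ?t :: 'k mpoly fract) (\<rho> (Upair k ?t))"
      using bounded_coord_pair_iff[OF 1(2) t(1) onlyj(5)[symmetric], where 'k = 'k] bounded_coord_var[OF onlyj(8), where 'k = 'k] by blast
    have G2: "bounded_coord (?u (Upair i ?t)) (\<rho> (Upair i ?t))" using 1(1)[OF t(2,1)] by blast
    have E: "?u (Upair i k) = (w k ?t + ?u (Upair i ?t) * ?u (Upair j k)) * inverse (?u (Upair j ?t))"
      by (rule plucker_solve(1)) (rule u_nonzero[OF leaf_pairs(2)[OF t(1)]])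
    have G: "bounded_coord ((w k ?t + ?u (Upair i ?t) * ?u (Upair j k)) * inverse (?u (Upair j ?t)))
        (max (\<rho> (Upair k ?t)) (\<rho> (Upair i ?t) * \<rho> (Upair j k)) * inverse (\<rho> (Upair j ?t)))"
      by (intro bounded_coord_mult bounded_coord_add G1 G2 bounded_coord_var[OF jI(1)] bounded_coord_inv W_j t(1) jI(2) onlyj(7))
    have le: "max (\<rho> (Upair k ?t)) (\<rho> (Upair i ?t) * \<rho> (Upair j k)) * inverse (\<rho> (Upair j ?t)) \<le> \<rho> (Upair i k)"
      using \<rho>_same_branch[OF meeting_vertex(2)[OF 1(2)] onlyj(3) onlyj(5)[symmetric]] \<rho>_pos[OF leaf_pairs(2)[OF t(1)] onlyj(7)]
      by (intro max_mult_inverse_le) auto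
    have "bounded_coord (?u (Upair i k)) (\<rho> (Upair i k))" by (subst E) (rule bounded_coord_mono[OF G le])
    then show ?thesis using bounded_coord_var[OF jI(1), where 'k = 'k] by blast
  next
    case onlyi
    have t: "?t \<in> other_leaves" "(?t, k) \<in> R" using onlyi own_branch_other_leaves by (auto simp: R_def)
    have iI: "Upair i k \<in> I" "Upair i ?t \<in> I" using onlyi meeting_vertex(2)[OF 1(2)] by blast+
    have G1: "bounded_coord (w k ?t :: 'k mpoly fract) (\<rho> (Upair k ?t))"
      using bounded_coord_pair_iff[OF 1(2) t(1) onlyi(5)[symmetric], where 'k = 'k] bounded_coord_var[OF onlyi(8), where 'k = 'k] by blast
    have G2: "bounded_coord (?u (Upair j ?t)) (\<rho> (Upair j ?t))" using 1(1)[OF t(2,1)] by blast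
    have E: "?u (Upair j k) = (?u (Upair i k) * ?u (Upair j ?t) - w k ?t) * inverse (?u (Upair i ?t))"
      by (rule plucker_solve(2)) (rule u_nonzero[OF leaf_pairs(1)[OF t(1)]])
    have G: "bounded_coord ((?u (Upair i k) * ?u (Upair j ?t) - w k ?t) * inverse (?u (Upair i ?t)))
        (max (\<rho> (Upair i k) * \<rho> (Upair j ?t)) (\<rho> (Upair k ?t)) * inverse (\<rho> (Upair i ?t)))"
      by (intro bounded_coord_mult bounded_coord_diff G1 G2 bounded_coord_var[OF iI(1)] bounded_coord_inv W_i t(1) iI(2) onlyi(6))
    have le: "max (\<rho> (Upair i k) * \<rho> (Upair j ?t)) (\<rho> (Upair k ?t)) * inverse (\<rho> (Upair i ?t)) \<le> \<rho> (Upair j k)"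
      using \<rho>_same_branch[OF meeting_vertex(2)[OF 1(2)] onlyi(3) onlyi(5)[symmetric]] \<rho>_pos[OF leaf_pairs(1)[OF t(1)] onlyi(6)]
      by (intro max_mult_inverse_le) (simp_all add: mult.commute)
    have "bounded_coord (?u (Upair j k)) (\<rho> (Upair j k))" by (subst E) (rule bounded_coord_mono[OF G le])
    then show ?thesis using bounded_coord_var[OF iI(1), where 'k = 'k] by blast
  qed
qed

text \<open>The direct estimate by the Pluecker relation. It is good enough for leaves in different
  branches, but may be too weak within one branch.\<close>

lemma bounded_coord_w:
  assumes "k \<in> other_leaves" "l \<in> other_leaves"
  shows "bounded_coord (w k l :: 'k::complete_nonarch_field mpoly fract)
    (max (\<rho> (Upair i k) * \<rho> (Upair j l)) (\<rho> (Upair i l) * \<rho> (Upair j k)))"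
  using bounded_coord_leaf[OF assms(1), where 'k = 'k] bounded_coord_leaf[OF assms(2), where 'k = 'k]
  by (intro bounded_coord_diff bounded_coord_mult) auto

text \<open>For a chain l, t, k the quartet with \<open>i\<close> has the cherry lt or tk. In the
  first case the first inequality is an equality and the second comes from the cherry inequality; in
  the second case the roles are exchanged. The two left-hand sides are the radii of the terms in the
  relation between kl, kt and tl.\<close>

lemma \<rho>_chain:
  assumes klt: "k \<in> other_leaves" "(l, t) \<in> r" "l \<noteq> t" "(t, k) \<in> r" "t \<noteq> k" and p: "p \<in> {i, j}"
  shows "\<rho> (Upair k t) * \<rho> (Upair p l) \<le> \<rho> (Upair k l) * \<rho> (Upair p t)"
    and "\<rho> (Upair t l) * \<rho> (Upair p k) \<le> \<rho> (Upair k l) * \<rho> (Upair p t)"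
proof -
  have lk: "l \<noteq> k" using klt r_antisym by blast
  have in_own_branch: "k \<in> own_branch k" "t \<in> own_branch k" "l \<in> own_branch k"
    using meeting_vertex(2) klt r_other_leaves r_same_meeting_vertex by metis+
  have comm: "Upair t k = Upair k t" "Upair l t = Upair t l" "Upair l k = Upair k l" by auto
  have "is_cherry (quartet T {i, l, t, k}) l t \<or> is_cherry (quartet T {i, l, t, k}) t k"
    using cherry klt unfolding cherry_property_def by blast
  then show "\<rho> (Upair k t) * \<rho> (Upair p l) \<le> \<rho> (Upair k l) * \<rho> (Upair p t)"
    and "\<rho> (Upair t l) * \<rho> (Upair p k) \<le> \<rho> (Upair k l) * \<rho> (Upair p t)"
  proof (atomize (full), elim disjE)
    assume "is_cherry (quartet T {i, l, t, k}) l t"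
    then have "is_cherry (quartet T {i, k, l, t}) l t" by (simp add: insert_commute)
    from \<rho>_cherry[OF in_own_branch(1,3,2) _ this p] lk klt
    show "\<rho> (Upair k t) * \<rho> (Upair p l) \<le> \<rho> (Upair k l) * \<rho> (Upair p t) \<and>
      \<rho> (Upair t l) * \<rho> (Upair p k) \<le> \<rho> (Upair k l) * \<rho> (Upair p t)"
      by (simp add: comm mult_ac)
  next
    assume "is_cherry (quartet T {i, l, t, k}) t k"
    from \<rho>_cherry[OF in_own_branch(3,2,1) _ this p] lk klt
    show "\<rho> (Upair k t) * \<rho> (Upair p l) \<le> \<rho> (Upair k l) * \<rho> (Upair p t) \<and>
      \<rho> (Upair t l) * \<rho> (Upair p k) \<le> \<rho> (Upair k l) * \<rho> (Upair p t)"
      by (simp add: comm mult_ac)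
  qed
qed

text \<open>If neither coordinate of \<open>l\<close> is in \<open>J\<close>, then \<open>k\<close>
  is not of kind (i), so it has a pivot t and \<open>l\<close> is t or below it. The expression
  through \<open>w k t\<close>, up to sign a chosen coordinate, and \<open>w t l\<close>, known by
  induction, avoids the possible cancellation in u_ik u_jl - u_il u_jk.\<close>

lemma bounded_coord_below:
  assumes "k \<in> other_leaves" "(l, k) \<in> R"
  shows "bounded_coord (w k l :: 'k::complete_nonarch_field mpoly fract) (\<rho> (Upair k l))"
  using assms
proof (induction k arbitrary: l rule: wf_induct_rule[OF wf_R])
  case (1 k)
  let ?u = "u :: nat uprod \<Rightarrow> 'k mpoly fract" and ?t = "pivot k"
  have l: "(l, k) \<in> r" "l \<noteq> k" "l \<in> other_leaves" using 1(3) r_other_leaves by (auto simp: R_def)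
  have lbr: "l \<in> own_branch k" using meeting_vertex(2)[OF l(3)] r_same_meeting_vertex[OF l(1)] by simp
  show ?case
  proof (cases "Upair i l \<in> J \<or> Upair j l \<in> J")
    case True
    \<comment> \<open>The two products of radii are equal and one of them has a factor 0, so the
      direct estimate is 0.\<close>
    have "max (\<rho> (Upair i k) * \<rho> (Upair j l)) (\<rho> (Upair i l) * \<rho> (Upair j k)) \<le> \<rho> (Upair k l)"
      using True \<rho>_same_branch(2)[OF meeting_vertex(2)[OF 1(2)] lbr l(2)[symmetric]] \<rho>_J by auto
    then show ?thesis using bounded_coord_w[OF 1(2) l(3)] bounded_coord_mono by blast
  next
    case False
    from 1(2) show ?thesis
    proof (cases rule: k_cases)
      case both
      then show ?thesis using False l by blast
    next
      case onlyj
      show ?thesis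
      proof (cases "l = ?t")
        case True
        then show ?thesis
          using bounded_coord_pair_iff[OF 1(2) l(3) l(2)[symmetric], where 'k = 'k] bounded_coord_var[OF onlyj(8), where 'k = 'k] by simp
      next
        case lt: False
        have t: "?t \<in> other_leaves" "(?t, k) \<in> R" using onlyj own_branch_other_leaves by (auto simp: R_def)
        \<comment> \<open>The pivot is the largest admissible leaf below \<open>k\<close>, and
          \<open>l\<close> is admissible.\<close>
        have ltr: "(l, ?t) \<in> r" using onlyj(9) l False by blast
        have jI: "Upair j ?t \<in> I" using onlyj by blast
        have G1: "bounded_coord (w k ?t :: 'k mpoly fract) (\<rho> (Upair k ?t))"
          using bounded_coord_pair_iff[OF 1(2) t(1) onlyj(5)[symmetric], where 'k = 'k] bounded_coord_var[OF onlyj(8), where 'k = 'k] by blast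
        have G2: "bounded_coord (w ?t l :: 'k mpoly fract) (\<rho> (Upair ?t l))"
          using 1(1)[OF t(2,1)] ltr lt by (simp add: R_def)
        have E: "w k l = (w k ?t * ?u (Upair j l) + w ?t l * ?u (Upair j k)) * inverse (?u (Upair j ?t))"
          by (rule plucker_solve(3)) (rule u_nonzero[OF leaf_pairs(2)[OF t(1)]])
        have G: "bounded_coord ((w k ?t * ?u (Upair j l) + w ?t l * ?u (Upair j k)) * inverse (?u (Upair j ?t)))
          (max (\<rho> (Upair k ?t) * \<rho> (Upair j l)) (\<rho> (Upair ?t l) * \<rho> (Upair j k)) * inverse (\<rho> (Upair j ?t)))"
          by (intro bounded_coord_mult bounded_coord_add G1 G2 bounded_coord_inv W_j t(1) jI onlyj(7))
            (use bounded_coord_leaf[OF 1(2)] bounded_coord_leaf[OF l(3)] in auto)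
        have le: "max (\<rho> (Upair k ?t) * \<rho> (Upair j l)) (\<rho> (Upair ?t l) * \<rho> (Upair j k)) *
            inverse (\<rho> (Upair j ?t)) \<le> \<rho> (Upair k l)"
          using \<rho>_chain[OF 1(2) ltr lt onlyj(4,5), of j] \<rho>_pos[OF leaf_pairs(2)[OF t(1)] onlyj(7)]
          by (intro max_mult_inverse_le) auto
        show ?thesis by (subst E) (rule bounded_coord_mono[OF G le])
      qed
    next
      case onlyi
      show ?thesis
      proof (cases "l = ?t")
        case True
        then show ?thesis
          using bounded_coord_pair_iff[OF 1(2) l(3) l(2)[symmetric], where 'k = 'k] bounded_coord_var[OF onlyi(8), where 'k = 'k] by simp
      next
        case lt: False
        have t: "?t \<in> other_leaves" "(?t, k) \<in> R" using onlyi own_branch_other_leaves by (auto simp: R_def)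
        have ltr: "(l, ?t) \<in> r" using onlyi(9) l False by blast
        have iI: "Upair i ?t \<in> I" using onlyi by blast
        have G1: "bounded_coord (w k ?t :: 'k mpoly fract) (\<rho> (Upair k ?t))"
          using bounded_coord_pair_iff[OF 1(2) t(1) onlyi(5)[symmetric], where 'k = 'k] bounded_coord_var[OF onlyi(8), where 'k = 'k] by blast
        have G2: "bounded_coord (w ?t l :: 'k mpoly fract) (\<rho> (Upair ?t l))"
          using 1(1)[OF t(2,1)] ltr lt by (simp add: R_def)
        have E: "w k l = (w k ?t * ?u (Upair i l) + w ?t l * ?u (Upair i k)) * inverse (?u (Upair i ?t))"
          by (rule plucker_solve(4)) (rule u_nonzero[OF leaf_pairs(1)[OF t(1)]])
        have G: "bounded_coord ((w k ?t * ?u (Upair i l) + w ?t l * ?u (Upair i k)) * inverse (?u (Upair i ?t)))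
          (max (\<rho> (Upair k ?t) * \<rho> (Upair i l)) (\<rho> (Upair ?t l) * \<rho> (Upair i k)) * inverse (\<rho> (Upair i ?t)))"
          by (intro bounded_coord_mult bounded_coord_add G1 G2 bounded_coord_inv W_i t(1) iI onlyi(6))
            (use bounded_coord_leaf[OF 1(2)] bounded_coord_leaf[OF l(3)] in auto)
        have le: "max (\<rho> (Upair k ?t) * \<rho> (Upair i l)) (\<rho> (Upair ?t l) * \<rho> (Upair i k)) *
            inverse (\<rho> (Upair i ?t)) \<le> \<rho> (Upair k l)"
          using \<rho>_chain[OF 1(2) ltr lt onlyi(4,5), of i] \<rho>_pos[OF leaf_pairs(1)[OF t(1)] onlyi(6)]
          by (intro max_mult_inverse_le) auto
        show ?thesis by (subst E) (rule bounded_coord_mono[OF G le])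
      qed
    qed
  qed
qed

text \<open>Between different branches the tree makes \<rho>_ik \<rho>_jl at most \<rho>_kl, so the
  direct estimate suffices. Within a branch the order is total and one leaf is below the
  other.\<close>

lemma bounded_coord_all:
  assumes "q \<in> pairs n" "q \<noteq> Upair i j"
  shows "bounded_coord (u q :: 'k::complete_nonarch_field mpoly fract) (\<rho> q)"
  using assms(1)
proof (cases rule: pair_cases[where i = i and j = j])
  case 1
  then show ?thesis using assms(2) by simp
next
  case (2 k)
  then show ?thesis using bounded_coord_leaf by blast
next
  case (3 k)
  then show ?thesis using bounded_coord_leaf by blast
next
  case (4 k l)
  show ?thesis
  proof (cases "meeting_vertex k = meeting_vertex l")
    case True
    have comm: "Upair l k = Upair k l" by auto
    from total[OF 4(1,2) True 4(3)] show ?thesis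
    proof
      assume "(k, l) \<in> r"
      then have "bounded_coord (u (Upair l k) :: 'k mpoly fract) (\<rho> (Upair l k))"
        using bounded_coord_below[OF 4(2), of k, where 'k = 'k] bounded_coord_pair_iff[OF 4(2,1) 4(3)[symmetric], where 'k = 'k] 4(3)
        unfolding R_def by blast
      then show ?thesis using 4(4) by (simp add: comm)
    next
      assume "(l, k) \<in> r"
      then show ?thesis
        using bounded_coord_below[OF 4(1), of l, where 'k = 'k] bounded_coord_pair_iff[OF 4(1-3), where 'k = 'k] 4(3,4)
        unfolding R_def by blast
    qed
  next
    case False
    have comm: "Upair l k = Upair k l" by auto
    have "max (\<rho> (Upair i k) * \<rho> (Upair j l)) (\<rho> (Upair i l) * \<rho> (Upair j k)) \<le> \<rho> (Upair k l)"
      using \<rho>_diff_branch[OF meeting_vertex(2)[OF 4(1)] meeting_vertex(2)[OF 4(2)] False 4(3)]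
        \<rho>_diff_branch[OF meeting_vertex(2)[OF 4(2)] meeting_vertex(2)[OF 4(1)] False[symmetric] 4(3)[symmetric]] by (simp add: comm)
    then show ?thesis using bounded_coord_w[OF 4(1,2), where 'k = 'k] bounded_coord_mono bounded_coord_pair_iff[OF 4(1-3), where 'k = 'k] 4(4) by blast
  qed
qed

text \<open>The interface to the analytic part: each adjoined element is a Laurent polynomial in the
  variables of A, and its norm is at most the radius of the domain.\<close>

theorem f_coord_bound:
  assumes "q \<in> pairs n" "q \<noteq> Upair i j"
  shows "gauss_le \<rho> (f_coord n i j I J q :: 'k::complete_nonarch_field lpoly) (\<rho> q)"
    and "\<alpha> \<in> Poly_Mapping.keys (f_coord n i j I J q :: 'k lpoly) \<Longrightarrow> Poly_Mapping.keys \<alpha> \<subseteq> I - J"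
proof -
  obtain p where p: "p \<in> mixed_ring I W" "eval_coord i j p = (u q :: 'k mpoly fract)"
    "gauss_le \<rho> (set_zero (I \<inter> J) p) (\<rho> q)"
    using bounded_coord_all[OF assms] unfolding bounded_coord_def by blast
  have "f_coord n i j I J q = set_zero (I \<inter> J) p"
    unfolding f_coord_def W_def[symmetric] using coord_incl_eq[OF p(1,2)] by simp
  then show "gauss_le \<rho> (f_coord n i j I J q :: 'k lpoly) (\<rho> q)"
    and "\<alpha> \<in> Poly_Mapping.keys (f_coord n i j I J q :: 'k lpoly) \<Longrightarrow> Poly_Mapping.keys \<alpha> \<subseteq> I - J"
    using p(3) set_zero_keys[OF p(1)] by auto
qed

end

section \<open>Laurent series on a torus\<close>

text \<open>What survives the passage to a Laurent domain in every case: a residue seminorm may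
  vanish on nonzero elements, fail to be multiplicative and even be 0 at 1.\<close>

locale seminormed_cring = cring R for R :: "('a, 'z) normed_ring_scheme" (structure) +
  assumes nrm_nonneg: "a \<in> carrier R \<Longrightarrow> nrm R a \<ge> 0"
    and nrm_zero: "nrm R \<zero> = 0"
    and nrm_minus: "a \<in> carrier R \<Longrightarrow> nrm R (\<ominus> a) = nrm R a"
    and nrm_add: "a \<in> carrier R \<Longrightarrow> b \<in> carrier R \<Longrightarrow> nrm R (a \<oplus> b) \<le> max (nrm R a) (nrm R b)"
    and nrm_mult_le: "a \<in> carrier R \<Longrightarrow> b \<in> carrier R \<Longrightarrow> nrm R (a \<otimes> b) \<le> nrm R a * nrm R b"

locale valued_cring = seminormed_cring +
  assumes nrm_mult: "a \<in> carrier R \<Longrightarrow> b \<in> carrier R \<Longrightarrow> nrm R (a \<otimes> b) = nrm R a * nrm R b"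
    and nrm_one: "nrm R \<one> = 1"

text \<open>Outside one finite set the terms of both families are at most \<epsilon>. All three
  infinite sums are then within \<epsilon> of their partial sums over this set, and by the
  ultrametric inequality so are the two sides of each other.\<close>

lemma nonarch_infsum_add:
  fixes f g :: "'i \<Rightarrow> 'k::complete_nonarch_field"
  assumes f: "\<And>\<epsilon>. \<epsilon> > 0 \<Longrightarrow> finite {a. nabs (f a) \<ge> \<epsilon>}" and g: "\<And>\<epsilon>. \<epsilon> > 0 \<Longrightarrow> finite {a. nabs (g a) \<ge> \<epsilon>}"
  shows "infsum (\<lambda>a. f a + g a) UNIV = infsum f UNIV + infsum g UNIV"
proof -
  have small: "nabs (infsum (\<lambda>a. f a + g a) UNIV - (infsum f UNIV + infsum g UNIV)) \<le> \<epsilon>" if \<epsilon>: "\<epsilon> > 0" for \<epsilon>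
  proof -
    define F where "F = {a. nabs (f a) \<ge> \<epsilon>} \<union> {a. nabs (g a) \<ge> \<epsilon>}"
    have F: "finite F" using f[OF \<epsilon>] g[OF \<epsilon>] by (simp add: F_def)
    have fg: "finite {a. nabs (f a + g a) \<ge> \<delta>}" if "\<delta> > 0" for \<delta>
    proof (rule finite_subset)
      show "{a. nabs (f a + g a) \<ge> \<delta>} \<subseteq> {a. nabs (f a) \<ge> \<delta>} \<union> {a. nabs (g a) \<ge> \<delta>}"
      proof
        fix a assume "a \<in> {a. nabs (f a + g a) \<ge> \<delta>}"
        then have "\<delta> \<le> max (nabs (f a)) (nabs (g a))" using nabs_add[of "f a" "g a"] by simp
        then show "a \<in> {a. nabs (f a) \<ge> \<delta>} \<union> {a. nabs (g a) \<ge> \<delta>}" by (auto simp: max_def split: if_splits)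
      qed
      show "finite ({a. nabs (f a) \<ge> \<delta>} \<union> {a. nabs (g a) \<ge> \<delta>})" using f[OF that] g[OF that] by simp
    qed
    have out: "nabs (f a) \<le> \<epsilon>" "nabs (g a) \<le> \<epsilon>" if "a \<notin> F" for a
      using that by (auto simp: F_def)
    have "nabs (f a + g a) \<le> \<epsilon>" if "a \<notin> F" for a
      by (rule order_trans[OF nabs_add]) (use out[OF that] in simp)
    then have a: "nabs (infsum (\<lambda>a. f a + g a) UNIV - (\<Sum>a\<in>F. f a + g a)) \<le> \<epsilon>"
      using \<epsilon> by (intro nonarch_infsum fg F) auto
    have b: "nabs (infsum f UNIV - sum f F) \<le> \<epsilon>" using \<epsilon> out by (intro nonarch_infsum f F) auto
    have c: "nabs (infsum g UNIV - sum g F) \<le> \<epsilon>" using \<epsilon> out by (intro nonarch_infsum g F) auto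
    have bc: "nabs ((infsum f UNIV - sum f F) + (infsum g UNIV - sum g F)) \<le> \<epsilon>"
      by (rule order_trans[OF nabs_add]) (use b c in simp)
    have "infsum (\<lambda>a. f a + g a) UNIV - (infsum f UNIV + infsum g UNIV) =
      (infsum (\<lambda>a. f a + g a) UNIV - (\<Sum>a\<in>F. f a + g a)) - ((infsum f UNIV - sum f F) + (infsum g UNIV - sum g F))"
      by (simp add: sum.distrib)
    also have "nabs \<dots> \<le> \<epsilon>"
      by (rule order_trans[OF nabs_diff max.boundedI[OF a bc]])
    finally show ?thesis .
  qed
  have "nabs (infsum (\<lambda>a. f a + g a) UNIV - (infsum f UNIV + infsum g UNIV)) \<le> 0"
    by (rule field_le_epsilon) (use small in simp)
  then have "infsum (\<lambda>a. f a + g a) UNIV - (infsum f UNIV + infsum g UNIV) = 0"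
    using nabs_nonneg nabs_eq_0 by (metis antisym)
  then show ?thesis by simp
qed

lemma nonarch_infsum_finite:
  fixes f :: "'i \<Rightarrow> 'k::complete_nonarch_field"
  assumes "finite F" "\<And>a. a \<notin> F \<Longrightarrow> f a = 0"
  shows "infsum f UNIV = sum f F"
proof -
  have "finite {a. nabs (f a) \<ge> \<epsilon>}" if "\<epsilon> > 0" for \<epsilon>
    by (rule finite_subset[OF _ assms(1)]) (use assms(2) that in \<open>force intro: ccontr\<close>)
  then have "nabs (infsum f UNIV - sum f F) \<le> 0"
    using assms by (intro nonarch_infsum) auto
  then have "infsum f UNIV - sum f F = 0"
    using nabs_nonneg nabs_eq_0 by (metis antisym)
  then show ?thesis by simp
qed

section \<open>Convergent Laurent series, their Gauss norm and their product\<close>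

locale torus =
  fixes V :: "'i::linorder set" and \<rho> :: "'i \<Rightarrow> real"
  assumes V: "finite V" and \<rho>_pos: "\<And>q. q \<in> V \<Longrightarrow> \<rho> q > 0"
begin

abbreviation "rad \<equiv> monomial_radius \<rho>"

lemma rad_pos: "Poly_Mapping.keys \<alpha> \<subseteq> V \<Longrightarrow> rad \<alpha> > 0"
  unfolding monomial_radius_eq using \<rho>_pos by (rule pm_monom_pos)

lemma rad_0 [simp]: "rad 0 = 1"
  by (simp add: monomial_radius_eq)

lemma rad_add: "Poly_Mapping.keys \<alpha> \<subseteq> V \<Longrightarrow> Poly_Mapping.keys \<beta> \<subseteq> V \<Longrightarrow> rad (\<alpha> + \<beta>) = rad \<alpha> * rad \<beta>"
  unfolding monomial_radius_eq by (rule pm_monom_add[where V = V]) (use \<rho>_pos in force)+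

definition sz :: "(('i \<Rightarrow>\<^sub>0 int) \<Rightarrow> 'k::complete_nonarch_field) \<Rightarrow> ('i \<Rightarrow>\<^sub>0 int) \<Rightarrow> real" where
  "sz c \<alpha> = nabs (c \<alpha>) * rad \<alpha>"

text \<open>Convergence without mention of degrees. By \<open>finite_exponents\<close>, smallness
  for large degree is the same as smallness off finite sets, which is the form needed for unordered
  sums.\<close>

definition null_seq :: "(('i \<Rightarrow>\<^sub>0 int) \<Rightarrow> 'k::complete_nonarch_field) \<Rightarrow> bool" where
  "null_seq c \<longleftrightarrow> (\<forall>\<alpha>. \<not> Poly_Mapping.keys \<alpha> \<subseteq> V \<longrightarrow> c \<alpha> = 0) \<and> (\<forall>\<epsilon>>0. finite {\<alpha>. sz c \<alpha> \<ge> \<epsilon>})"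

lemma finite_exponents:
  fixes N :: int
  shows "finite {\<alpha>. Poly_Mapping.keys \<alpha> \<subseteq> V \<and> (\<Sum>q\<in>Poly_Mapping.keys \<alpha>. \<bar>Poly_Mapping.lookup \<alpha> q\<bar>) < N}" (is "finite ?S")
proof (rule finite_imageD)
  have "Poly_Mapping.lookup ` ?S \<subseteq> {f. \<forall>x. (x \<in> V \<longrightarrow> f x \<in> {- \<bar>N\<bar>..\<bar>N\<bar>}) \<and> (x \<notin> V \<longrightarrow> f x = 0)}"
  proof (clarsimp, intro conjI allI impI)
    fix \<alpha> q
    assume \<alpha>: "Poly_Mapping.keys \<alpha> \<subseteq> V" "(\<Sum>q\<in>Poly_Mapping.keys \<alpha>. \<bar>Poly_Mapping.lookup \<alpha> q\<bar>) < N"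
    have "\<bar>Poly_Mapping.lookup \<alpha> q\<bar> < N"
    proof (cases "q \<in> Poly_Mapping.keys \<alpha>")
      case True
      then have "\<bar>Poly_Mapping.lookup \<alpha> q\<bar> \<le> (\<Sum>q\<in>Poly_Mapping.keys \<alpha>. \<bar>Poly_Mapping.lookup \<alpha> q\<bar>)"
        by (intro member_le_sum) auto
      then show ?thesis using \<alpha>(2) by simp
    next
      case False
      have "0 \<le> (\<Sum>q\<in>Poly_Mapping.keys \<alpha>. \<bar>Poly_Mapping.lookup \<alpha> q\<bar>)" by (rule sum_nonneg) simp
      then have "0 < N" using \<alpha>(2) by linarith
      then show ?thesis using False by (simp add: in_keys_iff)
    qed
    then show "- \<bar>N\<bar> \<le> Poly_Mapping.lookup \<alpha> q" "Poly_Mapping.lookup \<alpha> q \<le> \<bar>N\<bar>" by linarith+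
    assume "q \<notin> V"
    then show "Poly_Mapping.lookup \<alpha> q = 0" using \<alpha>(1) by (auto simp: in_keys_iff)
  qed
  then show "finite (Poly_Mapping.lookup ` ?S)"
    using finite_set_of_finite_funs[OF V, of "{- \<bar>N\<bar>..\<bar>N\<bar>}"] finite_subset by blast
  show "inj_on Poly_Mapping.lookup ?S"
    by (auto intro!: inj_onI poly_mapping_eqI)
qed

lemma sz_nonneg: "(\<And>\<alpha>. \<not> Poly_Mapping.keys \<alpha> \<subseteq> V \<Longrightarrow> c \<alpha> = 0) \<Longrightarrow> sz c \<alpha> \<ge> 0"
  unfolding sz_def using rad_pos[of \<alpha>] nabs_nonneg[of "c \<alpha>"] by (cases "Poly_Mapping.keys \<alpha> \<subseteq> V") auto

lemma carrier_eq: "carrier (torus_algebra V \<rho>) = {c :: _ \<Rightarrow> 'k::complete_nonarch_field. null_seq c}"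
proof -
  have "null_seq c" if cA: "c \<in> carrier (torus_algebra V \<rho>)" for c :: "('i \<Rightarrow>\<^sub>0 int) \<Rightarrow> 'k"
  proof -
  have c: "\<And>\<alpha>. \<not> Poly_Mapping.keys \<alpha> \<subseteq> V \<Longrightarrow> c \<alpha> = 0"
    "\<And>\<epsilon>. \<epsilon> > 0 \<Longrightarrow> \<exists>N. \<forall>\<alpha>. Poly_Mapping.keys \<alpha> \<subseteq> V \<and>
      (\<Sum>q\<in>Poly_Mapping.keys \<alpha>. \<bar>Poly_Mapping.lookup \<alpha> q\<bar>) \<ge> N \<longrightarrow> nabs (c \<alpha>) * rad \<alpha> < \<epsilon>"
    using cA by (auto simp: torus_algebra_def)
  have "finite {\<alpha>. sz c \<alpha> \<ge> \<epsilon>}" if \<epsilon>: "\<epsilon> > 0" for \<epsilon>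
  proof -
    obtain N where N: "\<And>\<alpha>. Poly_Mapping.keys \<alpha> \<subseteq> V \<Longrightarrow>
      (\<Sum>q\<in>Poly_Mapping.keys \<alpha>. \<bar>Poly_Mapping.lookup \<alpha> q\<bar>) \<ge> N \<Longrightarrow> nabs (c \<alpha>) * rad \<alpha> < \<epsilon>"
      using c(2)[OF \<epsilon>] by blast
    have "{\<alpha>. sz c \<alpha> \<ge> \<epsilon>} \<subseteq> {\<alpha>. Poly_Mapping.keys \<alpha> \<subseteq> V \<and>
        (\<Sum>q\<in>Poly_Mapping.keys \<alpha>. \<bar>Poly_Mapping.lookup \<alpha> q\<bar>) < N}"
    proof (rule subsetI, rule CollectI, rule conjI)
      fix \<alpha> assume "\<alpha> \<in> {\<alpha>. sz c \<alpha> \<ge> \<epsilon>}"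
      then have s: "sz c \<alpha> \<ge> \<epsilon>" by simp
      show k: "Poly_Mapping.keys \<alpha> \<subseteq> V"
      proof (rule ccontr)
        assume "\<not> Poly_Mapping.keys \<alpha> \<subseteq> V"
        then have "c \<alpha> = 0" by (rule c(1))
        then show False using s \<epsilon> by (simp add: sz_def)
      qed
      show "(\<Sum>q\<in>Poly_Mapping.keys \<alpha>. \<bar>Poly_Mapping.lookup \<alpha> q\<bar>) < N"
        using N[OF k] s by (fastforce simp: sz_def)
    qed
    then show ?thesis using finite_exponents finite_subset by blast
  qed
  then show ?thesis using c(1) by (simp add: null_seq_def)
  qed
  moreover have "c \<in> carrier (torus_algebra V \<rho>)" if cN: "null_seq c" for c :: "('i \<Rightarrow>\<^sub>0 int) \<Rightarrow> 'k"
  proof -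
  have c: "\<And>\<alpha>. \<not> Poly_Mapping.keys \<alpha> \<subseteq> V \<Longrightarrow> c \<alpha> = 0" "\<And>\<epsilon>. \<epsilon> > 0 \<Longrightarrow> finite {\<alpha>. sz c \<alpha> \<ge> \<epsilon>}"
    using cN by (auto simp: null_seq_def)
  have "\<exists>N. \<forall>\<alpha>. Poly_Mapping.keys \<alpha> \<subseteq> V \<and>
      (\<Sum>q\<in>Poly_Mapping.keys \<alpha>. \<bar>Poly_Mapping.lookup \<alpha> q\<bar>) \<ge> N \<longrightarrow> nabs (c \<alpha>) * rad \<alpha> < \<epsilon>" if \<epsilon>: "\<epsilon> > 0" for \<epsilon>
  proof -
    define m where "m \<alpha> = (\<Sum>q\<in>Poly_Mapping.keys \<alpha>. \<bar>Poly_Mapping.lookup \<alpha> q\<bar>)" for \<alpha> :: "'i \<Rightarrow>\<^sub>0 int"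
    define S where "S = insert 0 (m ` {\<alpha>. sz c \<alpha> \<ge> \<epsilon>})"
    have S: "finite S" using c(2)[OF \<epsilon>] by (simp add: S_def)
    have "nabs (c \<alpha>) * rad \<alpha> < \<epsilon>" if "m \<alpha> \<ge> Max S + 1" for \<alpha>
    proof (rule ccontr)
      assume "\<not> nabs (c \<alpha>) * rad \<alpha> < \<epsilon>"
      then have "m \<alpha> \<in> S" by (auto simp: S_def sz_def)
      then have "m \<alpha> \<le> Max S" using S by simp
      then show False using that by simp
    qed
    then show ?thesis unfolding m_def by blast
  qed
  then show ?thesis using c(1) by (simp add: torus_algebra_def)
  qed
  ultimately show ?thesis by blast
qed

lemma null_seqD: "null_seq c \<Longrightarrow> \<not> Poly_Mapping.keys \<alpha> \<subseteq> V \<Longrightarrow> c \<alpha> = 0"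
  by (simp add: null_seq_def)

lemma null_seq_finite: "null_seq c \<Longrightarrow> \<epsilon> > 0 \<Longrightarrow> finite {\<alpha>. sz c \<alpha> \<ge> \<epsilon>}"
  by (simp add: null_seq_def)

lemma null_seq_sz: "null_seq c \<Longrightarrow> sz c \<alpha> \<ge> 0"
  using sz_nonneg null_seqD by blast

lemma bdd_sz: assumes "null_seq c" shows "bdd_above (range (sz c))"
proof -
  have "range (sz c) \<subseteq> {..1} \<union> sz c ` {\<alpha>. sz c \<alpha> \<ge> 1}" by auto
  moreover have "bdd_above ({..1} \<union> sz c ` {\<alpha>. sz c \<alpha> \<ge> 1})"
    using null_seq_finite[OF assms, of 1] by simp
  ultimately show ?thesis by (rule bdd_above_mono[rotated])
qed

abbreviation "N c \<equiv> nrm (torus_algebra V \<rho>) c"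

lemma N_eq: "N c = (SUP \<alpha>. sz c \<alpha>)"
  by (simp add: torus_algebra_def sz_def)

lemma sz_le_N: "null_seq c \<Longrightarrow> sz c \<alpha> \<le> N c"
  unfolding N_eq by (rule cSUP_upper[OF _ bdd_sz]) auto

lemma N_le: "(\<And>\<alpha>. sz c \<alpha> \<le> e) \<Longrightarrow> N c \<le> e"
  unfolding N_eq by (rule cSUP_least) auto

lemma N_nonneg: "null_seq c \<Longrightarrow> N c \<ge> 0"
  using sz_le_N[of c 0] null_seq_sz[of c 0] by linarith

text \<open>Only finitely many coefficients have size at least \<open>N c / 2\<close>, so the
  supremum is a maximum. Multiplicativity of the norm and the kernel of the reduction rest on
  this.\<close>

lemma N_attained: assumes c: "null_seq c" obtains \<alpha> where "sz c \<alpha> = N c"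
proof (cases "N c > 0")
  case False
  then have "sz c 0 = N c" using sz_le_N[OF c, of 0] null_seq_sz[OF c, of 0] N_nonneg[OF c] by linarith
  then show thesis by (rule that)
next
  case True
  let ?S = "{\<alpha>. sz c \<alpha> \<ge> N c / 2}"
  have fin: "finite ?S" using null_seq_finite[OF c, of "N c / 2"] True by simp
  have "?S \<noteq> {}"
  proof
    assume "?S = {}"
    then have "N c \<le> N c / 2" by (intro N_le) (auto simp: not_le intro: less_imp_le)
    then show False using True by simp
  qed
  then have "Max (sz c ` ?S) \<in> sz c ` ?S" using fin by (intro Max_in) auto
  then obtain \<alpha> where \<alpha>0: "\<alpha> \<in> ?S" "Max (sz c ` ?S) = sz c \<alpha>" by blast
  have \<alpha>: "\<alpha> \<in> ?S" "\<And>\<beta>. \<beta> \<in> ?S \<Longrightarrow> sz c \<beta> \<le> sz c \<alpha>"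
    using \<alpha>0 fin Max_ge[of "sz c ` ?S"] by auto
  have "N c \<le> sz c \<alpha>"
  proof (rule N_le)
    fix \<beta> show "sz c \<beta> \<le> sz c \<alpha>"
      using \<alpha> by (cases "\<beta> \<in> ?S") auto
  qed
  then show thesis using sz_le_N[OF c, of \<alpha>] that by force
qed

lemma N_eq_0_iff: assumes "null_seq c" shows "N c = 0 \<longleftrightarrow> c = (\<lambda>_. 0)"
proof
  assume N0: "N c = 0"
  have "c \<alpha> = 0" for \<alpha>
  proof (cases "Poly_Mapping.keys \<alpha> \<subseteq> V")
    case True
    have "sz c \<alpha> = 0" using sz_le_N[OF assms, of \<alpha>] null_seq_sz[OF assms, of \<alpha>] N0 by simp
    then show ?thesis using rad_pos[OF True] by (simp add: sz_def nabs_eq_0)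
  qed (use null_seqD[OF assms] in auto)
  then show "c = (\<lambda>_. 0)" by blast
next
  assume "c = (\<lambda>_. 0)"
  then show "N c = 0" unfolding N_eq by (simp add: sz_def)
qed

lemma sz_add: "sz (\<lambda>\<alpha>. c \<alpha> + d \<alpha>) \<alpha> \<le> max (sz c \<alpha>) (sz d \<alpha>)" if "null_seq c" "null_seq d"
proof (cases "Poly_Mapping.keys \<alpha> \<subseteq> V")
  case True
  have "nabs (c \<alpha> + d \<alpha>) * rad \<alpha> \<le> max (nabs (c \<alpha>)) (nabs (d \<alpha>)) * rad \<alpha>"
    using nabs_add rad_pos[OF True] by (intro mult_right_mono) auto
  then show ?thesis unfolding sz_def by (auto simp: max_def split: if_splits)
qed (use null_seqD[OF that(1)] null_seqD[OF that(2)] in \<open>simp add: sz_def\<close>)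

lemma null_seq_add: assumes "null_seq c" "null_seq d" shows "null_seq (\<lambda>\<alpha>. c \<alpha> + d \<alpha>)"
  unfolding null_seq_def
proof (intro conjI allI impI)
  fix \<epsilon> :: real assume \<epsilon>: "\<epsilon> > 0"
  show "finite {\<alpha>. \<epsilon> \<le> sz (\<lambda>\<alpha>. c \<alpha> + d \<alpha>) \<alpha>}"
  proof (rule finite_subset)
    show "{\<alpha>. \<epsilon> \<le> sz (\<lambda>\<alpha>. c \<alpha> + d \<alpha>) \<alpha>} \<subseteq> {\<alpha>. \<epsilon> \<le> sz c \<alpha>} \<union> {\<alpha>. \<epsilon> \<le> sz d \<alpha>}"
    proof
      fix \<alpha> assume "\<alpha> \<in> {\<alpha>. \<epsilon> \<le> sz (\<lambda>\<alpha>. c \<alpha> + d \<alpha>) \<alpha>}"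
      then have "\<epsilon> \<le> max (sz c \<alpha>) (sz d \<alpha>)" using sz_add[OF assms, of \<alpha>] by simp
      then show "\<alpha> \<in> {\<alpha>. \<epsilon> \<le> sz c \<alpha>} \<union> {\<alpha>. \<epsilon> \<le> sz d \<alpha>}" by (auto simp: max_def split: if_splits)
    qed
    show "finite ({\<alpha>. \<epsilon> \<le> sz c \<alpha>} \<union> {\<alpha>. \<epsilon> \<le> sz d \<alpha>})"
      using null_seq_finite[OF _ \<epsilon>] assms by blast
  qed
qed (use null_seqD[OF assms(1)] null_seqD[OF assms(2)] in simp)

lemma null_seq_uminus: "null_seq c \<Longrightarrow> null_seq (\<lambda>\<alpha>. - c \<alpha>)"
  by (simp add: null_seq_def sz_def)

lemma null_seq_diff: "null_seq c \<Longrightarrow> null_seq d \<Longrightarrow> null_seq (\<lambda>\<alpha>. c \<alpha> - d \<alpha>)"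
  using null_seq_add[of c "\<lambda>\<alpha>. - d \<alpha>"] null_seq_uminus[of d] by simp

lemma N_add: "null_seq c \<Longrightarrow> null_seq d \<Longrightarrow> N (\<lambda>\<alpha>. c \<alpha> + d \<alpha>) \<le> max (N c) (N d)"
proof (rule N_le)
  fix \<alpha> assume "null_seq c" "null_seq d"
  then show "sz (\<lambda>\<alpha>. c \<alpha> + d \<alpha>) \<alpha> \<le> max (N c) (N d)"
    using sz_add[of c d \<alpha>] sz_le_N[of c \<alpha>] sz_le_N[of d \<alpha>] by auto
qed

lemma N_uminus: "N (\<lambda>\<alpha>. - c \<alpha>) = N c"
  by (simp add: N_eq sz_def)

definition conv :: "(('i \<Rightarrow>\<^sub>0 int) \<Rightarrow> 'k::complete_nonarch_field) \<Rightarrow> (('i \<Rightarrow>\<^sub>0 int) \<Rightarrow> 'k) \<Rightarrow> ('i \<Rightarrow>\<^sub>0 int) \<Rightarrow> 'k" where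
  "conv c d \<gamma> = (\<Sum>\<^sub>\<infinity>\<alpha>. c \<alpha> * d (\<gamma> - \<alpha>))"

lemma keys_diff_subset:
  assumes "Poly_Mapping.keys \<gamma> \<subseteq> V" "Poly_Mapping.keys \<alpha> \<subseteq> V"
  shows "Poly_Mapping.keys (\<gamma> - \<alpha> :: 'i \<Rightarrow>\<^sub>0 int) \<subseteq> V"
proof
  fix q assume "q \<in> Poly_Mapping.keys (\<gamma> - \<alpha>)"
  then have "q \<in> Poly_Mapping.keys \<gamma> \<or> q \<in> Poly_Mapping.keys \<alpha>"
    by (auto simp: in_keys_iff lookup_minus)
  then show "q \<in> V" using assms by blast
qed

lemma term_sz:
  assumes "null_seq c" "null_seq d" "Poly_Mapping.keys \<gamma> \<subseteq> V"
  shows "nabs (c \<alpha> * d (\<gamma> - \<alpha>)) * rad \<gamma> = sz c \<alpha> * sz d (\<gamma> - \<alpha>)"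
proof (cases "Poly_Mapping.keys \<alpha> \<subseteq> V")
  case True
  have "rad (\<alpha> + (\<gamma> - \<alpha>)) = rad \<alpha> * rad (\<gamma> - \<alpha>)"
    by (rule rad_add[OF True keys_diff_subset[OF assms(3) True]])
  then show ?thesis by (simp add: sz_def nabs_mult)
qed (use null_seqD[OF assms(1)] in \<open>simp add: sz_def\<close>)

lemma term_finite:
  assumes c: "null_seq c" and d: "null_seq d" and \<gamma>: "Poly_Mapping.keys \<gamma> \<subseteq> V" and \<epsilon>: "\<epsilon> > 0"
  shows "finite {\<alpha>. nabs (c \<alpha> * d (\<gamma> - \<alpha>)) \<ge> \<epsilon>}"
proof (rule finite_subset)
  \<comment> \<open>The added 1 keeps the denominator positive when \<open>d\<close> is
    zero.\<close>
  let ?e = "\<epsilon> * rad \<gamma> / (N d + 1)"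
  have pos: "N d + 1 > 0" using N_nonneg[OF d] by simp
  show "{\<alpha>. nabs (c \<alpha> * d (\<gamma> - \<alpha>)) \<ge> \<epsilon>} \<subseteq> {\<alpha>. sz c \<alpha> \<ge> ?e}"
  proof (intro subsetI CollectI)
    fix \<alpha> assume "\<alpha> \<in> {\<alpha>. nabs (c \<alpha> * d (\<gamma> - \<alpha>)) \<ge> \<epsilon>}"
    then have "\<epsilon> * rad \<gamma> \<le> sz c \<alpha> * sz d (\<gamma> - \<alpha>)"
      using rad_pos[OF \<gamma>] by (simp flip: term_sz[OF c d \<gamma>])
    also have "\<dots> \<le> sz c \<alpha> * (N d + 1)"
      using sz_le_N[OF d, of "\<gamma> - \<alpha>"] null_seq_sz[OF c, of \<alpha>] by (intro mult_left_mono) auto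
    finally show "?e \<le> sz c \<alpha>" using pos by (simp add: field_simps)
  qed
  show "finite {\<alpha>. sz c \<alpha> \<ge> ?e}"
    using null_seq_finite[OF c] pos \<epsilon> rad_pos[OF \<gamma>] by simp
qed

lemma conv_outside: assumes "null_seq c" "null_seq d" "\<not> Poly_Mapping.keys \<gamma> \<subseteq> V" shows "conv c d \<gamma> = 0"
proof -
  have "c \<alpha> * d (\<gamma> - \<alpha>) = 0" for \<alpha>
  proof (cases "Poly_Mapping.keys \<alpha> \<subseteq> V")
    case True
    have "\<not> Poly_Mapping.keys (\<gamma> - \<alpha>) \<subseteq> V"
    proof
      assume "Poly_Mapping.keys (\<gamma> - \<alpha>) \<subseteq> V"
      then have "Poly_Mapping.keys ((\<gamma> - \<alpha>) + \<alpha>) \<subseteq> V"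
        using True Poly_Mapping.keys_add[of "\<gamma> - \<alpha>" \<alpha>] by blast
      then show False using assms(3) by simp
    qed
    then show ?thesis using null_seqD[OF assms(2)] by simp
  qed (use null_seqD[OF assms(1)] in simp)
  then show ?thesis by (simp only: conv_def infsum_0)
qed

lemma conv_sz_less:
  assumes c: "null_seq c" and d: "null_seq d" and e: "e > 0" "\<And>\<alpha>. sz c \<alpha> * sz d (\<gamma> - \<alpha>) < e"
  shows "sz (conv c d) \<gamma> < e"
proof (cases "Poly_Mapping.keys \<gamma> \<subseteq> V")
  case True
  have "nabs (infsum (\<lambda>\<alpha>. c \<alpha> * d (\<gamma> - \<alpha>)) UNIV - sum (\<lambda>\<alpha>. c \<alpha> * d (\<gamma> - \<alpha>)) {}) < e / rad \<gamma>"
  proof (rule nonarch_infsum_less)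
    show "finite {\<alpha>. \<epsilon> \<le> nabs (c \<alpha> * d (\<gamma> - \<alpha>))}" if "\<epsilon> > 0" for \<epsilon>
      by (rule term_finite[OF c d True that])
    show "nabs (c \<alpha> * d (\<gamma> - \<alpha>)) < e / rad \<gamma>" for \<alpha>
      using e(2)[of \<alpha>] rad_pos[OF True] by (simp add: term_sz[OF c d True, symmetric] pos_less_divide_eq)
  qed (use e rad_pos[OF True] in auto)
  then show ?thesis using rad_pos[OF True] by (simp add: sz_def conv_def pos_less_divide_eq)
qed (use conv_outside[OF c d] e in \<open>simp add: sz_def\<close>)

text \<open>If a coefficient of the product has size at least \<epsilon>, so has one of its terms,
  and then both factors of this term reach fixed thresholds. The exponent thus lies in the sumset of
  two finite sets.\<close>

lemma null_seq_conv: assumes c: "null_seq c" and d: "null_seq d" shows "null_seq (conv c d)"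
  unfolding null_seq_def
proof (intro conjI allI impI)
  fix \<epsilon> :: real assume \<epsilon>: "\<epsilon> > 0"
  let ?C = "{\<alpha>. sz c \<alpha> \<ge> \<epsilon> / (N d + 1)}" and ?D = "{\<beta>. sz d \<beta> \<ge> \<epsilon> / (N c + 1)}"
  have pos: "N d + 1 > 0" "N c + 1 > 0" using N_nonneg[OF d] N_nonneg[OF c] by auto
  show "finite {\<gamma>. \<epsilon> \<le> sz (conv c d) \<gamma>}"
  proof (rule finite_subset)
    show "{\<gamma>. \<epsilon> \<le> sz (conv c d) \<gamma>} \<subseteq> (\<lambda>(\<alpha>, \<beta>). \<alpha> + \<beta>) ` (?C \<times> ?D)"
    proof
      fix \<gamma> assume "\<gamma> \<in> {\<gamma>. \<epsilon> \<le> sz (conv c d) \<gamma>}"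
      then have "\<not> (\<forall>\<alpha>. sz c \<alpha> * sz d (\<gamma> - \<alpha>) < \<epsilon>)"
        using conv_sz_less[OF c d \<epsilon>, of \<gamma>] by auto
      then obtain \<alpha> where \<alpha>: "\<epsilon> \<le> sz c \<alpha> * sz d (\<gamma> - \<alpha>)" by (auto simp: not_less)
      have "sz c \<alpha> * sz d (\<gamma> - \<alpha>) \<le> sz c \<alpha> * (N d + 1)"
        using sz_le_N[OF d, of "\<gamma> - \<alpha>"] null_seq_sz[OF c, of \<alpha>] by (intro mult_left_mono) auto
      then have "\<alpha> \<in> ?C" using \<alpha> pos by (simp add: pos_divide_le_eq)
      moreover have "sz c \<alpha> * sz d (\<gamma> - \<alpha>) \<le> (N c + 1) * sz d (\<gamma> - \<alpha>)"
        using sz_le_N[OF c, of \<alpha>] null_seq_sz[OF d, of "\<gamma> - \<alpha>"] by (intro mult_right_mono) auto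
      then have "\<gamma> - \<alpha> \<in> ?D" using \<alpha> pos by (simp add: pos_divide_le_eq mult.commute)
      ultimately show "\<gamma> \<in> (\<lambda>(\<alpha>, \<beta>). \<alpha> + \<beta>) ` (?C \<times> ?D)"
        by (intro image_eqI[of _ _ "(\<alpha>, \<gamma> - \<alpha>)"]) auto
    qed
    show "finite ((\<lambda>(\<alpha>, \<beta>). \<alpha> + \<beta>) ` (?C \<times> ?D))"
      using null_seq_finite[OF c, of "\<epsilon> / (N d + 1)"] null_seq_finite[OF d, of "\<epsilon> / (N c + 1)"] pos \<epsilon> by simp
  qed
qed (rule conv_outside[OF c d])

lemma N_conv_le: assumes c: "null_seq c" and d: "null_seq d" shows "N (conv c d) \<le> N c * N d"
proof (rule N_le)
  fix \<gamma>
  have le: "sz c \<alpha> * sz d (\<gamma> - \<alpha>) \<le> N c * N d" for \<alpha>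
    using sz_le_N[OF c] sz_le_N[OF d] null_seq_sz[OF c] null_seq_sz[OF d] N_nonneg[OF c] by (intro mult_mono) auto
  show "sz (conv c d) \<gamma> \<le> N c * N d"
  proof (rule field_le_epsilon)
    fix \<epsilon> :: real assume "\<epsilon> > 0"
    then have "sz (conv c d) \<gamma> < N c * N d + \<epsilon>"
      using N_nonneg[OF c] N_nonneg[OF d]
      by (intro conv_sz_less[OF c d] le_less_trans[OF le]) (auto intro: add_nonneg_pos)
    then show "sz (conv c d) \<gamma> \<le> N c * N d + \<epsilon>" by simp
  qed
qed

text \<open>The largest exponents (for the additive order on exponents) at which c and d attain their
  norms add up to an exponent at which the product attains the product of the norms.\<close>

lemma N_conv:
  fixes c d :: "_ \<Rightarrow> 'k::complete_nonarch_field"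
  assumes c: "null_seq c" and d: "null_seq d" shows "N (conv c d) = N c * N d"
proof (cases "N c = 0 \<or> N d = 0")
  case True
  then show ?thesis using N_conv_le[OF c d] N_nonneg[OF null_seq_conv[OF c d]] by auto
next
  case False
  then have pos: "N c > 0" "N d > 0" using N_nonneg[OF c] N_nonneg[OF d] by auto
  have top: "\<exists>\<alpha>. sz b \<alpha> = N b \<and> (\<forall>\<beta>. sz b \<beta> = N b \<longrightarrow> \<beta> \<le> \<alpha>)" if b: "null_seq b" "N b > 0" for b :: "_ \<Rightarrow> 'k"
  proof -
    have "finite {\<alpha>. sz b \<alpha> = N b}"
      by (rule finite_subset[OF _ null_seq_finite[OF b]]) auto
    moreover have "{\<alpha>. sz b \<alpha> = N b} \<noteq> {}" using N_attained[OF b(1)] by blast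
    ultimately show ?thesis using Max_in[of "{\<alpha>. sz b \<alpha> = N b}"] Max_ge[of "{\<alpha>. sz b \<alpha> = N b}"] by blast
  qed
  obtain \<alpha> where \<alpha>: "sz c \<alpha> = N c" "\<And>\<beta>. sz c \<beta> = N c \<Longrightarrow> \<beta> \<le> \<alpha>" using top[OF c pos(1)] by blast
  obtain \<beta> where \<beta>: "sz d \<beta> = N d" "\<And>\<alpha>. sz d \<alpha> = N d \<Longrightarrow> \<alpha> \<le> \<beta>" using top[OF d pos(2)] by blast
  define \<gamma> where "\<gamma> = \<alpha> + \<beta>"
  have kV: "Poly_Mapping.keys \<alpha> \<subseteq> V" "Poly_Mapping.keys \<beta> \<subseteq> V"
  proof -
    have "c \<alpha> \<noteq> 0" "d \<beta> \<noteq> 0" using \<alpha>(1) \<beta>(1) pos by (auto simp: sz_def)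
    then show "Poly_Mapping.keys \<alpha> \<subseteq> V" "Poly_Mapping.keys \<beta> \<subseteq> V"
      using null_seqD[OF c] null_seqD[OF d] by blast+
  qed
  then have \<gamma>V: "Poly_Mapping.keys \<gamma> \<subseteq> V" using Poly_Mapping.keys_add[of \<alpha> \<beta>] by (auto simp: \<gamma>_def)
  have "nabs (infsum (\<lambda>\<alpha>. c \<alpha> * d (\<gamma> - \<alpha>)) UNIV - sum (\<lambda>\<alpha>. c \<alpha> * d (\<gamma> - \<alpha>)) {\<alpha>}) < N c * N d / rad \<gamma>"
  proof (rule nonarch_infsum_less)
    show "finite {\<alpha>. \<epsilon> \<le> nabs (c \<alpha> * d (\<gamma> - \<alpha>))}" if "\<epsilon> > 0" for \<epsilon>
      by (rule term_finite[OF c d \<gamma>V that])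
    fix \<alpha>' assume "\<alpha>' \<notin> {\<alpha>}"
    then have ne: "\<alpha>' \<noteq> \<alpha>" by simp
    \<comment> \<open>In any other decomposition of \<open>\<gamma>\<close> one part exceeds the
      largest exponent at which the norm is attained, because the order on exponents is linear and
      compatible with addition.\<close>
    have "\<not> (sz c \<alpha>' = N c \<and> sz d (\<gamma> - \<alpha>') = N d)"
    proof
      assume "sz c \<alpha>' = N c \<and> sz d (\<gamma> - \<alpha>') = N d"
      then have "\<alpha>' \<le> \<alpha>" "\<gamma> - \<alpha>' \<le> \<beta>" using \<alpha> \<beta> by auto
      then have "\<alpha>' < \<alpha>" "\<alpha> \<le> \<alpha>'" using ne by (auto simp: \<gamma>_def diff_le_eq add.commute)
      then show False by simp
    qed
    then have "sz c \<alpha>' < N c \<or> sz d (\<gamma> - \<alpha>') < N d"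
      using sz_le_N[OF c, of \<alpha>'] sz_le_N[OF d, of "\<gamma> - \<alpha>'"] by linarith
    then have "sz c \<alpha>' * sz d (\<gamma> - \<alpha>') < N c * N d"
    proof
      assume *: "sz c \<alpha>' < N c"
      have "sz c \<alpha>' * sz d (\<gamma> - \<alpha>') \<le> sz c \<alpha>' * N d"
        using sz_le_N[OF d] null_seq_sz[OF c] by (intro mult_left_mono) auto
      also have "\<dots> < N c * N d" using * pos by simp
      finally show ?thesis .
    next
      assume *: "sz d (\<gamma> - \<alpha>') < N d"
      have "sz c \<alpha>' * sz d (\<gamma> - \<alpha>') \<le> N c * sz d (\<gamma> - \<alpha>')"
        using sz_le_N[OF c] null_seq_sz[OF d] by (intro mult_right_mono) auto
      also have "\<dots> < N c * N d" using * pos by simp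
      finally show ?thesis .
    qed
    then show "nabs (c \<alpha>' * d (\<gamma> - \<alpha>')) < N c * N d / rad \<gamma>"
      using rad_pos[OF \<gamma>V] by (simp add: term_sz[OF c d \<gamma>V, symmetric] pos_less_divide_eq)
  qed (use pos rad_pos[OF \<gamma>V] in auto)
  then have lt: "nabs (conv c d \<gamma> - c \<alpha> * d \<beta>) * rad \<gamma> < N c * N d"
    using rad_pos[OF \<gamma>V] by (simp add: conv_def \<gamma>_def pos_less_divide_eq)
  have eq: "nabs (c \<alpha> * d \<beta>) * rad \<gamma> = N c * N d"
    using term_sz[OF c d \<gamma>V, of \<alpha>] \<alpha>(1) \<beta>(1) by (simp add: \<gamma>_def)
  have "nabs (c \<alpha> * d \<beta>) \<le> max (nabs (conv c d \<gamma>)) (nabs (conv c d \<gamma> - c \<alpha> * d \<beta>))"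
    using nabs_diff[of "conv c d \<gamma>" "conv c d \<gamma> - c \<alpha> * d \<beta>"] by simp
  then have "nabs (c \<alpha> * d \<beta>) * rad \<gamma> \<le> max (nabs (conv c d \<gamma>)) (nabs (conv c d \<gamma> - c \<alpha> * d \<beta>)) * rad \<gamma>"
    using rad_pos[OF \<gamma>V] by (intro mult_right_mono) auto
  then have "N c * N d \<le> sz (conv c d) \<gamma>"
    using lt eq by (auto simp: sz_def max_def split: if_splits)
  then show ?thesis
    using sz_le_N[OF null_seq_conv[OF c d], of \<gamma>] N_conv_le[OF c d] by simp
qed

lemma conv_add_left:
  assumes "null_seq c" "null_seq c'" "null_seq d"
  shows "conv (\<lambda>\<alpha>. c \<alpha> + c' \<alpha>) d = (\<lambda>\<alpha>. conv c d \<alpha> + conv c' d \<alpha>)"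
proof
  fix \<gamma>
  show "conv (\<lambda>\<alpha>. c \<alpha> + c' \<alpha>) d \<gamma> = conv c d \<gamma> + conv c' d \<gamma>"
  proof (cases "Poly_Mapping.keys \<gamma> \<subseteq> V")
    case True
    show ?thesis unfolding conv_def distrib_right
      by (rule nonarch_infsum_add; rule term_finite) (use assms True in auto)
  qed (use conv_outside[OF assms(1,3)] conv_outside[OF assms(2,3)] conv_outside[OF null_seq_add[OF assms(1,2)] assms(3)] in simp)
qed

lemma conv_commute: "conv c d = conv d c"
proof
  fix \<gamma>
  have "bij_betw (\<lambda>\<alpha>. \<gamma> - \<alpha>) UNIV (UNIV :: ('i \<Rightarrow>\<^sub>0 int) set)"
    by (rule bij_betwI[where g = "\<lambda>\<alpha>. \<gamma> - \<alpha>"]) auto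
  from infsum_reindex_bij_betw[OF this, of "\<lambda>\<alpha>. c \<alpha> * d (\<gamma> - \<alpha>)"]
  show "conv c d \<gamma> = conv d c \<gamma>" by (simp add: conv_def mult.commute)
qed

lemma null_seq_lookup:
  assumes "\<And>\<alpha>. \<alpha> \<in> Poly_Mapping.keys p \<Longrightarrow> Poly_Mapping.keys \<alpha> \<subseteq> V"
  shows "null_seq (Poly_Mapping.lookup p)"
  unfolding null_seq_def
proof (intro conjI allI impI)
  fix \<epsilon> :: real assume "\<epsilon> > 0"
  then show "finite {\<alpha>. \<epsilon> \<le> sz (Poly_Mapping.lookup p) \<alpha>}"
    by (intro finite_subset[OF _ finite_keys[of p]]) (auto simp: sz_def in_keys_iff)
qed (use assms in \<open>auto simp: in_keys_iff\<close>)

lemma conv_lookup: "conv (Poly_Mapping.lookup p) (Poly_Mapping.lookup q) = Poly_Mapping.lookup (p * q)"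
proof
  fix \<gamma>
  have "conv (Poly_Mapping.lookup p) (Poly_Mapping.lookup q) \<gamma> =
      (\<Sum>\<alpha>\<in>Poly_Mapping.keys p. Poly_Mapping.lookup p \<alpha> * Poly_Mapping.lookup q (\<gamma> - \<alpha>))"
    unfolding conv_def by (rule nonarch_infsum_finite) (auto simp: in_keys_iff)
  also have "\<dots> = (\<Sum>\<alpha>\<in>Poly_Mapping.keys p. \<Sum>\<beta>\<in>Poly_Mapping.keys q.
      if \<beta> = \<gamma> - \<alpha> then Poly_Mapping.lookup p \<alpha> * Poly_Mapping.lookup q \<beta> else 0)"
    by (intro sum.cong refl) (simp add: sum.delta' in_keys_iff)
  also have "\<dots> = Poly_Mapping.lookup (p * q) \<gamma>"
    unfolding lookup_mult_sum lookup_sum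
    by (intro sum.cong refl) (auto simp: lookup_single when_def)
  finally show "conv (Poly_Mapping.lookup p) (Poly_Mapping.lookup q) \<gamma> = Poly_Mapping.lookup (p * q) \<gamma>" .
qed

lemma poly_dense:
  assumes c: "null_seq c" and \<epsilon>: "\<epsilon> > 0"
  obtains p where "null_seq (Poly_Mapping.lookup p)" "N (\<lambda>\<alpha>. c \<alpha> - Poly_Mapping.lookup p \<alpha>) \<le> \<epsilon>"
proof -
  define p where "p = Abs_poly_mapping (\<lambda>\<alpha>. if sz c \<alpha> \<ge> \<epsilon> then c \<alpha> else 0)"
  have "finite {\<alpha>. (if sz c \<alpha> \<ge> \<epsilon> then c \<alpha> else 0) \<noteq> 0}"
    by (rule finite_subset[OF _ null_seq_finite[OF c \<epsilon>]]) auto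
  then have l: "Poly_Mapping.lookup p \<alpha> = (if sz c \<alpha> \<ge> \<epsilon> then c \<alpha> else 0)" for \<alpha>
    unfolding p_def by (subst lookup_Abs_poly_mapping) auto
  have "null_seq (Poly_Mapping.lookup p)"
    by (rule null_seq_lookup) (use null_seqD[OF c] in \<open>auto simp: in_keys_iff l split: if_splits\<close>)
  moreover have "N (\<lambda>\<alpha>. c \<alpha> - Poly_Mapping.lookup p \<alpha>) \<le> \<epsilon>"
  proof (rule N_le)
    fix \<alpha>
    show "sz (\<lambda>\<alpha>. c \<alpha> - Poly_Mapping.lookup p \<alpha>) \<alpha> \<le> \<epsilon>"
      using \<epsilon> by (cases "sz c \<alpha> \<ge> \<epsilon>") (auto simp: l sz_def)
  qed
  ultimately show thesis by (rule that)
qed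

lemma conv_diff_left:
  assumes "null_seq c" "null_seq c'" "null_seq d"
  shows "conv (\<lambda>\<alpha>. c \<alpha> - c' \<alpha>) d = (\<lambda>\<alpha>. conv c d \<alpha> - conv c' d \<alpha>)"
proof -
  have "conv c d = (\<lambda>\<alpha>. conv (\<lambda>\<alpha>. c \<alpha> - c' \<alpha>) d \<alpha> + conv c' d \<alpha>)"
    using conv_add_left[OF null_seq_diff[OF assms(1,2)] assms(2,3)] by simp
  then show ?thesis by (metis add_diff_cancel)
qed

lemma conv_diff_right:
  assumes "null_seq c" "null_seq d" "null_seq d'"
  shows "conv c (\<lambda>\<alpha>. d \<alpha> - d' \<alpha>) = (\<lambda>\<alpha>. conv c d \<alpha> - conv c d' \<alpha>)"
  using conv_diff_left[OF assms(2,3,1)] by (simp add: conv_commute[of c])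

lemma N_diff: "null_seq c \<Longrightarrow> null_seq d \<Longrightarrow> N (\<lambda>\<alpha>. c \<alpha> - d \<alpha>) \<le> max (N c) (N d)"
  using N_add[of c "\<lambda>\<alpha>. - d \<alpha>"] null_seq_uminus[of d] N_uminus[of d] by simp

text \<open>The associator is bounded by the product of the norms, and it vanishes on Laurent polynomials.\<close>

lemma conv_assoc:
  fixes c d e :: "_ \<Rightarrow> 'k::complete_nonarch_field"
  assumes c: "null_seq c" and d: "null_seq d" and e: "null_seq e"
  shows "conv (conv c d) e = conv c (conv d e)"
proof -
  define assoc where "assoc c d e = (\<lambda>\<alpha>. conv (conv c d) e \<alpha> - conv c (conv d e) \<alpha>)" for c d e :: "_ \<Rightarrow> 'k"
  have nul: "null_seq (assoc c d e)" if "null_seq c" "null_seq d" "null_seq e" for c d e :: "_ \<Rightarrow> 'k"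
    unfolding assoc_def using that by (intro null_seq_diff null_seq_conv)
  have bd: "N (assoc c d e) \<le> N c * N d * N e" if "null_seq c" "null_seq d" "null_seq e" for c d e :: "_ \<Rightarrow> 'k"
    unfolding assoc_def using that
    by (intro order_trans[OF N_diff]) (simp_all add: null_seq_conv N_conv mult.assoc)
  have d1: "assoc (\<lambda>\<alpha>. c \<alpha> - c' \<alpha>) d e = (\<lambda>\<alpha>. assoc c d e \<alpha> - assoc c' d e \<alpha>)"
    if "null_seq c" "null_seq c'" "null_seq d" "null_seq e" for c c' d e :: "_ \<Rightarrow> 'k"
    unfolding assoc_def using that
    by (simp add: conv_diff_left null_seq_conv null_seq_diff) (simp add: algebra_simps)
  have d2: "assoc c (\<lambda>\<alpha>. d \<alpha> - d' \<alpha>) e = (\<lambda>\<alpha>. assoc c d e \<alpha> - assoc c d' e \<alpha>)"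
    if "null_seq c" "null_seq d" "null_seq d'" "null_seq e" for c d d' e :: "_ \<Rightarrow> 'k"
    unfolding assoc_def using that
    by (simp add: conv_diff_left conv_diff_right null_seq_conv null_seq_diff) (simp add: algebra_simps)
  have d3: "assoc c d (\<lambda>\<alpha>. e \<alpha> - e' \<alpha>) = (\<lambda>\<alpha>. assoc c d e \<alpha> - assoc c d e' \<alpha>)"
    if "null_seq c" "null_seq d" "null_seq e" "null_seq e'" for c d e e' :: "_ \<Rightarrow> 'k"
    unfolding assoc_def using that
    by (simp add: conv_diff_right null_seq_conv null_seq_diff) (simp add: algebra_simps)
  have poly: "assoc (Poly_Mapping.lookup p) (Poly_Mapping.lookup q) (Poly_Mapping.lookup r) = (\<lambda>_. 0)"
    for p q r :: "('i \<Rightarrow>\<^sub>0 int) \<Rightarrow>\<^sub>0 'k"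
    by (simp add: assoc_def conv_lookup mult.assoc)
  define B where "B = max 1 (max (N c) (max (N d) (N e)))"
  have B: "B \<ge> 1" "N c \<le> B" "N d \<le> B" "N e \<le> B" by (auto simp: B_def)
  have "N (assoc c d e) \<le> 0"
  proof (rule field_le_epsilon)
    fix \<epsilon>' :: real assume \<epsilon>': "\<epsilon>' > 0"
    \<comment> \<open>At most 1, so that the approximants also have norm at most \<open>B\<close>;
      divided by \<open>B * B\<close>, since an error in one factor is multiplied by the norms of
      the other two.\<close>
    define \<epsilon> where "\<epsilon> = min 1 (\<epsilon>' / (B * B))"
    have \<epsilon>: "\<epsilon> > 0" "\<epsilon> \<le> 1" "\<epsilon> * (B * B) \<le> \<epsilon>'"
      using \<epsilon>' B(1) by (auto simp: \<epsilon>_def min_def field_simps)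
    obtain p where p: "null_seq (Poly_Mapping.lookup p)" "N (\<lambda>\<alpha>. c \<alpha> - Poly_Mapping.lookup p \<alpha>) \<le> \<epsilon>"
      using poly_dense[OF c \<epsilon>(1)] by metis
    obtain q where q: "null_seq (Poly_Mapping.lookup q)" "N (\<lambda>\<alpha>. d \<alpha> - Poly_Mapping.lookup q \<alpha>) \<le> \<epsilon>"
      using poly_dense[OF d \<epsilon>(1)] by metis
    obtain r where r: "null_seq (Poly_Mapping.lookup r)" "N (\<lambda>\<alpha>. e \<alpha> - Poly_Mapping.lookup r \<alpha>) \<le> \<epsilon>"
      using poly_dense[OF e \<epsilon>(1)] by metis
    let ?p = "Poly_Mapping.lookup p" and ?q = "Poly_Mapping.lookup q" and ?r = "Poly_Mapping.lookup r"
    have "N ?p \<le> max (N c) (N (\<lambda>\<alpha>. c \<alpha> - ?p \<alpha>))"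
      using N_diff[OF c null_seq_diff[OF c p(1)]] by simp
    then have Np: "N ?p \<le> B" using B p(2) \<epsilon>(2) by simp
    have "N ?q \<le> max (N d) (N (\<lambda>\<alpha>. d \<alpha> - ?q \<alpha>))"
      using N_diff[OF d null_seq_diff[OF d q(1)]] by simp
    then have Nq: "N ?q \<le> B" using B q(2) \<epsilon>(2) by simp
    note nn = N_nonneg
    have three: "a * b * b' \<le> \<epsilon>'" if "0 \<le> a" "0 \<le> b" "0 \<le> b'" "a \<le> \<epsilon>" "b \<le> B" "b' \<le> B" for a b b' :: real
    proof -
      have "a * b * b' \<le> \<epsilon> * B * B" using that B(1) \<epsilon>(1) by (intro mult_mono) auto
      then show ?thesis using \<epsilon>(3) by (simp add: mult.assoc)
    qed
    define E where "E = (\<lambda>\<alpha>. c \<alpha> - ?p \<alpha>)"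
    define F where "F = (\<lambda>\<alpha>. d \<alpha> - ?q \<alpha>)"
    define G where "G = (\<lambda>\<alpha>. e \<alpha> - ?r \<alpha>)"
    have EFG: "null_seq E" "null_seq F" "null_seq G"
      unfolding E_def F_def G_def using c d e p q r by (auto intro: null_seq_diff)
    have t1: "N (assoc E d e) \<le> \<epsilon>'"
      using bd[OF EFG(1) d e] three[of "N E" "N d" "N e"] p(2) B nn EFG d e by (fastforce simp: E_def)
    have t2: "N (assoc ?p F e) \<le> \<epsilon>'"
      using bd[OF p(1) EFG(2) e] three[of "N F" "N ?p" "N e"] q(2) Np B nn EFG p(1) e
      by (fastforce simp: F_def mult_ac)
    have t3: "N (assoc ?p ?q G) \<le> \<epsilon>'"
      using bd[OF p(1) q(1) EFG(3)] three[of "N G" "N ?p" "N ?q"] r(2) Np Nq nn EFG p(1) q(1)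
      by (fastforce simp: G_def mult_ac)
    \<comment> \<open>The factors are replaced by Laurent polynomials one at a time, and the
      associator of the three polynomials is 0.\<close>
    have "assoc c d e = (\<lambda>\<alpha>. assoc E d e \<alpha> + (assoc ?p F e \<alpha> + assoc ?p ?q G \<alpha>))"
      unfolding E_def F_def G_def d1[OF c p(1) d e] d2[OF p(1) d q(1) e] d3[OF p(1) q(1) e r(1)]
      using poly[of p q r] by (simp add: fun_eq_iff)
    then have "N (assoc c d e) \<le> max (N (assoc E d e)) (max (N (assoc ?p F e)) (N (assoc ?p ?q G)))"
      using EFG c d e p(1) q(1)
      by (simp only:) (intro order_trans[OF N_add] max.mono nul null_seq_add order_refl)
    then show "N (assoc c d e) \<le> 0 + \<epsilon>'" using t1 t2 t3 by simp
  qed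
  then have "N (assoc c d e) = 0" using N_nonneg[OF nul[OF c d e]] by simp
  then have "assoc c d e = (\<lambda>_. 0)" using N_eq_0_iff[OF nul[OF c d e]] by simp
  then show ?thesis by (simp add: assoc_def fun_eq_iff)
qed

lemma null_seq_const: "null_seq (torus_const a)"
  unfolding null_seq_def
proof (intro conjI allI impI)
  fix \<epsilon> :: real assume "\<epsilon> > 0"
  show "finite {\<alpha>. \<epsilon> \<le> sz (torus_const a) \<alpha>}"
    by (rule finite_subset[of _ "{0}"]) (use \<open>\<epsilon> > 0\<close> in \<open>auto simp: sz_def torus_const_def split: if_splits\<close>)
qed (auto simp: torus_const_def)

lemma conv_const: "conv (torus_const a) d \<gamma> = a * d \<gamma>"
proof -
  have "conv (torus_const a) d \<gamma> = (\<Sum>\<alpha>\<in>{0}. torus_const a \<alpha> * d (\<gamma> - \<alpha>))"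
    unfolding conv_def by (rule nonarch_infsum_finite) (auto simp: torus_const_def)
  then show ?thesis by (simp add: torus_const_def)
qed

lemma N_const: "N (torus_const a :: _ \<Rightarrow> 'k::complete_nonarch_field) = nabs a"
proof (rule antisym)
  show "N (torus_const a) \<le> nabs a"
    by (rule N_le) (auto simp: sz_def torus_const_def nabs_nonneg)
  show "nabs a \<le> N (torus_const a)"
    using sz_le_N[OF null_seq_const[of a], of 0] by (simp add: sz_def torus_const_def)
qed

lemma torus_sel:
  "\<zero>\<^bsub>torus_algebra V \<rho>\<^esub> = (\<lambda>_. 0)" "\<one>\<^bsub>torus_algebra V \<rho>\<^esub> = torus_const 1"
  "c \<oplus>\<^bsub>torus_algebra V \<rho>\<^esub> d = (\<lambda>\<alpha>. c \<alpha> + d \<alpha>)" "c \<otimes>\<^bsub>torus_algebra V \<rho>\<^esub> d = conv c d"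
  by (simp_all add: torus_algebra_def torus_const_def conv_def fun_eq_iff)

lemma torus_cring: "cring (torus_algebra V \<rho> :: (('i \<Rightarrow>\<^sub>0 int) \<Rightarrow> 'k::complete_nonarch_field) normed_ring)"
proof (rule cringI)
  show "abelian_group (torus_algebra V \<rho> :: (('i \<Rightarrow>\<^sub>0 int) \<Rightarrow> 'k) normed_ring)"
  proof (rule abelian_groupI)
    show "\<zero>\<^bsub>torus_algebra V \<rho>\<^esub> \<in> carrier (torus_algebra V \<rho> :: (('i \<Rightarrow>\<^sub>0 int) \<Rightarrow> 'k) normed_ring)"
      using null_seq_const[of 0] by (simp add: carrier_eq torus_sel torus_const_def)
    show "\<exists>y\<in>carrier (torus_algebra V \<rho>). y \<oplus>\<^bsub>torus_algebra V \<rho>\<^esub> c = \<zero>\<^bsub>torus_algebra V \<rho>\<^esub>"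
      if "c \<in> carrier (torus_algebra V \<rho>)" for c :: "('i \<Rightarrow>\<^sub>0 int) \<Rightarrow> 'k"
      using that null_seq_uminus[of c] by (intro bexI[of _ "\<lambda>\<alpha>. - c \<alpha>"]) (auto simp: carrier_eq torus_sel)
  qed (auto simp: carrier_eq torus_sel null_seq_add add_ac)
  show "comm_monoid (torus_algebra V \<rho> :: (('i \<Rightarrow>\<^sub>0 int) \<Rightarrow> 'k) normed_ring)"
    by (rule comm_monoidI)
      (auto simp: carrier_eq torus_sel null_seq_conv null_seq_const conv_assoc conv_const fun_eq_iff
        intro: conv_commute[THEN fun_cong])
qed (auto simp: carrier_eq torus_sel conv_add_left)

lemma torus_a_inv:
  assumes "null_seq c"
  shows "\<ominus>\<^bsub>torus_algebra V \<rho>\<^esub> c = (\<lambda>\<alpha>. - (c \<alpha> :: 'k::complete_nonarch_field))"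
proof -
  interpret cring "torus_algebra V \<rho> :: (('i \<Rightarrow>\<^sub>0 int) \<Rightarrow> 'k) normed_ring" by (rule torus_cring)
  show ?thesis
    by (rule minus_equality) (use assms null_seq_uminus in \<open>auto simp: carrier_eq torus_sel\<close>)
qed

lemma torus_valued: "valued_cring (torus_algebra V \<rho> :: (('i \<Rightarrow>\<^sub>0 int) \<Rightarrow> 'k::complete_nonarch_field) normed_ring)"
proof -
  interpret cring "torus_algebra V \<rho> :: (('i \<Rightarrow>\<^sub>0 int) \<Rightarrow> 'k) normed_ring" by (rule torus_cring)
  show ?thesis
  proof
    show "N (\<zero>\<^bsub>torus_algebra V \<rho>\<^esub> :: _ \<Rightarrow> 'k) = 0"
      using N_const[of "0 :: 'k"] by (simp add: torus_sel torus_const_def)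
    show "N (\<one>\<^bsub>torus_algebra V \<rho>\<^esub> :: _ \<Rightarrow> 'k) = 1" by (simp add: torus_sel N_const)
  qed (auto simp: carrier_eq torus_sel N_nonneg torus_a_inv N_uminus N_add N_conv)
qed

end

section \<open>Relative Tate algebras and Laurent domains\<close>

lemma finsum_nrm_le:
  assumes "seminormed_cring R" "e \<ge> 0" "\<And>x. x \<in> A \<Longrightarrow> f x \<in> carrier R" "\<And>x. x \<in> A \<Longrightarrow> nrm R (f x) \<le> e"
  shows "nrm R (finsum R f A) \<le> e"
proof -
  interpret seminormed_cring R by fact
  show ?thesis using assms(3,4)
  proof (induction A rule: infinite_finite_induct)
    case (insert x F)
    have f: "f \<in> F \<rightarrow> carrier R" "f x \<in> carrier R" using insert.prems(1) by auto
    have "nrm R (f x \<oplus>\<^bsub>R\<^esub> finsum R f F) \<le> max (nrm R (f x)) (nrm R (finsum R f F))"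
      using f by (intro nrm_add finsum_closed)
    also have "\<dots> \<le> e" using insert.IH insert.prems by simp
    finally show ?case using insert.hyps f by (simp add: finsum_insert)
  qed (use assms(2) in \<open>simp_all add: finsum_infinite nrm_zero\<close>)
qed

text \<open>Formal power series over an arbitrary commutative ring. Applied twice it gives formal
  series in x and y, of which the relative Tate algebra is a subring.\<close>

definition pser :: "('a, 'z) ring_scheme \<Rightarrow> (nat \<Rightarrow> 'a) ring" where
  "pser R = \<lparr>carrier = {a. \<forall>n. a n \<in> carrier R},
    mult = (\<lambda>a b n. \<Oplus>\<^bsub>R\<^esub>i\<in>{..n}. a i \<otimes>\<^bsub>R\<^esub> b (n - i)),
    one = (\<lambda>n. if n = 0 then \<one>\<^bsub>R\<^esub> else \<zero>\<^bsub>R\<^esub>), zero = (\<lambda>_. \<zero>\<^bsub>R\<^esub>),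
    add = (\<lambda>a b n. a n \<oplus>\<^bsub>R\<^esub> b n)\<rparr>"

lemma pser_sel:
  "carrier (pser R) = {a. \<forall>n. a n \<in> carrier R}"
  "a \<otimes>\<^bsub>pser R\<^esub> b = (\<lambda>n. \<Oplus>\<^bsub>R\<^esub>i\<in>{..n}. a i \<otimes>\<^bsub>R\<^esub> b (n - i))"
  "\<one>\<^bsub>pser R\<^esub> = (\<lambda>n. if n = 0 then \<one>\<^bsub>R\<^esub> else \<zero>\<^bsub>R\<^esub>)" "\<zero>\<^bsub>pser R\<^esub> = (\<lambda>_. \<zero>\<^bsub>R\<^esub>)"
  "a \<oplus>\<^bsub>pser R\<^esub> b = (\<lambda>n. a n \<oplus>\<^bsub>R\<^esub> b n)"
  by (simp_all add: pser_def)

text \<open>The coefficients of a product up to a given degree only depend on truncations of the factors,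
  so the ring axioms for power series are inherited from the polynomial ring.\<close>

lemma pser_cring:
  assumes "cring R"
  shows "cring (pser R)"
proof -
  interpret R: cring R by fact
  interpret U: UP_cring R "UP R" by (intro UP_cring.intro assms) simp_all
  define tr where "tr N a = (\<lambda>i. if i \<le> N then a i else \<zero>\<^bsub>R\<^esub>)" for N :: nat and a :: "nat \<Rightarrow> _"
  have trc: "tr N a \<in> carrier (UP R)" if "a \<in> carrier (pser R)" for N a
    using that by (auto simp: UP_def tr_def pser_sel intro!: mem_upI exI[of _ N] bound.intro)
  have tra: "tr N a m = a m" if "m \<le> N" for N a m using that by (simp add: tr_def)
  have cl: "a m \<in> carrier R" if "a \<in> carrier (pser R)" for a m using that by (simp add: pser_sel)
  have mult: "(a \<otimes>\<^bsub>pser R\<^esub> b) m = (a' \<otimes>\<^bsub>UP R\<^esub> b') m"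
    if "a \<in> carrier (pser R)" "b \<in> carrier (pser R)" "a' \<in> carrier (UP R)" "b' \<in> carrier (UP R)"
      "\<And>i. i \<le> m \<Longrightarrow> a i = a' i" "\<And>i. i \<le> m \<Longrightarrow> b i = b' i" for a b a' b' m
  proof -
    have up: "a' \<in> up R" "b' \<in> up R" using that(3,4) by (simp_all add: UP_def)
    have "(a \<otimes>\<^bsub>pser R\<^esub> b) m = (\<Oplus>\<^bsub>R\<^esub>i\<in>{..m}. a' i \<otimes>\<^bsub>R\<^esub> b' (m - i))"
      unfolding pser_sel by (rule R.finsum_cong') (use that up in \<open>auto intro!: R.m_closed\<close>)
    also have "\<dots> = (a' \<otimes>\<^bsub>UP R\<^esub> b') m" using up by (simp add: UP_def)
    finally show ?thesis .
  qed
  have closed: "a \<otimes>\<^bsub>pser R\<^esub> b \<in> carrier (pser R)" if "a \<in> carrier (pser R)" "b \<in> carrier (pser R)" for a b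
    using that by (auto simp: pser_sel intro!: R.finsum_closed)
  show ?thesis
  proof (rule cringI)
    show "abelian_group (pser R)"
    proof (rule abelian_groupI)
      show "\<exists>y\<in>carrier (pser R). y \<oplus>\<^bsub>pser R\<^esub> x = \<zero>\<^bsub>pser R\<^esub>" if "x \<in> carrier (pser R)" for x
        using that by (intro bexI[of _ "\<lambda>n. \<ominus>\<^bsub>R\<^esub> x n"]) (auto simp: pser_sel R.l_neg)
    qed (auto simp: pser_sel R.a_assoc intro: R.a_comm)
    show "comm_monoid (pser R)"
    proof (rule comm_monoidI)
      show "\<one>\<^bsub>pser R\<^esub> \<in> carrier (pser R)" by (simp add: pser_sel)
      show "a \<otimes>\<^bsub>pser R\<^esub> b \<in> carrier (pser R)" if "a \<in> carrier (pser R)" "b \<in> carrier (pser R)" for a b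
        using closed that by blast
      show "a \<otimes>\<^bsub>pser R\<^esub> b \<otimes>\<^bsub>pser R\<^esub> c = a \<otimes>\<^bsub>pser R\<^esub> (b \<otimes>\<^bsub>pser R\<^esub> c)"
        if abc: "a \<in> carrier (pser R)" "b \<in> carrier (pser R)" "c \<in> carrier (pser R)" for a b c
      proof
        fix n
        let ?a = "tr n a" and ?b = "tr n b" and ?c = "tr n c"
        have ab: "(a \<otimes>\<^bsub>pser R\<^esub> b) m = (?a \<otimes>\<^bsub>UP R\<^esub> ?b) m" if "m \<le> n" for m
          by (rule mult) (use abc trc tra that in auto)
        have bc: "(b \<otimes>\<^bsub>pser R\<^esub> c) m = (?b \<otimes>\<^bsub>UP R\<^esub> ?c) m" if "m \<le> n" for m
          by (rule mult) (use abc trc tra that in auto)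
        have "(a \<otimes>\<^bsub>pser R\<^esub> b \<otimes>\<^bsub>pser R\<^esub> c) n = (?a \<otimes>\<^bsub>UP R\<^esub> ?b \<otimes>\<^bsub>UP R\<^esub> ?c) n"
          by (rule mult) (use abc closed trc tra ab in auto)
        also have "\<dots> = (?a \<otimes>\<^bsub>UP R\<^esub> (?b \<otimes>\<^bsub>UP R\<^esub> ?c)) n"
          using trc[OF abc(1)] trc[OF abc(2)] trc[OF abc(3)] by (simp add: U.P.m_assoc)
        also have "\<dots> = (a \<otimes>\<^bsub>pser R\<^esub> (b \<otimes>\<^bsub>pser R\<^esub> c)) n"
          by (rule mult[symmetric]) (use abc closed trc tra bc in auto)
        finally show "(a \<otimes>\<^bsub>pser R\<^esub> b \<otimes>\<^bsub>pser R\<^esub> c) n = (a \<otimes>\<^bsub>pser R\<^esub> (b \<otimes>\<^bsub>pser R\<^esub> c)) n" .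
      qed
      show "a \<otimes>\<^bsub>pser R\<^esub> b = b \<otimes>\<^bsub>pser R\<^esub> a" if ab: "a \<in> carrier (pser R)" "b \<in> carrier (pser R)" for a b
      proof
        fix n
        have "(a \<otimes>\<^bsub>pser R\<^esub> b) n = (tr n a \<otimes>\<^bsub>UP R\<^esub> tr n b) n"
          by (rule mult) (use ab trc tra in auto)
        also have "\<dots> = (tr n b \<otimes>\<^bsub>UP R\<^esub> tr n a) n"
          using trc[OF ab(1)] trc[OF ab(2)] by (simp add: U.P.m_comm)
        also have "\<dots> = (b \<otimes>\<^bsub>pser R\<^esub> a) n"
          by (rule mult[symmetric]) (use ab trc tra in auto)
        finally show "(a \<otimes>\<^bsub>pser R\<^esub> b) n = (b \<otimes>\<^bsub>pser R\<^esub> a) n" .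
      qed
      show "\<one>\<^bsub>pser R\<^esub> \<otimes>\<^bsub>pser R\<^esub> a = a" if a: "a \<in> carrier (pser R)" for a
      proof
        fix n
        have "(\<one>\<^bsub>pser R\<^esub> \<otimes>\<^bsub>pser R\<^esub> a) n = (\<one>\<^bsub>UP R\<^esub> \<otimes>\<^bsub>UP R\<^esub> tr n a) n"
          by (rule mult) (use a trc[OF a] tra U.UP_one_closed in \<open>auto simp: pser_sel UP_def\<close>)
        also have "\<dots> = tr n a n" using trc[OF a] by simp
        also have "\<dots> = a n" by (simp add: tr_def)
        finally show "(\<one>\<^bsub>pser R\<^esub> \<otimes>\<^bsub>pser R\<^esub> a) n = a n" .
      qed
    qed
    show "(a \<oplus>\<^bsub>pser R\<^esub> b) \<otimes>\<^bsub>pser R\<^esub> c = a \<otimes>\<^bsub>pser R\<^esub> c \<oplus>\<^bsub>pser R\<^esub> b \<otimes>\<^bsub>pser R\<^esub> c"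
      if "a \<in> carrier (pser R)" "b \<in> carrier (pser R)" "c \<in> carrier (pser R)" for a b c
    proof
      fix n
      have "(\<Oplus>\<^bsub>R\<^esub>i\<in>{..n}. (a i \<oplus>\<^bsub>R\<^esub> b i) \<otimes>\<^bsub>R\<^esub> c (n - i)) =
          (\<Oplus>\<^bsub>R\<^esub>i\<in>{..n}. a i \<otimes>\<^bsub>R\<^esub> c (n - i) \<oplus>\<^bsub>R\<^esub> b i \<otimes>\<^bsub>R\<^esub> c (n - i))"
        by (rule R.finsum_cong') (use that in \<open>auto simp: pser_sel R.l_distr\<close>)
      also have "\<dots> = (\<Oplus>\<^bsub>R\<^esub>i\<in>{..n}. a i \<otimes>\<^bsub>R\<^esub> c (n - i)) \<oplus>\<^bsub>R\<^esub> (\<Oplus>\<^bsub>R\<^esub>i\<in>{..n}. b i \<otimes>\<^bsub>R\<^esub> c (n - i))"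
        by (rule R.finsum_addf) (use that in \<open>auto simp: pser_sel\<close>)
      finally show "((a \<oplus>\<^bsub>pser R\<^esub> b) \<otimes>\<^bsub>pser R\<^esub> c) n = (a \<otimes>\<^bsub>pser R\<^esub> c \<oplus>\<^bsub>pser R\<^esub> b \<otimes>\<^bsub>pser R\<^esub> c) n"
        by (simp add: pser_sel)
    qed
  qed
qed

lemma pser_finsum:
  assumes "cring R" "finite A" "f \<in> A \<rightarrow> carrier (pser R)"
  shows "finsum (pser R) f A = (\<lambda>n. finsum R (\<lambda>x. f x n) A)"
  using assms(2,3)
proof (induction A rule: finite_induct)
  case empty
  interpret R: cring R by fact
  interpret S: cring "pser R" using pser_cring[OF assms(1)] .
  show ?case by (simp add: pser_sel)
next
  case (insert x F)
  interpret R: cring R by fact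
  interpret S: cring "pser R" using pser_cring[OF assms(1)] .
  have "\<And>n. (\<lambda>x. f x n) \<in> F \<rightarrow> carrier R" "\<And>n. f x n \<in> carrier R"
    using insert.prems by (auto simp: pser_sel Pi_def)
  then show ?case using insert by (simp add: S.finsum_insert R.finsum_insert pser_sel)
qed

text \<open>A subring criterion for records with operations of their own, which have to agree with
  those of the larger ring on the smaller carrier only. It serves Tate algebras, Laurent domains and
  unit balls alike.\<close>

lemma cring_subset:
  assumes "cring S" "carrier T \<subseteq> carrier S"
    and one: "\<one>\<^bsub>T\<^esub> = \<one>\<^bsub>S\<^esub>" "\<one>\<^bsub>T\<^esub> \<in> carrier T" and zero: "\<zero>\<^bsub>T\<^esub> = \<zero>\<^bsub>S\<^esub>" "\<zero>\<^bsub>T\<^esub> \<in> carrier T"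
    and add: "\<And>a b. a \<in> carrier T \<Longrightarrow> b \<in> carrier T \<Longrightarrow> a \<oplus>\<^bsub>T\<^esub> b = a \<oplus>\<^bsub>S\<^esub> b \<and> a \<oplus>\<^bsub>T\<^esub> b \<in> carrier T"
    and mult: "\<And>a b. a \<in> carrier T \<Longrightarrow> b \<in> carrier T \<Longrightarrow> a \<otimes>\<^bsub>T\<^esub> b = a \<otimes>\<^bsub>S\<^esub> b \<and> a \<otimes>\<^bsub>T\<^esub> b \<in> carrier T"
    and neg: "\<And>a. a \<in> carrier T \<Longrightarrow> \<ominus>\<^bsub>S\<^esub> a \<in> carrier T"
  shows "cring T"
proof -
  interpret S: cring S by fact
  have c: "a \<in> carrier S" if "a \<in> carrier T" for a using assms(2) that by blast
  have addE: "a \<oplus>\<^bsub>T\<^esub> b = a \<oplus>\<^bsub>S\<^esub> b" and addC: "a \<oplus>\<^bsub>S\<^esub> b \<in> carrier T"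
    if "a \<in> carrier T" "b \<in> carrier T" for a b using add[OF that] by auto
  have multE: "a \<otimes>\<^bsub>T\<^esub> b = a \<otimes>\<^bsub>S\<^esub> b" and multC: "a \<otimes>\<^bsub>S\<^esub> b \<in> carrier T"
    if "a \<in> carrier T" "b \<in> carrier T" for a b using mult[OF that] by auto
  show ?thesis
  proof (rule cringI)
    show "abelian_group T"
    proof (rule abelian_groupI)
      show "\<exists>y\<in>carrier T. y \<oplus>\<^bsub>T\<^esub> x = \<zero>\<^bsub>T\<^esub>" if "x \<in> carrier T" for x
        using neg[OF that] addE[OF neg[OF that] that] S.l_neg[OF c[OF that]] zero(1) by (intro bexI[of _ "\<ominus>\<^bsub>S\<^esub> x"]) simp_all
    qed (use zero in \<open>simp_all add: addE addC c S.a_ac\<close>)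
    show "comm_monoid T"
      by (rule comm_monoidI) (use one in \<open>simp_all add: multE multC c S.m_ac\<close>)
  qed (simp_all add: addE addC multE multC c S.l_distr)
qed

lemma tate_mult_eq:
  assumes "cring R" "a \<in> carrier (pser (pser R))" "b \<in> carrier (pser (pser R))"
  shows "a \<otimes>\<^bsub>pser (pser R)\<^esub> b = (\<lambda>m n. \<Oplus>\<^bsub>R\<^esub>p\<in>{..m}. \<Oplus>\<^bsub>R\<^esub>q\<in>{..n}. a p q \<otimes>\<^bsub>R\<^esub> b (m - p) (n - q))"
proof
  fix m
  interpret S: cring "pser R" using pser_cring[OF assms(1)] .
  have "(\<lambda>i. a i \<otimes>\<^bsub>pser R\<^esub> b (m - i)) \<in> {..m} \<rightarrow> carrier (pser R)"
    using assms(2,3) by (auto simp: pser_sel(1)[of "pser R"])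
  then have "(\<Oplus>\<^bsub>pser R\<^esub>i\<in>{..m}. a i \<otimes>\<^bsub>pser R\<^esub> b (m - i)) =
      (\<lambda>n. \<Oplus>\<^bsub>R\<^esub>i\<in>{..m}. (a i \<otimes>\<^bsub>pser R\<^esub> b (m - i)) n)"
    by (intro pser_finsum assms(1)) simp_all
  then show "(a \<otimes>\<^bsub>pser (pser R)\<^esub> b) m = (\<lambda>n. \<Oplus>\<^bsub>R\<^esub>p\<in>{..m}. \<Oplus>\<^bsub>R\<^esub>q\<in>{..n}. a p q \<otimes>\<^bsub>R\<^esub> b (m - p) (n - q))"
    by (simp only: pser_sel(2)[of "pser R"]) (simp only: pser_sel(2))
qed

section \<open>Relative Tate algebras with their Gauss norm\<close>

locale tate = seminormed_cring R for R :: "('a, 'z) normed_ring_scheme" (structure) +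
  fixes r s :: real
  assumes r: "r > 0" and s: "s > 0"
begin

abbreviation T :: "(nat \<Rightarrow> nat \<Rightarrow> 'a) normed_ring" where "T \<equiv> relative_tate R r s"

definition tz :: "(nat \<Rightarrow> nat \<Rightarrow> 'a) \<Rightarrow> nat \<Rightarrow> nat \<Rightarrow> real" where
  "tz a m n = nrm R (a m n) * r ^ m / s ^ n"

lemma T_carrier: "a \<in> carrier T \<longleftrightarrow> (\<forall>m n. a m n \<in> carrier R) \<and> (\<forall>\<epsilon>>0. \<exists>N. \<forall>m n. m + n \<ge> N \<longrightarrow> tz a m n < \<epsilon>)"
  by (simp add: relative_tate_def tz_def)

lemma null_T: "a \<in> carrier T \<Longrightarrow> \<epsilon> > 0 \<Longrightarrow> \<exists>N. \<forall>m n. m + n \<ge> N \<longrightarrow> tz a m n < \<epsilon>"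
  by (simp add: T_carrier)

lemma T_coeff [simp]: "a \<in> carrier T \<Longrightarrow> a m n \<in> carrier R"
  by (simp add: T_carrier)

lemma T_sel: "\<zero>\<^bsub>T\<^esub> = (\<lambda>m n. \<zero>)" "\<one>\<^bsub>T\<^esub> = (\<lambda>m n. if m = 0 \<and> n = 0 then \<one> else \<zero>)"
  "a \<oplus>\<^bsub>T\<^esub> b = (\<lambda>m n. a m n \<oplus> b m n)"
  "a \<otimes>\<^bsub>T\<^esub> b = (\<lambda>m n. \<Oplus>p\<in>{..m}. \<Oplus>q\<in>{..n}. a p q \<otimes> b (m - p) (n - q))"
  by (simp_all only: relative_tate_def ring.select_convs monoid.select_convs)

lemma tz_nonneg: "(\<And>m n. a m n \<in> carrier R) \<Longrightarrow> tz a m n \<ge> 0"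
  unfolding tz_def using r s nrm_nonneg by (intro divide_nonneg_pos mult_nonneg_nonneg) auto

lemma bdd_tz: assumes a: "a \<in> carrier T" shows "bdd_above (range (\<lambda>(m, n). tz a m n))"
proof -
  have "\<exists>N. \<forall>m n. N \<le> m + n \<longrightarrow> tz a m n < 1" using a unfolding T_carrier by simp
  then obtain N where N: "\<And>m n. m + n \<ge> N \<Longrightarrow> tz a m n < 1" by blast
  let ?S = "(\<lambda>(m, n). tz a m n) ` ({..N} \<times> {..N})"
  have "range (\<lambda>(m, n). tz a m n) \<subseteq> {..1} \<union> ?S"
  proof (clarsimp)
    fix m n assume "tz a m n \<notin> ?S"
    then have "m + n \<ge> N" by (force simp: image_iff)
    then show "tz a m n \<le> 1" using N by (simp add: less_imp_le)
  qed
  moreover have "bdd_above ({..1} \<union> ?S)" by simp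
  ultimately show ?thesis by (rule bdd_above_mono[rotated])
qed

lemma nrm_T: "nrm T a = (SUP (m, n). tz a m n)"
  by (simp only: relative_tate_def normed_ring.select_convs tz_def)

lemma tz_le: "a \<in> carrier T \<Longrightarrow> tz a m n \<le> nrm T a"
  unfolding nrm_T using cSUP_upper[OF _ bdd_tz, of "(m, n)" a] by simp

lemma nrm_T_le: "(\<And>m n. tz a m n \<le> e) \<Longrightarrow> nrm T a \<le> e"
  unfolding nrm_T by (rule cSUP_least) auto

lemma nrm_T_nonneg: "a \<in> carrier T \<Longrightarrow> nrm T a \<ge> 0"
  using tz_le[of a 0 0] tz_nonneg[of a 0 0] by (auto simp: T_carrier)

lemma tz_weight: "nrm R x * r ^ m / s ^ n \<le> e \<longleftrightarrow> nrm R x \<le> e * s ^ n / r ^ m"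
  using r s by (simp add: field_simps)

lemma tz_mult_le:
  assumes a: "\<And>m n. a m n \<in> carrier R" and b: "\<And>m n. b m n \<in> carrier R" and e: "e \<ge> 0"
    and le: "\<And>p q. p \<le> m \<Longrightarrow> q \<le> n \<Longrightarrow> tz a p q * tz b (m - p) (n - q) \<le> e"
  shows "tz (a \<otimes>\<^bsub>T\<^esub> b) m n \<le> e"
proof -
  have S: "seminormed_cring R" by unfold_locales
  have "nrm R (\<Oplus>p\<in>{..m}. \<Oplus>q\<in>{..n}. a p q \<otimes> b (m - p) (n - q)) \<le> e * s ^ n / r ^ m"
  proof (intro finsum_nrm_le[OF S])
    fix p q assume pq: "p \<in> {..m}" "q \<in> {..n}"
    have "nrm R (a p q \<otimes> b (m - p) (n - q)) * r ^ m / s ^ n \<le> (nrm R (a p q) * nrm R (b (m - p) (n - q))) * r ^ m / s ^ n"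
      using r s by (intro divide_right_mono mult_right_mono nrm_mult_le a b) auto
    also have "\<dots> = tz a p q * tz b (m - p) (n - q)"
    proof -
      have "r ^ m = r ^ p * r ^ (m - p)" "s ^ n = s ^ q * s ^ (n - q)"
        using pq by (simp_all flip: power_add)
      then show ?thesis by (simp add: tz_def)
    qed
    also have "\<dots> \<le> e" using le pq by simp
    finally show "nrm R (a p q \<otimes> b (m - p) (n - q)) \<le> e * s ^ n / r ^ m" by (simp only: tz_weight)
  qed (use a b e r s in \<open>auto intro!: finsum_closed divide_nonneg_pos\<close>)
  then show ?thesis by (simp only: T_sel tz_def tz_weight)
qed

lemma tz_mult_le_nrm: assumes "a \<in> carrier T" "b \<in> carrier T" shows "tz (a \<otimes>\<^bsub>T\<^esub> b) m n \<le> nrm T a * nrm T b"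
  using assms by (intro tz_mult_le mult_mono tz_le mult_nonneg_nonneg tz_nonneg nrm_T_nonneg) auto

lemma T_mult_closed: assumes a: "a \<in> carrier T" and b: "b \<in> carrier T" shows "a \<otimes>\<^bsub>T\<^esub> b \<in> carrier T"
  unfolding T_carrier
proof (intro conjI allI impI)
  fix m n
  show "(a \<otimes>\<^bsub>T\<^esub> b) m n \<in> carrier R" using a b by (auto simp: T_sel intro!: finsum_closed)
next
  fix \<epsilon> :: real assume \<epsilon>: "\<epsilon> > 0"
  have na: "nrm T a \<ge> 0" "nrm T b \<ge> 0" using nrm_T_nonneg a b by auto
  have "\<epsilon> / 2 / (nrm T b + 1) > 0" "\<epsilon> / 2 / (nrm T a + 1) > 0" using \<epsilon> na by auto
  note e12 = this
  obtain N1 where N1: "\<And>m n. m + n \<ge> N1 \<Longrightarrow> tz a m n < \<epsilon> / 2 / (nrm T b + 1)"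
    using null_T[OF a e12(1)] by blast
  obtain N2 where N2: "\<And>m n. m + n \<ge> N2 \<Longrightarrow> tz b m n < \<epsilon> / 2 / (nrm T a + 1)"
    using null_T[OF b e12(2)] by blast
  have small': "x * y \<le> \<delta>" if "0 \<le> x" "0 \<le> y" "x < \<delta> / w" "y \<le> w" "0 < w" for x y w \<delta> :: real
  proof -
    have "x * y \<le> (\<delta> / w) * w" using that by (intro mult_mono) auto
    then show ?thesis using that by simp
  qed
  have small: "x * y \<le> \<epsilon> / 2" if "0 \<le> x" "0 \<le> y" "x < \<epsilon> / 2 / (z + 1)" "y \<le> z" for x y z :: real
    by (rule small'[where w = "z + 1"]) (use that in auto)
  \<comment> \<open>If the total degree is at least N1 + N2, one factor of each term is in its small
    range while the other is bounded by its norm. The half of \<epsilon> leaves room for a strict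
    inequality.\<close>
  have "tz (a \<otimes>\<^bsub>T\<^esub> b) m n \<le> \<epsilon> / 2" if mn: "m + n \<ge> N1 + N2" for m n
  proof (rule tz_mult_le)
    fix p q assume pq: "p \<le> m" "q \<le> n"
    have nn: "0 \<le> tz a p q" "0 \<le> tz b (m - p) (n - q)" using a b tz_nonneg by auto
    show "tz a p q * tz b (m - p) (n - q) \<le> \<epsilon> / 2"
    proof (cases "p + q \<ge> N1")
      case True
      then show ?thesis using small[OF nn N1 tz_le[OF b]] by blast
    next
      case False
      then have "(m - p) + (n - q) \<ge> N2" using mn pq by linarith
      then show ?thesis using small[OF nn(2,1) N2 tz_le[OF a]] by (simp add: mult.commute)
    qed
  qed (use a b \<epsilon> in auto)
  then show "\<exists>N. \<forall>m n. N \<le> m + n \<longrightarrow> tz (a \<otimes>\<^bsub>T\<^esub> b) m n < \<epsilon>"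
    using \<epsilon> by (intro exI[of _ "N1 + N2"]) (fastforce intro: le_less_trans)
qed

lemma tz_add_le: "(\<And>m n. a m n \<in> carrier R) \<Longrightarrow> (\<And>m n. b m n \<in> carrier R) \<Longrightarrow>
    tz (a \<oplus>\<^bsub>T\<^esub> b) m n \<le> max (tz a m n) (tz b m n)"
proof -
  assume a: "\<And>m n. a m n \<in> carrier R" and b: "\<And>m n. b m n \<in> carrier R"
  have "nrm R (a m n \<oplus> b m n) * (r ^ m / s ^ n) \<le> max (nrm R (a m n)) (nrm R (b m n)) * (r ^ m / s ^ n)"
    using r s by (intro mult_right_mono nrm_add a b) auto
  also have "\<dots> = max (nrm R (a m n) * (r ^ m / s ^ n)) (nrm R (b m n) * (r ^ m / s ^ n))"
  proof -
    have "r ^ m / s ^ n \<ge> 0" using r s by simp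
    then show ?thesis by (simp only: max_mult_distrib_right if_True)
  qed
  finally show ?thesis by (simp add: tz_def T_sel)
qed

lemma T_add_closed: assumes a: "a \<in> carrier T" and b: "b \<in> carrier T" shows "a \<oplus>\<^bsub>T\<^esub> b \<in> carrier T"
  unfolding T_carrier
proof (intro conjI allI impI)
  fix m n show "(a \<oplus>\<^bsub>T\<^esub> b) m n \<in> carrier R" using a b by (simp add: T_sel)
next
  fix \<epsilon> :: real assume \<epsilon>: "\<epsilon> > 0"
  obtain N1 where N1: "\<And>m n. m + n \<ge> N1 \<Longrightarrow> tz a m n < \<epsilon>" using null_T[OF a \<epsilon>] by blast
  obtain N2 where N2: "\<And>m n. m + n \<ge> N2 \<Longrightarrow> tz b m n < \<epsilon>" using null_T[OF b \<epsilon>] by blast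
  note N = N1 N2
  have "tz (a \<oplus>\<^bsub>T\<^esub> b) m n < \<epsilon>" if "m + n \<ge> N1 + N2" for m n
    by (rule le_less_trans[OF tz_add_le]) (use a b N that in auto)
  then show "\<exists>N. \<forall>m n. N \<le> m + n \<longrightarrow> tz (a \<oplus>\<^bsub>T\<^esub> b) m n < \<epsilon>" by blast
qed

lemma T_neg_closed: "a \<in> carrier T \<Longrightarrow> (\<lambda>m n. \<ominus> a m n) \<in> carrier T"
  by (simp add: T_carrier tz_def nrm_minus)

lemma T_finite_support:
  assumes "\<And>m n. a m n \<in> carrier R" "finite F" "\<And>m n. (m, n) \<notin> F \<Longrightarrow> a m n = \<zero>"
  shows "a \<in> carrier T"
  unfolding T_carrier
proof (intro conjI allI impI assms(1))
  fix \<epsilon> :: real assume \<epsilon>: "\<epsilon> > 0"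
  define N where "N = Suc (\<Sum>(m, n)\<in>F. m + n)"
  have "tz a m n < \<epsilon>" if "m + n \<ge> N" for m n
  proof -
    have "(m, n) \<notin> F"
    proof
      assume "(m, n) \<in> F"
      then have "(case (m, n) of (m, n) \<Rightarrow> m + n) \<le> (\<Sum>(m, n)\<in>F. m + n)"
        using assms(2) by (intro member_le_sum) auto
      then show False using that by (simp add: N_def)
    qed
    then show ?thesis using assms(3) \<epsilon> by (simp add: tz_def nrm_zero)
  qed
  then show "\<exists>N. \<forall>m n. N \<le> m + n \<longrightarrow> tz a m n < \<epsilon>" by blast
qed

lemma T_cring: "cring T"
proof -
  have R: "cring R" by unfold_locales
  have P: "cring (pser (pser R))" by (intro pser_cring R)
  interpret P: cring "pser (pser R)" by (rule P)
  have sub: "a \<in> carrier (pser (pser R))" if "a \<in> carrier T" for a using that by (simp add: pser_sel)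
  show ?thesis
  proof (rule cring_subset[OF P])
    show "carrier T \<subseteq> carrier (pser (pser R))" using sub by blast
    show "\<one>\<^bsub>T\<^esub> = \<one>\<^bsub>pser (pser R)\<^esub>" by (auto simp: T_sel pser_sel fun_eq_iff)
    show "\<one>\<^bsub>T\<^esub> \<in> carrier T" by (rule T_finite_support[of _ "{(0, 0)}"]) (auto simp: T_sel)
    show "\<zero>\<^bsub>T\<^esub> = \<zero>\<^bsub>pser (pser R)\<^esub>" by (simp add: T_sel pser_sel)
    show "\<zero>\<^bsub>T\<^esub> \<in> carrier T" by (rule T_finite_support[of _ "{}"]) (auto simp: T_sel)
    show "a \<oplus>\<^bsub>T\<^esub> b = a \<oplus>\<^bsub>pser (pser R)\<^esub> b \<and> a \<oplus>\<^bsub>T\<^esub> b \<in> carrier T" if "a \<in> carrier T" "b \<in> carrier T" for a b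
      using T_add_closed[OF that] by (simp add: T_sel pser_sel)
    show "a \<otimes>\<^bsub>T\<^esub> b = a \<otimes>\<^bsub>pser (pser R)\<^esub> b \<and> a \<otimes>\<^bsub>T\<^esub> b \<in> carrier T" if "a \<in> carrier T" "b \<in> carrier T" for a b
      using T_mult_closed[OF that] tate_mult_eq[OF R sub[OF that(1)] sub[OF that(2)]] by (simp add: T_sel)
    show "\<ominus>\<^bsub>pser (pser R)\<^esub> a \<in> carrier T" if a: "a \<in> carrier T" for a
    proof -
      have "\<ominus>\<^bsub>pser (pser R)\<^esub> a = (\<lambda>m n. \<ominus> a m n)"
        by (rule P.minus_equality) (use a in \<open>auto simp: pser_sel l_neg\<close>)
      then show ?thesis using T_neg_closed[OF a] by simp
    qed
  qed
qed

lemma T_a_inv: assumes "a \<in> carrier T" shows "\<ominus>\<^bsub>T\<^esub> a = (\<lambda>m n. \<ominus> a m n)"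
proof -
  interpret T: cring T by (rule T_cring)
  show ?thesis by (rule T.minus_equality) (use assms T_neg_closed in \<open>auto simp: T_sel l_neg\<close>)
qed

lemma T_seminormed: "seminormed_cring T"
proof -
  interpret T: cring T by (rule T_cring)
  show ?thesis
  proof
    show "nrm T \<zero>\<^bsub>T\<^esub> = 0"
      using nrm_T_le[of "\<zero>\<^bsub>T\<^esub>" 0] nrm_T_nonneg[OF T.zero_closed] by (simp add: T_sel tz_def nrm_zero)
    show "nrm T (\<ominus>\<^bsub>T\<^esub> a) = nrm T a" if "a \<in> carrier T" for a
      using that by (simp add: T_a_inv nrm_T tz_def nrm_minus)
    show "nrm T (a \<oplus>\<^bsub>T\<^esub> b) \<le> max (nrm T a) (nrm T b)" if "a \<in> carrier T" "b \<in> carrier T" for a b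
    proof (rule nrm_T_le)
      fix m n
      have "tz (a \<oplus>\<^bsub>T\<^esub> b) m n \<le> max (tz a m n) (tz b m n)" using that by (intro tz_add_le) auto
      also have "\<dots> \<le> max (nrm T a) (nrm T b)" using tz_le that by (intro max.mono) auto
      finally show "tz (a \<oplus>\<^bsub>T\<^esub> b) m n \<le> max (nrm T a) (nrm T b)" .
    qed
    show "nrm T (a \<otimes>\<^bsub>T\<^esub> b) \<le> nrm T a * nrm T b" if "a \<in> carrier T" "b \<in> carrier T" for a b
      by (rule nrm_T_le) (rule tz_mult_le_nrm[OF that])
  qed (rule nrm_T_nonneg)
qed

text \<open>The monomial a x^p y^q.\<close>

definition mon :: "'a \<Rightarrow> nat \<Rightarrow> nat \<Rightarrow> nat \<Rightarrow> nat \<Rightarrow> 'a" where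
  "mon a p q = (\<lambda>m n. if m = p \<and> n = q then a else \<zero>)"

lemma mon_closed [simp]: "a \<in> carrier R \<Longrightarrow> mon a p q \<in> carrier T"
  by (rule T_finite_support[of _ "{(p, q)}"]) (auto simp: mon_def)

lemma mon_mult:
  assumes "a \<in> carrier R" "d \<in> carrier T"
  shows "(mon a p q \<otimes>\<^bsub>T\<^esub> d) = (\<lambda>m n. if p \<le> m \<and> q \<le> n then a \<otimes> d (m - p) (n - q) else \<zero>)"
proof (intro ext)
  fix m n
  have inner: "(\<Oplus>q'\<in>{..n}. mon a p q p' q' \<otimes> d (m - p') (n - q')) =
      (if p = p' then (if q \<le> n then a \<otimes> d (m - p') (n - q) else \<zero>) else \<zero>)" for p'
  proof -
    have "(\<Oplus>q'\<in>{..n}. mon a p q p' q' \<otimes> d (m - p') (n - q')) =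
        (\<Oplus>q'\<in>{..n}. if q = q' then (if p = p' then a \<otimes> d (m - p') (n - q') else \<zero>) else \<zero>)"
      by (rule finsum_cong') (use assms in \<open>auto simp: mon_def\<close>)
    also have "\<dots> = (if p = p' then (if q \<le> n then a \<otimes> d (m - p') (n - q) else \<zero>) else \<zero>)"
    proof (cases "q \<le> n")
      case True
      then show ?thesis
        using finsum_singleton[of q "{..n}" "\<lambda>q'. if p = p' then a \<otimes> d (m - p') (n - q') else \<zero>"] assms by auto
    next
      case False
      then have "(\<Oplus>q'\<in>{..n}. if q = q' then (if p = p' then a \<otimes> d (m - p') (n - q') else \<zero>) else \<zero>) = (\<Oplus>q'\<in>{..n}. \<zero>)"
        by (intro finsum_cong') auto
      then show ?thesis using False by simp
    qed
    finally show ?thesis .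
  qed
  have "(mon a p q \<otimes>\<^bsub>T\<^esub> d) m n =
      (\<Oplus>p'\<in>{..m}. if p = p' then (if q \<le> n then a \<otimes> d (m - p') (n - q) else \<zero>) else \<zero>)"
    by (simp add: T_sel inner)
  also have "\<dots> = (if p \<le> m \<and> q \<le> n then a \<otimes> d (m - p) (n - q) else \<zero>)"
  proof (cases "p \<le> m")
    case True
    then show ?thesis
      using finsum_singleton[of p "{..m}" "\<lambda>p'. if q \<le> n then a \<otimes> d (m - p') (n - q) else \<zero>"] assms by auto
  next
    case False
    then have "(\<Oplus>p'\<in>{..m}. if p = p' then (if q \<le> n then a \<otimes> d (m - p') (n - q) else \<zero>) else \<zero>) = (\<Oplus>p'\<in>{..m}. \<zero>)"
      by (intro finsum_cong') auto
    then show ?thesis using False by simp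
  qed
  finally show "(mon a p q \<otimes>\<^bsub>T\<^esub> d) m n = (if p \<le> m \<and> q \<le> n then a \<otimes> d (m - p) (n - q) else \<zero>)" .
qed

lemma mon_mult_mon: "a \<in> carrier R \<Longrightarrow> b \<in> carrier R \<Longrightarrow> mon a p q \<otimes>\<^bsub>T\<^esub> mon b p' q' = mon (a \<otimes> b) (p + p') (q + q')"
  by (subst mon_mult, assumption, erule mon_closed) (auto simp: mon_def fun_eq_iff)

lemma relative_const_eq: "relative_const R a = mon a 0 0"
  by (simp add: relative_const_def mon_def)

lemma relative_const_hom: "relative_const R \<in> ring_hom R T"
proof (rule ring_hom_memI)
  show "relative_const R x \<in> carrier T" if "x \<in> carrier R" for x
    using that by (simp add: relative_const_eq)
  show "relative_const R (x \<otimes> y) = relative_const R x \<otimes>\<^bsub>T\<^esub> relative_const R y"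
    if "x \<in> carrier R" "y \<in> carrier R" for x y
    using that by (simp add: relative_const_eq mon_mult_mon)
  show "relative_const R (x \<oplus> y) = relative_const R x \<oplus>\<^bsub>T\<^esub> relative_const R y"
    if "x \<in> carrier R" "y \<in> carrier R" for x y
    using that by (simp add: relative_const_eq T_sel mon_def fun_eq_iff)
  show "relative_const R \<one> = \<one>\<^bsub>T\<^esub>"
    by (simp add: relative_const_eq T_sel mon_def fun_eq_iff)
qed

lemma nrm_mon_le: "a \<in> carrier R \<Longrightarrow> nrm T (mon a p q) \<le> nrm R a * r ^ p / s ^ q"
  by (rule nrm_T_le) (use r s nrm_nonneg in \<open>auto simp: tz_def mon_def nrm_zero\<close>)

end

lemma le_mult_limit:
  fixes x y z :: real
  assumes "\<And>e e'. x < e \<Longrightarrow> y < e' \<Longrightarrow> z \<le> e * e'" "0 \<le> x" "0 \<le> y"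
  shows "z \<le> x * y"
proof (rule field_le_epsilon)
  fix \<delta> :: real assume \<delta>: "\<delta> > 0"
  \<comment> \<open>For \<epsilon> at most 1, (x + \<epsilon>)(y + \<epsilon>) exceeds x y by at
    most \<epsilon> (x + y + 1).\<close>
  define \<epsilon> where "\<epsilon> = min 1 (\<delta> / (x + y + 1))"
  have w: "x + y + 1 > 0" using assms(2,3) by simp
  have \<epsilon>: "\<epsilon> > 0" "\<epsilon> \<le> 1" using \<delta> w by (auto simp: \<epsilon>_def)
  have "\<epsilon> * (x + y + 1) \<le> (\<delta> / (x + y + 1)) * (x + y + 1)"
    using w by (intro mult_right_mono) (auto simp: \<epsilon>_def)
  also have "\<dots> = \<delta>" using w by (intro nonzero_divide_eq_eq[THEN iffD1, symmetric]) auto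
  finally have \<epsilon>3: "\<epsilon> * (x + y + 1) \<le> \<delta>" .
  have "z \<le> (x + \<epsilon>) * (y + \<epsilon>)" using \<epsilon> by (intro assms(1)) auto
  also have "\<dots> = x * y + \<epsilon> * (x + y + \<epsilon>)" by (simp add: algebra_simps)
  also have "\<dots> \<le> x * y + \<epsilon> * (x + y + 1)" using \<epsilon> by (intro add_left_mono mult_left_mono) auto
  also have "\<dots> \<le> x * y + \<delta>" using \<epsilon>3 by simp
  finally show "z \<le> x * y + \<delta>" .
qed

text \<open>The infimum that defines a quotient seminorm need not be attained. An element is
  therefore lifted with norm below an arbitrary larger bound, and the inequalities are obtained in
  the limit.\<close>

lemma seminormed_cringI_quotient:
  assumes T: "seminormed_cring T" and R: "cring R" and \<pi>: "\<pi> \<in> ring_hom T R" "\<pi> ` carrier T = carrier R"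
    and nonneg: "\<And>b. b \<in> carrier R \<Longrightarrow> nrm R b \<ge> 0"
    and le: "\<And>x. x \<in> carrier T \<Longrightarrow> nrm R (\<pi> x) \<le> nrm T x"
    and lift: "\<And>b e. b \<in> carrier R \<Longrightarrow> nrm R b < e \<Longrightarrow> \<exists>x\<in>carrier T. \<pi> x = b \<and> nrm T x < e"
  shows "seminormed_cring R"
proof -
  interpret T: seminormed_cring T by fact
  interpret R: cring R by fact
  interpret \<pi>: ring_hom_ring T R \<pi>
    by (rule ring_hom_ringI2) (use \<pi> T.ring_axioms R.ring_axioms in auto)
  have minus_le: "nrm R (\<ominus>\<^bsub>R\<^esub> b) \<le> nrm R b" if b: "b \<in> carrier R" for b
  proof (rule dense_ge)
    fix e assume "nrm R b < e"
    then obtain x where x: "x \<in> carrier T" "\<pi> x = b" "nrm T x < e" using lift[OF b] by blast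
    then have "\<ominus>\<^bsub>R\<^esub> b = \<pi> (\<ominus>\<^bsub>T\<^esub> x)" by simp
    then show "nrm R (\<ominus>\<^bsub>R\<^esub> b) \<le> e" using le[of "\<ominus>\<^bsub>T\<^esub> x"] x T.nrm_minus[OF x(1)] by simp
  qed
  show ?thesis
  proof
    show "nrm R b \<ge> 0" if "b \<in> carrier R" for b using nonneg[OF that] .
    show "nrm R \<zero>\<^bsub>R\<^esub> = 0"
      using le[OF T.zero_closed] nonneg[OF R.zero_closed] T.nrm_zero by simp
    show "nrm R (\<ominus>\<^bsub>R\<^esub> b) = nrm R b" if "b \<in> carrier R" for b
      using minus_le[OF that] minus_le[of "\<ominus>\<^bsub>R\<^esub> b"] that by simp
    show "nrm R (b \<oplus>\<^bsub>R\<^esub> b') \<le> max (nrm R b) (nrm R b')" if b: "b \<in> carrier R" "b' \<in> carrier R" for b b'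
    proof (rule dense_ge)
      fix e assume "max (nrm R b) (nrm R b') < e"
      then obtain x y where x: "x \<in> carrier T" "\<pi> x = b" "nrm T x < e" and y: "y \<in> carrier T" "\<pi> y = b'" "nrm T y < e"
        using lift[OF b(1)] lift[OF b(2)] by (meson max_less_iff_conj)
      have "nrm R (\<pi> (x \<oplus>\<^bsub>T\<^esub> y)) \<le> max (nrm T x) (nrm T y)"
        using le[of "x \<oplus>\<^bsub>T\<^esub> y"] T.nrm_add[OF x(1) y(1)] x(1) y(1) by simp
      then show "nrm R (b \<oplus>\<^bsub>R\<^esub> b') \<le> e" using x y by (simp add: max_def split: if_splits)
    qed
    show "nrm R (b \<otimes>\<^bsub>R\<^esub> b') \<le> nrm R b * nrm R b'" if b: "b \<in> carrier R" "b' \<in> carrier R" for b b'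
    proof (rule le_mult_limit)
      fix e e' assume "nrm R b < e" "nrm R b' < e'"
      then obtain x y where x: "x \<in> carrier T" "\<pi> x = b" "nrm T x < e" and y: "y \<in> carrier T" "\<pi> y = b'" "nrm T y < e'"
        using lift[OF b(1)] lift[OF b(2)] by meson
      have "nrm R (\<pi> (x \<otimes>\<^bsub>T\<^esub> y)) \<le> nrm T x * nrm T y"
        using le[of "x \<otimes>\<^bsub>T\<^esub> y"] T.nrm_mult_le[OF x(1) y(1)] x(1) y(1) by simp
      also have "\<dots> \<le> e * e'"
        using x y T.nrm_nonneg[OF x(1)] T.nrm_nonneg[OF y(1)] by (intro mult_mono) auto
      finally show "nrm R (b \<otimes>\<^bsub>R\<^esub> b') \<le> e * e'" using x y by simp
    qed (use nonneg b in auto)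
  qed
qed

lemma image_normed_ring_sel:
  "carrier (image_normed_ring h R) = h ` carrier R"
  "\<one>\<^bsub>image_normed_ring h R\<^esub> = h \<one>\<^bsub>R\<^esub>" "\<zero>\<^bsub>image_normed_ring h R\<^esub> = h \<zero>\<^bsub>R\<^esub>"
  "nrm (image_normed_ring h R) b = nrm R (inv_into (carrier R) h b)"
  "a \<otimes>\<^bsub>image_normed_ring h R\<^esub> b = h (inv_into (carrier R) h a \<otimes>\<^bsub>R\<^esub> inv_into (carrier R) h b)"
  "a \<oplus>\<^bsub>image_normed_ring h R\<^esub> b = h (inv_into (carrier R) h a \<oplus>\<^bsub>R\<^esub> inv_into (carrier R) h b)"
  by (simp_all add: image_normed_ring_def image_ring_def image_group_def monoid.defs ring.defs normed_ring.defs)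

lemma image_normed_ring:
  assumes R: "cring R" and h: "inj_on h (carrier R)"
  shows "cring (image_normed_ring h R)" "h \<in> ring_hom R (image_normed_ring h R)"
    "\<And>a. a \<in> carrier R \<Longrightarrow> nrm (image_normed_ring h R) (h a) = nrm R a"
proof -
  interpret R: cring R by fact
  show hom: "h \<in> ring_hom R (image_normed_ring h R)"
    by (rule ring_hom_memI) (simp_all add: image_normed_ring_sel h)
  show "nrm (image_normed_ring h R) (h a) = nrm R a" if "a \<in> carrier R" for a
    using that h by (simp add: image_normed_ring_sel)
  have "h \<in> ring_iso R (image_normed_ring h R)"
    using hom h by (simp add: ring_iso_def bij_betw_def image_normed_ring_sel)
  from R.ring_iso_imp_img_cring[OF this] have "cring ((image_normed_ring h R)\<lparr>zero := h \<zero>\<^bsub>R\<^esub>\<rparr>)" .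
  moreover have "(image_normed_ring h R)\<lparr>zero := h \<zero>\<^bsub>R\<^esub>\<rparr> = image_normed_ring h R"
    using image_normed_ring_sel(3)[of h R] by (metis ring.surjective ring.update_convs(1))
  ultimately show "cring (image_normed_ring h R)" by simp
qed

lemma laurent_domain_sel:
  fixes R :: "('a, 'z) normed_ring_scheme"
  shows "carrier (laurent_domain R f r g s) = carrier (relative_tate R r s Quot laurent_ideal R f r g s)"
  "\<one>\<^bsub>laurent_domain R f r g s\<^esub> = \<one>\<^bsub>relative_tate R r s Quot laurent_ideal R f r g s\<^esub>"
  "\<zero>\<^bsub>laurent_domain R f r g s\<^esub> = \<zero>\<^bsub>relative_tate R r s Quot laurent_ideal R f r g s\<^esub>"
  "mult (laurent_domain R f r g s) = mult (relative_tate R r s Quot laurent_ideal R f r g s)"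
  "add (laurent_domain R f r g s) = add (relative_tate R r s Quot laurent_ideal R f r g s)"
  "nrm (laurent_domain R f r g s) C = (INF a\<in>C. nrm (relative_tate R r s) a)"
  by (simp_all add: laurent_domain_def ring.defs normed_ring.defs)

section \<open>One step of the iteration as a quotient of a Tate algebra\<close>

definition step_ring :: "('e, 'k) tower normed_ring \<Rightarrow> ('e, 'k) tower \<Rightarrow> real \<Rightarrow> ('e, 'k) tower \<Rightarrow> real \<Rightarrow> ('e, 'k) tower normed_ring" where
  "step_ring R f r g s = image_normed_ring encode_class (laurent_domain R f r g s)"

definition step_map :: "('e, 'k) tower normed_ring \<Rightarrow> ('e, 'k) tower \<Rightarrow> real \<Rightarrow> ('e, 'k) tower \<Rightarrow> real \<Rightarrow>
    (nat \<Rightarrow> nat \<Rightarrow> ('e, 'k) tower) \<Rightarrow> ('e, 'k) tower" where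
  "step_map R f r g s c = encode_class (laurent_ideal R f r g s +>\<^bsub>relative_tate R r s\<^esub> c)"

locale laurent_step = tate R r s for R :: "('e, 'k) tower normed_ring" (structure) and r s +
  fixes f g :: "('e, 'k) tower"
  assumes f: "f \<in> carrier R" and g: "g \<in> carrier R"
begin

abbreviation "J \<equiv> laurent_ideal R f r g s"
abbreviation "LD \<equiv> laurent_domain R f r g s"
abbreviation "Q \<equiv> step_ring R f r g s"
abbreviation "\<pi> \<equiv> step_map R f r g s"

definition gen1 where "gen1 = mon \<one> 1 0 \<oplus>\<^bsub>T\<^esub> mon (\<ominus> f) 0 0"
definition gen2 where "gen2 = mon g 0 1 \<oplus>\<^bsub>T\<^esub> mon (\<ominus> \<one>) 0 0"

sublocale T: seminormed_cring T by (rule T_seminormed)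

lemma gen_closed: "gen1 \<in> carrier T" "gen2 \<in> carrier T"
  using f g by (simp_all add: gen1_def gen2_def)

lemma J_eq: "J = Idl\<^bsub>T\<^esub> {gen1, gen2}"
proof -
  have "gen1 = (\<lambda>m n. if m = 1 \<and> n = 0 then \<one> else if m = 0 \<and> n = 0 then \<ominus> f else \<zero>)"
    "gen2 = (\<lambda>m n. if m = 0 \<and> n = 1 then g else if m = 0 \<and> n = 0 then \<ominus> \<one> else \<zero>)"
    using f g by (auto simp: gen1_def gen2_def mon_def T_sel fun_eq_iff)
  then show ?thesis by (simp add: laurent_ideal_def)
qed

sublocale J: ideal J T
  unfolding J_eq by (rule T.genideal_ideal) (use gen_closed in auto)

lemma gen_J: "gen1 \<in> J" "gen2 \<in> J"
  using T.genideal_self[of "{gen1, gen2}"] gen_closed by (auto simp: J_eq)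

lemma coset_mem: "c \<in> carrier T \<Longrightarrow> c \<in> J +>\<^bsub>T\<^esub> c"
  by (rule J.a_rcos_self)

lemma LD_cring: "cring LD"
proof -
  have Q: "cring (T Quot J)" by (rule J.quotient_is_cring) (rule T.is_cring)
  interpret Q: cring "T Quot J" by (rule Q)
  show ?thesis by (rule cring_subset[OF Q]) (simp_all add: laurent_domain_sel)
qed

text \<open>The representative chosen for a class lies in it, and two cosets with a common element
  are equal.\<close>

lemma inj_encode: "inj_on encode_class (carrier LD)"
proof (rule inj_onI)
  fix C D assume CD: "C \<in> carrier LD" "D \<in> carrier LD" and e: "encode_class C = encode_class D"
  obtain c d where c: "c \<in> carrier T" "C = J +>\<^bsub>T\<^esub> c" and d: "d \<in> carrier T" "D = J +>\<^bsub>T\<^esub> d"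
    using CD by (auto simp: laurent_domain_sel FactRing_def A_RCOSETS_def')
  have "(SOME a. a \<in> C) \<in> C" "(SOME a. a \<in> D) \<in> D"
    using someI[of "\<lambda>a. a \<in> C" c] someI[of "\<lambda>a. a \<in> D" d] coset_mem[OF c(1)] coset_mem[OF d(1)] c(2) d(2)
    by blast+
  moreover have "(SOME a. a \<in> C) = (SOME a. a \<in> D)" using e by (simp add: encode_class_def)
  ultimately have *: "(SOME a. a \<in> C) \<in> J +>\<^bsub>T\<^esub> c" "(SOME a. a \<in> C) \<in> J +>\<^bsub>T\<^esub> d" using c d by auto
  show "C = D"
    using J.a_repr_independence'[OF *(1) c(1)] J.a_repr_independence'[OF *(2) d(1)] c d by simp
qed

lemma Q_cring: "cring Q"
  unfolding step_ring_def by (rule image_normed_ring(1)[OF LD_cring inj_encode])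

lemma \<pi>_hom: "\<pi> \<in> ring_hom T Q"
proof -
  have "(+>\<^bsub>T\<^esub>) J \<in> ring_hom T (T Quot J)" by (rule J.rcos_ring_hom)
  then have "(+>\<^bsub>T\<^esub>) J \<in> ring_hom T LD" by (simp add: ring_hom_def laurent_domain_sel)
  from ring_hom_trans[OF this image_normed_ring(2)[OF LD_cring inj_encode]]
  show ?thesis by (simp add: step_ring_def step_map_def[abs_def] o_def)
qed

lemma \<pi>_surj: "\<pi> ` carrier T = carrier Q"
  by (auto simp: step_ring_def step_map_def image_normed_ring_sel laurent_domain_sel FactRing_def A_RCOSETS_def')

sublocale Q: cring Q by (rule Q_cring)
sublocale \<pi>: ring_hom_ring T Q \<pi>
  by (rule ring_hom_ringI2) (rule T.ring_axioms, rule Q.ring_axioms, rule \<pi>_hom)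

lemma coset_LD: "c \<in> carrier T \<Longrightarrow> J +>\<^bsub>T\<^esub> c \<in> carrier LD"
  by (auto simp: laurent_domain_sel FactRing_def A_RCOSETS_def')

lemma nrm_\<pi>: "c \<in> carrier T \<Longrightarrow> nrm Q (\<pi> c) = (INF a\<in>J +>\<^bsub>T\<^esub> c. nrm T a)"
  unfolding step_ring_def step_map_def
  by (simp add: image_normed_ring(3)[OF LD_cring inj_encode coset_LD] laurent_domain_sel)

lemma coset_carrier: "a \<in> J +>\<^bsub>T\<^esub> c \<Longrightarrow> c \<in> carrier T \<Longrightarrow> a \<in> carrier T"
  using J.a_elemrcos_carrier by blast

lemma bdd_coset: "c \<in> carrier T \<Longrightarrow> bdd_below (nrm T ` (J +>\<^bsub>T\<^esub> c))"
  by (rule bdd_belowI[of _ 0]) (use T.nrm_nonneg coset_carrier in blast)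

lemma nrm_\<pi>_le: "c \<in> carrier T \<Longrightarrow> nrm Q (\<pi> c) \<le> nrm T c"
  unfolding nrm_\<pi> by (intro cINF_lower bdd_coset coset_mem)

lemma \<pi>_lift:
  assumes "b \<in> carrier Q" "nrm Q b < e"
  shows "\<exists>c\<in>carrier T. \<pi> c = b \<and> nrm T c < e"
proof -
  obtain c where c: "c \<in> carrier T" "b = \<pi> c" using assms(1) \<pi>_surj by blast
  have "J +>\<^bsub>T\<^esub> c \<noteq> {}" using coset_mem[OF c(1)] by blast
  then obtain a where a: "a \<in> J +>\<^bsub>T\<^esub> c" "nrm T a < e"
    using assms(2) unfolding c(2) nrm_\<pi>[OF c(1)] by (auto simp: cINF_less_iff bdd_coset[OF c(1)])
  have "\<pi> a = b" unfolding c(2) step_map_def using J.a_repr_independence'[OF a(1) c(1)] by simp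
  then show ?thesis using a coset_carrier[OF a(1) c(1)] by blast
qed

lemma nrm_Q_nonneg: assumes "b \<in> carrier Q" shows "nrm Q b \<ge> 0"
proof -
  obtain c where c: "c \<in> carrier T" "b = \<pi> c" using assms \<pi>_surj by blast
  have "J +>\<^bsub>T\<^esub> c \<noteq> {}" using coset_mem[OF c(1)] by blast
  then show ?thesis unfolding c(2) nrm_\<pi>[OF c(1)]
    by (rule cINF_greatest) (use T.nrm_nonneg coset_carrier c in blast)
qed

lemma Q_seminormed: "seminormed_cring Q"
  by (rule seminormed_cringI_quotient[OF T_seminormed Q_cring \<pi>_hom \<pi>_surj nrm_Q_nonneg nrm_\<pi>_le \<pi>_lift])

sublocale Q: seminormed_cring Q by (rule Q_seminormed)

lemma \<pi>_J: assumes "z \<in> J" shows "\<pi> z = \<zero>\<^bsub>Q\<^esub>"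
proof -
  have "J +>\<^bsub>T\<^esub> z = J +>\<^bsub>T\<^esub> \<zero>\<^bsub>T\<^esub>" using J.a_rcos_const[OF assms] T.a_rcos_zero J.is_ideal by (simp add: J.a_rcos_const)
  then have "\<pi> z = \<pi> \<zero>\<^bsub>T\<^esub>" by (simp add: step_map_def)
  then show ?thesis by simp
qed

lemma \<pi>_x: "\<pi> (mon \<one> 1 0) = \<pi> (mon f 0 0)"
proof -
  have m: "mon (\<ominus> f) 0 0 = \<ominus>\<^bsub>T\<^esub> mon f 0 0"
    unfolding T_a_inv[OF mon_closed[OF f]] by (simp add: mon_def fun_eq_iff)
  have "\<pi> gen1 = \<pi> (mon \<one> 1 0) \<oplus>\<^bsub>Q\<^esub> \<ominus>\<^bsub>Q\<^esub> \<pi> (mon f 0 0)"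
    using f unfolding gen1_def m by (simp del: One_nat_def)
  then have "\<pi> (mon \<one> 1 0) \<oplus>\<^bsub>Q\<^esub> \<ominus>\<^bsub>Q\<^esub> \<pi> (mon f 0 0) = \<zero>\<^bsub>Q\<^esub>" using \<pi>_J[OF gen_J(1)] by simp
  then show ?thesis using f
    by (metis Q.add.inv_solve_right' Q.l_zero Q.zero_closed \<pi>.hom_closed mon_closed one_closed)
qed

lemma \<pi>_gy: "\<pi> (mon g 0 1) = \<one>\<^bsub>Q\<^esub>"
proof -
  have m: "mon (\<ominus> \<one>) 0 0 = \<ominus>\<^bsub>T\<^esub> \<one>\<^bsub>T\<^esub>"
    unfolding T_a_inv[OF T.one_closed] by (simp add: mon_def T_sel fun_eq_iff)
  have "\<pi> gen2 = \<pi> (mon g 0 1) \<oplus>\<^bsub>Q\<^esub> \<ominus>\<^bsub>Q\<^esub> \<one>\<^bsub>Q\<^esub>"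
    using g unfolding gen2_def m by (simp del: One_nat_def)
  then have "\<pi> (mon g 0 1) \<oplus>\<^bsub>Q\<^esub> \<ominus>\<^bsub>Q\<^esub> \<one>\<^bsub>Q\<^esub> = \<zero>\<^bsub>Q\<^esub>" using \<pi>_J[OF gen_J(2)] by simp
  then show ?thesis using g
    by (metis Q.add.inv_solve_right' Q.l_zero Q.zero_closed Q.one_closed \<pi>.hom_closed mon_closed)
qed

end

context valued_cring
begin

lemma nrm_pow: "a \<in> carrier R \<Longrightarrow> nrm R (a [^] (n::nat)) = nrm R a ^ n"
  by (induction n) (simp_all add: nrm_one nrm_mult mult.commute)

end

context seminormed_cring
begin

lemma nrm_diff: "a \<in> carrier R \<Longrightarrow> b \<in> carrier R \<Longrightarrow> nrm R (a \<ominus> b) \<le> max (nrm R a) (nrm R b)"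
  unfolding a_minus_def using nrm_add[of a "\<ominus> b"] nrm_minus[of b] by simp

lemma nrm_eq_of_diff_less:
  assumes "x \<in> carrier R" "y \<in> carrier R" "nrm R (x \<ominus> y) < nrm R x"
  shows "nrm R y = nrm R x"
proof (rule antisym)
  have "y = x \<ominus> (x \<ominus> y)" using assms by algebra
  then show "nrm R y \<le> nrm R x" using nrm_diff[of x "x \<ominus> y"] assms by simp
  have "x = (x \<ominus> y) \<oplus> y" using assms by algebra
  then have "nrm R x \<le> max (nrm R (x \<ominus> y)) (nrm R y)" using nrm_add[of "x \<ominus> y" y] assms by simp
  then show "nrm R x \<le> nrm R y" using assms(3) by auto
qed

lemma nrm_neg_eq: assumes "a \<in> carrier R" "b \<in> carrier R" "a \<oplus> b = \<zero>" shows "nrm R a = nrm R b"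
  using minus_equality[OF assms(3)] nrm_minus assms by metis

end

section \<open>Adjoining an element and its inverse\<close>

locale unit_step = laurent_step R \<rho> \<rho> f f + valued_cring R
  for R :: "('e, 'k) tower normed_ring" (structure) and \<rho> f +
  assumes nrm_f: "nrm R f = \<rho>"
begin

abbreviation \<kappa> :: "('e, 'k) tower \<Rightarrow> (nat \<Rightarrow> nat \<Rightarrow> ('e, 'k) tower)" where "\<kappa> a \<equiv> mon a 0 0"

text \<open>f^N times the value at x = f, y = 1/f of the part of the series with m at most
  \<open>M\<close> and n at most \<open>N\<close>. As n is at most \<open>N\<close>, the exponent m
  + N - n is a natural number and no inverse of f is needed in the given ring.\<close>

definition partial_value :: "nat \<Rightarrow> nat \<Rightarrow> (nat \<Rightarrow> nat \<Rightarrow> ('e, 'k) tower) \<Rightarrow> ('e, 'k) tower" where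
  "partial_value N M c = (\<Oplus>m\<in>{..M}. \<Oplus>n\<in>{..N}. c m n \<otimes> f [^] (m + N - n))"

lemma f_pow [simp]: "f [^] (n::nat) \<in> carrier R"
  using f by simp

lemma gen1_mult:
  assumes "p \<in> carrier T"
  shows "(gen1 \<otimes>\<^bsub>T\<^esub> p) m n = (if 1 \<le> m then p (m - 1) n else \<zero>) \<oplus> (\<ominus> f) \<otimes> p m n"
proof -
  have "gen1 \<otimes>\<^bsub>T\<^esub> p = mon \<one> 1 0 \<otimes>\<^bsub>T\<^esub> p \<oplus>\<^bsub>T\<^esub> mon (\<ominus> f) 0 0 \<otimes>\<^bsub>T\<^esub> p"
    unfolding gen1_def using f assms by (intro T.l_distr) auto
  then show ?thesis
    using mon_mult[OF one_closed assms, of 1 0] mon_mult[OF a_inv_closed[OF f] assms, of 0 0] assms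
    by (simp add: T_sel(3))
qed

lemma gen2_mult:
  assumes "q \<in> carrier T"
  shows "(gen2 \<otimes>\<^bsub>T\<^esub> q) m n = (if 1 \<le> n then f \<otimes> q m (n - 1) else \<zero>) \<oplus> (\<ominus> \<one>) \<otimes> q m n"
proof -
  have "gen2 \<otimes>\<^bsub>T\<^esub> q = mon f 0 1 \<otimes>\<^bsub>T\<^esub> q \<oplus>\<^bsub>T\<^esub> mon (\<ominus> \<one>) 0 0 \<otimes>\<^bsub>T\<^esub> q"
    unfolding gen2_def using f assms by (intro T.l_distr) auto
  then show ?thesis
    using mon_mult[OF f assms, of 0 1] mon_mult[OF a_inv_closed[OF one_closed] assms, of 0 0] assms
    by (simp add: T_sel(3))
qed

text \<open>Substituting f for x and its inverse for y and clearing denominators, the multiples of the two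
  generators telescope to boundary terms, which are small because coefficients tend to zero.\<close>

lemma partial_value_gen1:
  assumes p: "p \<in> carrier T"
  shows "partial_value N M (gen1 \<otimes>\<^bsub>T\<^esub> p) \<oplus> (\<Oplus>n\<in>{..N}. p M n \<otimes> f [^] Suc (M + N - n)) = \<zero>"
proof (induction M)
  case 0
  have "(\<Oplus>n\<in>{..N}. (gen1 \<otimes>\<^bsub>T\<^esub> p) 0 n \<otimes> f [^] (0 + N - n)) \<oplus> (\<Oplus>n\<in>{..N}. p 0 n \<otimes> f [^] Suc (0 + N - n)) =
      (\<Oplus>n\<in>{..N}. (gen1 \<otimes>\<^bsub>T\<^esub> p) 0 n \<otimes> f [^] (0 + N - n) \<oplus> p 0 n \<otimes> f [^] Suc (0 + N - n))"
    by (rule finsum_addf[symmetric]) (use p f T_coeff[OF T_mult_closed[OF gen_closed(1) p]] in auto)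
  also have "\<dots> = (\<Oplus>n\<in>{..N}. \<zero>)"
  proof (rule finsum_cong')
    fix n
    define P F where "P = p 0 n" and "F = f [^] (0 + N - n)"
    have PF: "P \<in> carrier R" "F \<in> carrier R" using p by (auto simp: P_def F_def)
    have "(\<zero> \<oplus> (\<ominus> f) \<otimes> P) \<otimes> F \<oplus> P \<otimes> (F \<otimes> f) = \<zero>" using PF f by algebra
    then show "(gen1 \<otimes>\<^bsub>T\<^esub> p) 0 n \<otimes> f [^] (0 + N - n) \<oplus> p 0 n \<otimes> f [^] Suc (0 + N - n) = \<zero>"
      by (simp add: gen1_mult[OF p] P_def F_def)
  qed auto
  also have "\<dots> = \<zero>" by simp
  finally show ?case by (simp add: partial_value_def finsum_insert gen1_mult[OF p] p f)
next
  case (Suc M)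
  define row where "row = (\<Oplus>n\<in>{..N}. (gen1 \<otimes>\<^bsub>T\<^esub> p) (Suc M) n \<otimes> f [^] (Suc M + N - n))"
  define S S' where "S = (\<Oplus>n\<in>{..N}. p M n \<otimes> f [^] Suc (M + N - n))"
    and "S' = (\<Oplus>n\<in>{..N}. p (Suc M) n \<otimes> f [^] Suc (Suc M + N - n))"
  have cl: "(gen1 \<otimes>\<^bsub>T\<^esub> p) m n \<in> carrier R" "p m n \<in> carrier R" for m n
    using T_coeff[OF T_mult_closed[OF gen_closed(1) p]] p by auto
  \<comment> \<open>The new row turns the boundary term of degree \<open>Suc M\<close> into the one
    of degree \<open>M\<close>; this is the telescoping.\<close>
  have rowS: "row \<oplus> S' = S"
  proof -
    have "row \<oplus> S' = (\<Oplus>n\<in>{..N}. (gen1 \<otimes>\<^bsub>T\<^esub> p) (Suc M) n \<otimes> f [^] (Suc M + N - n) \<oplus> p (Suc M) n \<otimes> f [^] Suc (Suc M + N - n))"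
      unfolding row_def S'_def by (rule finsum_addf[symmetric]) (use cl f in auto)
    also have "\<dots> = S" unfolding S_def
    proof (rule finsum_cong')
      fix n assume n: "n \<in> {..N}"
      define P P' F where "P = p M n" and "P' = p (Suc M) n" and "F = f [^] (Suc M + N - n)"
      have PF: "P \<in> carrier R" "P' \<in> carrier R" "F \<in> carrier R" using cl by (auto simp: P_def P'_def F_def)
      have "(P \<oplus> (\<ominus> f) \<otimes> P') \<otimes> F \<oplus> P' \<otimes> (F \<otimes> f) = P \<otimes> F" using PF f by algebra
      moreover have "Suc M + N - n = Suc (M + N - n)" using n by simp
      ultimately show "(gen1 \<otimes>\<^bsub>T\<^esub> p) (Suc M) n \<otimes> f [^] (Suc M + N - n) \<oplus> p (Suc M) n \<otimes> f [^] Suc (Suc M + N - n) =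
          p M n \<otimes> f [^] Suc (M + N - n)"
        by (simp add: gen1_mult[OF p] P_def P'_def F_def)
    qed (use cl f in auto)
    finally show ?thesis .
  qed
  have "(\<Oplus>m\<in>{..Suc M}. \<Oplus>n\<in>{..N}. (gen1 \<otimes>\<^bsub>T\<^esub> p) m n \<otimes> f [^] (m + N - n)) =
      row \<oplus> partial_value N M (gen1 \<otimes>\<^bsub>T\<^esub> p)"
    unfolding partial_value_def row_def by (rule finsum_Suc) (use cl f in auto)
  then have "partial_value N (Suc M) (gen1 \<otimes>\<^bsub>T\<^esub> p) \<oplus> S' = row \<oplus> partial_value N M (gen1 \<otimes>\<^bsub>T\<^esub> p) \<oplus> S'"
    by (simp add: partial_value_def)
  also have "\<dots> = partial_value N M (gen1 \<otimes>\<^bsub>T\<^esub> p) \<oplus> (row \<oplus> S')"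
  proof -
    have "row \<in> carrier R" "S' \<in> carrier R" "partial_value N M (gen1 \<otimes>\<^bsub>T\<^esub> p) \<in> carrier R"
      unfolding row_def S'_def partial_value_def using cl f by (auto intro!: finsum_closed)
    then show ?thesis by (simp add: a_ac)
  qed
  also have "\<dots> = \<zero>" using Suc.IH by (simp add: rowS S_def)
  finally show ?case by (simp add: S'_def)
qed

text \<open>Here the telescoping runs over the powers of y within one row. Stopping at
  \<open>K\<close> allows the induction; at \<open>K\<close> = \<open>N\<close> the boundary
  coefficient is multiplied by f^m only.\<close>

lemma partial_value_gen2_row:
  assumes q: "q \<in> carrier T" and "K \<le> N"
  shows "(\<Oplus>n\<in>{..K}. (gen2 \<otimes>\<^bsub>T\<^esub> q) m n \<otimes> f [^] (m + N - n)) \<oplus> q m K \<otimes> f [^] (m + N - K) = \<zero>"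
  using assms(2)
proof (induction K)
  case 0
  define P F where "P = q m 0" and "F = f [^] (m + N)"
  have PF: "P \<in> carrier R" "F \<in> carrier R" using q by (auto simp: P_def F_def)
  have "(\<zero> \<oplus> (\<ominus> \<one>) \<otimes> P) \<otimes> F \<oplus> P \<otimes> F = \<zero>" using PF by (simp add: l_minus l_neg)
  moreover have "(\<Oplus>n\<in>{..0}. (gen2 \<otimes>\<^bsub>T\<^esub> q) m n \<otimes> f [^] (m + N - n)) = (\<zero> \<oplus> (\<ominus> \<one>) \<otimes> P) \<otimes> F"
    using PF by (simp add: gen2_mult[OF q] P_def F_def)
  ultimately show ?case by (simp add: P_def F_def)
next
  case (Suc K)
  have cl: "(gen2 \<otimes>\<^bsub>T\<^esub> q) m n \<in> carrier R" "q m n \<in> carrier R" for m n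
    using T_coeff[OF T_mult_closed[OF gen_closed(2) q]] q by auto
  define S where "S = (\<Oplus>n\<in>{..K}. (gen2 \<otimes>\<^bsub>T\<^esub> q) m n \<otimes> f [^] (m + N - n))"
  define P P' F where "P = q m K" and "P' = q m (Suc K)" and "F = f [^] (m + N - Suc K)"
  have PF: "P \<in> carrier R" "P' \<in> carrier R" "F \<in> carrier R" "S \<in> carrier R"
    using cl f by (auto simp: P_def P'_def F_def S_def intro!: finsum_closed)
  have "(\<Oplus>n\<in>{..Suc K}. (gen2 \<otimes>\<^bsub>T\<^esub> q) m n \<otimes> f [^] (m + N - n)) =
      (gen2 \<otimes>\<^bsub>T\<^esub> q) m (Suc K) \<otimes> f [^] (m + N - Suc K) \<oplus> S"
    unfolding S_def by (rule finsum_Suc) (use cl f in auto)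
  also have "(gen2 \<otimes>\<^bsub>T\<^esub> q) m (Suc K) = f \<otimes> P \<oplus> (\<ominus> \<one>) \<otimes> P'"
    by (simp add: gen2_mult[OF q] P_def P'_def)
  finally have e: "(\<Oplus>n\<in>{..Suc K}. (gen2 \<otimes>\<^bsub>T\<^esub> q) m n \<otimes> f [^] (m + N - n)) \<oplus> P' \<otimes> F =
      ((f \<otimes> P \<oplus> (\<ominus> \<one>) \<otimes> P') \<otimes> F \<oplus> S) \<oplus> P' \<otimes> F" by (simp only: F_def)
  also have "(\<ominus> \<one>) \<otimes> P' = \<ominus> P'" using PF by (simp add: l_minus)
  also have "((f \<otimes> P \<oplus> \<ominus> P') \<otimes> F \<oplus> S) \<oplus> P' \<otimes> F = S \<oplus> P \<otimes> (F \<otimes> f)" using PF f by algebra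
  also have "F \<otimes> f = f [^] (m + N - K)"
  proof -
    have "m + N - K = Suc (m + N - Suc K)" using Suc.prems by simp
    then show ?thesis by (simp add: F_def)
  qed
  also have "S \<oplus> P \<otimes> f [^] (m + N - K) = \<zero>" using Suc by (simp add: S_def P_def)
  finally show ?case by (simp only: P'_def F_def)
qed

lemma partial_value_gen2:
  assumes q: "q \<in> carrier T"
  shows "partial_value N M (gen2 \<otimes>\<^bsub>T\<^esub> q) \<oplus> (\<Oplus>m\<in>{..M}. q m N \<otimes> f [^] m) = \<zero>"
proof -
  have cl: "(gen2 \<otimes>\<^bsub>T\<^esub> q) m n \<in> carrier R" "q m n \<in> carrier R" for m n
    using T_coeff[OF T_mult_closed[OF gen_closed(2) q]] q by auto
  have "partial_value N M (gen2 \<otimes>\<^bsub>T\<^esub> q) \<oplus> (\<Oplus>m\<in>{..M}. q m N \<otimes> f [^] m) =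
      (\<Oplus>m\<in>{..M}. (\<Oplus>n\<in>{..N}. (gen2 \<otimes>\<^bsub>T\<^esub> q) m n \<otimes> f [^] (m + N - n)) \<oplus> q m N \<otimes> f [^] m)"
    unfolding partial_value_def by (rule finsum_addf[symmetric]) (use cl f in \<open>auto intro!: finsum_closed\<close>)
  also have "\<dots> = (\<Oplus>m\<in>{..M}. \<zero>)"
    by (rule finsum_cong') (use partial_value_gen2_row[OF q, of N N] in auto)
  finally show ?thesis by simp
qed

lemma partial_value_add:
  assumes "c \<in> carrier T" "d \<in> carrier T"
  shows "partial_value N M (c \<oplus>\<^bsub>T\<^esub> d) = partial_value N M c \<oplus> partial_value N M d"
proof -
  have cl: "c m n \<in> carrier R" "d m n \<in> carrier R" for m n using assms by auto
  have "(\<Oplus>n\<in>{..N}. (c \<oplus>\<^bsub>T\<^esub> d) m n \<otimes> f [^] (m + N - n)) =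
      (\<Oplus>n\<in>{..N}. c m n \<otimes> f [^] (m + N - n)) \<oplus> (\<Oplus>n\<in>{..N}. d m n \<otimes> f [^] (m + N - n))" for m
  proof -
    have "(\<Oplus>n\<in>{..N}. (c \<oplus>\<^bsub>T\<^esub> d) m n \<otimes> f [^] (m + N - n)) =
        (\<Oplus>n\<in>{..N}. c m n \<otimes> f [^] (m + N - n) \<oplus> d m n \<otimes> f [^] (m + N - n))"
      by (rule finsum_cong') (use cl f in \<open>auto simp: T_sel(3) l_distr\<close>)
    also have "\<dots> = (\<Oplus>n\<in>{..N}. c m n \<otimes> f [^] (m + N - n)) \<oplus> (\<Oplus>n\<in>{..N}. d m n \<otimes> f [^] (m + N - n))"
      by (rule finsum_addf) (use cl f in auto)
    finally show ?thesis .
  qed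
  then have "partial_value N M (c \<oplus>\<^bsub>T\<^esub> d) = (\<Oplus>m\<in>{..M}. (\<Oplus>n\<in>{..N}. c m n \<otimes> f [^] (m + N - n)) \<oplus>
      (\<Oplus>n\<in>{..N}. d m n \<otimes> f [^] (m + N - n)))"
    by (simp add: partial_value_def)
  also have "\<dots> = partial_value N M c \<oplus> partial_value N M d"
    unfolding partial_value_def by (rule finsum_addf) (use cl f in \<open>auto intro!: finsum_closed\<close>)
  finally show ?thesis .
qed

lemma partial_value_closed: "c \<in> carrier T \<Longrightarrow> partial_value N M c \<in> carrier R"
  unfolding partial_value_def using f by (auto intro!: finsum_closed)

lemma partial_value_const:
  assumes "a \<in> carrier R"
  shows "partial_value N M (\<kappa> a) = a \<otimes> f [^] N"
proof -
  have inner: "(\<Oplus>n\<in>{..N}. \<kappa> a m n \<otimes> f [^] (m + N - n)) = (if 0 = m then a \<otimes> f [^] N else \<zero>)" for m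
  proof -
    have "(\<Oplus>n\<in>{..N}. \<kappa> a m n \<otimes> f [^] (m + N - n)) =
        (\<Oplus>n\<in>{..N}. if 0 = n then (if 0 = m then a \<otimes> f [^] (N - n) else \<zero>) else \<zero>)"
      by (rule finsum_cong') (use assms f in \<open>auto simp: mon_def\<close>)
    also have "\<dots> = (if 0 = m then a \<otimes> f [^] N else \<zero>)"
      using finsum_singleton[of 0 "{..N}" "\<lambda>n. if 0 = m then a \<otimes> f [^] (N - n) else \<zero>"] assms f by auto
    finally show ?thesis .
  qed
  show ?thesis
    unfolding partial_value_def inner
    using finsum_singleton[of 0 "{..M}" "\<lambda>m. a \<otimes> f [^] N"] assms f by auto
qed

lemma nrm_coeff_pow: "a \<in> carrier R \<Longrightarrow> nrm R (a \<otimes> f [^] (k::nat)) = nrm R a * \<rho> ^ k"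
  using f by (simp add: nrm_mult nrm_pow nrm_f)

lemma seminormed: "seminormed_cring R"
  by unfold_locales

text \<open>As f has norm \<rho>, the factor f^(m+N-n) has the weight of x^m y^n times
  \<rho>^N.\<close>

lemma nrm_partial_value_le:
  assumes c: "c \<in> carrier T"
  shows "nrm R (partial_value N M c) \<le> nrm T c * \<rho> ^ N"
  unfolding partial_value_def
proof (intro finsum_nrm_le[OF seminormed])
  fix m n assume mn: "m \<in> {..M}" "n \<in> {..N}"
  have "\<rho> ^ (m + N - n) = \<rho> ^ m / \<rho> ^ n * \<rho> ^ N"
  proof -
    have "\<rho> ^ (m + N - n) * \<rho> ^ n = \<rho> ^ m * \<rho> ^ N" using mn by (simp flip: power_add)
    then show ?thesis using r by (simp add: field_simps)
  qed
  then have "nrm R (c m n \<otimes> f [^] (m + N - n)) = tz c m n * \<rho> ^ N"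
    using c by (simp add: nrm_coeff_pow tz_def)
  also have "\<dots> \<le> nrm T c * \<rho> ^ N" using tz_le[OF c] r by (intro mult_right_mono) auto
  finally show "nrm R (c m n \<otimes> f [^] (m + N - n)) \<le> nrm T c * \<rho> ^ N" .
qed (use c f r nrm_T_nonneg[OF c] in \<open>auto intro!: finsum_closed mult_nonneg_nonneg\<close>)

lemma J_elem:
  assumes "z \<in> J"
  obtains p q where "p \<in> carrier T" "q \<in> carrier T" "z = gen1 \<otimes>\<^bsub>T\<^esub> p \<oplus>\<^bsub>T\<^esub> gen2 \<otimes>\<^bsub>T\<^esub> q"
proof -
  let ?P = "PIdl\<^bsub>T\<^esub> gen1 <+>\<^bsub>T\<^esub> PIdl\<^bsub>T\<^esub> gen2"
  have id: "ideal (PIdl\<^bsub>T\<^esub> gen1) T" "ideal (PIdl\<^bsub>T\<^esub> gen2) T"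
    using T.cgenideal_ideal gen_closed by auto
  have z1: "\<zero>\<^bsub>T\<^esub> \<in> PIdl\<^bsub>T\<^esub> gen1" "\<zero>\<^bsub>T\<^esub> \<in> PIdl\<^bsub>T\<^esub> gen2"
    using id by (auto simp: additive_subgroup.zero_closed ideal.axioms(1))
  have "gen1 = gen1 \<oplus>\<^bsub>T\<^esub> \<zero>\<^bsub>T\<^esub>" "gen2 = \<zero>\<^bsub>T\<^esub> \<oplus>\<^bsub>T\<^esub> gen2" using gen_closed by simp_all
  then have "{gen1, gen2} \<subseteq> ?P"
    using z1 T.cgenideal_self gen_closed unfolding set_add_def' by blast
  then have "J \<subseteq> ?P" unfolding J_eq by (intro T.genideal_minimal T.add_ideals id)
  then obtain a b where "a \<in> PIdl\<^bsub>T\<^esub> gen1" "b \<in> PIdl\<^bsub>T\<^esub> gen2" "z = a \<oplus>\<^bsub>T\<^esub> b"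
    using assms unfolding set_add_def' by blast
  then show thesis
    using that gen_closed T.m_comm unfolding cgenideal_def by (smt (verit) mem_Collect_eq)
qed

text \<open>Of the multiples of the two generators only boundary terms remain, with coefficients
  p_Nn and q_mN. Their weights tend to 0 as N grows, uniformly in the other index.\<close>

lemma partial_value_J:
  assumes z: "z \<in> J" and \<epsilon>: "\<epsilon> > 0"
  obtains N where "nrm R (partial_value N N z) \<le> \<epsilon> * \<rho> ^ N"
proof -
  obtain p q where p: "p \<in> carrier T" and q: "q \<in> carrier T" and zpq: "z = gen1 \<otimes>\<^bsub>T\<^esub> p \<oplus>\<^bsub>T\<^esub> gen2 \<otimes>\<^bsub>T\<^esub> q"
    using J_elem[OF z] by metis
  \<comment> \<open>The boundary term of the first generator has one more factor f, relative to the
    weight of its coefficient, than that of the second.\<close>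
  have "\<epsilon> / \<rho> > 0" using \<epsilon> r by simp
  obtain N1 where N1: "\<And>m n. m + n \<ge> N1 \<Longrightarrow> tz p m n < \<epsilon> / \<rho>" using null_T[OF p \<open>\<epsilon> / \<rho> > 0\<close>] by blast
  obtain N2 where N2: "\<And>m n. m + n \<ge> N2 \<Longrightarrow> tz q m n < \<epsilon>" using null_T[OF q \<epsilon>] by blast
  define N where "N = N1 + N2"
  have cl: "p m n \<in> carrier R" "q m n \<in> carrier R" for m n using p q by auto
  have g: "gen1 \<otimes>\<^bsub>T\<^esub> p \<in> carrier T" "gen2 \<otimes>\<^bsub>T\<^esub> q \<in> carrier T" using p q gen_closed by auto
  have "nrm R (partial_value N N (gen1 \<otimes>\<^bsub>T\<^esub> p)) = nrm R (\<Oplus>n\<in>{..N}. p N n \<otimes> f [^] Suc (N + N - n))"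
    by (rule nrm_neg_eq[OF _ _ partial_value_gen1[OF p]])
      (use partial_value_closed[OF g(1)] cl f in \<open>auto intro!: finsum_closed simp del: nat_pow_Suc\<close>)
  also have "\<dots> \<le> \<epsilon> * \<rho> ^ N"
  proof (intro finsum_nrm_le[OF seminormed])
    fix n assume n: "n \<in> {..N}"
    have pw: "\<rho> ^ Suc (N + N - n) = \<rho> * (\<rho> ^ N / \<rho> ^ n) * \<rho> ^ N"
    proof -
      have "\<rho> ^ (N + N - n) * \<rho> ^ n = \<rho> ^ N * \<rho> ^ N" using n by (simp flip: power_add)
      then show ?thesis using r by (simp add: field_simps)
    qed
    have "nrm R (p N n \<otimes> f [^] Suc (N + N - n)) = (tz p N n * \<rho>) * \<rho> ^ N"
      unfolding nrm_coeff_pow[OF cl(1)] pw tz_def by simp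
    also have "\<dots> \<le> \<epsilon> * \<rho> ^ N"
    proof (rule mult_right_mono)
      have "tz p N n < \<epsilon> / \<rho>" by (rule N1) (simp add: N_def)
      then show "tz p N n * \<rho> \<le> \<epsilon>" using r by (simp add: field_simps)
    qed (use r in simp)
    finally show "nrm R (p N n \<otimes> f [^] Suc (N + N - n)) \<le> \<epsilon> * \<rho> ^ N" .
  qed (use \<epsilon> r cl f in \<open>auto simp del: nat_pow_Suc\<close>)
  finally have 1: "nrm R (partial_value N N (gen1 \<otimes>\<^bsub>T\<^esub> p)) \<le> \<epsilon> * \<rho> ^ N" .
  have "nrm R (partial_value N N (gen2 \<otimes>\<^bsub>T\<^esub> q)) = nrm R (\<Oplus>m\<in>{..N}. q m N \<otimes> f [^] m)"
    by (rule nrm_neg_eq[OF _ _ partial_value_gen2[OF q]])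
      (use partial_value_closed[OF g(2)] cl f in \<open>auto intro!: finsum_closed\<close>)
  also have "\<dots> \<le> \<epsilon> * \<rho> ^ N"
  proof (intro finsum_nrm_le[OF seminormed])
    fix m
    have "nrm R (q m N \<otimes> f [^] m) = tz q m N * \<rho> ^ N"
      unfolding nrm_coeff_pow[OF cl(2)] tz_def using r by simp
    also have "\<dots> \<le> \<epsilon> * \<rho> ^ N"
      using N2[of m N] r by (intro mult_right_mono) (auto simp: N_def)
    finally show "nrm R (q m N \<otimes> f [^] m) \<le> \<epsilon> * \<rho> ^ N" .
  qed (use \<epsilon> r cl f in auto)
  finally have 2: "nrm R (partial_value N N (gen2 \<otimes>\<^bsub>T\<^esub> q)) \<le> \<epsilon> * \<rho> ^ N" .
  have "nrm R (partial_value N N z) \<le> max (nrm R (partial_value N N (gen1 \<otimes>\<^bsub>T\<^esub> p))) (nrm R (partial_value N N (gen2 \<otimes>\<^bsub>T\<^esub> q)))"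
    unfolding zpq partial_value_add[OF g] by (intro nrm_add partial_value_closed g)
  then have "nrm R (partial_value N N z) \<le> \<epsilon> * \<rho> ^ N" using 1 2 by simp
  then show thesis by (rule that)
qed

text \<open>The partial value of the constant is a f^N, of norm |a| \<rho>^N. That of
  \<open>z\<close> is at most \<epsilon> \<rho>^N for a suitable N, so the size must come from the
  sum of both, whose partial value is bounded by its own norm times \<rho>^N. Hence no
  representative of the class of \<open>a\<close> is smaller than \<open>a\<close>.\<close>

lemma nrm_const_le_coset:
  assumes a: "a \<in> carrier R" and z: "z \<in> J"
  shows "nrm R a \<le> nrm T (z \<oplus>\<^bsub>T\<^esub> \<kappa> a)"
proof (rule field_le_epsilon)
  fix \<epsilon> :: real assume \<epsilon>: "\<epsilon> > 0"
  have zT: "z \<in> carrier T" using z J.a_Hcarr by blast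
  obtain N where N: "nrm R (partial_value N N z) \<le> \<epsilon> * \<rho> ^ N" using partial_value_J[OF z \<epsilon>] by blast
  let ?c = "z \<oplus>\<^bsub>T\<^esub> \<kappa> a"
  have cT: "?c \<in> carrier T" using zT a by simp
  have pc: "partial_value N N z \<in> carrier R" "partial_value N N ?c \<in> carrier R"
    using partial_value_closed zT cT by auto
  have "partial_value N N ?c = partial_value N N z \<oplus> a \<otimes> f [^] N"
    using partial_value_add[OF zT mon_closed[OF a]] partial_value_const[OF a] by simp
  moreover have "y = (x \<oplus> y) \<ominus> x" if "x \<in> carrier R" "y \<in> carrier R" for x y
    using that by algebra
  ultimately have "a \<otimes> f [^] N = partial_value N N ?c \<ominus> partial_value N N z"
    using pc(1) a by simp
  then have "nrm R a * \<rho> ^ N \<le> max (nrm R (partial_value N N ?c)) (nrm R (partial_value N N z))"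
    using nrm_coeff_pow[OF a, of N] nrm_diff[OF pc(2,1)] by simp
  also have "\<dots> \<le> max (nrm T ?c * \<rho> ^ N) (\<epsilon> * \<rho> ^ N)"
    by (intro max.mono nrm_partial_value_le cT N)
  also have "\<dots> \<le> (nrm T ?c + \<epsilon>) * \<rho> ^ N"
    using nrm_T_nonneg[OF cT] \<epsilon> r by (auto simp: distrib_right)
  finally show "nrm R a \<le> nrm T ?c + \<epsilon>" using r by simp
qed

lemma \<kappa>_isometry: assumes a: "a \<in> carrier R" shows "nrm Q (\<pi> (\<kappa> a)) = nrm R a"
proof (rule antisym)
  show "nrm Q (\<pi> (\<kappa> a)) \<le> nrm R a"
    using nrm_\<pi>_le[OF mon_closed[OF a], of 0 0] nrm_mon_le[OF a, of 0 0] by simp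
  show "nrm R a \<le> nrm Q (\<pi> (\<kappa> a))"
    unfolding nrm_\<pi>[OF mon_closed[OF a]]
  proof (rule cINF_greatest)
    show "J +>\<^bsub>T\<^esub> \<kappa> a \<noteq> {}" using coset_mem[OF mon_closed[OF a]] by blast
    fix c assume "c \<in> J +>\<^bsub>T\<^esub> \<kappa> a"
    then obtain z where "z \<in> J" "c = z \<oplus>\<^bsub>T\<^esub> \<kappa> a" by (auto simp: a_r_coset_def')
    then show "nrm R a \<le> nrm T c" using nrm_const_le_coset[OF a] by simp
  qed
qed

end

section \<open>Multiplicativity of the norm after f and its inverse are adjoined\<close>

context unit_step
begin

abbreviation "F \<equiv> \<pi> (\<kappa> f)"
abbreviation "Y \<equiv> \<pi> (mon \<one> 0 1)"

lemma FY_closed [simp]: "F \<in> carrier Q" "Y \<in> carrier Q"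
  using f by simp_all

lemma FY: "F \<otimes>\<^bsub>Q\<^esub> Y = \<one>\<^bsub>Q\<^esub>"
proof -
  have "F \<otimes>\<^bsub>Q\<^esub> Y = \<pi> (\<kappa> f \<otimes>\<^bsub>T\<^esub> mon \<one> 0 1)" using f by simp
  also have "\<dots> = \<pi> (mon f 0 1)" using f by (simp add: mon_mult_mon)
  finally show ?thesis using \<pi>_gy by simp
qed

lemma \<kappa>_pow: "F [^]\<^bsub>Q\<^esub> (N::nat) = \<pi> (\<kappa> (f [^] N))"
proof (induction N)
  case 0
  have "\<kappa> \<one> = \<one>\<^bsub>T\<^esub>" by (simp add: mon_def T_sel fun_eq_iff)
  then show ?case by simp
next
  case (Suc N)
  have "\<pi> (\<kappa> (f [^] Suc N)) = \<pi> (\<kappa> (f [^] N) \<otimes>\<^bsub>T\<^esub> \<kappa> f)" using f by (simp add: mon_mult_mon)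
  then show ?case using Suc f by simp
qed

text \<open>In the quotient x becomes f, and each factor y is cancelled by one factor f.\<close>

lemma \<pi>_mon: 
  assumes a: "a \<in> carrier R"
  shows "\<pi> (mon a p q) \<otimes>\<^bsub>Q\<^esub> F [^]\<^bsub>Q\<^esub> q = \<pi> (\<kappa> (a \<otimes> f [^] p))"
proof -
  have x: "\<pi> (mon a p q) = \<pi> (mon (a \<otimes> f [^] p) 0 q)" if "a \<in> carrier R" for a p q
    using that
  proof (induction p arbitrary: a)
    case (Suc p)
    have "\<pi> (mon a (Suc p) q) = \<pi> (mon a p q \<otimes>\<^bsub>T\<^esub> mon \<one> 1 0)"
      using Suc.prems by (simp add: mon_mult_mon del: \<pi>.hom_mult)
    also have "\<dots> = \<pi> (mon a p q) \<otimes>\<^bsub>Q\<^esub> \<pi> (\<kappa> f)"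
      using Suc.prems \<pi>_x by simp
    also have "\<dots> = \<pi> (mon a p q \<otimes>\<^bsub>T\<^esub> \<kappa> f)" using Suc.prems f by simp
    also have "\<dots> = \<pi> (mon (a \<otimes> f) p q)" using Suc.prems f by (simp add: mon_mult_mon del: \<pi>.hom_mult)
    also have "\<dots> = \<pi> (mon (a \<otimes> f \<otimes> f [^] p) 0 q)" using Suc f by simp
    also have "a \<otimes> f \<otimes> f [^] p = a \<otimes> f [^] Suc p" using Suc.prems f by (simp add: m_assoc m_comm)
    finally show ?case .
  qed simp
  have y: "\<pi> (mon a 0 q) \<otimes>\<^bsub>Q\<^esub> F [^]\<^bsub>Q\<^esub> q = \<pi> (\<kappa> a)" if "a \<in> carrier R" for a
  proof (induction q)
    case (Suc q)
    have "mon a 0 (Suc q) = mon a 0 q \<otimes>\<^bsub>T\<^esub> mon \<one> 0 1" using that by (simp add: mon_mult_mon)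
    then have "\<pi> (mon a 0 (Suc q)) = \<pi> (mon a 0 q) \<otimes>\<^bsub>Q\<^esub> Y" using that by simp
    then have "\<pi> (mon a 0 (Suc q)) \<otimes>\<^bsub>Q\<^esub> F [^]\<^bsub>Q\<^esub> Suc q =
        (\<pi> (mon a 0 q) \<otimes>\<^bsub>Q\<^esub> F [^]\<^bsub>Q\<^esub> q) \<otimes>\<^bsub>Q\<^esub> (F \<otimes>\<^bsub>Q\<^esub> Y)"
      using that f by (simp add: Q.m_ac)
    then show ?case using Suc that FY[unfolded One_nat_def] by simp
  qed (use that in simp)
  show ?thesis using x[OF a, of p q] y[of "a \<otimes> f [^] p"] a f by simp
qed

text \<open>The image of the given ring with f inverted, described without forming that
  ring.\<close>

definition D :: "('e, 'k) tower set" where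
  "D = {b \<in> carrier Q. \<exists>N::nat. \<exists>a\<in>carrier R. b \<otimes>\<^bsub>Q\<^esub> F [^]\<^bsub>Q\<^esub> N = \<pi> (\<kappa> a)}"

lemma \<kappa>_add: "a \<in> carrier R \<Longrightarrow> b \<in> carrier R \<Longrightarrow> \<pi> (\<kappa> (a \<oplus> b)) = \<pi> (\<kappa> a) \<oplus>\<^bsub>Q\<^esub> \<pi> (\<kappa> b)"
proof -
  assume ab: "a \<in> carrier R" "b \<in> carrier R"
  have "\<kappa> (a \<oplus> b) = \<kappa> a \<oplus>\<^bsub>T\<^esub> \<kappa> b" using ab by (simp add: mon_def T_sel(3) fun_eq_iff)
  then show ?thesis using ab by simp
qed

lemma \<kappa>_mult: "a \<in> carrier R \<Longrightarrow> b \<in> carrier R \<Longrightarrow> \<pi> (\<kappa> (a \<otimes> b)) = \<pi> (\<kappa> a) \<otimes>\<^bsub>Q\<^esub> \<pi> (\<kappa> b)"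
proof -
  assume ab: "a \<in> carrier R" "b \<in> carrier R"
  have "\<kappa> (a \<otimes> b) = \<kappa> a \<otimes>\<^bsub>T\<^esub> \<kappa> b" using ab by (simp add: mon_mult_mon)
  then show ?thesis using ab by simp
qed

lemma D_add: assumes "b \<in> D" "b' \<in> D" shows "b \<oplus>\<^bsub>Q\<^esub> b' \<in> D"
proof -
  obtain N a where N: "b \<in> carrier Q" "a \<in> carrier R" "b \<otimes>\<^bsub>Q\<^esub> F [^]\<^bsub>Q\<^esub> (N::nat) = \<pi> (\<kappa> a)"
    using assms(1) by (auto simp: D_def)
  obtain N' a' where N': "b' \<in> carrier Q" "a' \<in> carrier R" "b' \<otimes>\<^bsub>Q\<^esub> F [^]\<^bsub>Q\<^esub> (N'::nat) = \<pi> (\<kappa> a')"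
    using assms(2) by (auto simp: D_def)
  have c: "F [^]\<^bsub>Q\<^esub> N \<in> carrier Q" "F [^]\<^bsub>Q\<^esub> N' \<in> carrier Q" by simp_all
  have "(b \<oplus>\<^bsub>Q\<^esub> b') \<otimes>\<^bsub>Q\<^esub> F [^]\<^bsub>Q\<^esub> (N + N') =
      (b \<otimes>\<^bsub>Q\<^esub> F [^]\<^bsub>Q\<^esub> N) \<otimes>\<^bsub>Q\<^esub> F [^]\<^bsub>Q\<^esub> N' \<oplus>\<^bsub>Q\<^esub> (b' \<otimes>\<^bsub>Q\<^esub> F [^]\<^bsub>Q\<^esub> N') \<otimes>\<^bsub>Q\<^esub> F [^]\<^bsub>Q\<^esub> N"
    using N(1) N'(1) c by (simp add: Q.nat_pow_mult[symmetric] Q.l_distr Q.m_ac)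
  also have "\<dots> = \<pi> (\<kappa> (a \<otimes> f [^] N' \<oplus> a' \<otimes> f [^] N))"
    using N(2,3) N'(2,3) f by (simp add: \<kappa>_pow \<kappa>_add \<kappa>_mult del: \<pi>.hom_mult \<pi>.hom_add)
  finally have e: "(b \<oplus>\<^bsub>Q\<^esub> b') \<otimes>\<^bsub>Q\<^esub> F [^]\<^bsub>Q\<^esub> (N + N') = \<pi> (\<kappa> (a \<otimes> f [^] N' \<oplus> a' \<otimes> f [^] N))" .
  have "a \<otimes> f [^] N' \<oplus> a' \<otimes> f [^] N \<in> carrier R" using N(2) N'(2) f by simp
  then show ?thesis unfolding D_def using e N(1) N'(1) by blast
qed

lemma D_mon: "a \<in> carrier R \<Longrightarrow> \<pi> (mon a p q) \<in> D"
  unfolding D_def using \<pi>_mon[of a p q] f by (intro CollectI conjI exI[of _ q] bexI[of _ "a \<otimes> f [^] p"]) simp_all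

definition restr :: "(nat \<times> nat) set \<Rightarrow> (nat \<Rightarrow> nat \<Rightarrow> ('e, 'k) tower) \<Rightarrow> nat \<Rightarrow> nat \<Rightarrow> ('e, 'k) tower" where
  "restr A c = (\<lambda>m n. if (m, n) \<in> A then c m n else \<zero>)"

lemma restr_closed: "c \<in> carrier T \<Longrightarrow> finite A \<Longrightarrow> restr A c \<in> carrier T"
  by (rule T_finite_support[of _ A]) (auto simp: restr_def)

lemma D_restr: assumes c: "c \<in> carrier T" and A: "finite A" shows "\<pi> (restr A c) \<in> D"
  using A
proof (induction A rule: finite_induct)
  case empty
  have "restr {} c = mon \<zero> 0 0" by (auto simp: restr_def mon_def fun_eq_iff)
  then show ?case using D_mon[of \<zero> 0 0] by simp
next
  case (insert x A)
  obtain m n where x: "x = (m, n)" by (cases x)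
  have "restr (insert x A) c = restr A c \<oplus>\<^bsub>T\<^esub> mon (c m n) m n"
    using insert.hyps c unfolding x by (auto simp: restr_def mon_def T_sel(3) fun_eq_iff)
  then have "\<pi> (restr (insert x A) c) = \<pi> (restr A c) \<oplus>\<^bsub>Q\<^esub> \<pi> (mon (c m n) m n)"
    using restr_closed[OF c insert.hyps(1)] c by simp
  then show ?case using D_add[OF insert.IH D_mon[of "c m n" m n]] c by simp
qed

text \<open>A lift to the Tate algebra is cut off at finite degree. The rest has small norm, and
  finite sums of monomials lie in \<open>D\<close>.\<close>

lemma D_dense:
  assumes b: "b \<in> carrier Q" and \<epsilon>: "\<epsilon> > 0"
  obtains d where "d \<in> D" "nrm Q (b \<ominus>\<^bsub>Q\<^esub> d) \<le> \<epsilon>"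
proof -
  obtain c where c: "c \<in> carrier T" "b = \<pi> c" using b \<pi>_surj by blast
  obtain N where N: "\<And>m n. m + n \<ge> N \<Longrightarrow> tz c m n < \<epsilon>" using null_T[OF c(1) \<epsilon>] by blast
  let ?A = "{..N} \<times> {..N}"
  have rc: "restr ?A c \<in> carrier T" by (rule restr_closed[OF c(1)]) simp
  have "b \<ominus>\<^bsub>Q\<^esub> \<pi> (restr ?A c) = \<pi> (c \<ominus>\<^bsub>T\<^esub> restr ?A c)"
    unfolding c(2) a_minus_def using c(1) rc by simp
  moreover have "nrm Q (\<pi> (c \<ominus>\<^bsub>T\<^esub> restr ?A c)) \<le> nrm T (c \<ominus>\<^bsub>T\<^esub> restr ?A c)"
    by (intro nrm_\<pi>_le T.minus_closed c(1) rc)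
  moreover have "nrm T (c \<ominus>\<^bsub>T\<^esub> restr ?A c) \<le> \<epsilon>"
  proof (rule nrm_T_le)
    fix m n
    have e: "(c \<ominus>\<^bsub>T\<^esub> restr ?A c) m n = c m n \<oplus> \<ominus> (restr ?A c m n)"
      unfolding a_minus_def T_sel(3) T_a_inv[OF rc] ..
    show "tz (c \<ominus>\<^bsub>T\<^esub> restr ?A c) m n \<le> \<epsilon>"
    proof (cases "(m, n) \<in> ?A")
      case True
      then have "(c \<ominus>\<^bsub>T\<^esub> restr ?A c) m n = \<zero>" unfolding e using c(1) by (simp add: restr_def r_neg)
      then show ?thesis using \<epsilon> by (simp add: tz_def nrm_zero)
    next
      case False
      then have "(c \<ominus>\<^bsub>T\<^esub> restr ?A c) m n = c m n" unfolding e using c(1) by (auto simp: restr_def)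
      moreover have "m + n \<ge> N" using False by auto
      ultimately show ?thesis using N[of m n] by (simp add: tz_def)
    qed
  qed
  ultimately have "nrm Q (b \<ominus>\<^bsub>Q\<^esub> \<pi> (restr ?A c)) \<le> \<epsilon>" by simp
  moreover have "\<pi> (restr ?A c) \<in> D" by (rule D_restr[OF c(1)]) simp
  ultimately show thesis by (rule that[rotated])
qed

lemma nrm_F: "nrm Q F = \<rho>"
  using \<kappa>_isometry[OF f] nrm_f by simp

lemma nrm_Y_le: "nrm Q Y \<le> 1 / \<rho>"
  using nrm_\<pi>_le[OF mon_closed[OF one_closed], of 0 1] nrm_mon_le[OF one_closed, of 0 1] nrm_one by simp

text \<open>The inverse of f has norm at most 1/\<rho>, so multiplication by f loses nothing in the
  submultiplicative estimate. Norms on \<open>D\<close> are thereby reduced to norms in the given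
  ring.\<close>

lemma nrm_mult_F: assumes b: "b \<in> carrier Q" shows "nrm Q (b \<otimes>\<^bsub>Q\<^esub> F) = nrm Q b * \<rho>"
proof (rule antisym)
  show "nrm Q (b \<otimes>\<^bsub>Q\<^esub> F) \<le> nrm Q b * \<rho>" using Q.nrm_mult_le[OF b FY_closed(1)] nrm_F by simp
  have "b = (b \<otimes>\<^bsub>Q\<^esub> F) \<otimes>\<^bsub>Q\<^esub> Y" using b FY by (simp add: Q.m_assoc)
  then have "nrm Q b \<le> nrm Q (b \<otimes>\<^bsub>Q\<^esub> F) * nrm Q Y"
    using Q.nrm_mult_le[of "b \<otimes>\<^bsub>Q\<^esub> F" Y] b by simp
  also have "\<dots> \<le> nrm Q (b \<otimes>\<^bsub>Q\<^esub> F) * (1 / \<rho>)"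
    using nrm_Y_le Q.nrm_nonneg b by (intro mult_left_mono) auto
  finally show "nrm Q b * \<rho> \<le> nrm Q (b \<otimes>\<^bsub>Q\<^esub> F)" using r by (simp add: field_simps)
qed

lemma nrm_mult_F_pow: assumes b: "b \<in> carrier Q" shows "nrm Q (b \<otimes>\<^bsub>Q\<^esub> F [^]\<^bsub>Q\<^esub> (N::nat)) = nrm Q b * \<rho> ^ N"
proof (induction N)
  case (Suc N)
  have "b \<otimes>\<^bsub>Q\<^esub> F [^]\<^bsub>Q\<^esub> Suc N = (b \<otimes>\<^bsub>Q\<^esub> F [^]\<^bsub>Q\<^esub> N) \<otimes>\<^bsub>Q\<^esub> F" using b by (simp add: Q.m_assoc)
  then show ?case using Suc nrm_mult_F[of "b \<otimes>\<^bsub>Q\<^esub> F [^]\<^bsub>Q\<^esub> N"] b by simp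
qed (use b in simp)

lemma nrm_D_mult:
  assumes "d \<in> D" "d' \<in> D"
  shows "nrm Q (d \<otimes>\<^bsub>Q\<^esub> d') = nrm Q d * nrm Q d'"
proof -
  obtain N a where N: "d \<in> carrier Q" "a \<in> carrier R" "d \<otimes>\<^bsub>Q\<^esub> F [^]\<^bsub>Q\<^esub> (N::nat) = \<pi> (\<kappa> a)"
    using assms(1) by (auto simp: D_def)
  obtain N' a' where N': "d' \<in> carrier Q" "a' \<in> carrier R" "d' \<otimes>\<^bsub>Q\<^esub> F [^]\<^bsub>Q\<^esub> (N'::nat) = \<pi> (\<kappa> a')"
    using assms(2) by (auto simp: D_def)
  have "(d \<otimes>\<^bsub>Q\<^esub> d') \<otimes>\<^bsub>Q\<^esub> F [^]\<^bsub>Q\<^esub> (N + N') = (d \<otimes>\<^bsub>Q\<^esub> F [^]\<^bsub>Q\<^esub> N) \<otimes>\<^bsub>Q\<^esub> (d' \<otimes>\<^bsub>Q\<^esub> F [^]\<^bsub>Q\<^esub> N')"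
    using N(1) N'(1) by (simp add: Q.nat_pow_mult[symmetric] Q.m_ac)
  also have "\<dots> = \<pi> (\<kappa> (a \<otimes> a'))" using N N' by (simp add: \<kappa>_mult)
  finally have "nrm Q (d \<otimes>\<^bsub>Q\<^esub> d') * \<rho> ^ (N + N') = nrm R a * nrm R a'"
    using nrm_mult_F_pow[of "d \<otimes>\<^bsub>Q\<^esub> d'" "N + N'"] N(1,2) N'(1,2) \<kappa>_isometry[of "a \<otimes> a'"] by (simp add: nrm_mult)
  moreover have "nrm R a = nrm Q d * \<rho> ^ N" using nrm_mult_F_pow[OF N(1), of N] \<kappa>_isometry[OF N(2)] N(3) by simp
  moreover have "nrm R a' = nrm Q d' * \<rho> ^ N'" using nrm_mult_F_pow[OF N'(1), of N'] \<kappa>_isometry[OF N'(2)] N'(3) by simp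
  ultimately show ?thesis using r by (simp add: power_add)
qed

text \<open>On \<open>D\<close> multiplicativity follows by scaling with powers of f. An
  approximation with relative error 1/2 has the same norm as the element, and the product of two
  approximations differs from the product by less than its norm.\<close>

lemma Q_valued: "valued_cring Q"
proof
  show "nrm Q \<one>\<^bsub>Q\<^esub> = 1"
    using \<kappa>_isometry[OF one_closed] \<kappa>_pow[of 0] by (simp add: nrm_one)
  fix b b' assume b: "b \<in> carrier Q" "b' \<in> carrier Q"
  show "nrm Q (b \<otimes>\<^bsub>Q\<^esub> b') = nrm Q b * nrm Q b'"
  proof (cases "nrm Q b = 0 \<or> nrm Q b' = 0")
    case True
    then show ?thesis using Q.nrm_mult_le[OF b] Q.nrm_nonneg[of "b \<otimes>\<^bsub>Q\<^esub> b'"] b by auto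
  next
    case False
    then have pos: "nrm Q b > 0" "nrm Q b' > 0"
      using Q.nrm_nonneg[OF b(1)] Q.nrm_nonneg[OF b(2)] by auto
    obtain d where d: "d \<in> D" "nrm Q (b \<ominus>\<^bsub>Q\<^esub> d) \<le> nrm Q b / 2" using D_dense[OF b(1), of "nrm Q b / 2"] pos by auto
    obtain d' where d': "d' \<in> D" "nrm Q (b' \<ominus>\<^bsub>Q\<^esub> d') \<le> nrm Q b' / 2" using D_dense[OF b(2), of "nrm Q b' / 2"] pos by auto
    have dc: "d \<in> carrier Q" "d' \<in> carrier Q" using d d' by (auto simp: D_def)
    have n: "nrm Q d = nrm Q b" "nrm Q d' = nrm Q b'"
      using Q.nrm_eq_of_diff_less[OF b(1) dc(1)] Q.nrm_eq_of_diff_less[OF b(2) dc(2)] d(2) d'(2) pos by auto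
    let ?E = "(b \<ominus>\<^bsub>Q\<^esub> d) \<otimes>\<^bsub>Q\<^esub> b' \<oplus>\<^bsub>Q\<^esub> d \<otimes>\<^bsub>Q\<^esub> (b' \<ominus>\<^bsub>Q\<^esub> d')"
    have e: "d \<otimes>\<^bsub>Q\<^esub> d' \<ominus>\<^bsub>Q\<^esub> b \<otimes>\<^bsub>Q\<^esub> b' = \<ominus>\<^bsub>Q\<^esub> ?E"
      using b dc by algebra
    have "nrm Q ?E \<le> max (nrm Q ((b \<ominus>\<^bsub>Q\<^esub> d) \<otimes>\<^bsub>Q\<^esub> b')) (nrm Q (d \<otimes>\<^bsub>Q\<^esub> (b' \<ominus>\<^bsub>Q\<^esub> d')))"
      using b dc by (intro Q.nrm_add) auto
    also have "\<dots> \<le> max (nrm Q b / 2 * nrm Q b') (nrm Q b * (nrm Q b' / 2))"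
    proof (rule max.mono)
      show "nrm Q ((b \<ominus>\<^bsub>Q\<^esub> d) \<otimes>\<^bsub>Q\<^esub> b') \<le> nrm Q b / 2 * nrm Q b'"
        by (rule order_trans[OF Q.nrm_mult_le mult_right_mono[OF d(2)]]) (use b dc pos in auto)
      show "nrm Q (d \<otimes>\<^bsub>Q\<^esub> (b' \<ominus>\<^bsub>Q\<^esub> d')) \<le> nrm Q b * (nrm Q b' / 2)"
        unfolding n(1)[symmetric]
        by (rule order_trans[OF Q.nrm_mult_le mult_left_mono[OF d'(2)]]) (use b dc pos Q.nrm_nonneg in auto)
    qed
    also have "\<dots> < nrm Q b * nrm Q b'" using pos by simp
    finally have lt: "nrm Q (d \<otimes>\<^bsub>Q\<^esub> d' \<ominus>\<^bsub>Q\<^esub> b \<otimes>\<^bsub>Q\<^esub> b') < nrm Q (d \<otimes>\<^bsub>Q\<^esub> d')"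
      unfolding e nrm_D_mult[OF d(1) d'(1)] n using Q.nrm_minus[of ?E] b dc by simp
    have "nrm Q (b \<otimes>\<^bsub>Q\<^esub> b') = nrm Q (d \<otimes>\<^bsub>Q\<^esub> d')"
      by (rule Q.nrm_eq_of_diff_less[OF _ _ lt]) (use b dc in auto)
    then show ?thesis using nrm_D_mult[OF d(1) d'(1)] n by simp
  qed
qed

end

text \<open>The relation to A that is preserved by adjoining elements: unless the ring has become degenerate,
  it has a multiplicative seminorm extending the norm of A, and its elements are approximated by
  fractions of elements of A whose denominators have norm 1 and become units.\<close>

definition frac_dense :: "('a, 'z) normed_ring_scheme \<Rightarrow> ('b, 'y) normed_ring_scheme \<Rightarrow> ('a \<Rightarrow> 'b) \<Rightarrow> bool" where
  "frac_dense A R h \<longleftrightarrow> valued_cring R \<and> (\<forall>a\<in>carrier A. nrm R (h a) = nrm A a) \<and>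
    (\<forall>b\<in>carrier R. \<forall>\<epsilon>>0. \<exists>a\<in>carrier A. \<exists>s\<in>carrier A. nrm A s = 1 \<and> h s \<in> Units R \<and>
       nrm R (b \<otimes>\<^bsub>R\<^esub> h s \<ominus>\<^bsub>R\<^esub> h a) < \<epsilon>)"

definition nearly_localization :: "('a, 'z) normed_ring_scheme \<Rightarrow> ('b, 'y) normed_ring_scheme \<Rightarrow> ('a \<Rightarrow> 'b) \<Rightarrow> bool" where
  "nearly_localization A R h \<longleftrightarrow> seminormed_cring R \<and> h \<in> ring_hom A R \<and> (nrm R \<one>\<^bsub>R\<^esub> = 0 \<or> frac_dense A R h)"

lemma ring_hom_Units:
  assumes "h \<in> ring_hom A R" "u \<in> Units A"
  shows "h u \<in> Units R"
proof -
  obtain v where v: "u \<in> carrier A" "v \<in> carrier A" "v \<otimes>\<^bsub>A\<^esub> u = \<one>\<^bsub>A\<^esub>" "u \<otimes>\<^bsub>A\<^esub> v = \<one>\<^bsub>A\<^esub>"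
    using assms(2) by (auto simp: Units_def)
  have "h v \<otimes>\<^bsub>R\<^esub> h u = \<one>\<^bsub>R\<^esub>" "h u \<otimes>\<^bsub>R\<^esub> h v = \<one>\<^bsub>R\<^esub>"
    using ring_hom_mult[OF assms(1) v(2,1)] ring_hom_mult[OF assms(1) v(1,2)] ring_hom_one[OF assms(1)]
    by (simp_all add: v(3,4))
  then show ?thesis
    using ring_hom_closed[OF assms(1) v(1)] ring_hom_closed[OF assms(1) v(2)] by (auto simp: Units_def)
qed

text \<open>The unit \<open>w\<close> is where the value group enters: in the application it is a
  scalar of absolute value 1/\<rho>, and it rescales f to norm 1, as is required of
  denominators.\<close>

lemma nearly_localization_step:
  fixes A :: "'a normed_ring" and R :: "('e, 'k) tower normed_ring"
  assumes A: "valued_cring A" and R: "nearly_localization A R h"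
    and f: "f \<in> carrier A" "nrm A f \<le> \<rho>" and \<rho>: "\<rho> > 0" and w: "w \<in> Units A" "nrm A w = 1 / \<rho>"
  shows "nearly_localization A (step_ring R (h f) \<rho> (h f) \<rho>)
    (\<lambda>a. step_map R (h f) \<rho> (h f) \<rho> (relative_const R (h a)))"
proof -
  interpret A: valued_cring A by fact
  have Rs: "seminormed_cring R" and h: "h \<in> ring_hom A R"
    using R by (auto simp: nearly_localization_def)
  interpret R: seminormed_cring R by fact
  interpret h: ring_hom_ring A R h by (rule ring_hom_ringI2) (rule A.ring_axioms, rule R.ring_axioms, rule h)
  interpret L: laurent_step R \<rho> \<rho> "h f" "h f"
    by unfold_locales (use \<rho> f in auto)
  let ?h = "\<lambda>a. L.\<pi> (L.mon (h a) 0 0)"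
  have eq: "(\<lambda>a. L.\<pi> (relative_const R (h a))) = ?h" by (simp add: L.relative_const_eq)
  have hom: "?h \<in> ring_hom A L.Q"
  proof -
    have "L.\<pi> \<circ> (relative_const R \<circ> h) \<in> ring_hom A L.Q"
      by (rule ring_hom_trans[OF ring_hom_trans[OF h L.relative_const_hom] L.\<pi>_hom])
    then show ?thesis by (simp add: o_def L.relative_const_eq)
  qed
  have one_eq: "L.\<pi> (L.mon \<one>\<^bsub>R\<^esub> 0 0) = \<one>\<^bsub>L.Q\<^esub>" using ring_hom_one[OF hom] by simp
  have "nrm L.Q \<one>\<^bsub>L.Q\<^esub> = 0 \<or> frac_dense A L.Q ?h"
  proof (cases "nrm R \<one>\<^bsub>R\<^esub> = 0")
    case True
    have "nrm L.Q \<one>\<^bsub>L.Q\<^esub> \<le> nrm R \<one>\<^bsub>R\<^esub>"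
      using L.nrm_\<pi>_le[OF L.mon_closed[OF R.one_closed], of 0 0] L.nrm_mon_le[OF R.one_closed, of 0 0]
      by (simp add: one_eq)
    then show ?thesis using True L.Q.nrm_nonneg[OF L.Q.one_closed] by simp
  next
    case False
    then have D: "frac_dense A R h" using R by (simp add: nearly_localization_def)
    then have Rv: "valued_cring R" and iso: "\<And>a. a \<in> carrier A \<Longrightarrow> nrm R (h a) = nrm A a"
      by (auto simp: frac_dense_def)
    show ?thesis
    proof (cases "nrm A f < \<rho>")
      case True
      have "nrm L.Q \<one>\<^bsub>L.Q\<^esub> \<le> nrm R (h f) * \<rho> ^ 0 / \<rho> ^ 1"
        unfolding L.\<pi>_gy[symmetric] using f(1)
        by (intro order_trans[OF L.nrm_\<pi>_le L.nrm_mon_le] L.mon_closed) auto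
      also have "\<dots> < 1" using True \<rho> iso[OF f(1)] by simp
      finally have lt: "nrm L.Q \<one>\<^bsub>L.Q\<^esub> < 1" .
      \<comment> \<open>Submultiplicativity gives c \<le> c^2 for the seminorm c of 1, so c is 0
        once it is below 1.\<close>
      have "nrm L.Q \<one>\<^bsub>L.Q\<^esub> \<le> nrm L.Q \<one>\<^bsub>L.Q\<^esub> * nrm L.Q \<one>\<^bsub>L.Q\<^esub>"
        using L.Q.nrm_mult_le[OF L.Q.one_closed L.Q.one_closed] by simp
      then have "nrm L.Q \<one>\<^bsub>L.Q\<^esub> = 0"
        using lt L.Q.nrm_nonneg[OF L.Q.one_closed] mult_strict_right_mono[OF lt, of "nrm L.Q \<one>\<^bsub>L.Q\<^esub>"] by linarith
      then show ?thesis by simp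
    next
      case False
      then have nf: "nrm R (h f) = \<rho>" using f iso by simp
      interpret R: valued_cring R by (rule Rv)
      interpret U: unit_step R \<rho> "h f" by unfold_locales (rule nf)
      have iso': "nrm L.Q (?h a) = nrm A a" if "a \<in> carrier A" for a
        using U.\<kappa>_isometry[of "h a"] iso[OF that] that by simp
      interpret h': ring_hom_ring A L.Q ?h
        by (rule ring_hom_ringI2) (rule A.ring_axioms, rule L.Q.ring_axioms, rule hom)
      have wA: "w \<in> carrier A" using w by (simp add: Units_def)
      \<comment> \<open>The rescaled f has norm 1 and becomes invertible, hence its powers are
        admissible denominators.\<close>
      define v where "v = w \<otimes>\<^bsub>A\<^esub> f"
      have v: "v \<in> carrier A" "nrm A v = 1"
        using wA f(1) w(2) False f(2) \<rho> by (auto simp: v_def A.nrm_mult)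
      have FU: "U.F \<in> Units L.Q"
        using U.FY L.Q.m_comm[OF U.FY_closed] U.FY_closed unfolding Units_def by auto
      have vU: "?h v \<in> Units L.Q"
        using L.Q.Units_m_closed[OF ring_hom_Units[OF hom w(1)] FU]
        unfolding v_def ring_hom_mult[OF hom wA f(1)] .
      have "\<exists>a\<in>carrier A. \<exists>s\<in>carrier A. nrm A s = 1 \<and> ?h s \<in> Units L.Q \<and>
          nrm L.Q (b \<otimes>\<^bsub>L.Q\<^esub> ?h s \<ominus>\<^bsub>L.Q\<^esub> ?h a) < \<epsilon>" if b: "b \<in> carrier L.Q" and \<epsilon>: "\<epsilon> > 0" for b \<epsilon>
      proof -
        obtain d where d: "d \<in> U.D" "nrm L.Q (b \<ominus>\<^bsub>L.Q\<^esub> d) \<le> \<epsilon> / 2"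
          using U.D_dense[OF b, of "\<epsilon> / 2"] \<epsilon> by auto
        obtain N :: nat and c where dc: "d \<in> carrier L.Q" "c \<in> carrier R" "d \<otimes>\<^bsub>L.Q\<^esub> U.F [^]\<^bsub>L.Q\<^esub> N = L.\<pi> (L.mon c 0 0)"
          using d(1) by (auto simp: U.D_def)
        \<comment> \<open>As d f^N is the image of \<open>c\<close>, multiplying d by v^N gives that
          of c w^N. This element of the old ring is approximated by a fraction a/s, so v^N s is a
          denominator for d.\<close>
        define c' where "c' = c \<otimes>\<^bsub>R\<^esub> h (w [^]\<^bsub>A\<^esub> N)"
        have c': "c' \<in> carrier R" using dc wA by (simp add: c'_def)
        obtain a s where as: "a \<in> carrier A" "s \<in> carrier A" "nrm A s = 1" "h s \<in> Units R"
          "nrm R (c' \<otimes>\<^bsub>R\<^esub> h s \<ominus>\<^bsub>R\<^esub> h a) < \<epsilon>"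
          using D c' \<epsilon> unfolding frac_dense_def by blast
        define s' where "s' = v [^]\<^bsub>A\<^esub> N \<otimes>\<^bsub>A\<^esub> s"
        have s': "s' \<in> carrier A" "nrm A s' = 1"
          using v as by (auto simp: s'_def A.nrm_mult A.nrm_pow)
        have hsU: "?h s \<in> Units L.Q"
        proof -
          have "(\<lambda>x. L.\<pi> (L.mon x 0 0)) \<in> ring_hom R L.Q"
            using ring_hom_trans[OF L.relative_const_hom L.\<pi>_hom] by (simp add: o_def L.relative_const_eq)
          from ring_hom_Units[OF this as(4)] show ?thesis .
        qed
        have hv: "?h (v [^]\<^bsub>A\<^esub> N) = ?h (w [^]\<^bsub>A\<^esub> N) \<otimes>\<^bsub>L.Q\<^esub> U.F [^]\<^bsub>L.Q\<^esub> N"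
        proof -
          have "v [^]\<^bsub>A\<^esub> N = w [^]\<^bsub>A\<^esub> N \<otimes>\<^bsub>A\<^esub> f [^]\<^bsub>A\<^esub> N"
            unfolding v_def using wA f(1) by (rule A.nat_pow_distrib)
          then have "?h (v [^]\<^bsub>A\<^esub> N) = ?h (w [^]\<^bsub>A\<^esub> N) \<otimes>\<^bsub>L.Q\<^esub> ?h (f [^]\<^bsub>A\<^esub> N)"
            using ring_hom_mult[OF hom, of "w [^]\<^bsub>A\<^esub> N" "f [^]\<^bsub>A\<^esub> N"] wA f(1) by simp
          also have "?h (f [^]\<^bsub>A\<^esub> N) = U.F [^]\<^bsub>L.Q\<^esub> N"
          proof -
            have "h (f [^]\<^bsub>A\<^esub> N) = h f [^]\<^bsub>R\<^esub> N" by (induction N) (use f(1) in simp_all)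
            then show ?thesis unfolding U.\<kappa>_pow by simp
          qed
          finally show ?thesis .
        qed
        have vNU: "?h (v [^]\<^bsub>A\<^esub> N) \<in> Units L.Q"
        proof -
          have "?h (v [^]\<^bsub>A\<^esub> N) = ?h v [^]\<^bsub>L.Q\<^esub> N" by (induction N) (use v(1) ring_hom_one[OF hom] ring_hom_mult[OF hom] in auto)
          moreover have "?h v [^]\<^bsub>L.Q\<^esub> N \<in> Units L.Q"
            by (induction N) (use vU L.Q.Units_m_closed L.Q.Units_one_closed in \<open>simp_all only: L.Q.nat_pow_0 L.Q.nat_pow_Suc\<close>)
          ultimately show ?thesis by simp
        qed
        have s'U: "?h s' \<in> Units L.Q"
          using L.Q.Units_m_closed[OF vNU hsU] ring_hom_mult[OF hom, of "v [^]\<^bsub>A\<^esub> N" s] v(1) as(2)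
          by (simp add: s'_def)
        have ds': "d \<otimes>\<^bsub>L.Q\<^esub> ?h s' = L.\<pi> (L.mon (c' \<otimes>\<^bsub>R\<^esub> h s) 0 0)"
        proof -
          have "?h s' = (?h (w [^]\<^bsub>A\<^esub> N) \<otimes>\<^bsub>L.Q\<^esub> U.F [^]\<^bsub>L.Q\<^esub> N) \<otimes>\<^bsub>L.Q\<^esub> ?h s"
            using ring_hom_mult[OF hom, of "v [^]\<^bsub>A\<^esub> N" s] v(1) as(2) hv by (simp add: s'_def)
          moreover have cl: "?h (w [^]\<^bsub>A\<^esub> N) \<in> carrier L.Q" "?h s \<in> carrier L.Q" "U.F [^]\<^bsub>L.Q\<^esub> N \<in> carrier L.Q"
            using wA as(2) by auto
          ultimately have "d \<otimes>\<^bsub>L.Q\<^esub> ?h s' = (d \<otimes>\<^bsub>L.Q\<^esub> U.F [^]\<^bsub>L.Q\<^esub> N) \<otimes>\<^bsub>L.Q\<^esub> ?h (w [^]\<^bsub>A\<^esub> N) \<otimes>\<^bsub>L.Q\<^esub> ?h s"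
            using dc(1) by (simp add: L.Q.m_ac)
          also have "\<dots> = L.\<pi> (L.mon (c' \<otimes>\<^bsub>R\<^esub> h s) 0 0)"
            unfolding dc(3) c'_def using dc(2) wA as(2) by (simp add: U.\<kappa>_mult)
          finally show ?thesis .
        qed
        have \<kappa>_diff: "L.\<pi> (L.mon (x \<ominus>\<^bsub>R\<^esub> y) 0 0) = L.\<pi> (L.mon x 0 0) \<ominus>\<^bsub>L.Q\<^esub> L.\<pi> (L.mon y 0 0)"
          if "x \<in> carrier R" "y \<in> carrier R" for x y
        proof -
          have "L.\<pi> (L.mon x 0 0) = L.\<pi> (L.mon ((x \<ominus>\<^bsub>R\<^esub> y) \<oplus>\<^bsub>R\<^esub> y) 0 0)"
            using that by (simp add: a_minus_def R.a_assoc R.l_neg)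
          also have "\<dots> = L.\<pi> (L.mon (x \<ominus>\<^bsub>R\<^esub> y) 0 0) \<oplus>\<^bsub>L.Q\<^esub> L.\<pi> (L.mon y 0 0)"
            using that by (intro U.\<kappa>_add) auto
          finally show ?thesis
            using that by (simp add: a_minus_def L.Q.a_assoc L.Q.r_neg)
        qed
        \<comment> \<open>The error of replacing b by d is not enlarged, because s' has norm 1; the
          error of the approximation in the old ring is preserved by the isometry.\<close>
        define e1 e2 where "e1 = (b \<ominus>\<^bsub>L.Q\<^esub> d) \<otimes>\<^bsub>L.Q\<^esub> ?h s'" and "e2 = d \<otimes>\<^bsub>L.Q\<^esub> ?h s' \<ominus>\<^bsub>L.Q\<^esub> ?h a"
        have hc: "?h s' \<in> carrier L.Q" "?h a \<in> carrier L.Q" using s' as by auto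
        have ec: "e1 \<in> carrier L.Q" "e2 \<in> carrier L.Q" using b dc(1) hc by (auto simp: e1_def e2_def)
        have "b \<otimes>\<^bsub>L.Q\<^esub> ?h s' \<ominus>\<^bsub>L.Q\<^esub> ?h a = e1 \<oplus>\<^bsub>L.Q\<^esub> e2"
        proof -
          have "b \<otimes>\<^bsub>L.Q\<^esub> x \<ominus>\<^bsub>L.Q\<^esub> y = (b \<ominus>\<^bsub>L.Q\<^esub> d) \<otimes>\<^bsub>L.Q\<^esub> x \<oplus>\<^bsub>L.Q\<^esub> (d \<otimes>\<^bsub>L.Q\<^esub> x \<ominus>\<^bsub>L.Q\<^esub> y)"
            if "x \<in> carrier L.Q" "y \<in> carrier L.Q" for x y
            using b dc(1) that by algebra
          then show ?thesis unfolding e1_def e2_def using hc by blast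
        qed
        moreover have "nrm L.Q e1 \<le> \<epsilon> / 2"
        proof -
          have "nrm L.Q e1 \<le> nrm L.Q (b \<ominus>\<^bsub>L.Q\<^esub> d) * nrm L.Q (?h s')"
            unfolding e1_def using b dc(1) hc by (intro L.Q.nrm_mult_le) auto
          then show ?thesis using d(2) iso'[OF s'(1)] s'(2) by simp
        qed
        moreover have "nrm L.Q e2 < \<epsilon>"
        proof -
          have "e2 = L.\<pi> (L.mon (c' \<otimes>\<^bsub>R\<^esub> h s \<ominus>\<^bsub>R\<^esub> h a) 0 0)"
            unfolding e2_def ds' using c' as by (intro \<kappa>_diff[symmetric]) auto
          moreover have "c' \<otimes>\<^bsub>R\<^esub> h s \<ominus>\<^bsub>R\<^esub> h a \<in> carrier R" using c' as by simp
          ultimately show ?thesis using U.\<kappa>_isometry as(5) by simp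
        qed
        moreover have "nrm L.Q (e1 \<oplus>\<^bsub>L.Q\<^esub> e2) \<le> max (nrm L.Q e1) (nrm L.Q e2)"
          by (rule L.Q.nrm_add[OF ec])
        ultimately have "nrm L.Q (b \<otimes>\<^bsub>L.Q\<^esub> ?h s' \<ominus>\<^bsub>L.Q\<^esub> ?h a) < \<epsilon>" using \<epsilon> by simp
        then show ?thesis using as(1) s' s'U by blast
      qed
      then have "frac_dense A L.Q ?h"
        unfolding frac_dense_def using U.Q_valued iso' by blast
      then show ?thesis by simp
    qed
  qed
  then show ?thesis
    unfolding nearly_localization_def eq using L.Q_seminormed hom by blast
qed

lemma nearly_localization_iterated:
  fixes A :: "'a normed_ring" and R :: "('e, 'k) tower normed_ring"
  assumes A: "valued_cring A" and R: "nearly_localization A R h"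
    and fs: "\<And>f r g s. (f, r, g, s) \<in> set fs \<Longrightarrow> g = f \<and> s = r \<and> r > 0 \<and> f \<in> carrier A \<and> nrm A f \<le> r \<and>
      (\<exists>w\<in>Units A. nrm A w = 1 / r)"
  shows "nearly_localization A (fst (iterated_domain R h fs)) (snd (iterated_domain R h fs))"
  using R fs
proof (induction fs arbitrary: R h)
  case (Cons x fs)
  obtain f r g s where x: "x = (f, r, g, s)" by (cases x)
  have "g = f \<and> s = r \<and> r > 0 \<and> f \<in> carrier A \<and> nrm A f \<le> r \<and> (\<exists>w\<in>Units A. nrm A w = 1 / r)"
    by (rule Cons.prems(2)) (simp add: x)
  then obtain w where p: "g = f" "s = r" "r > 0" "f \<in> carrier A" "nrm A f \<le> r" "w \<in> Units A" "nrm A w = 1 / r"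
    by blast
  have "nearly_localization A (step_ring R (h f) r (h f) r) (\<lambda>a. step_map R (h f) r (h f) r (relative_const R (h a)))"
    by (rule nearly_localization_step[OF A Cons.prems(1) p(4,5,3,6,7)])
  then have "nearly_localization A
      (fst (iterated_domain (step_ring R (h f) r (h f) r) (\<lambda>a. step_map R (h f) r (h f) r (relative_const R (h a))) fs))
      (snd (iterated_domain (step_ring R (h f) r (h f) r) (\<lambda>a. step_map R (h f) r (h f) r (relative_const R (h a))) fs))"
    by (rule Cons.IH) (rule Cons.prems(2), simp)
  then show ?case
    unfolding x p(1,2) iterated_domain.simps step_ring_def step_map_def laurent_domain_map_def .
qed simp

text \<open>Nothing has been inverted yet, and the denominator 1 serves all elements.\<close>

lemma nearly_localization_ground:
  fixes A :: "('e \<Rightarrow> 'k) normed_ring"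
  assumes A: "valued_cring A"
  shows "nearly_localization A (image_normed_ring Ground A) (Ground :: _ \<Rightarrow> ('e, 'k) tower)"
proof -
  interpret A: valued_cring A by fact
  let ?G = "image_normed_ring (Ground :: _ \<Rightarrow> ('e, 'k) tower) A"
  have inj: "inj_on (Ground :: _ \<Rightarrow> ('e, 'k) tower) (carrier A)" by (simp add: inj_on_def)
  note G = image_normed_ring[OF A.is_cring inj]
  interpret G: cring ?G by (rule G(1))
  have car: "Ground ` carrier A = carrier ?G" by (simp add: image_normed_ring_sel)
  have sn: "seminormed_cring ?G"
    by (rule seminormed_cringI_quotient[OF A.seminormed_cring_axioms G(1,2) car])
      (use G(3) A.nrm_nonneg in \<open>auto simp: image_normed_ring_sel(1)\<close>)
  interpret G: seminormed_cring ?G by (rule sn)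
  have "valued_cring ?G"
  proof
    show "nrm ?G \<one>\<^bsub>?G\<^esub> = 1" using G(3)[OF A.one_closed] A.nrm_one by (simp add: image_normed_ring_sel(2))
    show "nrm ?G (a \<otimes>\<^bsub>?G\<^esub> b) = nrm ?G a * nrm ?G b" if ab: "a \<in> carrier ?G" "b \<in> carrier ?G" for a b
    proof -
      obtain x y where xy: "x \<in> carrier A" "y \<in> carrier A" "a = Ground x" "b = Ground y"
        using ab by (auto simp: image_normed_ring_sel(1))
      have "Ground x \<otimes>\<^bsub>?G\<^esub> Ground y = Ground (x \<otimes>\<^bsub>A\<^esub> y)" using ring_hom_mult[OF G(2) xy(1,2)] by simp
      then show ?thesis using xy G(3) A.nrm_mult by simp
    qed
  qed
  moreover have "\<exists>a\<in>carrier A. \<exists>s\<in>carrier A. nrm A s = 1 \<and> Ground s \<in> Units ?G \<and>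
       nrm ?G (b \<otimes>\<^bsub>?G\<^esub> Ground s \<ominus>\<^bsub>?G\<^esub> Ground a) < \<epsilon>" if b: "b \<in> carrier ?G" and "\<epsilon> > 0" for b \<epsilon>
  proof -
    obtain a where a: "a \<in> carrier A" "b = Ground a" using b by (auto simp: image_normed_ring_sel(1))
    have one: "Ground \<one>\<^bsub>A\<^esub> = \<one>\<^bsub>?G\<^esub>" by (simp add: image_normed_ring_sel(2))
    have "b \<otimes>\<^bsub>?G\<^esub> \<one>\<^bsub>?G\<^esub> \<ominus>\<^bsub>?G\<^esub> b = \<zero>\<^bsub>?G\<^esub>" using b by (simp add: a_minus_def G.r_neg)
    then have "nrm ?G (b \<otimes>\<^bsub>?G\<^esub> Ground \<one>\<^bsub>A\<^esub> \<ominus>\<^bsub>?G\<^esub> Ground a) < \<epsilon>"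
      using \<open>\<epsilon> > 0\<close> G.nrm_zero by (simp add: one a(2)[symmetric])
    moreover have "Ground \<one>\<^bsub>A\<^esub> \<in> Units ?G" unfolding one by (rule G.Units_one_closed)
    ultimately show ?thesis
      by (intro bexI[OF _ a(1)] bexI[OF _ A.one_closed] conjI A.nrm_one) (simp_all add: a(2))
  qed
  ultimately have "frac_dense A ?G Ground" unfolding frac_dense_def using G(3) by blast
  then show ?thesis unfolding nearly_localization_def using sn G(2) by blast
qed

section \<open>Reductions and localizations\<close>

lemma (in ring) minus_eq_zero_iff:
  assumes "a \<in> carrier R" "b \<in> carrier R"
  shows "a \<ominus> b = \<zero> \<longleftrightarrow> a = b"
proof
  assume "a \<ominus> b = \<zero>"
  then have "(a \<ominus> b) \<oplus> b = \<zero> \<oplus> b" by simp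
  then show "a = b" using assms by (simp add: a_minus_def a_assoc l_neg)
qed (use assms in \<open>simp add: a_minus_def r_neg\<close>)

text \<open>Covers the absolute value of the ground field, the norm of A and the spectral norm of B.
  \<open>N_one\<close> is an inequality in order to admit the degenerate case in which 1 has value
  0.\<close>

locale unit_ball = cring S for S :: "('a, 'z) ring_scheme" (structure) +
  fixes N :: "'a \<Rightarrow> real"
  assumes N_nonneg: "a \<in> carrier S \<Longrightarrow> N a \<ge> 0"
    and N_zero: "N \<zero> = 0"
    and N_minus: "a \<in> carrier S \<Longrightarrow> N (\<ominus> a) = N a"
    and N_add: "a \<in> carrier S \<Longrightarrow> b \<in> carrier S \<Longrightarrow> N (a \<oplus> b) \<le> max (N a) (N b)"
    and N_mult: "a \<in> carrier S \<Longrightarrow> b \<in> carrier S \<Longrightarrow> N (a \<otimes> b) \<le> N a * N b"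
    and N_one: "N \<one> \<le> 1"
begin

abbreviation "P \<equiv> ball_ring S N"
abbreviation "M \<equiv> open_ball_ideal S N"
abbreviation "red \<equiv> reduction_wrt S N"
abbreviation "cl a \<equiv> M +>\<^bsub>P\<^esub> a"

lemma P_sel:
  "carrier P = {a \<in> carrier S. N a \<le> 1}" "mult P = mult S" "add P = add S" "\<one>\<^bsub>P\<^esub> = \<one>" "\<zero>\<^bsub>P\<^esub> = \<zero>"
  by (simp_all add: ball_ring_def)

lemma N_mult_le_one:
  assumes "a \<in> carrier S" "b \<in> carrier S" "N a \<le> 1" "N b \<le> 1"
  shows "N (a \<otimes> b) \<le> 1"
  by (rule order_trans[OF N_mult mult_le_one]) (use assms N_nonneg in auto)

lemma N_add_le_one:
  assumes "a \<in> carrier S" "b \<in> carrier S" "N a \<le> 1" "N b \<le> 1"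
  shows "N (a \<oplus> b) \<le> 1"
  by (rule order_trans[OF N_add]) (use assms in auto)

lemma P_cring: "cring P"
  by (rule cring_subset[OF is_cring])
    (use N_one N_zero in \<open>auto simp: P_sel N_minus intro!: N_add_le_one N_mult_le_one\<close>)

sublocale P: cring P by (rule P_cring)

lemma P_minus: "a \<in> carrier P \<Longrightarrow> \<ominus>\<^bsub>P\<^esub> a = \<ominus> a"
  by (rule P.minus_equality) (auto simp: P_sel N_minus l_neg)

lemma P_diff: "a \<in> carrier P \<Longrightarrow> b \<in> carrier P \<Longrightarrow> a \<ominus>\<^bsub>P\<^esub> b = a \<ominus> b"
  by (simp only: a_minus_def P_minus P_sel(3))

sublocale M: ideal M P
proof (rule idealI)
  show "ring P" by (rule P.ring_axioms)
  show "subgroup M (add_monoid P)"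
  proof
    show "inv\<^bsub>add_monoid P\<^esub> a \<in> M" if "a \<in> M" for a
    proof -
      have "\<ominus>\<^bsub>P\<^esub> a = \<ominus> a" using that by (intro P_minus) (auto simp: P_sel open_ball_ideal_def)
      then show ?thesis using that by (auto simp: a_inv_def open_ball_ideal_def N_minus[unfolded a_inv_def])
    qed
    show "a \<otimes>\<^bsub>add_monoid P\<^esub> b \<in> M" if "a \<in> M" "b \<in> M" for a b
      using that le_less_trans[OF N_add[of a b]] by (auto simp: P_sel open_ball_ideal_def)
  qed (auto simp: P_sel open_ball_ideal_def N_zero)
  have *: "N (x \<otimes> a) < 1" if "x \<in> carrier S" "a \<in> carrier S" "N x \<le> 1" "N a < 1" for a x
  proof -
    have "N x * N a \<le> 1 * N a" using that N_nonneg by (intro mult_right_mono) auto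
    then show ?thesis using N_mult[of x a] that by simp
  qed
  show "x \<otimes>\<^bsub>P\<^esub> a \<in> M" "a \<otimes>\<^bsub>P\<^esub> x \<in> M" if "a \<in> M" "x \<in> carrier P" for a x
    using that * m_comm[of a x] by (auto simp: P_sel open_ball_ideal_def)
qed

lemma red_cring: "cring red"
  unfolding reduction_wrt_def by (rule M.quotient_is_cring) (rule P_cring)

sublocale red: cring red by (rule red_cring)

lemma cl_hom: "(\<lambda>a. cl a) \<in> ring_hom P red"
  unfolding reduction_wrt_def using M.rcos_ring_hom .

lemma cl_closed [simp]: "a \<in> carrier P \<Longrightarrow> cl a \<in> carrier red"
  by (rule ring_hom_closed[OF cl_hom])

lemma cl_mult: "a \<in> carrier P \<Longrightarrow> b \<in> carrier P \<Longrightarrow> cl (a \<otimes>\<^bsub>P\<^esub> b) = cl a \<otimes>\<^bsub>red\<^esub> cl b"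
  by (rule ring_hom_mult[OF cl_hom])

lemma cl_add: "a \<in> carrier P \<Longrightarrow> b \<in> carrier P \<Longrightarrow> cl (a \<oplus>\<^bsub>P\<^esub> b) = cl a \<oplus>\<^bsub>red\<^esub> cl b"
  by (rule ring_hom_add[OF cl_hom])

lemma cl_one: "cl \<one>\<^bsub>P\<^esub> = \<one>\<^bsub>red\<^esub>"
  by (rule ring_hom_one[OF cl_hom])

lemma cl_surj: "(\<lambda>a. cl a) ` carrier P = carrier red"
  by (auto simp: reduction_wrt_def FactRing_def A_RCOSETS_def')

lemma cl_obtain:
  assumes "y \<in> carrier red"
  obtains a where "a \<in> carrier S" "N a \<le> 1" "y = cl a"
proof -
  have "y \<in> (\<lambda>a. cl a) ` carrier P" using assms by (simp only: cl_surj)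
  then show thesis using that unfolding P_sel by blast
qed

lemma cl_zero_iff: assumes a: "a \<in> carrier P" shows "cl a = \<zero>\<^bsub>red\<^esub> \<longleftrightarrow> N a < 1"
proof -
  have z: "\<zero>\<^bsub>red\<^esub> = M" by (simp add: reduction_wrt_def FactRing_def)
  have "a \<in> M \<longleftrightarrow> cl a = M"
    using M.a_rcos_const M.a_rcos_self[OF a] by blast
  then show ?thesis unfolding z using a by (auto simp: P_sel open_ball_ideal_def)
qed

lemma cl_eq_iff: assumes "a \<in> carrier P" "b \<in> carrier P" shows "cl a = cl b \<longleftrightarrow> N (a \<ominus> b) < 1"
proof -
  have "cl a = cl b \<longleftrightarrow> a \<ominus>\<^bsub>P\<^esub> b \<in> M"
    using P.quotient_eq_iff_same_a_r_cos[OF M.ideal_axioms assms] by simp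
  then show ?thesis using P.minus_closed[OF assms] by (simp add: P_diff[OF assms] P_sel open_ball_ideal_def)
qed

lemma mem_cl_iff: assumes a: "a \<in> carrier P" shows "b \<in> cl a \<longleftrightarrow> b \<in> carrier P \<and> cl b = cl a"
proof
  assume b: "b \<in> cl a"
  show "b \<in> carrier P \<and> cl b = cl a"
    using M.a_elemrcos_carrier[OF a b] P.a_repr_independence[OF b a M.a_subgroup] by simp
qed (use M.a_rcos_self in blast)

end

text \<open>There is no map from \<open>L\<close> to \<open>R\<close> at hand, only a ring
  \<open>P\<close> that maps onto \<open>L\<close> and to \<open>R\<close>; in the application it is
  the unit ball of A. Invertible denominators (\<open>unit\<close>), surjectivity up to denominators
  (\<open>frac\<close>) and compatible kernels (\<open>ker\<close>) characterize \<open>R\<close> as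
  the localization of \<open>L\<close> at the image of \<open>Sm\<close>.\<close>

lemma localization_iso:
  fixes P :: "('p, 'z) ring_scheme" and L :: "('l, 'y) ring_scheme" and R :: "('r, 'x) ring_scheme"
  assumes "cring P" "cring L" "cring R"
    and p1: "p1 \<in> ring_hom P L" "p1 ` carrier P = carrier L" and p2: "p2 \<in> ring_hom P R"
    and Sm: "Sm \<subseteq> carrier P" "\<one>\<^bsub>P\<^esub> \<in> Sm" "\<And>s t. s \<in> Sm \<Longrightarrow> t \<in> Sm \<Longrightarrow> s \<otimes>\<^bsub>P\<^esub> t \<in> Sm"
    and unit: "\<And>s. s \<in> Sm \<Longrightarrow> p2 s \<in> Units R"
    and frac: "\<And>b. b \<in> carrier R \<Longrightarrow> \<exists>a\<in>carrier P. \<exists>s\<in>Sm. b \<otimes>\<^bsub>R\<^esub> p2 s = p2 a"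
    and ker: "\<And>a. a \<in> carrier P \<Longrightarrow> p2 a = \<zero>\<^bsub>R\<^esub> \<longleftrightarrow> (\<exists>t\<in>Sm. p1 (t \<otimes>\<^bsub>P\<^esub> a) = \<zero>\<^bsub>L\<^esub>)"
  shows "submonoid (p1 ` Sm) L"
    and "\<exists>\<phi>\<in>ring_iso R (localization L (p1 ` Sm)). \<forall>a\<in>carrier P. \<phi> (p2 a) = localization_map L (p1 ` Sm) (p1 a)"
proof -
  interpret P: cring P by fact
  interpret L: cring L by fact
  interpret R: cring R by fact
  interpret p1: ring_hom_ring P L p1 by (rule ring_hom_ringI2) (rule P.ring_axioms, rule L.ring_axioms, rule p1(1))
  interpret p2: ring_hom_ring P R p2 by (rule ring_hom_ringI2) (rule P.ring_axioms, rule R.ring_axioms, rule p2)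
  let ?S = "p1 ` Sm"
  let ?F = "frac_class L ?S"
  have SmP: "s \<in> carrier P" if "s \<in> Sm" for s using that Sm(1) by blast
  show sub: "submonoid ?S L"
  proof
    show "?S \<subseteq> carrier L" using SmP by auto
    show "x \<otimes>\<^bsub>L\<^esub> y \<in> ?S" if "x \<in> ?S" "y \<in> ?S" for x y
    proof -
      obtain s t where st: "s \<in> Sm" "x = p1 s" "t \<in> Sm" "y = p1 t" using \<open>x \<in> ?S\<close> \<open>y \<in> ?S\<close> by blast
      then have "x \<otimes>\<^bsub>L\<^esub> y = p1 (s \<otimes>\<^bsub>P\<^esub> t)" using SmP by simp
      then show ?thesis using Sm(3) st by blast
    qed
    show "\<one>\<^bsub>L\<^esub> \<in> ?S" using Sm(2) p1.hom_one by (metis imageI)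
  qed
  \<comment> \<open>\<open>rep b a s\<close> says that b is the fraction a/s in \<open>R\<close>.
    The set \<open>C b\<close> of the images in \<open>L\<close> of all such fractions turns out to
    be a class of the localization, and \<open>C\<close> is the isomorphism.\<close>
  define rep where "rep b a s \<longleftrightarrow> a \<in> carrier P \<and> s \<in> Sm \<and> b \<in> carrier R \<and> b \<otimes>\<^bsub>R\<^esub> p2 s = p2 a" for b a s
  define C where "C b = {(p1 a, p1 s) | a s. rep b a s}" for b
  have cancel: "x = y" if "x \<in> carrier R" "y \<in> carrier R" "s \<in> Sm" "x \<otimes>\<^bsub>R\<^esub> p2 s = y \<otimes>\<^bsub>R\<^esub> p2 s" for x y s
    using that unit[OF that(3)] R.Units_l_cancel[of "p2 s" x y] R.m_comm[of _ "p2 s"] R.Units_closed by simp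
  \<comment> \<open>Equality in \<open>R\<close> is expressed by the kernel of \<open>p2\<close>,
    and \<open>ker\<close> translates this into the multiplier that occurs in
    \<open>frac_rel\<close>.\<close>
  have key: "((p1 a, p1 s), (p1 a', p1 s')) \<in> frac_rel L ?S \<longleftrightarrow> b = b'" if r: "rep b a s" "rep b' a' s'" for a s b a' s' b'
  proof -
    have c: "a \<in> carrier P" "s \<in> Sm" "b \<in> carrier R" "b \<otimes>\<^bsub>R\<^esub> p2 s = p2 a" "s \<in> carrier P"
      "a' \<in> carrier P" "s' \<in> Sm" "b' \<in> carrier R" "b' \<otimes>\<^bsub>R\<^esub> p2 s' = p2 a'" "s' \<in> carrier P"
      using r SmP by (auto simp: rep_def)
    let ?d = "a \<otimes>\<^bsub>P\<^esub> s' \<ominus>\<^bsub>P\<^esub> a' \<otimes>\<^bsub>P\<^esub> s"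
    have "b = b' \<longleftrightarrow> b \<otimes>\<^bsub>R\<^esub> p2 (s \<otimes>\<^bsub>P\<^esub> s') = b' \<otimes>\<^bsub>R\<^esub> p2 (s \<otimes>\<^bsub>P\<^esub> s')"
      using cancel[of b b' "s \<otimes>\<^bsub>P\<^esub> s'"] c Sm(3) by blast
    also have "b \<otimes>\<^bsub>R\<^esub> p2 (s \<otimes>\<^bsub>P\<^esub> s') = (b \<otimes>\<^bsub>R\<^esub> p2 s) \<otimes>\<^bsub>R\<^esub> p2 s'"
      using c(3,5,10) by (simp add: R.m_assoc)
    also have "\<dots> = p2 (a \<otimes>\<^bsub>P\<^esub> s')" unfolding c(4) using c(1,10) by simp
    also have "b' \<otimes>\<^bsub>R\<^esub> p2 (s \<otimes>\<^bsub>P\<^esub> s') = (b' \<otimes>\<^bsub>R\<^esub> p2 s') \<otimes>\<^bsub>R\<^esub> p2 s"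
      using c(5,8,10) by (simp add: R.m_ac)
    also have "\<dots> = p2 (a' \<otimes>\<^bsub>P\<^esub> s)" unfolding c(9) using c(5,6) by simp
    also have "p2 (a \<otimes>\<^bsub>P\<^esub> s') = p2 (a' \<otimes>\<^bsub>P\<^esub> s) \<longleftrightarrow> p2 ?d = \<zero>\<^bsub>R\<^esub>"
      using c by (simp add: a_minus_def R.minus_eq_zero_iff[unfolded a_minus_def])
    also have "\<dots> \<longleftrightarrow> (\<exists>t\<in>Sm. p1 (t \<otimes>\<^bsub>P\<^esub> ?d) = \<zero>\<^bsub>L\<^esub>)" using c by (intro ker) simp
    also have "\<dots> \<longleftrightarrow> (\<exists>t\<in>Sm. p1 t \<otimes>\<^bsub>L\<^esub> (p1 a \<otimes>\<^bsub>L\<^esub> p1 s') = p1 t \<otimes>\<^bsub>L\<^esub> (p1 a' \<otimes>\<^bsub>L\<^esub> p1 s))"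
    proof (rule bex_cong[OF refl])
      fix t assume "t \<in> Sm"
      then have t: "t \<in> carrier P" by (rule SmP)
      have cl: "p1 t \<in> carrier L" "p1 a \<otimes>\<^bsub>L\<^esub> p1 s' \<in> carrier L" "p1 a' \<otimes>\<^bsub>L\<^esub> p1 s \<in> carrier L" using t c by simp_all
      have "p1 (t \<otimes>\<^bsub>P\<^esub> ?d) = p1 t \<otimes>\<^bsub>L\<^esub> (p1 a \<otimes>\<^bsub>L\<^esub> p1 s' \<ominus>\<^bsub>L\<^esub> p1 a' \<otimes>\<^bsub>L\<^esub> p1 s)"
        using t c by (simp add: a_minus_def)
      also have "\<dots> = p1 t \<otimes>\<^bsub>L\<^esub> (p1 a \<otimes>\<^bsub>L\<^esub> p1 s') \<ominus>\<^bsub>L\<^esub> p1 t \<otimes>\<^bsub>L\<^esub> (p1 a' \<otimes>\<^bsub>L\<^esub> p1 s)"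
        using cl by (simp add: a_minus_def L.r_distr L.r_minus)
      finally show "p1 (t \<otimes>\<^bsub>P\<^esub> ?d) = \<zero>\<^bsub>L\<^esub> \<longleftrightarrow> p1 t \<otimes>\<^bsub>L\<^esub> (p1 a \<otimes>\<^bsub>L\<^esub> p1 s') = p1 t \<otimes>\<^bsub>L\<^esub> (p1 a' \<otimes>\<^bsub>L\<^esub> p1 s)"
        using cl by (simp only: L.minus_eq_zero_iff L.m_closed)
    qed
    also have "\<dots> \<longleftrightarrow> ((p1 a, p1 s), (p1 a', p1 s')) \<in> frac_rel L ?S"
      using c by (auto simp: frac_rel_def)
    finally show ?thesis by blast
  qed
  have ex_rep: "\<exists>b. rep b a s" if "a \<in> carrier P" "s \<in> Sm" for a s
  proof -
    have "rep (p2 a \<otimes>\<^bsub>R\<^esub> inv\<^bsub>R\<^esub> p2 s) a s"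
      unfolding rep_def using that unit[OF that(2)] SmP[OF that(2)] by (simp add: R.m_assoc)
    then show ?thesis by blast
  qed
  have F: "?F (p1 a) (p1 s) = C b" if r: "rep b a s" for a s b
  proof (rule equalityI; rule subrelI)
    fix x y assume xy: "(x, y) \<in> ?F (p1 a) (p1 s)"
    then have rel: "((p1 a, p1 s), (x, y)) \<in> frac_rel L ?S" by (simp add: frac_class_def)
    then have "x \<in> carrier L" "y \<in> ?S" by (auto simp: frac_rel_def)
    then obtain a' s' where as: "a' \<in> carrier P" "x = p1 a'" "s' \<in> Sm" "y = p1 s'"
      using p1(2) by blast
    obtain b' where b': "rep b' a' s'" using ex_rep[OF as(1,3)] by blast
    have "b' = b" using key[OF r b'] rel as by blast
    then show "(x, y) \<in> C b" using b' as unfolding C_def by blast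
  next
    fix x y assume "(x, y) \<in> C b"
    then obtain a' s' where as: "rep b a' s'" "x = p1 a'" "y = p1 s'" unfolding C_def by blast
    then show "(x, y) \<in> ?F (p1 a) (p1 s)" using key[OF r as(1)] by (simp add: frac_class_def)
  qed
  have C_ne: "\<exists>a s. rep b a s" if "b \<in> carrier R" for b
    using frac[OF that] that unfolding rep_def by blast
  have C_inj: "b = b'" if b: "b \<in> carrier R" "b' \<in> carrier R" and eq: "C b = C b'" for b b'
  proof -
    obtain a s where r: "rep b a s" using C_ne[OF b(1)] by blast
    then have "(p1 a, p1 s) \<in> C b" unfolding C_def by blast
    then have "(p1 a, p1 s) \<in> C b'" by (simp only: eq)
    then obtain a' s' where r': "rep b' a' s'" "p1 a = p1 a'" "p1 s = p1 s'" unfolding C_def by blast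
    have "((p1 a, p1 s), (p1 a', p1 s')) \<in> frac_rel L ?S"
      using key[OF r r] r'(2,3) by simp
    then show ?thesis using key[OF r r'(1)] by blast
  qed
  let ?Q = "localization L ?S"
  have car: "carrier ?Q = C ` carrier R"
  proof
    show "carrier ?Q \<subseteq> C ` carrier R"
    proof
      fix X assume "X \<in> carrier ?Q"
      then obtain x y where xy: "x \<in> carrier L" "y \<in> ?S" "X = ?F x y"
        by (auto simp: localization_def quotient_def frac_class_def)
      then obtain a s where as: "a \<in> carrier P" "x = p1 a" "s \<in> Sm" "y = p1 s" using p1(2) by blast
      obtain b where b: "rep b a s" using ex_rep[OF as(1,3)] by blast
      then have "X = C b" "b \<in> carrier R" using F[OF b] xy as by (auto simp: rep_def)
      then show "X \<in> C ` carrier R" by blast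
    qed
    show "C ` carrier R \<subseteq> carrier ?Q"
    proof
      fix X assume "X \<in> C ` carrier R"
      then obtain b where b: "b \<in> carrier R" "X = C b" by blast
      obtain a s where r: "rep b a s" using C_ne[OF b(1)] by blast
      then have "(p1 a, p1 s) \<in> carrier L \<times> ?S" by (auto simp: rep_def)
      moreover have "X = frac_rel L ?S `` {(p1 a, p1 s)}" using F[OF r] b by (simp add: frac_class_def)
      ultimately have "X \<in> (carrier L \<times> ?S) // frac_rel L ?S" by (simp only: quotientI)
      then show "X \<in> carrier ?Q" by (simp add: localization_def)
    qed
  qed
  have rep_mult: "rep (b \<otimes>\<^bsub>R\<^esub> b') (a \<otimes>\<^bsub>P\<^esub> a') (s \<otimes>\<^bsub>P\<^esub> s')" if "rep b a s" "rep b' a' s'" for b a s b' a' s'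
  proof -
    have c: "a \<in> carrier P" "s \<in> Sm" "b \<in> carrier R" "b \<otimes>\<^bsub>R\<^esub> p2 s = p2 a" "s \<in> carrier P"
      "a' \<in> carrier P" "s' \<in> Sm" "b' \<in> carrier R" "b' \<otimes>\<^bsub>R\<^esub> p2 s' = p2 a'" "s' \<in> carrier P"
      using that SmP by (auto simp: rep_def)
    have "(b \<otimes>\<^bsub>R\<^esub> b') \<otimes>\<^bsub>R\<^esub> p2 (s \<otimes>\<^bsub>P\<^esub> s') = (b \<otimes>\<^bsub>R\<^esub> p2 s) \<otimes>\<^bsub>R\<^esub> (b' \<otimes>\<^bsub>R\<^esub> p2 s')"
      using c(3,5,8,10) by (simp add: R.m_ac)
    also have "\<dots> = p2 (a \<otimes>\<^bsub>P\<^esub> a')" unfolding c(4,9) using c(1,6) by simp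
    finally show ?thesis
      unfolding rep_def using c(1,3,6,8) by - (intro conjI Sm(3)[OF c(2,7)], simp_all)
  qed
  have rep_add: "rep (b \<oplus>\<^bsub>R\<^esub> b') (a \<otimes>\<^bsub>P\<^esub> s' \<oplus>\<^bsub>P\<^esub> a' \<otimes>\<^bsub>P\<^esub> s) (s \<otimes>\<^bsub>P\<^esub> s')" if "rep b a s" "rep b' a' s'" for b a s b' a' s'
  proof -
    have c: "a \<in> carrier P" "s \<in> Sm" "b \<in> carrier R" "b \<otimes>\<^bsub>R\<^esub> p2 s = p2 a" "s \<in> carrier P"
      "a' \<in> carrier P" "s' \<in> Sm" "b' \<in> carrier R" "b' \<otimes>\<^bsub>R\<^esub> p2 s' = p2 a'" "s' \<in> carrier P"
      using that SmP by (auto simp: rep_def)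
    have "(b \<oplus>\<^bsub>R\<^esub> b') \<otimes>\<^bsub>R\<^esub> p2 (s \<otimes>\<^bsub>P\<^esub> s') =
        (b \<otimes>\<^bsub>R\<^esub> p2 s) \<otimes>\<^bsub>R\<^esub> p2 s' \<oplus>\<^bsub>R\<^esub> (b' \<otimes>\<^bsub>R\<^esub> p2 s') \<otimes>\<^bsub>R\<^esub> p2 s"
    proof -
      have e: "(b \<oplus>\<^bsub>R\<^esub> b') \<otimes>\<^bsub>R\<^esub> (x \<otimes>\<^bsub>R\<^esub> y) = b \<otimes>\<^bsub>R\<^esub> x \<otimes>\<^bsub>R\<^esub> y \<oplus>\<^bsub>R\<^esub> b' \<otimes>\<^bsub>R\<^esub> y \<otimes>\<^bsub>R\<^esub> x"
        if "x \<in> carrier R" "y \<in> carrier R" for x y using c(3,8) that by algebra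
      show ?thesis unfolding p2.hom_mult[OF c(5,10)] by (rule e) (use c(5,10) in simp_all)
    qed
    also have "\<dots> = p2 (a \<otimes>\<^bsub>P\<^esub> s' \<oplus>\<^bsub>P\<^esub> a' \<otimes>\<^bsub>P\<^esub> s)" unfolding c(4,9) using c(1,5,6,10) by simp
    finally show ?thesis
      unfolding rep_def using c(1,3,5,6,8,10) by - (intro conjI Sm(3)[OF c(2,7)], simp_all)
  qed
  \<comment> \<open>The operations of \<open>localization\<close> are unions over representatives; a
    union of equal sets is that set.\<close>
  have UN: "(\<Union>(x, y)\<in>C b. \<Union>(x', y')\<in>C b'. G x y x' y') = Z"
    if b: "b \<in> carrier R" "b' \<in> carrier R"
      and G: "\<And>a s a' s'. rep b a s \<Longrightarrow> rep b' a' s' \<Longrightarrow> G (p1 a) (p1 s) (p1 a') (p1 s') = Z"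
    for b b' and G :: "_ \<Rightarrow> _ \<Rightarrow> _ \<Rightarrow> _ \<Rightarrow> ('l \<times> 'l) set" and Z
  proof -
    obtain a s where r: "rep b a s" using C_ne[OF b(1)] by blast
    obtain a' s' where r': "rep b' a' s'" using C_ne[OF b(2)] by blast
    have ne: "C b \<noteq> {}" "C b' \<noteq> {}" using r r' unfolding C_def by blast+
    have G': "G x y x' y' = Z" if "(x, y) \<in> C b" "(x', y') \<in> C b'" for x y x' y'
      using that G unfolding C_def by blast
    show ?thesis
    proof (rule SUP_eq_const[OF ne(1)])
      fix u assume u: "u \<in> C b"
      obtain x y where xy: "u = (x, y)" by (cases u)
      have "(\<Union>(x', y')\<in>C b'. G x y x' y') = Z"
        by (rule SUP_eq_const[OF ne(2)]) (use G' u xy in \<open>simp only: split_paired_all prod.case\<close>)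
      then show "(case u of (x, y) \<Rightarrow> \<Union>(x', y')\<in>C b'. G x y x' y') = Z" by (simp only: xy prod.case)
    qed
  qed
  have rep_p2: "rep (p2 a) a \<one>\<^bsub>P\<^esub>" if "a \<in> carrier P" for a
    unfolding rep_def using that Sm(2) by simp
  have "C \<in> ring_hom R ?Q"
  proof (rule ring_hom_memI)
    show "C b \<in> carrier ?Q" if "b \<in> carrier R" for b using that car by blast
    show "C (b \<otimes>\<^bsub>R\<^esub> b') = C b \<otimes>\<^bsub>?Q\<^esub> C b'" if b: "b \<in> carrier R" "b' \<in> carrier R" for b b'
    proof -
      have "(\<Union>(x, y)\<in>C b. \<Union>(x', y')\<in>C b'. ?F (x \<otimes>\<^bsub>L\<^esub> x') (y \<otimes>\<^bsub>L\<^esub> y')) = C (b \<otimes>\<^bsub>R\<^esub> b')"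
      proof (rule UN[OF b])
        fix a s a' s' assume r: "rep b a s" "rep b' a' s'"
        then have "a \<in> carrier P" "a' \<in> carrier P" "s \<in> carrier P" "s' \<in> carrier P" using SmP by (auto simp: rep_def)
        then show "?F (p1 a \<otimes>\<^bsub>L\<^esub> p1 a') (p1 s \<otimes>\<^bsub>L\<^esub> p1 s') = C (b \<otimes>\<^bsub>R\<^esub> b')"
          using F[OF rep_mult[OF r]] by simp
      qed
      then show ?thesis by (simp add: localization_def)
    qed
    show "C (b \<oplus>\<^bsub>R\<^esub> b') = C b \<oplus>\<^bsub>?Q\<^esub> C b'" if b: "b \<in> carrier R" "b' \<in> carrier R" for b b'
    proof -
      have "(\<Union>(x, y)\<in>C b. \<Union>(x', y')\<in>C b'. ?F (x \<otimes>\<^bsub>L\<^esub> y' \<oplus>\<^bsub>L\<^esub> x' \<otimes>\<^bsub>L\<^esub> y) (y \<otimes>\<^bsub>L\<^esub> y')) = C (b \<oplus>\<^bsub>R\<^esub> b')"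
      proof (rule UN[OF b])
        fix a s a' s' assume r: "rep b a s" "rep b' a' s'"
        then have "a \<in> carrier P" "a' \<in> carrier P" "s \<in> carrier P" "s' \<in> carrier P" using SmP by (auto simp: rep_def)
        then show "?F (p1 a \<otimes>\<^bsub>L\<^esub> p1 s' \<oplus>\<^bsub>L\<^esub> p1 a' \<otimes>\<^bsub>L\<^esub> p1 s) (p1 s \<otimes>\<^bsub>L\<^esub> p1 s') = C (b \<oplus>\<^bsub>R\<^esub> b')"
          using F[OF rep_add[OF r]] by simp
      qed
      then show ?thesis by (simp add: localization_def)
    qed
    show "C \<one>\<^bsub>R\<^esub> = \<one>\<^bsub>?Q\<^esub>"
      using F[OF rep_p2[OF P.one_closed]] by (simp add: localization_def)
  qed
  moreover have "bij_betw C (carrier R) (carrier ?Q)"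
    unfolding bij_betw_def car by (rule conjI[OF inj_onI refl]) (rule C_inj)
  ultimately have "C \<in> ring_iso R ?Q" by (simp add: ring_iso_def)
  moreover have "C (p2 a) = localization_map L ?S (p1 a)" if "a \<in> carrier P" for a
    using F[OF rep_p2[OF that]] by (simp add: localization_map_def)
  ultimately show "\<exists>\<phi>\<in>ring_iso R ?Q. \<forall>a\<in>carrier P. \<phi> (p2 a) = localization_map L ?S (p1 a)" by blast
qed

text \<open>The powers of a number above 1 exceed every constant; this replaces the passage to n-th
  roots.\<close>

lemma multiplicative_bound:
  fixes x y C :: real
  assumes "0 \<le> y" "\<And>n::nat. x ^ n \<le> C * y ^ n"
  shows "x \<le> y"
proof (rule ccontr)
  assume "\<not> x \<le> y"
  then have xy: "y < x" by simp
  show False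
  proof (cases "y = 0")
    case True
    then show ?thesis using assms(2)[of 1] xy by simp
  next
    case False
    then have y: "y > 0" using assms(1) by simp
    obtain n where "C < (x / y) ^ n" using real_arch_pow[of "x / y" C] xy y by auto
    then have "C * y ^ n < x ^ n" using y by (simp add: power_divide field_simps)
    then show False using assms(2)[of n] by simp
  qed
qed

lemma (in valued_cring) nrm_in_spectrum: "nrm R \<in> berkovich_spectrum R"
  unfolding berkovich_spectrum_def
proof (intro CollectI conjI ballI)
  show "nrm R (a \<oplus> b) \<le> nrm R a + nrm R b" if "a \<in> carrier R" "b \<in> carrier R" for a b
    by (rule order_trans[OF nrm_add[OF that]]) (use nrm_nonneg that in simp)
  show "\<exists>C. \<forall>f\<in>carrier R. nrm R f \<le> C * nrm R f" by (rule exI[of _ 1]) simp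
qed (simp_all add: nrm_nonneg nrm_zero nrm_one nrm_mult)

text \<open>Boundedness of a point of the spectrum involves a constant. Applied to the powers of an
  element, multiplicativity removes it.\<close>

lemma (in seminormed_cring) spectrum_le_nrm:
  assumes \<gamma>: "\<gamma> \<in> berkovich_spectrum R" and a: "a \<in> carrier R"
  shows "\<gamma> a \<le> nrm R a"
proof -
  obtain C where C: "\<And>f. f \<in> carrier R \<Longrightarrow> \<gamma> f \<le> C * nrm R f"
    and g: "\<And>f. f \<in> carrier R \<Longrightarrow> \<gamma> f \<ge> 0" "\<gamma> \<one> = 1" "\<And>f g. f \<in> carrier R \<Longrightarrow> g \<in> carrier R \<Longrightarrow> \<gamma> (f \<otimes> g) = \<gamma> f * \<gamma> g"
    using \<gamma> unfolding berkovich_spectrum_def by blast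
  have C0: "C > 0"
  proof (rule ccontr)
    assume "\<not> C > 0"
    then have "C * nrm R \<one> \<le> 0" using nrm_nonneg[OF one_closed] by (simp add: mult_nonpos_nonneg)
    then show False using C[OF one_closed] g(2) by simp
  qed
  have pow: "\<gamma> (a [^] n) = \<gamma> a ^ n" for n :: nat
    by (induction n) (use a g in \<open>auto simp: mult.commute\<close>)
  \<comment> \<open>The constant takes care of the power 0, as the seminorm of 1 need not be
    1.\<close>
  have nrm_pow_le: "nrm R (a [^] n) \<le> max (nrm R \<one>) 1 * nrm R a ^ n" for n :: nat
  proof (induction n)
    case (Suc n)
    have "nrm R (a [^] Suc n) \<le> nrm R (a [^] n) * nrm R a"
      using nrm_mult_le[of "a [^] n" a] a by simp
    also have "\<dots> \<le> (max (nrm R \<one>) 1 * nrm R a ^ n) * nrm R a"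
      using Suc nrm_nonneg[OF a] by (intro mult_right_mono) auto
    finally show ?case by (simp add: mult_ac)
  qed simp
  show ?thesis
  proof (rule multiplicative_bound)
    show "0 \<le> nrm R a" using nrm_nonneg[OF a] .
    fix n :: nat
    have "\<gamma> a ^ n \<le> C * nrm R (a [^] n)" using C[of "a [^] n"] a pow by simp
    also have "\<dots> \<le> C * (max (nrm R \<one>) 1 * nrm R a ^ n)"
      using nrm_pow_le[of n] C0 by (intro mult_left_mono) auto
    finally show "\<gamma> a ^ n \<le> (C * max (nrm R \<one>) 1) * nrm R a ^ n" by (simp add: mult_ac)
  qed
qed

text \<open>A multiplicative norm is itself a point of the spectrum, and the largest one.\<close>

lemma (in valued_cring) spectral_norm_eq:
  assumes "a \<in> carrier R" shows "spectral_norm R a = nrm R a"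
  unfolding spectral_norm_def
  by (rule cSup_eq_maximum) (use assms nrm_in_spectrum nrm_nonneg spectrum_le_nrm in auto)

text \<open>A point of the spectrum is 1 at 1 and bounded by the seminorm, so there is none, and the
  value 0 inserted in \<open>spectral_norm\<close> decides.\<close>

lemma (in seminormed_cring) spectral_norm_degenerate:
  assumes "nrm R \<one> = 0" shows "spectral_norm R a = 0"
proof -
  have "\<gamma> \<notin> berkovich_spectrum R" for \<gamma>
  proof
    assume g: "\<gamma> \<in> berkovich_spectrum R"
    then have "\<gamma> \<one> = 1" by (simp add: berkovich_spectrum_def)
    then show False using spectrum_le_nrm[OF g one_closed] assms by simp
  qed
  then show ?thesis by (simp add: spectral_norm_def)
qed

lemma (in seminormed_cring) unit_ballI:
  assumes "\<And>a. a \<in> carrier R \<Longrightarrow> N a = nrm R a" "nrm R \<one> \<le> 1"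
  shows "unit_ball R N"
  by unfold_locales (use assms nrm_nonneg nrm_zero nrm_minus nrm_add nrm_mult_le in simp_all)

lemma reduction_localization:
  fixes A :: "('a, 'z) normed_ring_scheme" and B :: "('b, 'y) normed_ring_scheme" and L :: "('l, 'x) ring_scheme"
  assumes A: "valued_cring A" and B: "nearly_localization A B \<iota>" and L: "cring L"
    and p: "p \<in> ring_hom (ball_ring A (nrm A)) L" "p ` carrier (ball_ring A (nrm A)) = carrier L"
    and ker: "\<And>a. a \<in> carrier (ball_ring A (nrm A)) \<Longrightarrow> p a = \<zero>\<^bsub>L\<^esub> \<longleftrightarrow> nrm A a < 1"
  shows "unit_ball B (spectral_norm B)"
    and "\<And>a. a \<in> carrier A \<Longrightarrow> spectral_norm B (\<iota> a) \<le> nrm A a"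
    and "\<exists>S. submonoid S L \<and> (\<exists>\<phi>\<in>ring_iso (reduction B) (localization L S). \<forall>a\<in>carrier (ball_ring A (nrm A)).
      \<phi> (open_ball_ideal B (spectral_norm B) +>\<^bsub>ball_ring B (spectral_norm B)\<^esub> \<iota> a) = localization_map L S (p a))"
proof -
  interpret A: valued_cring A by fact
  interpret AU: unit_ball A "nrm A" by (rule A.unit_ballI) (use A.nrm_one in auto)
  have "seminormed_cring B" and \<iota>: "\<iota> \<in> ring_hom A B" using B by (auto simp: nearly_localization_def)
  then interpret B: seminormed_cring B by simp
  interpret \<iota>: ring_hom_ring A B \<iota> by (rule ring_hom_ringI2) (rule A.ring_axioms, rule B.ring_axioms, rule \<iota>)
  let ?N = "spectral_norm B"
  consider (deg) "nrm B \<one>\<^bsub>B\<^esub> = 0" | (dense) "frac_dense A B \<iota>" using B by (auto simp: nearly_localization_def)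
  then have cases: "(nrm B \<one>\<^bsub>B\<^esub> = 0 \<and> (\<forall>a. ?N a = 0)) \<or> (frac_dense A B \<iota> \<and> valued_cring B \<and>
      (\<forall>b\<in>carrier B. ?N b = nrm B b) \<and> (\<forall>a\<in>carrier A. ?N (\<iota> a) = nrm A a))"
  proof cases
    case deg
    then show ?thesis using B.spectral_norm_degenerate by blast
  next
    case dense
    then have v: "valued_cring B" and "\<And>a. a \<in> carrier A \<Longrightarrow> nrm B (\<iota> a) = nrm A a" by (auto simp: frac_dense_def)
    then show ?thesis using dense valued_cring.spectral_norm_eq[OF v] by simp
  qed
  show U: "unit_ball B ?N"
    using cases
  proof
    assume "nrm B \<one>\<^bsub>B\<^esub> = 0 \<and> (\<forall>a. ?N a = 0)"
    then show ?thesis by unfold_locales simp_all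
  next
    assume d: "frac_dense A B \<iota> \<and> valued_cring B \<and> (\<forall>b\<in>carrier B. ?N b = nrm B b) \<and> (\<forall>a\<in>carrier A. ?N (\<iota> a) = nrm A a)"
    then have "nrm B \<one>\<^bsub>B\<^esub> = 1" using valued_cring.nrm_one by blast
    then show ?thesis using d by (intro B.unit_ballI) auto
  qed
  interpret U: unit_ball B ?N by (rule U)
  show le: "?N (\<iota> a) \<le> nrm A a" if "a \<in> carrier A" for a
    using cases that A.nrm_nonneg[OF that] by auto
  let ?p = "\<lambda>a. U.cl (\<iota> a)"
  have PB: "\<iota> a \<in> carrier U.P" if "a \<in> carrier AU.P" for a
    using le[of a] that by (simp add: AU.P_sel U.P_sel)
  have p2: "?p \<in> ring_hom AU.P U.red"
  proof -
    have "\<iota> \<in> ring_hom AU.P U.P"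
      by (rule ring_hom_memI) (use PB in \<open>auto simp: AU.P_sel U.P_sel\<close>)
    from ring_hom_trans[OF this U.cl_hom] show ?thesis by (simp add: o_def)
  qed
  have "\<exists>Sm. Sm \<subseteq> carrier AU.P \<and> \<one>\<^bsub>AU.P\<^esub> \<in> Sm \<and> (\<forall>s\<in>Sm. \<forall>t\<in>Sm. s \<otimes>\<^bsub>AU.P\<^esub> t \<in> Sm) \<and> (\<forall>s\<in>Sm. ?p s \<in> Units U.red) \<and>
    (\<forall>b\<in>carrier U.red. \<exists>a\<in>carrier AU.P. \<exists>s\<in>Sm. b \<otimes>\<^bsub>U.red\<^esub> ?p s = ?p a) \<and>
    (\<forall>a\<in>carrier AU.P. ?p a = \<zero>\<^bsub>U.red\<^esub> \<longleftrightarrow> (\<exists>t\<in>Sm. p (t \<otimes>\<^bsub>AU.P\<^esub> a) = \<zero>\<^bsub>L\<^esub>))"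
    using cases
  proof
    assume deg: "nrm B \<one>\<^bsub>B\<^esub> = 0 \<and> (\<forall>a. ?N a = 0)"
    have triv: "y = \<zero>\<^bsub>U.red\<^esub>" if y: "y \<in> carrier U.red" for y
    proof -
      obtain b where "b \<in> carrier B" "?N b \<le> 1" "y = U.cl b" by (rule U.cl_obtain[OF y])
      then show ?thesis using U.cl_zero_iff[of b] deg by (simp add: U.P_sel)
    qed
    have pc: "?p a \<in> carrier U.red" if "a \<in> carrier AU.P" for a using ring_hom_closed[OF p2 that] .
    have one: "\<one>\<^bsub>U.red\<^esub> = \<zero>\<^bsub>U.red\<^esub>" by (rule triv) simp
    \<comment> \<open>All elements of the unit ball serve as denominators, 0 among them; the
      localization is the zero ring.\<close>
    show ?thesis
    proof (intro exI[of _ "carrier AU.P"] conjI ballI)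
      show "?p s \<in> Units U.red" if "s \<in> carrier AU.P" for s
        using triv[OF pc[OF that]] one U.red.Units_one_closed by simp
      show "\<exists>a\<in>carrier AU.P. \<exists>s\<in>carrier AU.P. y \<otimes>\<^bsub>U.red\<^esub> ?p s = ?p a" if "y \<in> carrier U.red" for y
        using triv[OF pc[OF AU.P.one_closed]] that AU.P.one_closed
        by (intro bexI[of _ "\<one>\<^bsub>AU.P\<^esub>"]) (simp_all only: U.red.r_null)
      show "?p a = \<zero>\<^bsub>U.red\<^esub> \<longleftrightarrow> (\<exists>t\<in>carrier AU.P. p (t \<otimes>\<^bsub>AU.P\<^esub> a) = \<zero>\<^bsub>L\<^esub>)" if a: "a \<in> carrier AU.P" for a
      proof -
        have "p (\<zero>\<^bsub>AU.P\<^esub> \<otimes>\<^bsub>AU.P\<^esub> a) = \<zero>\<^bsub>L\<^esub>"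
          using a ker[OF AU.P.zero_closed] A.nrm_zero by (simp add: AU.P_sel)
        then show ?thesis using triv[OF pc[OF a]] AU.P.zero_closed by blast
      qed
    qed simp_all
  next
    assume "frac_dense A B \<iota> \<and> valued_cring B \<and> (\<forall>b\<in>carrier B. ?N b = nrm B b) \<and> (\<forall>a\<in>carrier A. ?N (\<iota> a) = nrm A a)"
    then have D: "frac_dense A B \<iota>" and Bv: "valued_cring B" and Nn: "\<And>b. b \<in> carrier B \<Longrightarrow> ?N b = nrm B b"
      and iso: "\<And>a. a \<in> carrier A \<Longrightarrow> nrm B (\<iota> a) = nrm A a" by (auto simp: frac_dense_def)
    interpret Bv: valued_cring B by (rule Bv)
    \<comment> \<open>Norm 1 forces the inverse of the image to have norm 1 as well, so it lies in
      the unit ball and has a class in the reduction.\<close>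
    let ?Sm = "{s \<in> carrier A. nrm A s = 1 \<and> \<iota> s \<in> Units B}"
    show ?thesis
    proof (intro exI[of _ ?Sm] conjI ballI)
      show "?Sm \<subseteq> carrier AU.P" by (auto simp: AU.P_sel)
      show "\<one>\<^bsub>AU.P\<^esub> \<in> ?Sm" using A.nrm_one B.Units_one_closed by (simp add: AU.P_sel)
      show "s \<otimes>\<^bsub>AU.P\<^esub> t \<in> ?Sm" if "s \<in> ?Sm" "t \<in> ?Sm" for s t
        using that by (simp add: AU.P_sel A.nrm_mult)
      show "?p s \<in> Units U.red" if "s \<in> ?Sm" for s
      proof -
        from that obtain v where v: "v \<in> carrier B" "v \<otimes>\<^bsub>B\<^esub> \<iota> s = \<one>\<^bsub>B\<^esub>" and s: "s \<in> carrier A" "nrm A s = 1"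
          by (auto simp: Units_def)
        have "nrm B v * nrm B (\<iota> s) = 1" using Bv.nrm_mult[OF v(1), of "\<iota> s"] v(2) s(1) Bv.nrm_one by simp
        then have vP: "v \<in> carrier U.P" "\<iota> s \<in> carrier U.P" using v(1) s iso Nn by (auto simp: U.P_sel)
        have "U.cl v \<otimes>\<^bsub>U.red\<^esub> U.cl (\<iota> s) = U.cl (v \<otimes>\<^bsub>U.P\<^esub> \<iota> s)"
          using vP by (rule U.cl_mult[symmetric])
        also have "v \<otimes>\<^bsub>U.P\<^esub> \<iota> s = \<one>\<^bsub>U.P\<^esub>" using v(2) by (simp add: U.P_sel)
        finally have e: "U.cl v \<otimes>\<^bsub>U.red\<^esub> U.cl (\<iota> s) = \<one>\<^bsub>U.red\<^esub>" by (simp only: U.cl_one)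
        have cc: "U.cl v \<in> carrier U.red" "U.cl (\<iota> s) \<in> carrier U.red" using vP by simp_all
        show ?thesis using e cc U.red.m_comm[OF cc] unfolding Units_def by auto
      qed
      show "\<exists>a\<in>carrier AU.P. \<exists>s\<in>?Sm. y \<otimes>\<^bsub>U.red\<^esub> ?p s = ?p a" if y: "y \<in> carrier U.red" for y
      proof -
        obtain b where b: "b \<in> carrier B" "?N b \<le> 1" "y = U.cl b" by (rule U.cl_obtain[OF y])
        \<comment> \<open>An error below 1 is enough, since it vanishes in the reduction.\<close>
        obtain a s where as: "a \<in> carrier A" "s \<in> carrier A" "nrm A s = 1" "\<iota> s \<in> Units B"
          "nrm B (b \<otimes>\<^bsub>B\<^esub> \<iota> s \<ominus>\<^bsub>B\<^esub> \<iota> a) < 1"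
          using D b(1) unfolding frac_dense_def by (meson zero_less_one)
        have P: "b \<in> carrier U.P" "\<iota> s \<in> carrier U.P" using b as iso Nn by (auto simp: U.P_sel)
        have bs: "b \<otimes>\<^bsub>B\<^esub> \<iota> s \<in> carrier U.P" using U.P.m_closed[OF P] by (simp add: U.P_sel)
        have bc: "b \<otimes>\<^bsub>B\<^esub> \<iota> s \<in> carrier B" "nrm B (b \<otimes>\<^bsub>B\<^esub> \<iota> s) \<le> 1" using bs Nn by (auto simp: U.P_sel)
        have "\<iota> a = (b \<otimes>\<^bsub>B\<^esub> \<iota> s) \<ominus>\<^bsub>B\<^esub> (b \<otimes>\<^bsub>B\<^esub> \<iota> s \<ominus>\<^bsub>B\<^esub> \<iota> a)"
        proof -
          have e: "y = x \<ominus>\<^bsub>B\<^esub> (x \<ominus>\<^bsub>B\<^esub> y)" if "x \<in> carrier B" "y \<in> carrier B" for x y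
            using that by algebra
          show ?thesis by (rule e[OF bc(1)]) (use as(1) in simp)
        qed
        then have "nrm B (\<iota> a) \<le> max (nrm B (b \<otimes>\<^bsub>B\<^esub> \<iota> s)) (nrm B (b \<otimes>\<^bsub>B\<^esub> \<iota> s \<ominus>\<^bsub>B\<^esub> \<iota> a))"
          using B.nrm_add[of "b \<otimes>\<^bsub>B\<^esub> \<iota> s" "\<ominus>\<^bsub>B\<^esub> (b \<otimes>\<^bsub>B\<^esub> \<iota> s \<ominus>\<^bsub>B\<^esub> \<iota> a)"] bc(1) as(1)
            B.nrm_minus[of "b \<otimes>\<^bsub>B\<^esub> \<iota> s \<ominus>\<^bsub>B\<^esub> \<iota> a"] by (simp add: a_minus_def)
        then have aP: "a \<in> carrier AU.P" using bc(2) as iso by (simp add: AU.P_sel)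
        have "U.cl (b \<otimes>\<^bsub>B\<^esub> \<iota> s) = U.cl (\<iota> a)"
          using U.cl_eq_iff[OF bs PB[OF aP]] as(1,5) bc(1) Nn by simp
        moreover have "U.cl (b \<otimes>\<^bsub>U.P\<^esub> \<iota> s) = U.cl b \<otimes>\<^bsub>U.red\<^esub> U.cl (\<iota> s)"
          using P by (rule U.cl_mult)
        ultimately have "y \<otimes>\<^bsub>U.red\<^esub> ?p s = ?p a" unfolding b(3) by (simp add: U.P_sel)
        then show ?thesis using aP as by blast
      qed
      show "?p a = \<zero>\<^bsub>U.red\<^esub> \<longleftrightarrow> (\<exists>t\<in>?Sm. p (t \<otimes>\<^bsub>AU.P\<^esub> a) = \<zero>\<^bsub>L\<^esub>)" if a: "a \<in> carrier AU.P" for a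
      proof -
        have ac: "a \<in> carrier A" "nrm A a \<le> 1" using a by (auto simp: AU.P_sel)
        have "?p a = \<zero>\<^bsub>U.red\<^esub> \<longleftrightarrow> nrm A a < 1"
          using U.cl_zero_iff[OF PB[OF a]] ac(1) iso Nn by simp
        \<comment> \<open>Multiplication by an element of norm 1 preserves norms, so the kernel
          condition does not depend on the multiplier.\<close>
        moreover have "p (t \<otimes>\<^bsub>AU.P\<^esub> a) = \<zero>\<^bsub>L\<^esub> \<longleftrightarrow> nrm A a < 1" if t: "t \<in> ?Sm" for t
        proof -
          have "t \<otimes>\<^bsub>AU.P\<^esub> a \<in> carrier AU.P" using t a by (intro AU.P.m_closed) (auto simp: AU.P_sel)
          from ker[OF this] show ?thesis using t ac A.nrm_mult[of t a] by (simp add: AU.P_sel)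
        qed
        moreover have "\<one>\<^bsub>A\<^esub> \<in> ?Sm" using A.nrm_one B.Units_one_closed by simp
        ultimately show ?thesis by blast
      qed
    qed
  qed
  then obtain Sm where "Sm \<subseteq> carrier AU.P" "\<one>\<^bsub>AU.P\<^esub> \<in> Sm" "\<forall>s\<in>Sm. \<forall>t\<in>Sm. s \<otimes>\<^bsub>AU.P\<^esub> t \<in> Sm" "\<forall>s\<in>Sm. ?p s \<in> Units U.red"
    "\<forall>b\<in>carrier U.red. \<exists>a\<in>carrier AU.P. \<exists>s\<in>Sm. b \<otimes>\<^bsub>U.red\<^esub> ?p s = ?p a"
    "\<forall>a\<in>carrier AU.P. ?p a = \<zero>\<^bsub>U.red\<^esub> \<longleftrightarrow> (\<exists>t\<in>Sm. p (t \<otimes>\<^bsub>AU.P\<^esub> a) = \<zero>\<^bsub>L\<^esub>)" by blast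
  note S = this
  have "submonoid (p ` Sm) L"
    "\<exists>\<phi>\<in>ring_iso U.red (localization L (p ` Sm)). \<forall>a\<in>carrier AU.P. \<phi> (?p a) = localization_map L (p ` Sm) (p a)"
    by (rule localization_iso[OF AU.P_cring L U.red_cring p p2 S(1,2)]; use S in blast)+
  then show "\<exists>S. submonoid S L \<and> (\<exists>\<phi>\<in>ring_iso (reduction B) (localization L S). \<forall>a\<in>carrier (ball_ring A (nrm A)).
      \<phi> (open_ball_ideal B ?N +>\<^bsub>ball_ring B ?N\<^esub> \<iota> a) = localization_map L S (p a))"
    unfolding reduction_def by blast
qed

section \<open>The reduction of a torus algebra\<close>

text \<open>Transports the ring axioms to a structure known only as a homomorphic image. Laurent
  polynomials over the residue field obtain them in this way from the unit ball of A.\<close>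

lemma surj_hom_cring:
  assumes "cring P" and h: "h \<in> ring_hom P L" "h ` carrier P = carrier L" "h \<zero>\<^bsub>P\<^esub> = \<zero>\<^bsub>L\<^esub>"
  shows "cring L"
proof -
  interpret P: cring P by fact
  have "L\<lparr>carrier := carrier L, zero := \<zero>\<^bsub>L\<^esub>\<rparr> = L" by (rule ring.equality) simp_all
  then have L: "ring L" using P.ring_hom_imp_img_ring[OF h(1)] by (simp only: h(2,3))
  have comm: "x \<otimes>\<^bsub>L\<^esub> y = y \<otimes>\<^bsub>L\<^esub> x" if xy: "x \<in> carrier L" "y \<in> carrier L" for x y
  proof -
    obtain a b where ab: "a \<in> carrier P" "b \<in> carrier P" "x = h a" "y = h b" using h(2) xy by blast
    show ?thesis unfolding ab(3,4) using ab(1,2) ring_hom_mult[OF h(1), of a b] ring_hom_mult[OF h(1), of b a] P.m_comm[of a b] by simp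
  qed
  show ?thesis
    by (rule cring.intro[OF L comm_monoid.intro[OF ring.axioms(2)[OF L] comm_monoid_axioms.intro]]) (rule comm)
qed

lemma type_ring_sel [simp]:
  "carrier type_ring = UNIV" "\<one>\<^bsub>type_ring\<^esub> = 1" "\<zero>\<^bsub>type_ring\<^esub> = 0" "a \<otimes>\<^bsub>type_ring\<^esub> b = a * b" "a \<oplus>\<^bsub>type_ring\<^esub> b = a + b"
  by (simp_all add: type_ring_def)

lemma type_ring_cring: "cring (type_ring :: 'a::comm_ring_1 ring)"
proof (rule cringI)
  show "abelian_group (type_ring :: 'a ring)"
  proof (rule abelian_groupI)
    show "\<exists>y\<in>carrier type_ring. y \<oplus>\<^bsub>type_ring\<^esub> x = \<zero>\<^bsub>type_ring\<^esub>" for x :: 'a by (auto intro: exI[of _ "- x"])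
  qed (auto simp: algebra_simps)
  show "comm_monoid (type_ring :: 'a ring)" by (rule comm_monoidI) (auto simp: algebra_simps)
qed (auto simp: algebra_simps)

lemma type_ring_minus [simp]: "\<ominus>\<^bsub>type_ring\<^esub> a = - a" "a \<ominus>\<^bsub>type_ring\<^esub> b = (a - b :: 'a::comm_ring_1)"
proof -
  interpret cring "type_ring :: 'a ring" by (rule type_ring_cring)
  have *: "\<ominus>\<^bsub>type_ring\<^esub> a = - a" for a :: 'a by (rule minus_equality) auto
  show "\<ominus>\<^bsub>type_ring\<^esub> a = - a" "a \<ominus>\<^bsub>type_ring\<^esub> b = a - b" by (simp_all add: * a_minus_def)
qed

lemma nabs_unit_ball: "unit_ball (type_ring :: 'k::complete_nonarch_field ring) nabs"
proof -
  interpret cring "type_ring :: 'k ring" by (rule type_ring_cring)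
  show ?thesis by unfold_locales (simp_all add: nabs_nonneg nabs_add nabs_mult)
qed

abbreviation residue :: "'k::complete_nonarch_field \<Rightarrow> 'k set" where
  "residue a \<equiv> open_ball_ideal type_ring nabs +>\<^bsub>ball_ring type_ring nabs\<^esub> a"

lemmas nabs_ball = unit_ball.P_sel[OF nabs_unit_ball]

lemma residue_field_cring: "cring (residue_field :: 'k::complete_nonarch_field set ring)"
  unfolding residue_field_def by (rule unit_ball.red_cring[OF nabs_unit_ball])

interpretation residue_field: cring "residue_field :: 'k::complete_nonarch_field set ring"
  by (rule residue_field_cring)

lemma residue_closed [simp]: "nabs a \<le> 1 \<Longrightarrow> residue a \<in> carrier residue_field"
  using unit_ball.cl_closed[OF nabs_unit_ball, folded residue_field_def, of a] by (simp add: nabs_ball)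

lemma residue_add: "nabs a \<le> 1 \<Longrightarrow> nabs b \<le> 1 \<Longrightarrow> residue (a + b) = residue a \<oplus>\<^bsub>residue_field\<^esub> residue b"
  using unit_ball.cl_add[OF nabs_unit_ball, folded residue_field_def, of a b] by (simp add: nabs_ball)

lemma residue_mult: "nabs a \<le> 1 \<Longrightarrow> nabs b \<le> 1 \<Longrightarrow> residue (a * b) = residue a \<otimes>\<^bsub>residue_field\<^esub> residue b"
  using unit_ball.cl_mult[OF nabs_unit_ball, folded residue_field_def, of a b] by (simp add: nabs_ball)

lemma residue_0 [simp]: "residue 0 = \<zero>\<^bsub>residue_field\<^esub>"
  using unit_ball.cl_zero_iff[OF nabs_unit_ball, folded residue_field_def, of 0] by (simp add: nabs_ball)

lemma residue_1 [simp]: "residue 1 = \<one>\<^bsub>residue_field\<^esub>"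
  using unit_ball.cl_one[OF nabs_unit_ball, folded residue_field_def] by (simp add: nabs_ball)

lemma residue_eq_0_iff: "nabs a \<le> 1 \<Longrightarrow> residue a = \<zero>\<^bsub>residue_field\<^esub> \<longleftrightarrow> nabs a < 1"
  using unit_ball.cl_zero_iff[OF nabs_unit_ball, folded residue_field_def, of a] by (simp add: nabs_ball)

lemma residue_eq_iff: "nabs a \<le> 1 \<Longrightarrow> nabs b \<le> 1 \<Longrightarrow> residue a = residue b \<longleftrightarrow> nabs (a - b) < 1"
  using unit_ball.cl_eq_iff[OF nabs_unit_ball, of a b] by (simp add: nabs_ball)

lemma residue_obtain:
  assumes "c \<in> carrier (residue_field :: 'k::complete_nonarch_field set ring)"
  obtains a where "nabs a \<le> 1" "c = residue a"
  using unit_ball.cl_obtain[OF nabs_unit_ball, folded residue_field_def, OF assms] by blast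

lemma mem_residue_iff: "nabs a \<le> 1 \<Longrightarrow> b \<in> residue a \<longleftrightarrow> nabs b \<le> 1 \<and> nabs (b - a) < 1"
  using unit_ball.mem_cl_iff[OF nabs_unit_ball, of a b] residue_eq_iff[of b a] by (auto simp: nabs_ball)

lemma residue_sum:
  fixes f :: "'i \<Rightarrow> 'k::complete_nonarch_field"
  assumes "finite F" "\<And>x. x \<in> F \<Longrightarrow> nabs (f x) \<le> 1"
  shows "residue (sum f F) = (\<Oplus>\<^bsub>residue_field\<^esub>x\<in>F. residue (f x))"
  using assms
proof (induction F rule: finite_induct)
  case (insert x F)
  have "nabs (sum f F) \<le> 1" by (rule nabs_sum_le) (use insert.prems in auto)
  then have "residue (sum f (insert x F)) = residue (f x) \<oplus>\<^bsub>residue_field\<^esub> residue (sum f F)"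
    using insert.hyps insert.prems residue_add[of "f x" "sum f F"] by simp
  also have "\<dots> = (\<Oplus>\<^bsub>residue_field\<^esub>x\<in>insert x F. residue (f x))"
    using insert by (subst residue_field.finsum_insert) auto
  finally show ?case .
qed simp

section \<open>Reduction of Laurent series after rescaling\<close>

locale rational_torus = torus V \<rho> for V :: "'i::linorder set" and \<rho> +
  fixes c :: "'i \<Rightarrow> 'k::complete_nonarch_field"
  assumes c: "\<And>q. q \<in> V \<Longrightarrow> nabs (c q) = \<rho> q"
begin

abbreviation "\<mu> \<equiv> pm_monom c"

lemma c_nonzero: "q \<in> V \<Longrightarrow> c q \<noteq> 0"
  using c[of q] \<rho>_pos[of q] by auto

lemma nabs_\<mu>: "Poly_Mapping.keys \<alpha> \<subseteq> V \<Longrightarrow> nabs (\<mu> \<alpha>) = rad \<alpha>"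
  unfolding pm_monom_def monomial_radius_def nabs_prod nabs_powi
  by (rule prod.cong) (use c in auto)

lemma \<mu>_nonzero: "Poly_Mapping.keys \<alpha> \<subseteq> V \<Longrightarrow> \<mu> \<alpha> \<noteq> 0"
  using nabs_\<mu>[of \<alpha>] rad_pos[of \<alpha>] by auto

lemma \<mu>_add: "Poly_Mapping.keys \<alpha> \<subseteq> V \<Longrightarrow> Poly_Mapping.keys \<beta> \<subseteq> V \<Longrightarrow> \<mu> (\<alpha> + \<beta>) = \<mu> \<alpha> * \<mu> \<beta>"
  by (rule pm_monom_add[where V = V]) (use c_nonzero in auto)

lemma nabs_times_\<mu>: "null_seq a \<Longrightarrow> nabs (a \<alpha> * \<mu> \<alpha>) = sz a \<alpha>"
  by (cases "Poly_Mapping.keys \<alpha> \<subseteq> V") (auto simp: nabs_mult nabs_\<mu> sz_def null_seqD)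

abbreviation "A \<equiv> torus_algebra V \<rho> :: (('i \<Rightarrow>\<^sub>0 int) \<Rightarrow> 'k) normed_ring"
abbreviation "L \<equiv> laurent_poly_ring (residue_field :: 'k set ring) V"

sublocale A: valued_cring A by (rule torus_valued)
sublocale AU: unit_ball A "nrm A" by (rule A.unit_ballI) (use A.nrm_one in auto)

text \<open>The substitution of c_q u_q for u_q brings all radii to 1 and multiplies the coefficient
  at \<alpha> by \<open>\<mu> \<alpha>\<close>; the rescaled coefficients are then reduced one by
  one.\<close>

definition reduce :: "(('i \<Rightarrow>\<^sub>0 int) \<Rightarrow> 'k) \<Rightarrow> ('i \<Rightarrow>\<^sub>0 int) \<Rightarrow> 'k set" where
  "reduce a \<alpha> = residue (a \<alpha> * \<mu> \<alpha>)"

lemma P_carrier: "carrier AU.P = {a. null_seq a \<and> N a \<le> 1}"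
  by (auto simp: AU.P_sel carrier_eq)

lemma le_one: "a \<in> carrier AU.P \<Longrightarrow> nabs (a \<alpha> * \<mu> \<alpha>) \<le> 1"
  using sz_le_N[of a \<alpha>] nabs_times_\<mu>[of a \<alpha>] by (simp add: P_carrier)

lemma reduce_eq_0_iff: "a \<in> carrier AU.P \<Longrightarrow> reduce a \<alpha> = \<zero>\<^bsub>residue_field\<^esub> \<longleftrightarrow> sz a \<alpha> < 1"
  unfolding reduce_def using residue_eq_0_iff[OF le_one, of a \<alpha>] nabs_times_\<mu>[of a \<alpha>] by (simp add: P_carrier)

lemma reduce_finite: "a \<in> carrier AU.P \<Longrightarrow> finite {\<alpha>. reduce a \<alpha> \<noteq> \<zero>\<^bsub>residue_field\<^esub>}"
  using null_seq_finite[of a 1] by (simp add: reduce_eq_0_iff not_less P_carrier)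

lemma reduce_outside: "a \<in> carrier AU.P \<Longrightarrow> \<not> Poly_Mapping.keys \<alpha> \<subseteq> V \<Longrightarrow> reduce a \<alpha> = \<zero>\<^bsub>residue_field\<^esub>"
  using null_seqD[of a \<alpha>] by (simp add: P_carrier reduce_def)

lemma reduce_coeff: "a \<in> carrier AU.P \<Longrightarrow> reduce a \<alpha> \<in> carrier residue_field"
  unfolding reduce_def by (intro residue_closed le_one)

lemma reduce_closed: "a \<in> carrier AU.P \<Longrightarrow> reduce a \<in> carrier L"
  using reduce_finite reduce_outside reduce_coeff by (simp add: laurent_poly_ring_def)

text \<open>The coefficient of the product is an infinite sum, its reduction a finite one: where the
  first factor reduces to 0, the rescaled terms have absolute value below 1, and so has their
  sum.\<close>

lemma reduce_conv:
  assumes a: "a \<in> carrier AU.P" and b: "b \<in> carrier AU.P"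
  shows "reduce (conv a b) \<gamma> = (\<Oplus>\<^bsub>residue_field\<^esub>\<alpha>\<in>{\<alpha>. reduce a \<alpha> \<noteq> \<zero>\<^bsub>residue_field\<^esub>}. reduce a \<alpha> \<otimes>\<^bsub>residue_field\<^esub> reduce b (\<gamma> - \<alpha>))"
    (is "_ = finsum _ ?g ?F")
proof (cases "Poly_Mapping.keys \<gamma> \<subseteq> V")
  case False
  have "reduce b (\<gamma> - \<alpha>) = \<zero>\<^bsub>residue_field\<^esub>" if "\<alpha> \<in> ?F" for \<alpha>
  proof (rule reduce_outside[OF b])
    have \<alpha>: "Poly_Mapping.keys \<alpha> \<subseteq> V" using that reduce_outside[OF a] by blast
    show "\<not> Poly_Mapping.keys (\<gamma> - \<alpha>) \<subseteq> V"
      using Poly_Mapping.keys_add[of \<alpha> "\<gamma> - \<alpha>"] \<alpha> False by auto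
  qed
  then have "finsum residue_field ?g ?F = finsum residue_field (\<lambda>_. \<zero>\<^bsub>residue_field\<^esub>) ?F"
    by (intro residue_field.finsum_cong' refl) (simp_all add: reduce_coeff[OF a])
  then show ?thesis using conv_outside[of a b \<gamma>] False a b by (simp add: reduce_def P_carrier residue_field.finsum_zero)
next
  case True
  have ns: "null_seq a" "null_seq b" "N a \<le> 1" "N b \<le> 1" using a b by (auto simp: P_carrier)
  let ?t = "\<lambda>\<alpha>. a \<alpha> * b (\<gamma> - \<alpha>)"
  have F: "finite ?F" by (rule reduce_finite[OF a])
  have FV: "Poly_Mapping.keys \<alpha> \<subseteq> V" if "\<alpha> \<in> ?F" for \<alpha> using that reduce_outside[OF a] by blast
  have split: "?t \<alpha> * \<mu> \<gamma> = (a \<alpha> * \<mu> \<alpha>) * (b (\<gamma> - \<alpha>) * \<mu> (\<gamma> - \<alpha>))" if "\<alpha> \<in> ?F" for \<alpha>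
    using \<mu>_add[OF FV[OF that] keys_diff_subset[OF True FV[OF that]]] by simp
  have t1: "nabs (?t \<alpha> * \<mu> \<gamma>) \<le> 1" if "\<alpha> \<in> ?F" for \<alpha>
    unfolding split[OF that] nabs_mult[of "a \<alpha> * \<mu> \<alpha>"]
    by (intro mult_le_one le_one a b nabs_nonneg)
  have res: "residue (?t \<alpha> * \<mu> \<gamma>) = ?g \<alpha>" if "\<alpha> \<in> ?F" for \<alpha>
    unfolding split[OF that] reduce_def[of a] reduce_def[of b] by (intro residue_mult le_one a b)
  have "nabs (infsum ?t UNIV - sum ?t ?F) < 1 / rad \<gamma>"
  proof (rule nonarch_infsum_less)
    show "finite {\<alpha>. \<epsilon> \<le> nabs (?t \<alpha>)}" if "\<epsilon> > 0" for \<epsilon> by (rule term_finite[OF ns(1,2) True that])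
    show "nabs (?t \<alpha>) < 1 / rad \<gamma>" if "\<alpha> \<notin> ?F" for \<alpha>
    proof -
      have lt: "sz a \<alpha> < 1" using that reduce_eq_0_iff[OF a] by blast
      have "sz a \<alpha> * sz b (\<gamma> - \<alpha>) \<le> sz a \<alpha> * 1"
        using sz_le_N[OF ns(2), of "\<gamma> - \<alpha>"] ns(4) null_seq_sz[OF ns(1)] by (intro mult_left_mono) auto
      then show ?thesis using lt term_sz[OF ns(1,2) True, of \<alpha>] rad_pos[OF True] by (simp add: pos_less_divide_eq)
    qed
  qed (use F rad_pos[OF True] in auto)
  then have small: "nabs (conv a b \<gamma> * \<mu> \<gamma> - sum ?t ?F * \<mu> \<gamma>) < 1"
    using rad_pos[OF True] by (simp add: conv_def nabs_mult nabs_\<mu>[OF True] pos_less_divide_eq flip: left_diff_distrib)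
  have s1: "nabs (sum ?t ?F * \<mu> \<gamma>) \<le> 1"
    unfolding sum_distrib_right by (rule nabs_sum_le) (use t1 in auto)
  have cP: "conv a b \<in> carrier AU.P" using AU.P.m_closed[OF a b] by (simp add: AU.P_sel(2) torus_sel)
  have "reduce (conv a b) \<gamma> = residue (sum ?t ?F * \<mu> \<gamma>)"
    unfolding reduce_def[of "conv a b"] by (rule iffD2[OF residue_eq_iff[OF le_one[OF cP] s1] small])
  also have "\<dots> = (\<Oplus>\<^bsub>residue_field\<^esub>\<alpha>\<in>?F. residue (?t \<alpha> * \<mu> \<gamma>))"
    unfolding sum_distrib_right by (rule residue_sum[OF F t1])
  also have "\<dots> = finsum residue_field ?g ?F"
    by (intro residue_field.finsum_cong' refl) (simp_all add: res reduce_coeff[OF a] reduce_coeff[OF b])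
  finally show ?thesis .
qed

lemma reduce_hom: "reduce \<in> ring_hom AU.P L"
proof (rule ring_hom_memI)
  fix a b assume ab: "a \<in> carrier AU.P" "b \<in> carrier AU.P"
  show "reduce (a \<otimes>\<^bsub>AU.P\<^esub> b) = reduce a \<otimes>\<^bsub>L\<^esub> reduce b"
    using reduce_conv[OF ab] by (simp add: AU.P_sel(2) torus_sel laurent_poly_ring_def fun_eq_iff)
  show "reduce (a \<oplus>\<^bsub>AU.P\<^esub> b) = reduce a \<oplus>\<^bsub>L\<^esub> reduce b"
    using residue_add[OF le_one le_one] ab
    by (simp add: AU.P_sel(3) torus_sel laurent_poly_ring_def fun_eq_iff reduce_def distrib_right)
next
  show "reduce \<one>\<^bsub>AU.P\<^esub> = \<one>\<^bsub>L\<^esub>"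
    by (simp add: AU.P_sel(4) torus_sel laurent_poly_ring_def fun_eq_iff reduce_def torus_const_def)
qed (rule reduce_closed)

lemma reduce_surj: "reduce ` carrier AU.P = carrier L"
proof
  show "reduce ` carrier AU.P \<subseteq> carrier L" using reduce_closed by blast
  show "carrier L \<subseteq> reduce ` carrier AU.P"
  proof
    fix d assume "d \<in> carrier L"
    then have d: "\<And>\<alpha>. d \<alpha> \<in> carrier residue_field" "finite {\<alpha>. d \<alpha> \<noteq> \<zero>\<^bsub>residue_field\<^esub>}"
      "\<And>\<alpha>. \<not> Poly_Mapping.keys \<alpha> \<subseteq> V \<Longrightarrow> d \<alpha> = \<zero>\<^bsub>residue_field\<^esub>"
      by (auto simp: laurent_poly_ring_def)
    \<comment> \<open>The class 0 is lifted to 0 itself, so that the lifted series has finite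
      support.\<close>
    have "\<exists>x. nabs x \<le> 1 \<and> d \<alpha> = residue x \<and> (d \<alpha> = \<zero>\<^bsub>residue_field\<^esub> \<longrightarrow> x = 0)" for \<alpha>
    proof (cases "d \<alpha> = \<zero>\<^bsub>residue_field\<^esub>")
      case True
      then show ?thesis by (intro exI[of _ 0]) simp
    next
      case False
      obtain a where "nabs a \<le> 1" "d \<alpha> = residue a" by (rule residue_obtain[OF d(1)])
      then show ?thesis using False by blast
    qed
    then obtain x where x: "\<And>\<alpha>. nabs (x \<alpha>) \<le> 1" "\<And>\<alpha>. d \<alpha> = residue (x \<alpha>)" "\<And>\<alpha>. d \<alpha> = \<zero>\<^bsub>residue_field\<^esub> \<Longrightarrow> x \<alpha> = 0"
      by metis
    define a where "a \<alpha> = x \<alpha> / \<mu> \<alpha>" for \<alpha>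
    have a\<mu>: "a \<alpha> * \<mu> \<alpha> = x \<alpha>" for \<alpha>
      using \<mu>_nonzero[of \<alpha>] x(3)[OF d(3), of \<alpha>] by (cases "Poly_Mapping.keys \<alpha> \<subseteq> V") (auto simp: a_def)
    have out: "a \<alpha> = 0" if "d \<alpha> = \<zero>\<^bsub>residue_field\<^esub>" for \<alpha> using x(3)[OF that] by (simp add: a_def)
    have ns: "null_seq a"
      unfolding null_seq_def
    proof (intro conjI allI impI)
      fix \<epsilon> :: real assume "\<epsilon> > 0"
      then show "finite {\<alpha>. \<epsilon> \<le> sz a \<alpha>}"
        by (intro finite_subset[OF _ d(2)]) (auto simp: sz_def out)
    qed (use d(3) out in blast)
    have "N a \<le> 1" by (rule N_le) (use x(1) in \<open>simp add: a\<mu> flip: nabs_times_\<mu>[OF ns]\<close>)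
    then have "a \<in> carrier AU.P" using ns by (simp add: P_carrier)
    moreover have "reduce a = d" by (simp add: reduce_def a\<mu> x(2) fun_eq_iff)
    ultimately show "d \<in> reduce ` carrier AU.P" by blast
  qed
qed

text \<open>The norm is attained, so it is below 1 as soon as all coefficients have size below
  1.\<close>

lemma reduce_zero_iff:
  assumes a: "a \<in> carrier AU.P" shows "reduce a = \<zero>\<^bsub>L\<^esub> \<longleftrightarrow> nrm A a < 1"
proof -
  have "reduce a = \<zero>\<^bsub>L\<^esub> \<longleftrightarrow> (\<forall>\<alpha>. sz a \<alpha> < 1)"
    using reduce_eq_0_iff[OF a] by (simp add: laurent_poly_ring_def fun_eq_iff)
  also have "\<dots> \<longleftrightarrow> N a < 1"
  proof -
    have ns: "null_seq a" using a by (simp add: P_carrier)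
    obtain \<alpha> where "sz a \<alpha> = N a" by (rule N_attained[OF ns])
    then show ?thesis using sz_le_N[OF ns] by (metis le_less_trans)
  qed
  finally show ?thesis .
qed

lemma L_cring: "cring L"
proof (rule surj_hom_cring[OF AU.P_cring reduce_hom reduce_surj])
  show "reduce \<zero>\<^bsub>AU.P\<^esub> = \<zero>\<^bsub>L\<^esub>"
    by (simp add: AU.P_sel(5) torus_sel laurent_poly_ring_def fun_eq_iff reduce_def)
qed

lemma reduce_const: "reduce (torus_const a) = laurent_poly_const residue_field (residue a)"
  by (simp add: reduce_def torus_const_def laurent_poly_const_def fun_eq_iff)

lemma const_in_P: "nabs a \<le> 1 \<Longrightarrow> torus_const a \<in> carrier AU.P"
  by (simp add: P_carrier null_seq_const N_const)

lemma const_Unit: assumes "a \<noteq> 0" shows "torus_const a \<in> Units A"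
proof -
  have "conv (torus_const a) (torus_const b) = torus_const (a * b)" for a b :: 'k
    by (rule ext, simp only: conv_const) (simp add: torus_const_def)
  then have "torus_const (inverse a) \<otimes>\<^bsub>A\<^esub> torus_const a = \<one>\<^bsub>A\<^esub>" "torus_const a \<otimes>\<^bsub>A\<^esub> torus_const (inverse a) = \<one>\<^bsub>A\<^esub>"
    using assms by (simp_all add: torus_sel)
  then show ?thesis unfolding Units_def using null_seq_const by (auto simp: carrier_eq)
qed

text \<open>Beyond the ring isomorphism this contains linearity over the residue field: both
  structure maps are induced by the constants in the unit ball of A, where the isomorphism is
  known.\<close>

lemma algebra_isomorphic_localization:
  assumes B: "nearly_localization A B \<iota>"
  shows "\<exists>S. submonoid S L \<and> algebra_isomorphic (residue_field :: 'k set ring)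
    (reduction B) (reduction_map (\<iota> \<circ> torus_const) B)
    (localization L S) (localization_map L S \<circ> laurent_poly_const (residue_field :: 'k set ring))"
proof -
  note red = reduction_localization[OF torus_valued B L_cring reduce_hom reduce_surj reduce_zero_iff]
  have le: "spectral_norm B (\<iota> a) \<le> nrm A a" if "a \<in> carrier A" for a
    by (rule red(2)) (use that in auto)
  interpret U: unit_ball B "spectral_norm B" by (rule red(1))
  have \<iota>: "\<iota> \<in> ring_hom A B" using B by (simp add: nearly_localization_def)
  interpret \<iota>: ring_hom_ring A B \<iota> by (rule ring_hom_ringI2) (rule A.ring_axioms, rule U.ring_axioms, rule \<iota>)
  obtain S \<phi> where S: "submonoid S L" and \<phi>: "\<phi> \<in> ring_iso (reduction B) (localization L S)"
    "\<And>a. a \<in> carrier AU.P \<Longrightarrow> \<phi> (U.cl (\<iota> a)) = localization_map L S (reduce a)"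
    using red(3) by blast
  have "\<phi> (reduction_map (\<iota> \<circ> torus_const) B y) = (localization_map L S \<circ> laurent_poly_const residue_field) y"
    if y: "y \<in> carrier (residue_field :: 'k set ring)" for y
  proof -
    obtain a where a: "nabs a \<le> 1" "y = residue a" by (rule residue_obtain[OF y])
    \<comment> \<open>\<open>reduction_map\<close> picks the only element of an image, so the class
      must not depend on the lift. Two lifts differ by a scalar of absolute value below 1, whose
      image has spectral norm below 1.\<close>
    have cl_eq: "U.cl (\<iota> (torus_const b)) = U.cl (\<iota> (torus_const a))" if b: "b \<in> y" for b
    proof -
      have b1: "nabs b \<le> 1" "nabs (b - a) < 1" using b a mem_residue_iff[OF a(1)] by auto
      have ca: "torus_const a \<in> carrier A" "torus_const b \<in> carrier A" "torus_const (b - a) \<in> carrier A"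
        using null_seq_const by (auto simp: carrier_eq)
      have "torus_const b \<ominus>\<^bsub>A\<^esub> torus_const a = torus_const (b - a)"
        unfolding a_minus_def torus_a_inv[OF null_seq_const] torus_sel by (simp add: torus_const_def fun_eq_iff)
      then have "\<iota> (torus_const b) \<ominus>\<^bsub>B\<^esub> \<iota> (torus_const a) = \<iota> (torus_const (b - a))"
        using \<iota>.hom_add[OF ca(2) A.a_inv_closed[OF ca(1)]] \<iota>.hom_a_inv[OF ca(1)] by (simp add: a_minus_def)
      then have lt: "spectral_norm B (\<iota> (torus_const b) \<ominus>\<^bsub>B\<^esub> \<iota> (torus_const a)) < 1"
        using le[OF ca(3)] b1(2) by (simp add: N_const)
      have "\<iota> (torus_const b) \<in> carrier U.P" "\<iota> (torus_const a) \<in> carrier U.P"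
        using le[OF ca(1)] le[OF ca(2)] a(1) b1(1) ca by (auto simp: U.P_sel N_const)
      then show ?thesis by (rule iffD2[OF U.cl_eq_iff lt])
    qed
    have "y \<noteq> {}" using a mem_residue_iff[OF a(1), of a] by auto
    then have "reduction_map (\<iota> \<circ> torus_const) B y = U.cl (\<iota> (torus_const a))"
      unfolding reduction_map_def o_def by (rule the_elem_image_unique) (rule cl_eq)
    then show ?thesis using \<phi>(2)[OF const_in_P[OF a(1)]] by (simp add: a(2) reduce_const)
  qed
  then show ?thesis using S \<phi>(1) unfolding algebra_isomorphic_def by blast
qed

end

theorem theorem5p8:
  fixes n i j :: nat
    and x :: "nat uprod \<Rightarrow> ereal"
    and T :: "'v ltree"
    and r :: "nat rel"
    and I J :: "nat uprod set"
    and \<rho> :: "nat uprod \<Rightarrow> real"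
    and rss :: "nat uprod list"
    and f :: "nat uprod \<Rightarrow> (nat uprod \<Rightarrow>\<^sub>0 int) \<Rightarrow> 'k::complete_nonarch_field"
    and A :: "((nat uprod \<Rightarrow>\<^sub>0 int) \<Rightarrow> 'k) normed_ring"
    and B :: "(nat uprod \<Rightarrow>\<^sub>0 int, 'k) tower normed_ring"
    and \<iota> :: "((nat uprod \<Rightarrow>\<^sub>0 int) \<Rightarrow> 'k) \<Rightarrow> (nat uprod \<Rightarrow>\<^sub>0 int, 'k) tower"
  assumes "i \<in> {1..n}" "j \<in> {1..n}" "i \<noteq> j"
    and "x \<in> trop_vectors (pairs n)"
    and "trop_class (pairs n) x \<in> trop_chart TYPE('k) n i j"
    and "J = {q \<in> pairs n. x q = - \<infinity>}"
    and "tree_on n T"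
    and "trop_class (pairs n) x \<in> trop_proj_topology (pairs n) closure_of tree_cone n T"
    and "partial_order_on ({1..n} - {i, j}) r"
    and "cherry_property n T i j r"
    and "compatible n T i j r (J \<inter> chart_vars n i j) I"
    and "\<rho> = (\<lambda>q. trop_exp (x q - x (Upair i j)))"
    and "f = (\<lambda>q. Poly_Mapping.lookup (f_coord n i j I J q))"
    and "distinct rss" "set rss = pairs n - (I \<union> J \<union> {Upair i j})"
    and "A = torus_algebra (I - J) \<rho>"
    and "(B, \<iota>) = iterated_domain (image_normed_ring Ground A) Ground
                    (map (\<lambda>q. (f q, \<rho> q, f q, \<rho> q)) rss)"
    and "\<forall>q\<in>pairs n - (J \<union> {Upair i j}). \<rho> q \<in> nabs ` (UNIV - {0 :: 'k})"
  shows "\<exists>S. let L = laurent_poly_ring (residue_field :: 'k set ring) (I - J) in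
           submonoid S L \<and>
           algebra_isomorphic (residue_field :: 'k set ring)
             (reduction B) (reduction_map (\<iota> \<circ> torus_const) B)
             (localization L S)
             (localization_map L S \<circ> laurent_poly_const (residue_field :: 'k set ring))"
proof -
  note asm = assms
  \<comment> \<open>Membership in the chart is a statement about all representatives of the class;
    \<open>x\<close> is one of them.\<close>
  have "x \<in> trop_class (pairs n) x"
    using asm(4) by (auto simp: trop_class_def intro!: exI[of _ 0] simp flip: zero_ereal_def)
  then have xij: "x (Upair i j) \<noteq> - \<infinity>" using asm(5) by (auto simp: trop_chart_def)
  interpret chart_data n i j x T r I J \<rho>
    by unfold_locales (fact asm xij)+
  have IV: "I - J \<subseteq> pairs n - (J \<union> {Upair i j})"
    using I_pairs asm(11) by (auto simp: compatible_def)
  have finite_pairs: "finite (pairs n)"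
  proof -
    have "pairs n \<subseteq> (\<lambda>(k, l). Upair k l) ` ({1..n} \<times> {1..n})" by (auto simp: pairs_def)
    then show ?thesis by (rule finite_subset) simp
  qed
  \<comment> \<open>Scalars that realize the radii. For pairs in \<open>I - J\<close> they rescale
    the variables; for the adjoined elements their inverses are the units of norm 1/\<rho>.\<close>
  define c :: "nat uprod \<Rightarrow> 'k" where "c q = (SOME a. a \<noteq> 0 \<and> nabs a = \<rho> q)" for q
  have c: "c q \<noteq> 0 \<and> nabs (c q) = \<rho> q" if "q \<in> pairs n - (J \<union> {Upair i j})" for q
    unfolding c_def by (rule someI_ex) (use bspec[OF asm(18) that] in \<open>auto simp: image_iff\<close>)
  interpret R: rational_torus "I - J" \<rho> c
  proof
    show "finite (I - J)" using finite_subset[OF I_pairs finite_pairs] by simp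
    show "\<rho> q > 0" if "q \<in> I - J" for q using that I_pairs by (intro \<rho>_pos) auto
    show "nabs (c q) = \<rho> q" if "q \<in> I - J" for q using c[OF subsetD[OF IV that]] by simp
  qed
  have A: "A = R.A" by (rule asm(16))
  have B: "B = fst (iterated_domain (image_normed_ring Ground R.A) Ground (map (\<lambda>q. (f q, \<rho> q, f q, \<rho> q)) rss))"
    "\<iota> = snd (iterated_domain (image_normed_ring Ground R.A) Ground (map (\<lambda>q. (f q, \<rho> q, f q, \<rho> q)) rss))"
    using asm(17)[symmetric] by (simp_all add: A)
  have "nearly_localization R.A B \<iota>"
    unfolding B
  proof (rule nearly_localization_iterated[OF R.torus_valued nearly_localization_ground[OF R.torus_valued]])
    fix g s g' s' assume "(g, s, g', s') \<in> set (map (\<lambda>q. (f q, \<rho> q, f q, \<rho> q)) rss)"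
    then obtain q where q: "q \<in> set rss" "g = f q" "g' = f q" "s = \<rho> q" "s' = \<rho> q" by auto
    then have q': "q \<in> pairs n" "q \<noteq> Upair i j" "q \<notin> J" "q \<in> pairs n - (J \<union> {Upair i j})"
      using asm(15) by auto
    note bound = f_coord_bound[OF q'(1,2), where 'k = 'k]
    have fq: "f q = Poly_Mapping.lookup (f_coord n i j I J q)" by (simp add: asm(13))
    have pos: "\<rho> q > 0" by (rule \<rho>_pos[OF q'(1,3)])
    have carr: "f q \<in> carrier R.A"
      unfolding fq R.carrier_eq by (intro CollectI R.null_seq_lookup bound(2))
    have le: "nrm R.A (f q) \<le> \<rho> q"
      unfolding fq by (rule R.N_le) (use bound(1) in \<open>simp add: gauss_le_def R.sz_def\<close>)
    have w: "torus_const (inverse (c q)) \<in> Units R.A" "nrm R.A (torus_const (inverse (c q))) = 1 / \<rho> q"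
      using c[OF q'(4)] by (auto intro!: R.const_Unit simp: R.N_const nabs_inverse divide_inverse)
    show "g' = g \<and> s' = s \<and> s > 0 \<and> g \<in> carrier R.A \<and> nrm R.A g \<le> s \<and> (\<exists>w\<in>Units R.A. nrm R.A w = 1 / s)"
      unfolding q(2-5) using pos carr le w by blast
  qed
  from R.algebra_isomorphic_localization[OF this] show ?thesis by (simp only: Let_def)
qed

end
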